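(* Let $\mathscr{A}$ be a strictly supersolvable toric arrangement. Then the integral cohomology ring $H^*(M(\mathscr{A});\mathbb{Z})\cong\mathsf{E}/\mathsf{I}$ is a Koszul algebra, where $\mathsf{E}=\bigwedge H^1(M(\mathscr{A});\mathbb{Z})$ is the exterior algebra and $\mathsf{I}$ is the ideal of $\mathsf{E}$ generated by the kernel of the cup product map $\bigwedge^2H^1(M(\mathscr{A});\mathbb{Z})\to H^2(M(\mathscr{A});\mathbb{Z})$.
   Context: Let $\Gamma\cong\mathbb{Z}^d$ be a finitely generated free abelian group and $T=\mathrm{Hom}(\Gamma,\mathbb{C}^\times)$. For $\chi\in\Gamma$ put $H_\chi=\{t\in T\mid t(\chi)=1\}$. A toric arrangement $\mathscr{A}$ in $T$ is the set of all connected components of the $H_\chi$, $\chi\in\mathfrak{X}$, for a finite set $\mathfrak{X}\subseteq\Gamma\smallsetminus\{0\}$; its complement is $M(\mathscr{A})=T\smallsetminus\bigcup_{\chi\in\mathfrak X}H_\chi$; its poset of layers $\mathscr{P}(\mathscr{A})$ consists of the nonempty connected components of intersections $\bigcap_{\chi\in S}H_\chi$, $S\subseteq\mathfrak{X}$, ordered by reverse inclusion; its rank is the rank of this poset, i.e. of the subgroup generated by $\mathfrak{X}$. A subgroup $Y\subseteq T$ is admissible if there is a decomposition $\Gamma=\Gamma'\oplus\Gamma''$ with $\Gamma'$ of rank one and $Y=\{t\mid t|_{\Gamma''}\equiv1\}$. Let $p\colon T\to T/Y\cong\mathrm{Hom}(\Gamma'',\mathbb{C}^\times)$ be the projection, $\mathscr{A}_Y=\{H\in\mathscr{A}\mid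 H\text{ is a union of cosets of }Y\}$, and $\mathscr{A}/Y=\{p(H)\mid H\in\mathscr{A}_Y\}$, a toric arrangement in $T/Y$. $\mathscr{P}(\mathscr{A}_Y)$ is a TM-ideal of $\mathscr{P}(\mathscr{A})$ if for any distinct $H_1,H_2\in\mathscr{A}\smallsetminus\mathscr{A}_Y$ and any connected component $X$ of $H_1\cap H_2$ there is $H_3\in\mathscr{A}_Y$ with $H_3\supseteq X$, and $H\cap Y$ is connected for all $H\in\mathscr{A}\smallsetminus\mathscr{A}_Y$. $\mathscr{A}$ is strictly supersolvable if either it has rank $0$, or there is an admissible $Y$ such that $\mathscr{P}(\mathscr{A}_Y)$ is a TM-ideal of $\mathscr{P}(\mathscr{A})$ of rank one less than $\mathscr{P}(\mathscr{A})$, and $\mathscr{A}/Y$ is again strictly supersolvable. A graded ring $A=\bigoplus_{k\ge0}A_k$ with $A_0=\mathbb{Z}$ and each $A_k$ a finitely generated free abelian group is Koszul if $\mathrm{Tor}^A_{i}(\mathbb{Z},\mathbb{Z})_j=0$ for all $i\ne j$, where $j$ is the internal grading. *)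

theory Defs
  imports "HOL-Homology.Homology" "HOL-Algebra.QuotRing"
begin

section \<open>Toric arrangements\<close>

text \<open>The character lattice is a commutative group \<open>\<Gamma>\<close>, written multiplicatively as usual in HOL-Algebra;
  thus \<open>\<one>\<close> is the zero character. Elements of the torus are functions that are \<open>extensional\<close>
  on \<open>\<Gamma>\<close>, so that they are determined by their values on \<open>\<Gamma>\<close>.\<close>

definition nonzero_complex :: "complex monoid" where
  "nonzero_complex = \<lparr>carrier = - {0}, monoid.mult = (*), one = 1\<rparr>"

definition torus :: "('g, 'r) monoid_scheme \<Rightarrow> ('g \<Rightarrow> complex) monoid" where
  "torus \<Gamma> =
    \<lparr>carrier = hom \<Gamma> nonzero_complex \<inter> extensional (carrier \<Gamma>),
     monoid.mult = (\<lambda>s t. \<lambda>a\<in>carrier \<Gamma>. s a * t a),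
     one = (\<lambda>a\<in>carrier \<Gamma>. 1)\<rparr>"

text \<open>The topology of pointwise convergence; for \<open>\<Gamma>\<close> free on \<open>d\<close> generators this is the usual
  topology of \<open>(\<complex> - {0})\<^sup>d\<close>.\<close>

definition torus_topology :: "('g, 'r) monoid_scheme \<Rightarrow> ('g \<Rightarrow> complex) topology" where
  "torus_topology \<Gamma> =
    subtopology (product_topology (\<lambda>_. euclidean) (carrier \<Gamma>)) (carrier (torus \<Gamma>))"

definition components :: "('g, 'r) monoid_scheme \<Rightarrow> ('g \<Rightarrow> complex) set \<Rightarrow> ('g \<Rightarrow> complex) set set" where
  "components \<Gamma> S = connected_components_of (subtopology (torus_topology \<Gamma>) S)"

definition char_kernel :: "('g, 'r) monoid_scheme \<Rightarrow> 'g \<Rightarrow> ('g \<Rightarrow> complex) set" where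
  "char_kernel \<Gamma> a = {t \<in> carrier (torus \<Gamma>). t a = 1}"

definition toric_arrangement :: "('g, 'r) monoid_scheme \<Rightarrow> ('g \<Rightarrow> complex) set set \<Rightarrow> bool" where
  "toric_arrangement \<Gamma> \<A> \<longleftrightarrow>
    (\<exists>X. finite X \<and> X \<subseteq> carrier \<Gamma> - {\<one>\<^bsub>\<Gamma>\<^esub>} \<and> \<A> = (\<Union>a\<in>X. components \<Gamma> (char_kernel \<Gamma> a)))"

definition complement :: "('g, 'r) monoid_scheme \<Rightarrow> ('g \<Rightarrow> complex) set set \<Rightarrow> ('g \<Rightarrow> complex) topology" where
  "complement \<Gamma> \<A> = subtopology (torus_topology \<Gamma>) (carrier (torus \<Gamma>) - \<Union>\<A>)"

text \<open>Each intersection of sets \<open>H\<^sub>a\<close> is a disjoint union of finitely many closed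
  intersections of their components, so the connected components of intersections of members of
  \<open>\<A>\<close> are those of intersections of the \<open>H\<^sub>a\<close>. The empty intersection is the whole torus.
  Members of \<open>connected_components_of\<close> are nonempty.\<close>

definition layers :: "('g, 'r) monoid_scheme \<Rightarrow> ('g \<Rightarrow> complex) set set \<Rightarrow> ('g \<Rightarrow> complex) set set" where
  "layers \<Gamma> \<A> = (\<Union>S\<in>Pow \<A>. components \<Gamma> (carrier (torus \<Gamma>) \<inter> \<Inter>S))"

text \<open>Length of a longest chain; the chains for inclusion and for reverse inclusion agree.\<close>

definition poset_rank :: "'a set set \<Rightarrow> nat" where
  "poset_rank P = Max {card C - 1 | C. C \<subseteq> P \<and> chain\<^sub>\<subseteq> C}"

definition arrangement_rank :: "('g, 'r) monoid_scheme \<Rightarrow> ('g \<Rightarrow> complex) set set \<Rightarrow> nat" where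
  "arrangement_rank \<Gamma> \<A> = poset_rank (layers \<Gamma> \<A>)"

text \<open>\<open>admissible \<Gamma> K Y\<close>: the subgroup \<open>Y\<close> of the torus is admissible with respect to a
  decomposition of \<open>\<Gamma>\<close> as the direct sum of a subgroup \<open>L\<close> of rank one and \<open>K\<close>.\<close>

definition admissible :: "('g, 'r) monoid_scheme \<Rightarrow> 'g set \<Rightarrow> ('g \<Rightarrow> complex) set \<Rightarrow> bool" where
  "admissible \<Gamma> K Y \<longleftrightarrow>
    (\<exists>L. subgroup L \<Gamma> \<and> subgroup K \<Gamma> \<and> L \<inter> K = {\<one>\<^bsub>\<Gamma>\<^esub>} \<and> L <#>\<^bsub>\<Gamma>\<^esub> K = carrier \<Gamma> \<and>
         \<Gamma>\<lparr>carrier := L\<rparr> \<cong> integer_group) \<and>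
    Y = {t \<in> carrier (torus \<Gamma>). \<forall>a\<in>K. t a = 1}"

definition sub_arrangement ::
    "('g, 'r) monoid_scheme \<Rightarrow> ('g \<Rightarrow> complex) set set \<Rightarrow> ('g \<Rightarrow> complex) set \<Rightarrow> ('g \<Rightarrow> complex) set set" where
  "sub_arrangement \<Gamma> \<A> Y = {H \<in> \<A>. \<exists>\<C> \<subseteq> rcosets\<^bsub>torus \<Gamma>\<^esub> Y. H = \<Union>\<C>}"

text \<open>Under the identification of the quotient by \<open>Y\<close> with the torus of \<open>K\<close>, the projection is
  restriction of characters to \<open>K\<close>.\<close>

definition quotient_arrangement ::
    "('g, 'r) monoid_scheme \<Rightarrow> ('g \<Rightarrow> complex) set set \<Rightarrow> 'g set \<Rightarrow> ('g \<Rightarrow> complex) set \<Rightarrow> ('g \<Rightarrow> complex) set set" where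
  "quotient_arrangement \<Gamma> \<A> K Y = (\<lambda>H. (\<lambda>t. restrict t K) ` H) ` sub_arrangement \<Gamma> \<A> Y"

definition TM_ideal :: "('g, 'r) monoid_scheme \<Rightarrow> ('g \<Rightarrow> complex) set set \<Rightarrow> ('g \<Rightarrow> complex) set \<Rightarrow> bool" where
  "TM_ideal \<Gamma> \<A> Y \<longleftrightarrow>
    (\<forall>H\<^sub>1 \<in> \<A> - sub_arrangement \<Gamma> \<A> Y. \<forall>H\<^sub>2 \<in> \<A> - sub_arrangement \<Gamma> \<A> Y. H\<^sub>1 \<noteq> H\<^sub>2 \<longrightarrow>
       (\<forall>X \<in> components \<Gamma> (H\<^sub>1 \<inter> H\<^sub>2). \<exists>H\<^sub>3 \<in> sub_arrangement \<Gamma> \<A> Y. X \<subseteq> H\<^sub>3)) \<and>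
    (\<forall>H \<in> \<A> - sub_arrangement \<Gamma> \<A> Y. connectedin (torus_topology \<Gamma>) (H \<inter> Y))"

inductive strictly_supersolvable :: "('g, 'r) monoid_scheme \<Rightarrow> ('g \<Rightarrow> complex) set set \<Rightarrow> bool" where
  rank_zero: "arrangement_rank \<Gamma> \<A> = 0 \<Longrightarrow> strictly_supersolvable \<Gamma> \<A>"
| step: "\<lbrakk>admissible \<Gamma> K Y; TM_ideal \<Gamma> \<A> Y;
          arrangement_rank \<Gamma> \<A> = arrangement_rank \<Gamma> (sub_arrangement \<Gamma> \<A> Y) + 1;
          strictly_supersolvable (\<Gamma>\<lparr>carrier := K\<rparr>) (quotient_arrangement \<Gamma> \<A> K Y)\<rbrakk>
         \<Longrightarrow> strictly_supersolvable \<Gamma> \<A>"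


section \<open>The integral singular cohomology ring\<close>

text \<open>An element of the total cochain ring assigns to each degree \<open>n\<close> an integer-valued function on
  singular \<open>n\<close>-simplices (extended by zero), nonzero in finitely many degrees only.\<close>

type_synonym 'a cochain = "nat \<Rightarrow> ((nat \<Rightarrow> real) \<Rightarrow> 'a) \<Rightarrow> int"

definition cochains :: "'a topology \<Rightarrow> 'a cochain set" where
  "cochains X = {f. (\<forall>n \<sigma>. \<sigma> \<notin> singular_simplex_set n X \<longrightarrow> f n \<sigma> = 0) \<and> finite {n. f n \<noteq> (\<lambda>\<sigma>. 0)}}"

definition coboundary :: "'a topology \<Rightarrow> 'a cochain \<Rightarrow> 'a cochain" where
  "coboundary X f n \<sigma> =
    (if n > 0 \<and> \<sigma> \<in> singular_simplex_set n X
     then \<Sum>k\<le>n. (-1)^k * f (n - 1) (singular_face n k \<sigma>) else 0)"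

text \<open>Restrictions of a singular simplex to the face spanned by the vertices \<open>0, \<dots>, p\<close>, and to
  the face (of dimension \<open>q\<close>) spanned by the vertices \<open>p, \<dots>, p + q\<close>.\<close>

definition front_face :: "nat \<Rightarrow> ((nat \<Rightarrow> real) \<Rightarrow> 'a) \<Rightarrow> (nat \<Rightarrow> real) \<Rightarrow> 'a" where
  "front_face p \<sigma> = restrict \<sigma> (standard_simplex p)"

definition back_face :: "nat \<Rightarrow> nat \<Rightarrow> ((nat \<Rightarrow> real) \<Rightarrow> 'a) \<Rightarrow> (nat \<Rightarrow> real) \<Rightarrow> 'a" where
  "back_face p q \<sigma> = (\<lambda>x\<in>standard_simplex q. \<sigma> (\<lambda>i. if i < p then 0 else x (i - p)))"

definition cup_product :: "'a topology \<Rightarrow> 'a cochain \<Rightarrow> 'a cochain \<Rightarrow> 'a cochain" where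
  "cup_product X f g n \<sigma> =
    (if \<sigma> \<in> singular_simplex_set n X
     then \<Sum>p\<le>n. f p (front_face p \<sigma>) * g (n - p) (back_face p (n - p) \<sigma>) else 0)"

definition cochain_ring :: "'a topology \<Rightarrow> 'a cochain ring" where
  "cochain_ring X =
    \<lparr>carrier = cochains X, monoid.mult = cup_product X,
     one = (\<lambda>n \<sigma>. if n = 0 \<and> \<sigma> \<in> singular_simplex_set n X then 1 else 0),
     zero = (\<lambda>n \<sigma>. 0), add = (\<lambda>f g n \<sigma>. f n \<sigma> + g n \<sigma>)\<rparr>"

definition cocycles :: "'a topology \<Rightarrow> 'a cochain set" where
  "cocycles X = {f \<in> cochains X. coboundary X f = (\<lambda>n \<sigma>. 0)}"

definition coboundaries :: "'a topology \<Rightarrow> 'a cochain set" where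
  "coboundaries X = coboundary X ` cochains X"

definition cocycle_ring :: "'a topology \<Rightarrow> 'a cochain ring" where
  "cocycle_ring X = (cochain_ring X)\<lparr>carrier := cocycles X\<rparr>"

definition cohomology_ring :: "'a topology \<Rightarrow> 'a cochain set ring" where
  "cohomology_ring X = cocycle_ring X Quot coboundaries X"

definition cohomology_part :: "'a topology \<Rightarrow> nat \<Rightarrow> 'a cochain set set" where
  "cohomology_part X k =
    {coboundaries X +>\<^bsub>cocycle_ring X\<^esub> f | f. f \<in> cocycles X \<and> (\<forall>n. n \<noteq> k \<longrightarrow> f n = (\<lambda>\<sigma>. 0))}"

definition first_cohomology_group :: "'a topology \<Rightarrow> 'a cochain set monoid" where
  "first_cohomology_group X = (add_monoid (cohomology_ring X))\<lparr>carrier := cohomology_part X 1\<rparr>"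


section \<open>Exterior algebras\<close>

text \<open>The free associative unital ring on a set \<open>S\<close>: integer combinations of words in \<open>S\<close>.\<close>

definition free_ring :: "'a set \<Rightarrow> ('a list \<Rightarrow>\<^sub>0 int) ring" where
  "free_ring S =
    \<lparr>carrier = {c. Poly_Mapping.keys c \<subseteq> lists S},
     monoid.mult = (\<lambda>x y. frag_extend (\<lambda>u. frag_extend (\<lambda>v. frag_of (u @ v)) y) x),
     one = frag_of [], zero = 0, add = (+)\<rparr>"

text \<open>For a commutative group \<open>G\<close>, written multiplicatively: the first family of relations turns
  the free ring on the set \<open>G\<close> into the tensor algebra of \<open>G\<close>, the second one turns the latter
  into the exterior algebra.\<close>

definition exterior_relations :: "('a, 'r) monoid_scheme \<Rightarrow> ('a list \<Rightarrow>\<^sub>0 int) set" where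
  "exterior_relations G =
    {frag_of [v \<otimes>\<^bsub>G\<^esub> w] - frag_of [v] - frag_of [w] | v w. v \<in> carrier G \<and> w \<in> carrier G} \<union>
    {frag_of [v, v] | v. v \<in> carrier G}"

definition exterior_ideal :: "('a, 'r) monoid_scheme \<Rightarrow> ('a list \<Rightarrow>\<^sub>0 int) set" where
  "exterior_ideal G = Idl\<^bsub>free_ring (carrier G)\<^esub> (exterior_relations G)"

definition exterior_algebra :: "('a, 'r) monoid_scheme \<Rightarrow> ('a list \<Rightarrow>\<^sub>0 int) set ring" where
  "exterior_algebra G = free_ring (carrier G) Quot exterior_ideal G"

definition exterior_class :: "('a, 'r) monoid_scheme \<Rightarrow> ('a list \<Rightarrow>\<^sub>0 int) \<Rightarrow> ('a list \<Rightarrow>\<^sub>0 int) set" where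
  "exterior_class G x = exterior_ideal G +>\<^bsub>free_ring (carrier G)\<^esub> x"

definition exterior_power :: "('a, 'r) monoid_scheme \<Rightarrow> nat \<Rightarrow> ('a list \<Rightarrow>\<^sub>0 int) set set" where
  "exterior_power G k =
    {exterior_class G x | x. \<forall>w\<in>Poly_Mapping.keys x. w \<in> lists (carrier G) \<and> length w = k}"

definition eval_words :: "('a, 'r) ring_scheme \<Rightarrow> ('a list \<Rightarrow>\<^sub>0 int) \<Rightarrow> 'a" where
  "eval_words R x =
    (\<Oplus>\<^bsub>R\<^esub>w\<in>Poly_Mapping.keys x. [Poly_Mapping.lookup x w] \<cdot>\<^bsub>R\<^esub> foldr (\<otimes>\<^bsub>R\<^esub>) w \<one>\<^bsub>R\<^esub>)"

text \<open>The map sending the class of \<open>v\<^sub>1 \<and> \<dots> \<and> v\<^sub>k\<close> to the cup product of the \<open>v\<^sub>i\<close>. It is well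
  defined since integral cohomology classes of degree one have square zero: evaluation of words
  is constant on each coset.\<close>

definition cup_map :: "'a topology \<Rightarrow> ('a cochain set list \<Rightarrow>\<^sub>0 int) set \<Rightarrow> 'a cochain set" where
  "cup_map X c = the_elem (eval_words (cohomology_ring X) ` c)"

definition exterior_cohomology :: "'a topology \<Rightarrow> ('a cochain set list \<Rightarrow>\<^sub>0 int) set ring" where
  "exterior_cohomology X = exterior_algebra (first_cohomology_group X)"

definition cup_kernel_ideal :: "'a topology \<Rightarrow> ('a cochain set list \<Rightarrow>\<^sub>0 int) set set" where
  "cup_kernel_ideal X =
    Idl\<^bsub>exterior_cohomology X\<^esub>
      {c \<in> exterior_power (first_cohomology_group X) 2. cup_map X c = \<zero>\<^bsub>cohomology_ring X\<^esub>}"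


section \<open>Koszul rings\<close>

locale graded_ring = ring R for R (structure) +
  fixes gr :: "nat \<Rightarrow> 'a set"
  assumes gr_subgroup: "additive_subgroup (gr k) R"
    and one_gr: "\<one> \<in> gr 0"
    and mult_gr: "\<lbrakk>x \<in> gr i; y \<in> gr j\<rbrakk> \<Longrightarrow> x \<otimes> y \<in> gr (i + j)"
    and direct_sum: "x \<in> carrier R \<Longrightarrow>
      \<exists>!f. (\<forall>k. f k \<in> gr k) \<and> finite {k. f k \<noteq> \<zero>} \<and> x = (\<Oplus>k\<in>{k. f k \<noteq> \<zero>}. f k)"

text \<open>The projection onto degree zero, for a graded ring with degree-zero part \<open>\<int>\<close>. It turns
  \<open>\<int>\<close> into a left and a right module.\<close>

definition augmentation :: "('a, 'r) ring_scheme \<Rightarrow> (nat \<Rightarrow> 'a set) \<Rightarrow> 'a \<Rightarrow> int" where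
  "augmentation R gr a = (THE n. a \<ominus>\<^bsub>R\<^esub> [n] \<cdot>\<^bsub>R\<^esub> \<one>\<^bsub>R\<^esub> \<in> Idl\<^bsub>R\<^esub> (\<Union>k\<in>{0<..}. gr k))"

text \<open>The free left module on a basis \<open>B\<close>, its homogeneous elements of degree \<open>j\<close> when basis
  elements \<open>b\<close> have degree \<open>wt b\<close>, and the linear map that sends \<open>b\<close> to the element \<open>D b\<close>.\<close>

definition free_module :: "('a, 'r) ring_scheme \<Rightarrow> 'b set \<Rightarrow> ('b \<Rightarrow> 'a) set" where
  "free_module R B =
    {f. range f \<subseteq> carrier R \<and> (\<forall>b. b \<notin> B \<longrightarrow> f b = \<zero>\<^bsub>R\<^esub>) \<and> finite {b. f b \<noteq> \<zero>\<^bsub>R\<^esub>}}"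

definition free_module_part ::
    "('a, 'r) ring_scheme \<Rightarrow> (nat \<Rightarrow> 'a set) \<Rightarrow> 'b set \<Rightarrow> ('b \<Rightarrow> nat) \<Rightarrow> nat \<Rightarrow> ('b \<Rightarrow> 'a) set" where
  "free_module_part R gr B wt j =
    {f \<in> free_module R B. \<forall>b\<in>B. if wt b \<le> j then f b \<in> gr (j - wt b) else f b = \<zero>\<^bsub>R\<^esub>}"

definition free_module_map :: "('a, 'r) ring_scheme \<Rightarrow> ('b \<Rightarrow> 'c \<Rightarrow> 'a) \<Rightarrow> ('b \<Rightarrow> 'a) \<Rightarrow> 'c \<Rightarrow> 'a" where
  "free_module_map R D f c = (\<Oplus>\<^bsub>R\<^esub>b\<in>{b. f b \<noteq> \<zero>\<^bsub>R\<^esub>}. f b \<otimes>\<^bsub>R\<^esub> D b c)"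

text \<open>The linear map to \<open>\<int>\<close> that sends \<open>b\<close> to \<open>e b\<close>.\<close>

definition to_int_map ::
    "('a, 'r) ring_scheme \<Rightarrow> (nat \<Rightarrow> 'a set) \<Rightarrow> ('b \<Rightarrow> int) \<Rightarrow> ('b \<Rightarrow> 'a) \<Rightarrow> int" where
  "to_int_map R gr e f = (\<Sum>b | f b \<noteq> \<zero>\<^bsub>R\<^esub>. augmentation R gr (f b) * e b)"

text \<open>A graded free resolution of the left module \<open>\<int>\<close> (in degree 0), with degree-preserving maps:
  the \<open>i\<close>-th module has basis \<open>B i\<close> with degrees \<open>wt i\<close>, the differential from the
  \<open>(i+1)\<close>-st to the \<open>i\<close>-th module is given by \<open>D i\<close>, and the augmentation by \<open>e\<close>.\<close>

definition graded_free_resolution ::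
    "('a, 'r) ring_scheme \<Rightarrow> (nat \<Rightarrow> 'a set) \<Rightarrow> (nat \<Rightarrow> 'b set) \<Rightarrow> (nat \<Rightarrow> 'b \<Rightarrow> nat) \<Rightarrow>
     (nat \<Rightarrow> 'b \<Rightarrow> 'b \<Rightarrow> 'a) \<Rightarrow> ('b \<Rightarrow> int) \<Rightarrow> bool" where
  "graded_free_resolution R gr B wt D e \<longleftrightarrow>
    (\<forall>i. \<forall>b\<in>B (Suc i). D i b \<in> free_module_part R gr (B i) (wt i) (wt (Suc i) b)) \<and>
    (\<forall>b\<in>B 0. wt 0 b \<noteq> 0 \<longrightarrow> e b = 0) \<and>
    to_int_map R gr e ` free_module R (B 0) = UNIV \<and>
    {f \<in> free_module R (B 0). to_int_map R gr e f = 0} =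
      free_module_map R (D 0) ` free_module R (B 1) \<and>
    (\<forall>i. {f \<in> free_module R (B (Suc i)). free_module_map R (D i) f = (\<lambda>_. \<zero>\<^bsub>R\<^esub>)} =
      free_module_map R (D (Suc i)) ` free_module R (B (Suc (Suc i))))"

text \<open>Tensoring the free left module on \<open>B\<close> with the right module \<open>\<int>\<close> gives the free abelian
  group on \<open>B\<close>, and replaces the entries of \<open>D\<close> by their augmentations. \<open>Tor\<close> in homological
  degree \<open>i\<close> and internal degree \<open>j\<close> is the homology of the resulting complex.\<close>

definition tensored_map ::
    "('a, 'r) ring_scheme \<Rightarrow> (nat \<Rightarrow> 'a set) \<Rightarrow> ('b \<Rightarrow> 'c \<Rightarrow> 'a) \<Rightarrow> ('b \<Rightarrow>\<^sub>0 int) \<Rightarrow> ('c \<Rightarrow>\<^sub>0 int)" where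
  "tensored_map R gr D =
    frag_extend (\<lambda>b. \<Sum>c | D b c \<noteq> \<zero>\<^bsub>R\<^esub>. frag_cmul (augmentation R gr (D b c)) (frag_of c))"

definition tensored_part ::
    "(nat \<Rightarrow> 'b set) \<Rightarrow> (nat \<Rightarrow> 'b \<Rightarrow> nat) \<Rightarrow> nat \<Rightarrow> nat \<Rightarrow> ('b \<Rightarrow>\<^sub>0 int) monoid" where
  "tensored_part B wt i j = free_Abelian_group {b \<in> B i. wt i b = j}"

definition tor_cycles ::
    "('a, 'r) ring_scheme \<Rightarrow> (nat \<Rightarrow> 'a set) \<Rightarrow> (nat \<Rightarrow> 'b set) \<Rightarrow> (nat \<Rightarrow> 'b \<Rightarrow> nat) \<Rightarrow>
     (nat \<Rightarrow> 'b \<Rightarrow> 'b \<Rightarrow> 'a) \<Rightarrow> nat \<Rightarrow> nat \<Rightarrow> ('b \<Rightarrow>\<^sub>0 int) set" where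
  "tor_cycles R gr B wt D i j =
    {z \<in> carrier (tensored_part B wt i j). i = 0 \<or> tensored_map R gr (D (i - 1)) z = 0}"

definition Tor ::
    "('a, 'r) ring_scheme \<Rightarrow> (nat \<Rightarrow> 'a set) \<Rightarrow> (nat \<Rightarrow> 'b set) \<Rightarrow> (nat \<Rightarrow> 'b \<Rightarrow> nat) \<Rightarrow>
     (nat \<Rightarrow> 'b \<Rightarrow> 'b \<Rightarrow> 'a) \<Rightarrow> nat \<Rightarrow> nat \<Rightarrow> ('b \<Rightarrow>\<^sub>0 int) set monoid" where
  "Tor R gr B wt D i j =
    (tensored_part B wt i j)\<lparr>carrier := tor_cycles R gr B wt D i j\<rparr> Mod
      (tensored_map R gr (D i) ` carrier (tensored_part B wt (Suc i) j))"

text \<open>\<open>Tor\<close> may be computed from any graded free resolution. When all graded parts are finitely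
  generated abelian groups there are resolutions with countable bases, so it is no restriction
  to index basis elements by natural numbers.\<close>

definition Koszul :: "('a, 'r) ring_scheme \<Rightarrow> (nat \<Rightarrow> 'a set) \<Rightarrow> bool" where
  "Koszul R gr \<longleftrightarrow>
    graded_ring R gr \<and>
    bij_betw (\<lambda>n::int. [n] \<cdot>\<^bsub>R\<^esub> \<one>\<^bsub>R\<^esub>) UNIV (gr 0) \<and>
    (\<forall>k. \<exists>n::nat. (add_monoid R)\<lparr>carrier := gr k\<rparr> \<cong> free_Abelian_group {..<n}) \<and>
    (\<exists>(B :: nat \<Rightarrow> nat set) wt D e. graded_free_resolution R gr B wt D e \<and>
       (\<forall>i j. i \<noteq> j \<longrightarrow> trivial_group (Tor R gr B wt D i j)))"

end

theory Submission
 imports Defs "HOL-Library.Function_Algebras" "HOL-Analysis.Analysis"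
begin

text \<open>If \<open>H \<inter> Y\<close> is connected for all \<open>H\<close> outside \<open>\<A>\<^sub>Y\<close>, each such \<open>H\<close> is the graph of a map to \<open>\<complex>\<^sup>\<times>\<close> over the
 complement of \<open>\<A>/Y\<close>, and the TM-ideal condition makes these graphs pairwise disjoint there. So the complement \<open>M\<close> arises
 from a point by repeatedly passing to the complement of disjoint graphs \<open>s\<^sub>1, \<dots>, s\<^sub>m\<close> in a trivial bundle of
 planes \<open>\<pi>: M \<rightarrow> B\<close>.

 By Mayer--Vietoris, \<open>H(M)\<close> is the free \<open>H(B)\<close>-module on \<open>1, \<omega>\<^sub>1, \<dots>, \<omega>\<^sub>m\<close>, where \<open>\<omega>\<^sub>j\<close> is the pullback of the
 generator of \<open>H\<^sup>1(\<complex>\<^sup>\<times>)\<close> under \<open>z - s\<^sub>j\<close>, and the products satisfy the Arnold relations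
 \<open>\<omega>\<^sub>i \<omega>\<^sub>j = (\<omega>\<^sub>i - \<omega>\<^sub>j) \<theta>\<close> with \<open>\<theta> \<in> H\<^sup>1(B)\<close>. It follows that a list of classes \<open>x\<^sub>1, \<dots>, x\<^sub>n\<close> of degree one that
 generates the augmentation ideal of \<open>H(B)\<close> and whose successive annihilators
 \<open>((x\<^sub>1, \<dots>, x\<^sub>i\<^sub>-\<^sub>1) : x\<^sub>i)\<close> are again of the form \<open>(x\<^sub>1, \<dots>, x\<^sub>c)\<close> extends to such a list for \<open>H(M)\<close>. Such a flag
 yields a linear free resolution of \<open>\<int>\<close>, hence Koszulness, and shows that all relations follow from the quadratic ones.
 All this is carried out with singular cochains.\<close>

text \<open>The induction carries the flag and not Koszulness, since the flag visibly passes from B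
  to M. For a class from B the colon ideal keeps its generators, because H(M) is free over H(B). For
  a fibre class it is the whole augmentation ideal: modulo positive degree classes from B all
  products of two fibre classes vanish, while no nonzero integral multiple of the new fibre class
  lies in the preceding ideal. Only left ideals occur, and coefficients of fibre classes stand on
  their right, so graded commutativity is needed just for moving a class of degree one past a class
  from B; this is derived from the flag of B. Koszulness over the integers also demands free graded
  pieces. The flag yields them, provided that all quotients by its ideals are treated together. The
  graph description rests on divisibility. Write a character additively as a = n l + k, where l
  generates the rank one summand and k lies in the other one. Connectedness of the intersection with
  Y, for the component through the identity, forces n to divide k, so t(a) = 1 reads (t(l) t(k/n))^n
  = 1, and every component fixes the value of t(l) t(k/n) to be one root of unity.\<close>

lemma sum_fun_apply: "(\<Sum>i\<in>I. f i) x = (\<Sum>i\<in>I. f i x)" by (induction I rule: infinite_finite_induct) auto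

lemma zero_cochain: "(\<lambda>n \<sigma>. 0) = (0::'a cochain)" by (simp add: fun_eq_iff)

section \<open>Integral cohomology at the level of cochains, up to the winding class of a
  nonvanishing function\<close>

section \<open>Singular cochains\<close>

subsection \<open>Faces\<close>

text \<open>Points of the p-simplex vanish beyond coordinate p, so a zero inserted at a later
  position changes nothing.\<close>

lemma simplical_face_upper:
 assumes "x \<in> standard_simplex p" "p < k"
 shows "simplical_face k x = x" using assms by (auto simp: simplical_face_def standard_simplex_def fun_eq_iff)

text \<open>The affine embedding of a simplex as the face on the vertices p, p + 1, ...; back faces
  are compositions with it.\<close>

definition shift :: "nat \<Rightarrow> (nat \<Rightarrow> real) \<Rightarrow> nat \<Rightarrow> real" where
 "shift p x = (\<lambda>i. if i < p then 0 else x (i - p))"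

lemma back_face_shift: "back_face p q \<sigma> = restrict (\<sigma> \<circ> shift p) (standard_simplex q)"
 by (simp add: back_face_def shift_def comp_def)

lemma shift_in_standard_simplex:
 assumes "x \<in> standard_simplex q" shows "shift p x \<in> standard_simplex (p + q)"
proof -
 have "(\<Sum>i\<le>p+q. shift p x i) = (\<Sum>i\<in>{p..p+q}. x (i - p))" by (rule sum.mono_neutral_cong_right) (auto simp: shift_def)
 also have "\<dots> = (\<Sum>i\<le>q. x i)" by (rule sum.reindex_bij_witness[where i="\<lambda>i. i + p" and j="\<lambda>i. i - p"]) auto
 finally show ?thesis using assms by (auto simp: standard_simplex_def shift_def)
qed

lemma simplical_face_shift_le:
 "k \<le> p \<Longrightarrow> simplical_face k (shift p x) = shift (Suc p) x" by (auto simp: simplical_face_def shift_def fun_eq_iff)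

lemma simplical_face_shift_ge:
 "p \<le> k \<Longrightarrow> simplical_face k (shift p x) = shift p (simplical_face (k - p) x)"
proof -
 assume "p \<le> k"
 then have "i - Suc p = i - p - Suc 0" "(i - Suc 0 - p) = i - p - Suc 0" for i by auto
 with \<open>p \<le> k\<close> show ?thesis by (auto simp: simplical_face_def shift_def fun_eq_iff)
qed

lemma continuous_map_shift:
 "continuous_map (subtopology (powertop_real UNIV) (standard_simplex q))
  (subtopology (powertop_real UNIV) (standard_simplex (p + q))) (shift p)"
proof -
 have "continuous_map (powertop_real UNIV) euclideanreal (\<lambda>x. shift p x i)" for i
  by (auto simp: shift_def intro: continuous_map_product_projection)
 then show ?thesis by (auto simp: continuous_map_in_subtopology continuous_map_componentwise shift_in_standard_simplex
    intro: continuous_map_from_subtopology)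
qed

lemma singular_simplex_front_face:
 assumes "singular_simplex n X \<sigma>" "p \<le> n"
 shows "singular_simplex p X (front_face p \<sigma>)"
proof -
 have "continuous_map (subtopology (powertop_real UNIV) (standard_simplex p)) X \<sigma>"
  using assms standard_simplex_mono[OF \<open>p \<le> n\<close>] by (metis continuous_map_from_subtopology_mono singular_simplex_def)
 then show ?thesis by (auto simp: singular_simplex_def front_face_def intro: continuous_map_eq)
qed

lemma singular_simplex_back_face:
 assumes "singular_simplex n X \<sigma>" "n = p + q"
 shows "singular_simplex q X (back_face p q \<sigma>)"
proof -
 have "continuous_map (subtopology (powertop_real UNIV) (standard_simplex q)) X (\<sigma> \<circ> shift p)"
  using assms continuous_map_shift continuous_map_compose singular_simplex_def by blast
 then show ?thesis by (auto simp: singular_simplex_def back_face_shift intro: continuous_map_eq)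
qed

lemma front_face_upper:
 assumes "p \<le> n" "p < k"
 shows "front_face p (singular_face (Suc n) k \<sigma>) = front_face p \<sigma>"
 using assms standard_simplex_mono[OF \<open>p \<le> n\<close>]
 by (auto simp: front_face_def singular_face_def fun_eq_iff simplical_face_upper)

lemma front_face_lower:
 assumes "p \<le> n" "k \<le> Suc p"
 shows "front_face p (singular_face (Suc n) k \<sigma>) = singular_face (Suc p) k (front_face (Suc p) \<sigma>)"
 using assms standard_simplex_mono[OF \<open>p \<le> n\<close>] simplical_face_in_standard_simplex[of "Suc p" k]
 by (auto simp: front_face_def singular_face_def fun_eq_iff)

lemma back_face_lower:
 assumes "k \<le> p"
 shows "back_face p q (singular_face (Suc (p + q)) k \<sigma>) = back_face (Suc p) q \<sigma>" using assms
 by (auto simp: back_face_shift singular_face_def fun_eq_iff shift_in_standard_simplex simplical_face_shift_le)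

lemma back_face_upper:
 assumes "p \<le> k" "k \<le> Suc (p + q)"
 shows "back_face p q (singular_face (Suc (p + q)) k \<sigma>) = singular_face (Suc q) (k - p) (back_face p (Suc q) \<sigma>)"
 using assms simplical_face_in_standard_simplex[of "Suc q" "k - p"]
 by (auto simp: back_face_shift singular_face_def fun_eq_iff shift_in_standard_simplex simplical_face_shift_ge)

lemma front_front: "p \<le> n \<Longrightarrow> front_face p (front_face n \<sigma>) = front_face p \<sigma>"
 using standard_simplex_mono[of p n] by (auto simp: front_face_def fun_eq_iff)

lemma shift_shift: "shift p (shift q x) = shift (p + q) x" by (auto simp: shift_def fun_eq_iff add.commute)

lemma back_back: "back_face p r (back_face q (p + r) \<sigma>) = back_face (q + p) r \<sigma>"
 by (auto simp: back_face_shift fun_eq_iff shift_in_standard_simplex shift_shift)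

lemma front_back: "front_face p (back_face q (p + r) \<sigma>) = back_face q p (front_face (q + p) \<sigma>)"
 using standard_simplex_mono[of p "p + r"] by (auto simp: back_face_shift front_face_def fun_eq_iff shift_in_standard_simplex)

lemma front_face_self: "singular_simplex n X \<sigma> \<Longrightarrow> front_face n \<sigma> = \<sigma>"
 by (auto simp: front_face_def singular_simplex_def extensional_restrict)

lemma back_face_self: "singular_simplex n X \<sigma> \<Longrightarrow> back_face 0 n \<sigma> = \<sigma>"
 by (auto simp: back_face_shift singular_simplex_def shift_def comp_def extensional_restrict)

subsection \<open>Evaluation of cochains on chains\<close>

text \<open>The linear extension of a function on simplices to chains. The integers appear as the
  free abelian group on the single point \<open>()\<close>, so that the linearity of
  \<open>frag_extend\<close> can be reused.\<close>

definition ev :: "('b \<Rightarrow> int) \<Rightarrow> ('b \<Rightarrow>\<^sub>0 int) \<Rightarrow> int" where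
 "ev f c = Poly_Mapping.lookup (frag_extend (\<lambda>\<sigma>. frag_cmul (f \<sigma>) (frag_of ())) c) ()"

lemma ev_0 [simp]: "ev f 0 = 0" by (simp add: ev_def)

lemma ev_of [simp]: "ev f (frag_of \<sigma>) = f \<sigma>" by (simp add: ev_def)

lemma ev_add: "ev f (a + b) = ev f a + ev f b" by (simp add: ev_def frag_extend_add lookup_add)

lemma ev_diff: "ev f (a - b) = ev f a - ev f b" by (simp add: ev_def frag_extend_diff lookup_minus)

lemma ev_cmul: "ev f (frag_cmul k b) = k * ev f b" by (simp add: ev_def frag_extend_cmul)

lemma ev_sum: "ev f (\<Sum>i\<in>I. g i) = (\<Sum>i\<in>I. ev f (g i))" by (induction I rule: infinite_finite_induct) (auto simp: ev_add)

lemma ev_zero: "(\<And>\<sigma>. \<sigma> \<in> Poly_Mapping.keys c \<Longrightarrow> f \<sigma> = 0) \<Longrightarrow> ev f c = 0"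
proof -
 assume "\<And>\<sigma>. \<sigma> \<in> Poly_Mapping.keys c \<Longrightarrow> f \<sigma> = 0"
 then have "Poly_Mapping.keys c \<subseteq> {\<sigma>. f \<sigma> = 0}" by auto
 then show ?thesis by (induction c rule: frag_induction) (auto simp: ev_diff)
qed

lemma ev_extend: "ev f (frag_extend g c) = ev (\<lambda>\<sigma>. ev f (g \<sigma>)) c" using subset_UNIV
 by (induction c rule: frag_induction) (auto simp: ev_diff frag_extend_diff)

subsection \<open>The cochain complex\<close>

lemma cochainsD: "f \<in> cochains X \<Longrightarrow> \<not> singular_simplex n X \<sigma> \<Longrightarrow> f n \<sigma> = 0"
 by (simp add: cochains_def)

lemma cochains_ext:
 assumes "f \<in> cochains X" "g \<in> cochains X"
  "\<And>n \<sigma>. singular_simplex n X \<sigma> \<Longrightarrow> f n \<sigma> = g n \<sigma>"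
 shows "f = g" using assms by (metis cochainsD ext)

lemma finite_support_mono:
 assumes "finite {n. f n \<noteq> (\<lambda>\<sigma>. 0)}" "\<And>n. f n = (\<lambda>\<sigma>. 0) \<Longrightarrow> g n = (\<lambda>\<sigma>. 0)"
 shows "finite {n. g n \<noteq> (\<lambda>\<sigma>. 0)}" using assms(2) by (auto intro!: finite_subset[OF _ assms(1)])

lemma cochains_zero [simp]: "0 \<in> cochains X" by (simp add: cochains_def zero_fun_def)

lemma cochains_add [simp]: "f \<in> cochains X \<Longrightarrow> g \<in> cochains X \<Longrightarrow> f + g \<in> cochains X"
proof -
 assume *: "f \<in> cochains X" "g \<in> cochains X"
 then have "finite ({n. f n \<noteq> (\<lambda>\<sigma>. 0)} \<union> {n. g n \<noteq> (\<lambda>\<sigma>. 0)})"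
  by (simp add: cochains_def)
 then have "finite {n. (f + g) n \<noteq> (\<lambda>\<sigma>. 0)}" by (rule rev_finite_subset) (auto simp: fun_eq_iff)
 with * show ?thesis by (simp add: cochains_def)
qed

lemma cochains_uminus [simp]: "f \<in> cochains X \<Longrightarrow> - f \<in> cochains X" by (auto simp: cochains_def fun_eq_iff)

lemma cochains_diff [simp]: "f \<in> cochains X \<Longrightarrow> g \<in> cochains X \<Longrightarrow> f - g \<in> cochains X"
 using cochains_add[of f X "- g"] by simp

lemma cochains_sum: "(\<And>i. i \<in> I \<Longrightarrow> f i \<in> cochains X) \<Longrightarrow> (\<Sum>i\<in>I. f i) \<in> cochains X"
 by (induction I rule: infinite_finite_induct) auto

lemma cochains_coboundary [simp]:
 assumes "f \<in> cochains X" shows "coboundary X f \<in> cochains X"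
proof -
 have "finite (Suc ` {n. f n \<noteq> (\<lambda>\<sigma>. 0)})" using assms by (simp add: cochains_def)
 moreover have "{n. coboundary X f n \<noteq> (\<lambda>\<sigma>. 0)} \<subseteq> Suc ` {n. f n \<noteq> (\<lambda>\<sigma>. 0)}"
 proof
  fix n assume "n \<in> {n. coboundary X f n \<noteq> (\<lambda>\<sigma>. 0)}"
  then have n: "coboundary X f n \<noteq> (\<lambda>\<sigma>. 0)" by simp
  then have "n > 0" by (cases n) (auto simp: coboundary_def fun_eq_iff)
  moreover have "f (n - 1) \<noteq> (\<lambda>\<sigma>. 0)"
  proof
   assume "f (n - 1) = (\<lambda>\<sigma>. 0)"
   then have "coboundary X f n = (\<lambda>\<sigma>. 0)" by (simp add: coboundary_def fun_eq_iff)
   with n show False by contradiction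
  qed
  ultimately show "n \<in> Suc ` {n. f n \<noteq> (\<lambda>\<sigma>. 0)}" by (intro image_eqI[of _ _ "n - 1"]) auto
 qed
 ultimately show ?thesis by (simp add: cochains_def coboundary_def finite_subset)
qed

lemma coboundary_0 [simp]: "coboundary X f 0 \<sigma> = 0" by (simp add: coboundary_def)

lemma coboundary_Suc:
 "singular_simplex (Suc n) X \<sigma> \<Longrightarrow> coboundary X f (Suc n) \<sigma> = ev (f n) (chain_boundary (Suc n) (frag_of \<sigma>))"
 by (simp add: coboundary_def chain_boundary_of ev_sum ev_cmul del: sum.atMost_Suc)

lemma coboundary_Suc_sum:
 "singular_simplex (Suc n) X \<sigma> \<Longrightarrow>
  coboundary X f (Suc n) \<sigma> = (\<Sum>k\<le>Suc n. (-1)^k * f n (singular_face (Suc n) k \<sigma>))" by (simp add: coboundary_def)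

lemma ev_coboundary:
 assumes "singular_chain (Suc n) X c"
 shows "ev (coboundary X f (Suc n)) c = ev (f n) (chain_boundary (Suc n) c)" using assms unfolding singular_chain_def
 by (induction c rule: frag_induction) (auto simp: coboundary_Suc ev_diff chain_boundary_diff)

lemma coboundary_coboundary [simp]: "coboundary X (coboundary X f) = 0"
proof (intro ext, goal_cases)
 case (1 n \<sigma>)
 show ?case
 proof (cases "\<exists>m. n = Suc (Suc m) \<and> singular_simplex n X \<sigma>")
  case True
  then obtain m where m: "n = Suc (Suc m)" "singular_simplex n X \<sigma>" by blast
  then have "singular_chain n X (frag_of \<sigma>)" by (simp add: singular_chain_of)
  with m show ?thesis using chain_boundary_boundary[of n X "frag_of \<sigma>"] singular_chain_boundary[of n X "frag_of \<sigma>"]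
   by (simp add: coboundary_Suc ev_coboundary)
 next
  case False
  then consider "n = 0" | "n = 1" | "\<not> singular_simplex n X \<sigma>" by (metis One_nat_def not0_implies_Suc)
  then show ?thesis by cases (auto simp: coboundary_def)
 qed
qed

lemma coboundary_zero [simp]: "coboundary X 0 = 0" by (intro ext) (simp add: coboundary_def)

lemma coboundary_add: "coboundary X (f + g) = coboundary X f + coboundary X g"
 by (intro ext) (simp add: coboundary_def sum.distrib algebra_simps)

lemma coboundary_minus: "coboundary X (- g) = - coboundary X g" by (intro ext) (simp add: coboundary_def sum_negf)

lemma coboundary_diff: "coboundary X (f - g) = coboundary X f - coboundary X g"
 using coboundary_add[of X f "- g"] by (simp add: coboundary_minus)

lemma cocycles_iff: "f \<in> cocycles X \<longleftrightarrow> f \<in> cochains X \<and> coboundary X f = 0"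
 by (simp add: cocycles_def zero_cochain)

lemma cocycles_zero [simp]: "0 \<in> cocycles X" by (simp add: cocycles_iff)

lemma cocycles_add [simp]: "f \<in> cocycles X \<Longrightarrow> g \<in> cocycles X \<Longrightarrow> f + g \<in> cocycles X"
 by (simp add: cocycles_iff coboundary_add)

lemma cocycles_uminus [simp]: "f \<in> cocycles X \<Longrightarrow> - f \<in> cocycles X" by (simp add: cocycles_iff coboundary_minus)

lemma cocycles_diff [simp]: "f \<in> cocycles X \<Longrightarrow> g \<in> cocycles X \<Longrightarrow> f - g \<in> cocycles X"
 by (simp add: cocycles_iff coboundary_diff)

lemma cocycles_sum: "(\<And>i. i \<in> I \<Longrightarrow> f i \<in> cocycles X) \<Longrightarrow> (\<Sum>i\<in>I. f i) \<in> cocycles X"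
 by (induction I rule: infinite_finite_induct) auto

lemma cocyclesD: "f \<in> cocycles X \<Longrightarrow> f \<in> cochains X" by (simp add: cocycles_iff)

lemma coboundaries_cocycles: "f \<in> coboundaries X \<Longrightarrow> f \<in> cocycles X" by (auto simp: coboundaries_def cocycles_iff)

lemma coboundariesI: "f \<in> cochains X \<Longrightarrow> g = coboundary X f \<Longrightarrow> g \<in> coboundaries X"
 by (auto simp: coboundaries_def)

lemma coboundaries_zero [simp]: "0 \<in> coboundaries X" by (rule coboundariesI[of 0]) auto

lemma coboundaries_add [simp]: "f \<in> coboundaries X \<Longrightarrow> g \<in> coboundaries X \<Longrightarrow> f + g \<in> coboundaries X"
 by (auto simp: coboundaries_def simp flip: coboundary_add intro!: imageI)

lemma coboundaries_uminus [simp]: "f \<in> coboundaries X \<Longrightarrow> - f \<in> coboundaries X"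
 by (auto simp: coboundaries_def simp flip: coboundary_minus intro!: imageI)

lemma coboundaries_diff [simp]: "f \<in> coboundaries X \<Longrightarrow> g \<in> coboundaries X \<Longrightarrow> f - g \<in> coboundaries X"
 using coboundaries_add[of f X "- g"] by simp

lemma coboundaries_sum: "(\<And>i. i \<in> I \<Longrightarrow> f i \<in> coboundaries X) \<Longrightarrow> (\<Sum>i\<in>I. f i) \<in> coboundaries X"
 by (induction I rule: infinite_finite_induct) auto

subsection \<open>Pullback\<close>

text \<open>Cochains are zero off the singular simplices of their space, hence the case distinction.
  With \<phi> = \<open>id\<close> this is restriction to a subspace.\<close>

definition pull :: "'a topology \<Rightarrow> ('a \<Rightarrow> 'b) \<Rightarrow> 'b cochain \<Rightarrow> 'a cochain" where
 "pull X \<phi> f = (\<lambda>n \<sigma>. if singular_simplex n X \<sigma> then f n (simplex_map n \<phi> \<sigma>) else 0)"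

lemma pull_zero [simp]: "pull X \<phi> 0 = 0" by (intro ext) (simp add: pull_def)

lemma pull_add: "pull X \<phi> (f + g) = pull X \<phi> f + pull X \<phi> g" by (intro ext) (simp add: pull_def)

lemma pull_minus: "pull X \<phi> (- g) = - pull X \<phi> g" by (intro ext) (simp add: pull_def)

lemma pull_diff: "pull X \<phi> (f - g) = pull X \<phi> f - pull X \<phi> g" by (intro ext) (simp add: pull_def)

lemma pull_sum: "pull X \<phi> (\<Sum>i\<in>I. f i) = (\<Sum>i\<in>I. pull X \<phi> (f i))"
 by (intro ext) (simp add: pull_def sum_fun_apply)

lemma pull_cochains [simp]: "f \<in> cochains Y \<Longrightarrow> pull X \<phi> f \<in> cochains X"
 by (auto simp: cochains_def pull_def intro!: finite_support_mono[of f])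

lemma pull_pull:
 assumes "continuous_map X Y \<phi>"
 shows "pull X \<phi> (pull Y \<psi> f) = pull X (\<psi> \<circ> \<phi>) f" using assms singular_simplex_simplex_map[of _ X _ Y \<phi>]
 by (auto simp: pull_def fun_eq_iff simplex_map_compose)

lemma pull_cong:
 assumes "\<And>x. x \<in> topspace X \<Longrightarrow> \<phi> x = \<psi> x"
 shows "pull X \<phi> f = pull X \<psi> f" using simplex_map_eq[of _ X _ \<phi> \<psi>, OF _ assms] by (auto simp: pull_def intro!: ext)

lemma pull_id: 
 assumes "f \<in> cochains X" "\<And>x. x \<in> topspace X \<Longrightarrow> \<phi> x = x"
 shows "pull X \<phi> f = f" using assms(2) by (intro cochains_ext[OF pull_cochains[OF assms(1)] assms(1)])
  (simp add: pull_def simplex_map_id_gen)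

lemma pull_coboundary:
 assumes "continuous_map X Y \<phi>"
 shows "pull X \<phi> (coboundary Y f) = coboundary X (pull X \<phi> f)"
proof (intro ext, goal_cases)
 case (1 n \<sigma>)
 show ?case
 proof (cases "singular_simplex n X \<sigma>")
  case True
  have eq: "singular_face n k (simplex_map n \<phi> \<sigma>) = simplex_map (n - 1) \<phi> (singular_face n k \<sigma>)"
   if "0 < n" "k \<le> n" for k using that by (fastforce simp add: singular_face_def simplex_map_def simplical_face_in_standard_simplex)
  show ?thesis using True singular_simplex_simplex_map[OF True assms] singular_simplex_singular_face[OF True]
   by (auto simp: pull_def coboundary_def eq intro!: sum.cong)
 qed (auto simp: pull_def coboundary_def)
qed

lemma pull_cocycles:
 assumes "continuous_map X Y \<phi>" "f \<in> cocycles Y" shows "pull X \<phi> f \<in> cocycles X"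
 using assms(2) pull_coboundary[OF assms(1), of f] pull_cochains[of f Y X \<phi>] by (simp add: cocycles_iff)

lemma pull_coboundaries:
 assumes "continuous_map X Y \<phi>" "f \<in> coboundaries Y" shows "pull X \<phi> f \<in> coboundaries X"
 using assms by (auto simp: coboundaries_def pull_coboundary)

subsection \<open>The cup product\<close>

lemma cup_product_apply:
 "singular_simplex n X \<sigma> \<Longrightarrow>
  cup_product X f g n \<sigma> = (\<Sum>p\<le>n. f p (front_face p \<sigma>) * g (n - p) (back_face p (n - p) \<sigma>))"
 by (simp add: cup_product_def)

lemma cochains_cup [simp]:
 assumes "f \<in> cochains X" "g \<in> cochains X" shows "cup_product X f g \<in> cochains X"
proof -
 let ?F = "{n. f n \<noteq> (\<lambda>\<sigma>. 0)}" and ?G = "{n. g n \<noteq> (\<lambda>\<sigma>. 0)}"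
 have "finite ((\<lambda>(p,q). p + q) ` (?F \<times> ?G))" using assms by (simp add: cochains_def)
 moreover have "{n. cup_product X f g n \<noteq> (\<lambda>\<sigma>. 0)} \<subseteq> (\<lambda>(p,q). p + q) ` (?F \<times> ?G)"
 proof
  fix n assume "n \<in> {n. cup_product X f g n \<noteq> (\<lambda>\<sigma>. 0)}"
  then obtain \<sigma> where "cup_product X f g n \<sigma> \<noteq> 0" by (auto simp: fun_eq_iff)
  then have "(\<Sum>p\<le>n. f p (front_face p \<sigma>) * g (n - p) (back_face p (n - p) \<sigma>)) \<noteq> 0"
   by (simp add: cup_product_def split: if_splits)
  then obtain p where "p \<le> n" "f p (front_face p \<sigma>) * g (n - p) (back_face p (n - p) \<sigma>) \<noteq> 0"
   by (meson atMost_iff sum.not_neutral_contains_not_neutral)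
  then have "p \<in> ?F" "n - p \<in> ?G" by (auto simp: fun_eq_iff)
  with \<open>p \<le> n\<close> show "n \<in> (\<lambda>(p,q). p + q) ` (?F \<times> ?G)" by (intro image_eqI[of _ _ "(p, n - p)"]) auto
 qed
 ultimately show ?thesis by (simp add: cochains_def cup_product_def finite_subset)
qed

lemma cup_add_left: "cup_product X (f + g) h = cup_product X f h + cup_product X g h"
 by (intro ext) (simp add: cup_product_def sum.distrib algebra_simps)

lemma cup_add_right: "cup_product X h (f + g) = cup_product X h f + cup_product X h g"
 by (intro ext) (simp add: cup_product_def sum.distrib algebra_simps)

lemma cup_minus_left: "cup_product X (- f) h = - cup_product X f h" by (intro ext) (simp add: cup_product_def sum_negf)

lemma cup_minus_right: "cup_product X h (- f) = - cup_product X h f" by (intro ext) (simp add: cup_product_def sum_negf)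

lemma cup_zero_left [simp]: "cup_product X 0 h = 0" by (intro ext) (simp add: cup_product_def)

lemma cup_zero_right [simp]: "cup_product X h 0 = 0" by (intro ext) (simp add: cup_product_def)

lemma cup_diff_left: "cup_product X (f - g) h = cup_product X f h - cup_product X g h"
 using cup_add_left[of X f "- g"] by (simp add: cup_minus_left)

lemma cup_diff_right: "cup_product X h (f - g) = cup_product X h f - cup_product X h g"
 using cup_add_right[of X h f "- g"] by (simp add: cup_minus_right)

lemma cup_assoc: "cup_product X (cup_product X f g) h = cup_product X f (cup_product X g h)"
proof (intro ext, goal_cases)
 case (1 n \<sigma>)
 show ?case
 proof (cases "singular_simplex n X \<sigma>")
  case True
  let ?t = "\<lambda>p q. f p (front_face p \<sigma>) * g q (back_face p q (front_face (p + q) \<sigma>)) *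
    h (n - (p + q)) (back_face (p + q) (n - (p + q)) \<sigma>)"
  have "cup_product X (cup_product X f g) h n \<sigma>
   = (\<Sum>r\<le>n. (\<Sum>p\<le>r. f p (front_face p (front_face r \<sigma>)) * g (r - p) (back_face p (r - p) (front_face r \<sigma>))) *
      h (n - r) (back_face r (n - r) \<sigma>))" using singular_simplex_front_face[OF True] by (simp add: cup_product_apply True)
  also have "\<dots> = (\<Sum>r\<le>n. \<Sum>p\<le>r. ?t p (r - p))" by (intro sum.cong refl) (simp add: sum_distrib_right front_front)
  also have "\<dots> = (\<Sum>(r,p)\<in>Sigma {..n} (\<lambda>r. {..r}). ?t p (r - p))" by (rule sum.Sigma) auto
  \<comment> \<open>Both bracketings sum over all ways to cut the simplex into three consecutive
    blocks. The position r of the later cut is traded for the length q = r - p of the middle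
    block.\<close>
  also have "\<dots> = (\<Sum>(p,q)\<in>Sigma {..n} (\<lambda>p. {..n - p}). ?t p q)"
   by (rule sum.reindex_bij_witness[where i="\<lambda>(p,q). (p + q, p)" and j="\<lambda>(r,p). (p, r - p)"]) auto
  also have "\<dots> = (\<Sum>p\<le>n. \<Sum>q\<le>n - p. ?t p q)" by (simp add: sum.Sigma)
  also have "\<dots> = (\<Sum>p\<le>n. f p (front_face p \<sigma>) *
     (\<Sum>q\<le>n - p. g q (front_face q (back_face p (n - p) \<sigma>)) *
       h (n - p - q) (back_face q (n - p - q) (back_face p (n - p) \<sigma>))))"
  proof (rule sum.cong[OF refl])
   fix p assume p: "p \<in> {..n}"
   have "?t p q = f p (front_face p \<sigma>) * (g q (front_face q (back_face p (n - p) \<sigma>)) *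
       h (n - p - q) (back_face q (n - p - q) (back_face p (n - p) \<sigma>)))" if q: "q \<le> n - p" for q
   proof -
    define r where "r = n - p - q"
    have r: "n - p = q + r" "n - (p + q) = r" using p q by (auto simp: r_def)
    show ?thesis unfolding r_def[symmetric] unfolding r front_back back_back by (simp add: mult.assoc)
   qed
   then show "(\<Sum>q\<le>n - p. ?t p q) = f p (front_face p \<sigma>) *
     (\<Sum>q\<le>n - p. g q (front_face q (back_face p (n - p) \<sigma>)) *
       h (n - p - q) (back_face q (n - p - q) (back_face p (n - p) \<sigma>)))"
    unfolding sum_distrib_left by (intro sum.cong[OF refl]) simp
  qed
  also have "\<dots> = cup_product X f (cup_product X g h) n \<sigma>"
   using singular_simplex_back_face[OF True] by (simp add: cup_product_apply True)
  finally show ?thesis .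
 qed (simp add: cup_product_def)
qed

definition one_cochain :: "'a topology \<Rightarrow> 'a cochain" where
 "one_cochain X = (\<lambda>n \<sigma>. if n = 0 \<and> singular_simplex n X \<sigma> then 1 else 0)"

lemma one_cochain_in [simp]: "one_cochain X \<in> cochains X" unfolding cochains_def one_cochain_def
 by (auto intro!: finite_subset[of _ "{0}"] simp: fun_eq_iff)

lemma cup_one_left: "f \<in> cochains X \<Longrightarrow> cup_product X (one_cochain X) f = f"
proof (rule cochains_ext[of _ X], goal_cases)
 case (3 n \<sigma>)
 have "cup_product X (one_cochain X) f n \<sigma> = (\<Sum>p\<in>{0}. f (n - p) (back_face p (n - p) \<sigma>))"
  unfolding cup_product_apply[OF 3(2)] using singular_simplex_front_face[OF 3(2)]
  by (intro sum.mono_neutral_cong_right) (auto simp: one_cochain_def)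
 then show ?case using 3 by (simp add: back_face_self)
qed auto

lemma cup_one_right: "f \<in> cochains X \<Longrightarrow> cup_product X f (one_cochain X) = f"
proof (rule cochains_ext[of _ X], goal_cases)
 case (3 n \<sigma>)
 have "cup_product X f (one_cochain X) n \<sigma> = (\<Sum>p\<in>{n}. f p (front_face p \<sigma>))" unfolding cup_product_apply[OF 3(2)]
  using singular_simplex_back_face[OF 3(2)] by (intro sum.mono_neutral_cong_right) (auto simp: one_cochain_def)
 then show ?case using 3 by (simp add: front_face_self)
qed auto

text \<open>The degree sign of the Leibniz rule, in a form that makes sense for inhomogeneous
  cochains.\<close>

definition sgn_cochain :: "'a cochain \<Rightarrow> 'a cochain" where
 "sgn_cochain f = (\<lambda>n \<sigma>. (-1)^n * f n \<sigma>)"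

lemma sgn_cochain_in [simp]: "f \<in> cochains X \<Longrightarrow> sgn_cochain f \<in> cochains X"
 by (auto simp: cochains_def sgn_cochain_def intro: finite_support_mono)

lemma sgn_zero [simp]: "sgn_cochain 0 = 0" by (simp add: sgn_cochain_def fun_eq_iff)

lemma sgn_sgn [simp]: "sgn_cochain (sgn_cochain f) = f" by (simp add: sgn_cochain_def fun_eq_iff flip: mult.assoc power_add)

lemma coboundary_sgn: "coboundary X (sgn_cochain f) = - sgn_cochain (coboundary X f)"
proof (intro ext, goal_cases)
 case (1 n \<sigma>)
 then show ?case by (cases n) (auto simp: coboundary_def sgn_cochain_def sum_distrib_left algebra_simps sum_negf simp del: sum.atMost_Suc)
qed

lemma cup_leibniz:
 "coboundary X (cup_product X f g) = cup_product X (coboundary X f) g + cup_product X (sgn_cochain f) (coboundary X g)"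
proof (intro ext, goal_cases)
 case (1 n \<sigma>)
 show ?case
 proof (cases "n > 0 \<and> singular_simplex n X \<sigma>")
  case True
  then obtain m where n: "n = Suc m" and \<sigma>: "singular_simplex (Suc m) X \<sigma>" by (metis gr0_implies_Suc)
  let ?d = "\<lambda>k. singular_face (Suc m) k \<sigma>"
  let ?fr = "\<lambda>p. front_face p \<sigma>"
  let ?b = "\<lambda>p q. back_face p q \<sigma>"
  have d: "singular_simplex m X (?d k)" if "k \<le> Suc m" for k using singular_simplex_singular_face[OF \<sigma>] that by simp
  have "coboundary X (cup_product X f g) n \<sigma> =
   (\<Sum>k\<le>Suc m. (-1)^k * (\<Sum>p\<le>m. f p (front_face p (?d k)) * g (m - p) (back_face p (m - p) (?d k))))"
   by (simp add: n \<sigma> coboundary_Suc_sum cup_product_apply d del: sum.atMost_Suc)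
  also have "\<dots> = (\<Sum>p\<le>m. \<Sum>k\<le>Suc m. (-1)^k * (f p (front_face p (?d k)) * g (m - p) (back_face p (m - p) (?d k))))"
   by (subst sum.swap) (simp add: sum_distrib_left del: sum.atMost_Suc)
  also have "\<dots> = (\<Sum>p\<le>m. (\<Sum>k\<le>Suc p. (-1)^k * f p (singular_face (Suc p) k (?fr (Suc p)))) * g (m - p) (?b (Suc p) (m - p))
    + (-1)^p * f p (?fr p) * (\<Sum>j\<le>Suc (m - p). (-1)^j * g (m - p) (singular_face (Suc (m - p)) j (?b p (Suc (m - p))))))"
  proof (rule sum.cong[OF refl])
   fix p assume "p \<in> {..m}"
   then have p: "p \<le> m" by simp
   define q where "q = m - p"
   have m: "m = p + q" using p by (simp add: q_def)
   let ?t = "\<lambda>k. (-1)^k * (f p (front_face p (?d k)) * g q (back_face p q (?d k)))"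
   \<comment> \<open>The faces with k \<le> p shorten the front part and keep the back part; those
     with k > p do the opposite.\<close>
   have "sum ?t {..Suc m} = sum ?t {..p} + sum ?t {Suc p..Suc m}"
   proof -
    have "{..Suc m} = {..p} \<union> {Suc p..Suc m}" using p by auto
    then show ?thesis by (simp add: sum.union_disjoint del: sum.atMost_Suc)
   qed
   also have "sum ?t {..p} = (\<Sum>k\<le>p. (-1)^k * f p (singular_face (Suc p) k (?fr (Suc p)))) * g q (?b (Suc p) q)"
    unfolding sum_distrib_right
   proof (rule sum.cong[OF refl], goal_cases)
    case (1 k)
    then show ?case using front_face_lower[OF p, of k \<sigma>] back_face_lower[of k p q \<sigma>] by (simp add: m)
   qed
   also have "sum ?t {Suc p..Suc m} = (\<Sum>j\<in>{Suc 0..Suc q}. (-1)^p * f p (?fr p) * ((-1)^j * g q (singular_face (Suc q) j (?b p (Suc q)))))"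
   proof (rule sum.reindex_bij_witness[where i="\<lambda>j. j + p" and j="\<lambda>k. k - p"], goal_cases)
    case (5 k)
    then have k: "p < k" "k \<le> Suc (p + q)" "p \<le> k" by (auto simp: m)
    then have "(-1::int) ^ k = (-1)^p * (-1)^(k - p)" by (simp flip: power_add)
    then show ?case using front_face_upper[OF p k(1), of \<sigma>] back_face_upper[OF k(3,2), of \<sigma>] by (simp add: m)
   qed (auto simp: m)
   finally have L: "sum ?t {..Suc m} =
    (\<Sum>k\<le>p. (-1)^k * f p (singular_face (Suc p) k (?fr (Suc p)))) * g q (?b (Suc p) q) +
    (\<Sum>j\<in>{Suc 0..Suc q}. (-1)^p * f p (?fr p) * ((-1)^j * g q (singular_face (Suc q) j (?b p (Suc q)))))" .
   \<comment> \<open>The last face of the longer front part and the zeroth face of the longer back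
     part give the same product with opposite signs. These two terms are missing on the left and
     cancel on the right.\<close>
   have e1: "singular_face (Suc p) (Suc p) (?fr (Suc p)) = ?fr p"
    using front_face_lower[OF p, of "Suc p" \<sigma>] front_face_upper[OF p, of "Suc p" \<sigma>] by simp
   have e2: "singular_face (Suc q) 0 (?b p (Suc q)) = ?b (Suc p) q"
    using back_face_lower[of p p q \<sigma>] back_face_upper[of p p q \<sigma>] by simp
   have "{..Suc q} = insert 0 {Suc 0..Suc q}" by auto
   then have s: "(\<Sum>j\<le>Suc q. F j) = F 0 + (\<Sum>j\<in>{Suc 0..Suc q}. F j)" for F :: "nat \<Rightarrow> int" by simp
   show "sum (\<lambda>k. (-1)^k * (f p (front_face p (?d k)) * g (m - p) (back_face p (m - p) (?d k)))) {..Suc m} =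
    (\<Sum>k\<le>Suc p. (-1)^k * f p (singular_face (Suc p) k (?fr (Suc p)))) * g (m - p) (?b (Suc p) (m - p))
    + (-1)^p * f p (?fr p) * (\<Sum>j\<le>Suc (m - p). (-1)^j * g (m - p) (singular_face (Suc (m - p)) j (?b p (Suc (m - p)))))"
    unfolding q_def[symmetric] L s by (simp add: e1 e2 sum_distrib_left algebra_simps)
  qed
  also have "\<dots> = (\<Sum>p\<le>m. coboundary X f (Suc p) (?fr (Suc p)) * g (m - p) (?b (Suc p) (m - p)))
    + (\<Sum>p\<le>m. (-1)^p * f p (?fr p) * coboundary X g (Suc (m - p)) (?b p (Suc (m - p))))" unfolding sum.distrib[symmetric]
   by (rule sum.cong[OF refl])
    (simp add: coboundary_Suc_sum singular_simplex_front_face[OF \<sigma>] singular_simplex_back_face[OF \<sigma>] del: sum.atMost_Suc)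
  also have "(\<Sum>p\<le>m. coboundary X f (Suc p) (?fr (Suc p)) * g (m - p) (?b (Suc p) (m - p)))
    = cup_product X (coboundary X f) g n \<sigma>" unfolding n cup_product_apply[OF \<sigma>] sum.atMost_Suc_shift by simp
  also have "(\<Sum>p\<le>m. (-1)^p * f p (?fr p) * coboundary X g (Suc (m - p)) (?b p (Suc (m - p))))
   = cup_product X (sgn_cochain f) (coboundary X g) n \<sigma>"
   unfolding n cup_product_apply[OF \<sigma>] by (auto simp: sgn_cochain_def Suc_diff_le intro!: sum.cong)
  finally show ?thesis by simp
 next
  case False
  then show ?thesis by (auto simp: coboundary_def cup_product_def)
 qed
qed

lemma cup_cocycles: "f \<in> cocycles X \<Longrightarrow> g \<in> cocycles X \<Longrightarrow> cup_product X f g \<in> cocycles X"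
 by (simp add: cocycles_iff cup_leibniz)

lemma cup_coboundary_left:
 assumes "f \<in> coboundaries X" "g \<in> cocycles X" shows "cup_product X f g \<in> coboundaries X"
proof -
 obtain h where "h \<in> cochains X" "f = coboundary X h" using assms(1) by (auto simp: coboundaries_def)
 with assms(2) show ?thesis by (intro coboundariesI[of "cup_product X h g"]) (auto simp: cup_leibniz cocycles_iff)
qed

lemma cup_coboundary_right:
 assumes "f \<in> cocycles X" "g \<in> coboundaries X" shows "cup_product X f g \<in> coboundaries X"
proof -
 obtain h where "h \<in> cochains X" "g = coboundary X h" using assms(2) by (auto simp: coboundaries_def)
 with assms(1) show ?thesis by (intro coboundariesI[of "cup_product X (sgn_cochain f) h"])
   (auto simp: cup_leibniz cocycles_iff coboundary_sgn)
qed

lemma one_cochain_cocycle [simp]: "one_cochain X \<in> cocycles X"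
proof -
 have "coboundary X (one_cochain X) n \<sigma> = 0" for n \<sigma>
 proof (cases "n = 1 \<and> singular_simplex n X \<sigma>")
  case True
  then show ?thesis using singular_simplex_singular_face[of 1 X \<sigma>] by (simp add: coboundary_def one_cochain_def)
 next
  case False
  then show ?thesis by (cases "n \<le> 1") (auto simp: coboundary_def one_cochain_def le_Suc_eq intro!: sum.neutral)
 qed
 then show ?thesis by (simp add: cocycles_iff fun_eq_iff)
qed

lemma pull_one:
 assumes "continuous_map X Y \<phi>" shows "pull X \<phi> (one_cochain Y) = one_cochain X"
 using singular_simplex_simplex_map[OF _ assms] by (auto simp: pull_def one_cochain_def fun_eq_iff)

lemma pull_cup:
 assumes "continuous_map X Y \<phi>"
 shows "pull X \<phi> (cup_product Y f g) = cup_product X (pull X \<phi> f) (pull X \<phi> g)"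
proof (intro ext, goal_cases)
 case (1 n \<sigma>)
 show ?case
 proof (cases "singular_simplex n X \<sigma>")
  case True
  have "front_face p (simplex_map n \<phi> \<sigma>) = simplex_map p \<phi> (front_face p \<sigma>)" if "p \<le> n" for p
   using standard_simplex_mono[OF that] by (auto simp: front_face_def simplex_map_def fun_eq_iff)
  moreover have "back_face p (n - p) (simplex_map n \<phi> \<sigma>) = simplex_map (n - p) \<phi> (back_face p (n - p) \<sigma>)" if "p \<le> n" for p
   using shift_in_standard_simplex[of _ "n - p" p] that by (auto simp: back_face_shift simplex_map_def fun_eq_iff)
  ultimately show ?thesis
   using True singular_simplex_simplex_map[OF True assms] singular_simplex_front_face[OF True] singular_simplex_back_face[OF True]
   by (simp add: pull_def cup_product_apply)
 qed (simp add: pull_def cup_product_def)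
qed

subsection \<open>Acyclic subcomplexes\<close>

text \<open>The quotient of the singular chains by the span of the simplices in \<open>Sm\<close> is free and acyclic, hence
 contractible; dualising a contraction \<open>K\<close> gives the result.\<close>

lemma vanishing_cocycle_is_coboundary:
 assumes face: "\<And>n k \<sigma>. Sm (Suc n) \<sigma> \<Longrightarrow> k \<le> Suc n \<Longrightarrow> Sm n (singular_face (Suc n) k \<sigma>)"
  and acyc: "\<And>n c. singular_chain n X c \<Longrightarrow> Poly_Mapping.keys (chain_boundary n c) \<subseteq> Collect (Sm (n - 1)) \<Longrightarrow>
   \<exists>e. singular_chain (Suc n) X e \<and> Poly_Mapping.keys (c - chain_boundary (Suc n) e) \<subseteq> Collect (Sm n)"
  and f: "f \<in> cocycles X" "\<And>n \<sigma>. Sm n \<sigma> \<Longrightarrow> f n \<sigma> = 0"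
 obtains g where "g \<in> cochains X" "f = coboundary X g" "\<And>n \<sigma>. Sm n \<sigma> \<Longrightarrow> g n \<sigma> = 0"
proof -
 define small where "small n c \<longleftrightarrow> Poly_Mapping.keys c \<subseteq> Collect (Sm n)" for n and c :: "'a chain"
 have small_0: "small n 0" for n by (simp add: small_def)
 have small_add: "small n (a + b)" if "small n a" "small n b" for n a b using that keys_add[of a b] by (auto simp: small_def)
 have small_uminus: "small n (- a)" if "small n a" for n a using that by (simp add: small_def)
 have small_diff: "small n (a - b)" if "small n a" "small n b" for n a b using that small_add[of n a "- b"] small_uminus by simp
 have small_cmul: "small n (frag_cmul k a)" if "small n a" for n k a using that by (auto simp: small_def)
 have small_sum: "small n (\<Sum>i\<in>I. F i)" if "\<And>i. i \<in> I \<Longrightarrow> small n (F i)" for n I and F :: "nat \<Rightarrow> _"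
  using that by (induction I rule: infinite_finite_induct) (auto simp: small_0 small_add)
 \<comment> \<open>One level k of the contraction relative to the level k' below it: up to small
   chains, k' after the boundary plus the boundary after k is the identity, and k vanishes on small
   simplices.\<close>
 define H where "H n k k' \<longleftrightarrow> (\<forall>\<sigma>. singular_simplex n X \<sigma> \<longrightarrow> singular_chain (Suc n) X (k \<sigma>) \<and>
  small n (frag_of \<sigma> - frag_extend k' (chain_boundary n (frag_of \<sigma>)) - chain_boundary (Suc n) (k \<sigma>)) \<and>
  (Sm n \<sigma> \<longrightarrow> k \<sigma> = 0))" for n and k k' :: "((nat \<Rightarrow> real) \<Rightarrow> 'a) \<Rightarrow> 'a chain"
 have ext: "small n (d - frag_extend k' (chain_boundary n d) - chain_boundary (Suc n) (frag_extend k d)) \<and>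
   singular_chain (Suc n) X (frag_extend k d)" if "H n k k'" "singular_chain n X d" for n k k' d
  using that(2) unfolding singular_chain_def
 proof (induction d rule: frag_induction)
  case (one \<sigma>)
  then show ?case using that(1) by (auto simp: H_def singular_chain_def)
 next
  case (diff a b)
  have eq: "a - b - frag_extend k' (chain_boundary n (a - b)) - chain_boundary (Suc n) (frag_extend k (a - b)) =
   (a - frag_extend k' (chain_boundary n a) - chain_boundary (Suc n) (frag_extend k a)) -
   (b - frag_extend k' (chain_boundary n b) - chain_boundary (Suc n) (frag_extend k b))"
   by (simp add: frag_extend_diff chain_boundary_diff)
  have "small n (a - b - frag_extend k' (chain_boundary n (a - b)) - chain_boundary (Suc n) (frag_extend k (a - b)))"
   unfolding eq using diff by (blast intro: small_diff)
  then show ?case using diff keys_diff[of "frag_extend k a" "frag_extend k b"] by (auto simp: frag_extend_diff)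
 qed (simp add: small_0)
 have step: "\<exists>k'. H n k' k" if n: "n = 0 \<or> (\<exists>k0. H (n - 1) k k0)" for n k
 proof -
  have "\<exists>e. singular_chain (Suc n) X e \<and>
   small n (frag_of \<sigma> - frag_extend k (chain_boundary n (frag_of \<sigma>)) - chain_boundary (Suc n) e) \<and>
   (Sm n \<sigma> \<longrightarrow> e = 0)" if \<sigma>: "singular_simplex n X \<sigma>" for \<sigma>
  proof (cases "Sm n \<sigma>")
   case True
   have "frag_extend k (chain_boundary n (frag_of \<sigma>)) = 0"
   proof (cases n)
    case (Suc m)
    then obtain k0 where k0: "H m k k0" using n by auto
    have "k (singular_face (Suc m) i \<sigma>) = 0" if "i \<le> Suc m" for i
     using k0 face[of m \<sigma> i] True Suc that singular_simplex_singular_face[OF \<sigma>, of i] by (auto simp: H_def)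
    then show ?thesis by (simp add: Suc chain_boundary_of frag_extend_sum frag_extend_cmul del: sum.atMost_Suc)
   qed (simp add: chain_boundary_def)
   then show ?thesis using True by (intro exI[of _ 0]) (simp add: small_def)
  next
   case False
   have sc: "singular_chain n X (frag_of \<sigma>)" using \<sigma> by (simp add: singular_chain_of)
   \<comment> \<open>By the property of the level below, applied to the boundary of \<sigma>, this
     chain has small boundary; acyclicity then supplies the value of the next level at
     \<sigma>.\<close>
   let ?c = "frag_of \<sigma> - frag_extend k (chain_boundary n (frag_of \<sigma>))"
   have "singular_chain n X ?c \<and> small (n - 1) (chain_boundary n ?c)"
   proof (cases n)
    case 0
    then show ?thesis using sc by (simp add: chain_boundary_def small_0)
   next
    case (Suc m)
    then obtain k0 where k0: "H m k k0" using n by auto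
    have d: "singular_chain m X (chain_boundary n (frag_of \<sigma>))" using sc Suc singular_chain_boundary_alt by blast
    have dd: "chain_boundary m (chain_boundary n (frag_of \<sigma>)) = 0" using chain_boundary_boundary[OF sc] Suc by simp
    show ?thesis using ext[OF k0 d] sc unfolding dd unfolding Suc by (simp add: chain_boundary_diff singular_chain_diff)
   qed
   then obtain e where "singular_chain (Suc n) X e" "small n (?c - chain_boundary (Suc n) e)"
    using acyc[of n ?c] by (auto simp: small_def)
   with False show ?thesis by blast
  qed
  then show ?thesis unfolding H_def by metis
 qed
 have "\<exists>K. \<forall>n. (\<exists>k0. H n (K n) k0) \<and> H (Suc n) (K (Suc n)) (K n)"
 proof (rule dependent_nat_choice)
  show "\<exists>k k0. H 0 k k0" using step[of 0] by blast
  show "\<exists>k'. (\<exists>k0. H (Suc n) k' k0) \<and> H (Suc n) k' k" if "\<exists>k0. H n k k0" for k n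
   using step[of "Suc n" k] that by auto
 qed
 then obtain K where K0: "\<And>n. \<exists>k0. H n (K n) k0" and KS: "\<And>n. H (Suc n) (K (Suc n)) (K n)" by blast
 have f_small: "ev (f n) c = 0" if "small n c" for n c using that f(2) by (intro ev_zero) (auto simp: small_def)
 have f_bd: "ev (f n) (chain_boundary (Suc n) e) = 0" if "singular_chain (Suc n) X e" for n e
  using ev_coboundary[OF that, of f] f(1) by (simp add: cocycles_iff ev_zero)
 define g where "g = (\<lambda>n \<sigma>. if singular_simplex n X \<sigma> then ev (f (Suc n)) (K n \<sigma>) else 0)"
 have g: "g \<in> cochains X"
 proof -
  have "{n. g n \<noteq> (\<lambda>\<sigma>. 0)} \<subseteq> Suc -` {n. f n \<noteq> (\<lambda>\<sigma>. 0)}"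
  proof -
   have "g n = (\<lambda>\<sigma>. 0)" if "f (Suc n) = (\<lambda>\<sigma>. 0)" for n using that by (auto simp: g_def fun_eq_iff ev_zero)
   then show ?thesis by auto
  qed
  moreover have "finite (Suc -` {n. f n \<noteq> (\<lambda>\<sigma>. 0)})"
   using f(1) by (intro finite_vimageI) (auto simp: cocycles_iff cochains_def)
  ultimately have "finite {n. g n \<noteq> (\<lambda>\<sigma>. 0)}" by (rule finite_subset)
  then show ?thesis by (simp add: cochains_def g_def)
 qed
 moreover have "f = coboundary X g"
 proof (rule cochains_ext)
  fix n \<sigma> assume \<sigma>: "singular_simplex n X \<sigma>"
  show "f n \<sigma> = coboundary X g n \<sigma>"
  proof (cases n)
   case 0
   then show ?thesis using K0[of 0] \<sigma> f_small f_bd[of 0 "K 0 \<sigma>"] unfolding H_def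
    by (force simp: chain_boundary_def ev_diff)
  next
   case (Suc m)
   have c: "singular_chain (Suc m) X (frag_of \<sigma>)" using \<sigma> by (simp add: singular_chain_of Suc)
   define b where "b = chain_boundary (Suc m) (frag_of \<sigma>)"
   have sb: "singular_chain m X b" using c singular_chain_boundary_alt unfolding b_def by blast
   have "ev (g m) b = ev (\<lambda>\<tau>. ev (f (Suc m)) (K m \<tau>)) b"
   proof -
    have "ev (\<lambda>\<tau>. g m \<tau> - ev (f (Suc m)) (K m \<tau>)) b = 0"
     using sb by (intro ev_zero) (auto simp: g_def singular_chain_def)
    moreover have "ev (\<lambda>\<tau>. p \<tau> - q \<tau>) b = ev p b - ev q b" for p q
     using subset_UNIV by (induction b rule: frag_induction) (auto simp: ev_diff)
    ultimately show ?thesis by simp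
   qed
   also have "\<dots> = ev (f (Suc m)) (frag_extend (K m) b)" by (simp add: ev_extend)
   also have "\<dots> = f (Suc m) \<sigma>"
   proof -
    have H: "singular_chain (Suc (Suc m)) X (K (Suc m) \<sigma>)"
     "small (Suc m) (frag_of \<sigma> - frag_extend (K m) b - chain_boundary (Suc (Suc m)) (K (Suc m) \<sigma>))"
     using KS[of m] \<sigma> by (auto simp: H_def Suc b_def)
    show ?thesis using f_small[OF H(2)] f_bd[OF H(1)] by (simp add: ev_diff)
   qed
   finally show ?thesis using \<sigma> by (simp add: Suc coboundary_Suc b_def)
  qed
 qed (use f(1) g in \<open>auto simp: cocycles_iff\<close>)
 moreover have "g n \<sigma> = 0" if "Sm n \<sigma>" for n \<sigma> using K0[of n] that by (auto simp: g_def H_def)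
 ultimately show thesis using that by blast
qed

subsection \<open>Restriction to subspaces and the Mayer--Vietoris argument\<close>

lemma pull_id_apply: "pull Y id f n \<sigma> = (if singular_simplex n Y \<sigma> then f n \<sigma> else 0)"
 by (auto simp: pull_def singular_simplex_def extensional_restrict)

lemma continuous_map_id_subtopology: "S \<subseteq> T \<Longrightarrow> continuous_map (subtopology X S) (subtopology X T) id"
 by (auto simp: continuous_map_in_subtopology continuous_map_from_subtopology)

lemma continuous_map_id_subtopology': "continuous_map (subtopology X S) X id" by (auto simp: continuous_map_from_subtopology)

lemma cochains_extend:
 assumes "f \<in> cochains (subtopology X S)" "S \<subseteq> T" shows "f \<in> cochains (subtopology X T)"
proof -
 have "f n \<sigma> = 0" if "\<not> singular_simplex n (subtopology X T) \<sigma>" for n \<sigma>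
  using that cochainsD[OF assms(1)] singular_simplex_mono[OF _ assms(2)] by blast
 with assms(1) show ?thesis by (simp add: cochains_def)
qed

lemma pull_subtopology_self: "f \<in> cochains Y \<Longrightarrow> pull Y id f = f" by (simp add: pull_id)

locale open_cover =
 fixes X :: "'a topology" and U V :: "'a set"
 assumes openU: "openin X U" and openV: "openin X V" and cover: "U \<union> V = topspace X"
begin

abbreviation "XU \<equiv> subtopology X U"
abbreviation "XV \<equiv> subtopology X V"
abbreviation "XW \<equiv> subtopology X (U \<inter> V)"

lemma contUW: "continuous_map XW XU id" and contVW: "continuous_map XW XV id"
 and contU: "continuous_map XU X id" and contV: "continuous_map XV X id"
 by (simp_all add: continuous_map_id_subtopology continuous_map_id_subtopology')

text \<open>Small simplices are those inside U or inside V. Finitely many subdivisions make a chain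
  small, and the chain homotopy between subdivision and the identity preserves chains of subspaces.
  Hence a chain with small boundary is small up to a boundary, which is the acyclicity required
  above.\<close>

lemma vanishing_on_cover:
 assumes "f \<in> cocycles X" "pull XU id f = 0" "pull XV id f = 0"
 obtains g where "g \<in> cochains X" "f = coboundary X g" "pull XU id g = 0" "pull XV id g = 0"
proof -
 define Sm where "Sm n \<sigma> \<longleftrightarrow> singular_simplex n XU \<sigma> \<or> singular_simplex n XV \<sigma>" for n \<sigma>
 have face: "Sm n (singular_face (Suc n) k \<sigma>)" if "Sm (Suc n) \<sigma>" "k \<le> Suc n" for n k \<sigma>
  using that singular_simplex_singular_face[of "Suc n" _ \<sigma> k] by (auto simp: Sm_def)
 have acyc: "\<exists>e. singular_chain (Suc n) X e \<and> Poly_Mapping.keys (c - chain_boundary (Suc n) e) \<subseteq> Collect (Sm n)"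
  if c: "singular_chain n X c" and bd: "Poly_Mapping.keys (chain_boundary n c) \<subseteq> Collect (Sm (n - 1))" for n c
 proof -
  obtain m where m: "\<And>\<sigma>. \<sigma> \<in> Poly_Mapping.keys ((singular_subdivision n ^^ m) c) \<Longrightarrow> \<exists>A\<in>{U,V}. \<sigma> \<in> standard_simplex n \<rightarrow> A"
  proof (rule sufficient_iterated_singular_subdivision_exists[of "{U,V}" X n c])
   show "openin X A" if "A \<in> {U,V}" for A using that openU openV by auto
   show "topspace X \<subseteq> \<Union>{U,V}" using cover by simp
  qed (use c in auto)
  obtain h where h0: "\<And>p. h p 0 = (0 :: 'a chain)"
    and hd: "\<And>p c1 c2. h p (c1-c2) = h p c1 - h p c2"
    and hs: "\<And>p X c. singular_chain p X c \<Longrightarrow> singular_chain (Suc p) X (h p c)"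
    and hb: "\<And>p X c. singular_chain p X c
        \<Longrightarrow> chain_boundary (Suc p) (h p c) + h (p - Suc 0) (chain_boundary p c)
         = (singular_subdivision p ^^ m) c - c" using chain_homotopic_iterated_singular_subdivision[of m] by blast
  let ?e = "- h n c"
  have e: "singular_chain (Suc n) X ?e" using hs[OF c] by (simp add: singular_chain_minus)
  have eq: "c - chain_boundary (Suc n) ?e = (singular_subdivision n ^^ m) c - h (n - Suc 0) (chain_boundary n c)"
   using hb[OF c] by (simp add: chain_boundary_minus algebra_simps)
  have "singular_chain n X ((singular_subdivision n ^^ i) c)" for i by (induction i) (auto simp: singular_chain_singular_subdivision c)
  then have k1: "Poly_Mapping.keys ((singular_subdivision n ^^ m) c) \<subseteq> Collect (Sm n)"
   using m unfolding singular_chain_def Sm_def singular_simplex_subtopology by fast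
  have k2: "Poly_Mapping.keys (h (n - 1) (chain_boundary n c)) \<subseteq> Collect (Sm n)"
  proof (cases n)
   case 0
   then show ?thesis by (simp add: chain_boundary_def h0)
  next
   case (Suc p)
   have "Poly_Mapping.keys (h p d) \<subseteq> Collect (Sm n)" if "Poly_Mapping.keys d \<subseteq> Collect (Sm p)" for d using that
   proof (induction d rule: frag_induction)
    case (one \<sigma>)
    then show ?case using hs[of p XU "frag_of \<sigma>"] hs[of p XV "frag_of \<sigma>"]
     by (auto simp: Sm_def singular_chain_of singular_chain_def Suc)
   next
    case (diff a b)
    then show ?case using keys_diff[of "h p a" "h p b"] by (auto simp: hd)
   qed (simp add: h0)
   then show ?thesis using bd by (simp add: Suc)
  qed
  show ?thesis using e eq k1 k2 keys_diff[of "(singular_subdivision n ^^ m) c" "h (n - 1) (chain_boundary n c)"]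
   by (intro exI[of _ ?e]) auto
 qed
 have "f n \<sigma> = 0" if "Sm n \<sigma>" for n \<sigma>
 proof -
  have "pull XU id f n \<sigma> = 0" "pull XV id f n \<sigma> = 0" using assms by (simp_all)
  then show ?thesis using that by (auto simp: Sm_def pull_id_apply split: if_splits)
 qed
 from vanishing_cocycle_is_coboundary[OF face acyc assms(1) this]
 obtain g where g: "g \<in> cochains X" "f = coboundary X g" "\<And>n \<sigma>. Sm n \<sigma> \<Longrightarrow> g n \<sigma> = 0" by blast
 have "pull XU id g = 0" "pull XV id g = 0" using g(3) by (auto simp: pull_id_apply Sm_def intro!: ext)
 with g that show thesis by blast
qed

lemma glue_cochains:
 assumes "a \<in> cochains XU" "b \<in> cochains XV" "pull XW id a = pull XW id b"
 obtains e where "e \<in> cochains X" "pull XU id e = a" "pull XV id e = b"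
proof -
 define e where "e = (\<lambda>n \<sigma>. if singular_simplex n XU \<sigma> then a n \<sigma> else b n \<sigma>)"
 have ab: "a n \<sigma> = b n \<sigma>" if "singular_simplex n XU \<sigma>" "singular_simplex n XV \<sigma>" for n \<sigma>
 proof -
  have "singular_simplex n XW \<sigma>" using that by (auto simp: singular_simplex_subtopology)
  with assms(3) show ?thesis by (auto simp: pull_id_apply fun_eq_iff) (metis)
 qed
 have "finite {n. e n \<noteq> (\<lambda>\<sigma>. 0)}"
 proof (rule finite_subset)
  show "{n. e n \<noteq> (\<lambda>\<sigma>. 0)} \<subseteq> {n. a n \<noteq> (\<lambda>\<sigma>. 0)} \<union> {n. b n \<noteq> (\<lambda>\<sigma>. 0)}"
   by (auto simp: e_def)
 qed (use assms in \<open>simp add: cochains_def\<close>)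
 moreover have "e n \<sigma> = 0" if "\<not> singular_simplex n X \<sigma>" for n \<sigma>
  using that assms(2) by (auto simp: e_def singular_simplex_subtopology cochains_def)
 ultimately have "e \<in> cochains X" by (simp add: cochains_def)
 moreover have "pull XU id e = a" "pull XV id e = b"
  using ab cochainsD[OF assms(1)] cochainsD[OF assms(2)] by (auto simp: pull_id_apply e_def intro!: ext)
 ultimately show thesis using that by blast
qed

text \<open>The glued cochain may fail to be closed on simplices that lie in neither set. Its
  coboundary vanishes on both sets, so it has a primitive vanishing on both sets, and this is
  subtracted.\<close>

lemma glue_cocycles:
 assumes "p \<in> cocycles XU" "q \<in> cocycles XV" "pull XW id p = pull XW id q"
 obtains F where "F \<in> cocycles X" "pull XU id F = p" "pull XV id F = q"
proof -
 obtain e where e: "e \<in> cochains X" "pull XU id e = p" "pull XV id e = q" using glue_cochains assms cocyclesD by metis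
 have "coboundary X e \<in> cocycles X" using e by (simp add: cocycles_iff)
 moreover have "pull XU id (coboundary X e) = 0" "pull XV id (coboundary X e) = 0"
  using e assms by (simp_all add: pull_coboundary[OF contU] pull_coboundary[OF contV] cocycles_iff)
 ultimately obtain g where g: "g \<in> cochains X" "coboundary X e = coboundary X g" "pull XU id g = 0" "pull XV id g = 0"
  using vanishing_on_cover by metis
 show thesis by (rule that[of "e - g"]) (use e g in \<open>auto simp: cocycles_iff coboundary_diff pull_diff\<close>)
qed

text \<open>A primitive on the intersection extends by zero to U. This turns agreement up to a
  coboundary into equality, as the gluing lemmas require.\<close>

lemma adjust:
 assumes "a \<in> cochains XU" "pull XW id a - b \<in> coboundaries XW"
 obtains c where "c \<in> cochains XU" "pull XW id (a - coboundary XU c) = b"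
proof -
 obtain c where c: "c \<in> cochains XW" "pull XW id a - b = coboundary XW c" using assms(2) by (auto simp: coboundaries_def)
 have c': "c \<in> cochains XU" using cochains_extend[OF c(1)] by blast
 have "pull XW id (coboundary XU c) = pull XW id a - b"
  unfolding c(2) using c(1) by (simp add: pull_coboundary[OF contUW] pull_subtopology_self)
 then have "pull XW id (a - coboundary XU c) = b" unfolding pull_diff by (simp only: diff_diff_eq2 add_diff_cancel_left')
 with c' show thesis by (rule that)
qed

text \<open>Exactness of the Mayer--Vietoris sequence: primitives on the two sets define the class
  of their difference on the intersection, and once that class is zero they can be corrected to
  glue.\<close>

lemma coboundary_if_cover:
 assumes f: "f \<in> cocycles X" and a: "a \<in> cochains XU" "pull XU id f = coboundary XU a"
  and b: "b \<in> cochains XV" "pull XV id f = coboundary XV b"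
  and ab: "pull XW id a - pull XW id b \<in> coboundaries XW"
 shows "f \<in> coboundaries X"
proof -
 obtain c where c: "c \<in> cochains XU" "pull XW id (a - coboundary XU c) = pull XW id b" by (rule adjust[OF a(1) ab])
 have "a - coboundary XU c \<in> cochains XU" using a c by simp
 then obtain e where e: "e \<in> cochains X" "pull XU id e = a - coboundary XU c" "pull XV id e = b"
  by (rule glue_cochains[OF _ b(1) c(2)])
 have "f - coboundary X e \<in> cocycles X" using e f by (simp add: cocycles_iff coboundary_diff)
 moreover have "pull XU id (f - coboundary X e) = 0" "pull XV id (f - coboundary X e) = 0"
  using e a b by (simp_all add: pull_diff pull_coboundary[OF contU] pull_coboundary[OF contV] coboundary_diff)
 ultimately obtain g where "g \<in> cochains X" "f - coboundary X e = coboundary X g" using vanishing_on_cover by metis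
 then show ?thesis using e by (intro coboundariesI[of "g + e"]) (simp_all add: coboundary_add flip: diff_eq_eq)
qed

lemma glue_cocycles_mod:
 assumes "p \<in> cocycles XU" "q \<in> cocycles XV" "pull XW id p - pull XW id q \<in> coboundaries XW"
 obtains F where "F \<in> cocycles X" "pull XU id F - p \<in> coboundaries XU" "pull XV id F = q"
proof -
 obtain c where c: "c \<in> cochains XU" "pull XW id (p - coboundary XU c) = pull XW id q"
  by (rule adjust[OF cocyclesD[OF assms(1)] assms(3)])
 have "p - coboundary XU c \<in> cocycles XU" using assms c by (simp add: cocycles_iff coboundary_diff)
 then obtain F where "F \<in> cocycles X" "pull XU id F = p - coboundary XU c" "pull XV id F = q"
  using glue_cocycles[OF _ assms(2) c(2)] by blast
 then show thesis using c by (intro that[of F]) (auto intro!: coboundariesI[of "- c"] simp: coboundary_minus)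
qed

text \<open>The connecting map of the Mayer--Vietoris sequence: extend f by zero to U, take its
  coboundary there, and glue with zero on V.\<close>

lemma connecting:
 assumes "f \<in> cocycles XW"
 obtains F where "F \<in> cocycles X" "pull XU id F = coboundary XU f" "pull XV id F = 0"
proof -
 have "f \<in> cochains XU" using assms cochains_extend[of f X "U \<inter> V" U] by (auto simp: cocycles_iff)
 then have "coboundary XU f \<in> cocycles XU" by (simp add: cocycles_iff)
 moreover have "pull XW id (coboundary XU f) = 0" using assms by (simp add: pull_coboundary[OF contUW] pull_subtopology_self cocycles_iff)
 ultimately show thesis using glue_cocycles[of "coboundary XU f" 0] that cocycles_zero pull_zero by metis
qed

end

lemma disjoint_union_coboundary:
 assumes "openin X U" "openin X V" "U \<union> V = topspace X" "U \<inter> V = {}"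
  "f \<in> cocycles X" "pull (subtopology X U) id f \<in> coboundaries (subtopology X U)"
  "pull (subtopology X V) id f \<in> coboundaries (subtopology X V)"
 shows "f \<in> coboundaries X"
proof -
 interpret open_cover X U V using assms by unfold_locales
 obtain a b where "a \<in> cochains XU" "pull XU id f = coboundary XU a" "b \<in> cochains XV" "pull XV id f = coboundary XV b"
  using assms by (auto simp: coboundaries_def)
 moreover have "pull XW id g = 0" for g :: "'a cochain" using singular_simplex_empty[of XW] assms(4) by (auto simp: pull_def intro!: ext)
 ultimately show ?thesis using coboundary_if_cover[OF assms(5)] by simp
qed

subsection \<open>Homotopy invariance for deformation retracts\<close>

text \<open>After subtracting the pullback of a primitive on B, the cocycle vanishes on every
  simplex in the image of the section. The homotopy keeps this image in itself, so chains modulo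
  those in the image are acyclic, and a cocycle vanishing on the image bounds.\<close>

lemma coboundary_if_coboundary_on_section:
 assumes \<pi>: "continuous_map X B \<pi>" and \<sigma>: "continuous_map B X \<sigma>"
  and \<pi>\<sigma>: "\<And>b. b \<in> topspace B \<Longrightarrow> \<pi> (\<sigma> b) = b"
  and hom: "homotopic_with (\<lambda>h. h \<in> \<sigma> ` topspace B \<rightarrow> \<sigma> ` topspace B) X X id (\<sigma> \<circ> \<pi>)"
  and f: "f \<in> cocycles X" "pull B \<sigma> f \<in> coboundaries B"
 shows "f \<in> coboundaries X"
proof -
 obtain g where g: "g \<in> cochains B" "pull B \<sigma> f = coboundary B g" using f(2) by (auto simp: coboundaries_def)
 define f' where "f' = f - coboundary X (pull X \<pi> g)"
 have f': "f' \<in> cocycles X" using f g by (simp add: f'_def cocycles_iff coboundary_diff)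
 have "pull B \<sigma> (pull X \<pi> g) = g" unfolding pull_pull[OF \<sigma>] using g \<pi>\<sigma> by (intro pull_id) auto
 then have "pull B \<sigma> f' = 0" by (simp add: f'_def pull_diff pull_coboundary[OF \<sigma>] g)
 let ?S = "\<sigma> ` topspace B"
 define Sm where "Sm n \<tau> \<longleftrightarrow> singular_simplex n (subtopology X ?S) \<tau>" for n \<tau>
 have face: "Sm n (singular_face (Suc n) k \<tau>)" if "Sm (Suc n) \<tau>" "k \<le> Suc n" for n k \<tau>
  using that singular_simplex_singular_face[of "Suc n" _ \<tau> k] by (auto simp: Sm_def)
 have cont: "continuous_map X (subtopology X ?S) (\<sigma> \<circ> \<pi>)"
  using continuous_map_compose[OF \<pi> \<sigma>] continuous_map_image_subset_topspace[OF \<pi>]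
  by (auto simp: continuous_map_in_subtopology)
 have acyc: "\<exists>e. singular_chain (Suc n) X e \<and> Poly_Mapping.keys (c - chain_boundary (Suc n) e) \<subseteq> Collect (Sm n)"
  if c: "singular_chain n X c" and bd: "Poly_Mapping.keys (chain_boundary n c) \<subseteq> Collect (Sm (n - 1))" for n c
 proof -
  \<comment> \<open>As the homotopy is one of pairs, a relative cycle c differs by a relative
    boundary from its retract, which consists of simplices in the image.\<close>
  have "singular_relcycle n X ?S c" using c bd by (simp add: singular_relcycle singular_chain_def Sm_def[abs_def])
  from homotopic_imp_homologous_rel_chain_maps[OF hom this]
  have "singular_relboundary n X ?S (c - chain_map n (\<sigma> \<circ> \<pi>) c)"
   using c by (simp add: homologous_rel_def chain_map_ident)
  then obtain d where d: "singular_chain (Suc n) X d"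
   "singular_chain n (subtopology X ?S) (chain_boundary (Suc n) d - (c - chain_map n (\<sigma> \<circ> \<pi>) c))"
   by (auto simp: singular_relboundary_def mod_subset_def)
  have "singular_chain n (subtopology X ?S) (chain_map n (\<sigma> \<circ> \<pi>) c)" using singular_chain_chain_map[OF c cont] .
  from singular_chain_diff[OF this d(2)]
  have "singular_chain n (subtopology X ?S) (c - chain_boundary (Suc n) d)" by simp
  with d(1) show ?thesis by (auto simp: singular_chain_def Sm_def[abs_def])
 qed
 have "f' n \<tau> = 0" if "Sm n \<tau>" for n \<tau>
 proof -
  have \<tau>: "singular_simplex n X \<tau>" "\<tau> ` standard_simplex n \<subseteq> ?S"
   using that by (auto simp: Sm_def singular_simplex_subtopology)
  have "simplex_map n \<sigma> (simplex_map n \<pi> \<tau>) = \<tau>"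
   using \<tau> \<pi>\<sigma> by (auto simp: simplex_map_def singular_simplex_def extensional_def fun_eq_iff)
  moreover have "pull B \<sigma> f' n (simplex_map n \<pi> \<tau>) = 0" using \<open>pull B \<sigma> f' = 0\<close> by simp
  ultimately show ?thesis using singular_simplex_simplex_map[OF \<tau>(1) \<pi>] by (simp add: pull_def)
 qed
 from vanishing_cocycle_is_coboundary[OF face acyc f' this]
 obtain g' where "g' \<in> cochains X" "f' = coboundary X g'" by blast
 then show ?thesis using g by (intro coboundariesI[of "g' + pull X \<pi> g"]) (simp_all add: coboundary_add f'_def flip: diff_eq_eq)
qed

lemma section_retraction_mod:
 assumes \<pi>: "continuous_map X B \<pi>" and \<sigma>: "continuous_map B X \<sigma>"
  and \<pi>\<sigma>: "\<And>b. b \<in> topspace B \<Longrightarrow> \<pi> (\<sigma> b) = b"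
  and hom: "homotopic_with (\<lambda>h. h \<in> \<sigma> ` topspace B \<rightarrow> \<sigma> ` topspace B) X X id (\<sigma> \<circ> \<pi>)"
  and f: "f \<in> cocycles X"
 shows "f - pull X \<pi> (pull B \<sigma> f) \<in> coboundaries X"
proof (rule coboundary_if_coboundary_on_section[OF assms(1-4)])
 show "f - pull X \<pi> (pull B \<sigma> f) \<in> cocycles X"
  using f by (intro cocycles_diff pull_cocycles[OF \<pi>] pull_cocycles[OF \<sigma>])
 have "pull B \<sigma> (pull X \<pi> (pull B \<sigma> f)) = pull B \<sigma> f"
  unfolding pull_pull[OF \<sigma>] using \<pi>\<sigma> f by (intro pull_id) (auto dest: cocyclesD)
 then show "pull B \<sigma> (f - pull X \<pi> (pull B \<sigma> f)) \<in> coboundaries B" by (simp add: pull_diff)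
qed

subsection \<open>Squares of classes of degree one\<close>

definition concentrated :: "nat \<Rightarrow> 'a cochain \<Rightarrow> bool" where
 "concentrated k f \<longleftrightarrow> (\<forall>n. n \<noteq> k \<longrightarrow> f n = (\<lambda>\<sigma>. 0))"

text \<open>If \<open>a\<close> is an integral cocycle of degree one, the function \<open>a (a - 1) / 2\<close> on edges bounds the negative of its square.\<close>

lemma cup_square_coboundary:
 assumes v: "v \<in> cocycles X" "concentrated 1 v"
 shows "cup_product X v v \<in> coboundaries X"
proof -
 define g :: "'a cochain" where "g = (\<lambda>n \<sigma>. if n = 1 then - (v 1 \<sigma> * (v 1 \<sigma> - 1) div 2) else 0)"
 have g: "g \<in> cochains X"
 proof -
  have "{n. g n \<noteq> (\<lambda>\<sigma>. 0)} \<subseteq> {1}" by (auto simp: g_def fun_eq_iff split: if_splits)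
  then show ?thesis using v by (auto simp: cochains_def cocycles_iff g_def finite_subset)
 qed
 have "cup_product X v v = coboundary X g"
 proof (rule cochains_ext)
  fix n \<sigma> assume \<sigma>: "singular_simplex n X \<sigma>"
  show "cup_product X v v n \<sigma> = coboundary X g n \<sigma>"
  proof (cases "n = 2")
   case True
   have v0: "v 0 = (\<lambda>\<sigma>. 0)" "v 2 = (\<lambda>\<sigma>. 0)" using v(2) by (auto simp: concentrated_def)
   define a b c where "a = v 1 (singular_face 2 2 \<sigma>)" and "b = v 1 (singular_face 2 0 \<sigma>)" and "c = v 1 (singular_face 2 1 \<sigma>)"
   have fr: "front_face 1 \<sigma> = singular_face 2 2 \<sigma>" and bk: "back_face 1 1 \<sigma> = singular_face 2 0 \<sigma>"
   proof -
    have s: "singular_simplex 1 X (singular_face 2 k \<sigma>)" if "k \<le> 2" for k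
     using singular_simplex_singular_face[of 2 X \<sigma> k] \<sigma> True that by simp
    show "front_face 1 \<sigma> = singular_face 2 2 \<sigma>"
     using front_face_upper[of 1 1 2 \<sigma>] front_face_self[OF s[of 2]] by (simp add: numeral_2_eq_2)
    show "back_face 1 1 \<sigma> = singular_face 2 0 \<sigma>"
     using back_face_lower[of 0 0 1 \<sigma>] back_face_self[OF s[of 0]] by (simp add: numeral_2_eq_2)
   qed
   have "coboundary X v 2 \<sigma> = 0" using v by (simp add: cocycles_iff)
   then have c: "c = a + b" using \<sigma> True by (simp add: coboundary_def a_def b_def c_def numeral_2_eq_2)
   have "cup_product X v v n \<sigma> = a * b" using \<sigma> True fr bk v0 by (simp add: cup_product_apply numeral_2_eq_2 a_def b_def)
   moreover have "coboundary X g n \<sigma> = - (b * (b - 1) div 2) + c * (c - 1) div 2 - a * (a - 1) div 2"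
    using \<sigma> True by (simp add: coboundary_def g_def numeral_2_eq_2 a_def b_def c_def)
   \<comment> \<open>Products of consecutive integers are even, so the division is exact. The
     required identity is verified after doubling, with c = a + b from the cocycle
     condition.\<close>
   moreover have "2 * (x * (x - 1) div 2) = x * (x - 1)" for x :: int by simp
   then have "2 * (- (b * (b - 1) div 2) + c * (c - 1) div 2 - a * (a - 1) div 2) =
    - (b * (b - 1)) + c * (c - 1) - a * (a - 1)" unfolding right_diff_distrib[of 2] distrib_left[of 2] mult_minus_right by metis
   then have "2 * (- (b * (b - 1) div 2) + c * (c - 1) div 2 - a * (a - 1) div 2) = 2 * (a * b)"
    unfolding c by (simp only: algebra_simps)
   then have "- (b * (b - 1) div 2) + c * (c - 1) div 2 - a * (a - 1) div 2 = a * b" by (rule mult_left_cancel[THEN iffD1, rotated]) simp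
   ultimately show ?thesis by (simp only:)
  next
   case False
   have "cup_product X v v n \<sigma> = 0" unfolding cup_product_apply[OF \<sigma>]
   proof (intro sum.neutral ballI)
    fix p assume "p \<in> {..n}"
    then have "p \<noteq> 1 \<or> n - p \<noteq> 1" using False by auto
    then have "v p = (\<lambda>\<sigma>. 0) \<or> v (n - p) = (\<lambda>\<sigma>. 0)" using v(2) unfolding concentrated_def by blast
    then show "v p (front_face p \<sigma>) * v (n - p) (back_face p (n - p) \<sigma>) = 0" by auto
   qed
   moreover have "coboundary X g n \<sigma> = 0" using False by (auto simp: coboundary_def g_def intro!: sum.neutral)
   ultimately show ?thesis by simp
  qed
 qed (use v g in \<open>auto simp: cocycles_iff\<close>)
 then show ?thesis using g by (intro coboundariesI)
qed

text \<open>Polarisation of the vanishing of squares.\<close>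

lemma cup_anticommute_coboundary:
 assumes v: "v \<in> cocycles X" "concentrated 1 v" and w: "w \<in> cocycles X" "concentrated 1 w"
 shows "cup_product X v w + cup_product X w v \<in> coboundaries X"
proof -
 have "concentrated 1 (v + w)" using v w by (auto simp: concentrated_def plus_fun_def)
 then have "cup_product X (v + w) (v + w) \<in> coboundaries X" using v w by (intro cup_square_coboundary) auto
 from coboundaries_diff[OF coboundaries_diff[OF this cup_square_coboundary[OF v]] cup_square_coboundary[OF w]]
 show ?thesis by (simp add: cup_add_left cup_add_right add.commute)
qed

subsection \<open>The cohomology of a point\<close>

text \<open>A point has one simplex \<open>c m\<close> in each dimension, and the coboundary into
  degree m is the identity for even m > 0 and zero for odd m. Hence cocycles of odd degree vanish
  and those of positive even degree bound.\<close>

lemma point_cocycle_coboundary: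
 assumes X: "topspace X = {x}" and f: "f \<in> cocycles X" "concentrated n f" "n > 0"
 shows "f \<in> coboundaries X"
proof -
 have uniq: "\<sigma> = (\<lambda>y\<in>standard_simplex m. x)" if "singular_simplex m X \<sigma>" for m \<sigma>
  using that continuous_map_image_subset_topspace[of _ X \<sigma>] X
  by (fastforce simp: singular_simplex_def extensional_def restrict_def)
 define c :: "nat \<Rightarrow> (nat \<Rightarrow> real) \<Rightarrow> 'a" where "c m = (\<lambda>y\<in>standard_simplex m. x)" for m
 have c: "singular_simplex m X (c m)" for m
  using X by (auto simp: singular_simplex_def c_def intro: continuous_map_eq[of _ _ "\<lambda>y. x"])
 have face: "singular_face (Suc m) k (c (Suc m)) = c m" if "k \<le> Suc m" for m k
  using uniq[OF singular_simplex_singular_face[OF c[of "Suc m"], of k]] that by (simp add: c_def)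
 have alt: "(\<Sum>k\<le>m. (-1)^k) = (if even m then 1 else (0::int))" for m :: nat by (induction m) auto
 have cob: "coboundary X g (Suc m) (c (Suc m)) = (if even (Suc m) then g m (c m) else 0)" for g m
 proof -
  have "coboundary X g (Suc m) (c (Suc m)) = (\<Sum>k\<le>Suc m. (-1)^k) * g m (c m)"
   using c[of "Suc m"] by (simp add: coboundary_Suc_sum face sum_distrib_right del: sum.atMost_Suc)
  then show ?thesis unfolding alt by simp
 qed
 have f0: "f m = (\<lambda>\<sigma>. 0)" if "m \<noteq> n" for m using f(2) that by (auto simp: concentrated_def)
 define g :: "'a cochain" where "g = (\<lambda>m \<sigma>. if Suc m = n \<and> singular_simplex m X \<sigma> then f n (c n) else 0)"
 have g: "g \<in> cochains X" unfolding cochains_def by (auto simp: g_def intro!: finite_subset[of _ "{n - 1}"] ext)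
 have "f = coboundary X g"
 proof (rule cochains_ext)
  fix m \<sigma> assume \<sigma>: "singular_simplex m X \<sigma>"
  then have "\<sigma> = c m" using uniq by (simp add: c_def)
  moreover have "f m (c m) = coboundary X g m (c m)"
  proof (cases m)
   case 0
   then show ?thesis using f(3) f0[of 0] by simp
  next
   case (Suc l)
   show ?thesis
   proof (cases "even m")
    case True
    then show ?thesis using cob[of g l] c[of l] f0[of m] by (auto simp: Suc g_def)
   next
    case False
    then have "coboundary X f (Suc m) (c (Suc m)) = f m (c m)" using cob[of f m] by simp
    then have "f m (c m) = 0" using f(1) by (simp add: cocycles_iff)
    with False show ?thesis using cob[of g l] by (simp add: Suc)
   qed
  qed
  ultimately show "f m \<sigma> = coboundary X g m \<sigma>" by simp
 qed (use f g in \<open>auto simp: cocycles_iff\<close>)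
 with g show ?thesis by (intro coboundariesI)
qed

subsection \<open>Homogeneous parts\<close>

definition part :: "nat \<Rightarrow> 'a cochain \<Rightarrow> 'a cochain" where
 "part k f = (\<lambda>n. if n = k then f n else (\<lambda>\<sigma>. 0))"

lemma concentrated_part [simp]: "concentrated k (part k f)" by (simp add: concentrated_def part_def)

lemma part_concentrated: "concentrated k f \<Longrightarrow> part n f = (if n = k then f else 0)"
 by (auto simp: concentrated_def part_def fun_eq_iff)

lemma part_zero [simp]: "part k 0 = 0" by (auto simp: part_def fun_eq_iff)

lemma part_add: "part k (f + g) = part k f + part k g" by (auto simp: part_def fun_eq_iff)

lemma part_minus: "part k (- g) = - part k g" by (auto simp: part_def fun_eq_iff)

lemma part_diff: "part k (f - g) = part k f - part k g" by (auto simp: part_def fun_eq_iff)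

lemma part_sum: "part k (\<Sum>i\<in>I. f i) = (\<Sum>i\<in>I. part k (f i))" by (auto simp: part_def fun_eq_iff sum_fun_apply)

lemma part_cochains [simp]: "f \<in> cochains X \<Longrightarrow> part k f \<in> cochains X"
 by (auto simp: cochains_def part_def intro!: finite_support_mono[of f])

lemma part_coboundary_Suc: "part (Suc k) (coboundary X f) = coboundary X (part k f)"
 by (auto simp: part_def coboundary_def fun_eq_iff intro!: sum.neutral)

lemma part_coboundary_0: "part 0 (coboundary X f) = 0" by (auto simp: part_def coboundary_def fun_eq_iff)

lemma part_cocycles [simp]: "f \<in> cocycles X \<Longrightarrow> part k f \<in> cocycles X"
 by (simp add: cocycles_iff flip: part_coboundary_Suc)

lemma part_coboundaries [simp]: "f \<in> coboundaries X \<Longrightarrow> part k f \<in> coboundaries X"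
proof -
 assume "f \<in> coboundaries X"
 then obtain h where "h \<in> cochains X" "f = coboundary X h" by (auto simp: coboundaries_def)
 then show ?thesis by (cases k) (auto simp: part_coboundary_Suc part_coboundary_0 intro!: coboundariesI[OF part_cochains refl])
qed

lemma part_pull: "part k (pull X \<phi> f) = pull X \<phi> (part k f)" by (auto simp: part_def pull_def fun_eq_iff)

lemma part_cup_Suc:
 assumes "concentrated 1 f"
 shows "part (Suc k) (cup_product X f g) = cup_product X f (part k g)"
proof (intro ext, goal_cases)
 case (1 n \<sigma>)
 show ?case
 proof (cases "singular_simplex n X \<sigma>")
  case True
  have "part (Suc k) (cup_product X f g) n \<sigma> = (if n = Suc k then cup_product X f g n \<sigma> else 0)" by (simp add: part_def)
  also have "\<dots> = (\<Sum>p\<le>n. if n = Suc k then f p (front_face p \<sigma>) * g (n - p) (back_face p (n - p) \<sigma>) else 0)"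
   unfolding cup_product_apply[OF True] by (cases "n = Suc k") (simp_all del: sum.atMost_Suc)
  also have "\<dots> = (\<Sum>p\<le>n. f p (front_face p \<sigma>) * part k g (n - p) (back_face p (n - p) \<sigma>))"
  proof (intro sum.cong refl)
   fix p assume "p \<in> {..n}"
   moreover have "f p = (\<lambda>\<sigma>. 0)" if "p \<noteq> 1" using assms that by (auto simp: concentrated_def)
   ultimately show "(if n = Suc k then f p (front_face p \<sigma>) * g (n - p) (back_face p (n - p) \<sigma>) else 0) =
    f p (front_face p \<sigma>) * part k g (n - p) (back_face p (n - p) \<sigma>)" by (cases "p = 1") (auto simp: part_def)
  qed
  finally show ?thesis by (simp add: cup_product_apply[OF True])
 qed (auto simp: part_def cup_product_def)
qed

lemma part_cup_0:
 assumes "concentrated 1 f"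
 shows "part 0 (cup_product X f g) = 0" using assms by (auto simp: part_def cup_product_def concentrated_def fun_eq_iff)

lemma concentrated_cup:
 assumes "concentrated i f" "concentrated j g"
 shows "concentrated (i + j) (cup_product X f g)" unfolding concentrated_def
proof (intro allI impI ext)
 fix n \<sigma> assume n: "n \<noteq> i + j"
 show "cup_product X f g n \<sigma> = 0" unfolding cup_product_def
 proof (auto intro!: sum.neutral)
  fix p assume p: "p \<le> n" and nz: "g (n - p) (back_face p (n - p) \<sigma>) \<noteq> 0"
  have "n - p = j" using nz assms(2) by (auto simp: concentrated_def fun_eq_iff)
  with n p have "p \<noteq> i" by auto
  then show "f p (front_face p \<sigma>) = 0" using assms(1) by (simp add: concentrated_def)
 qed
qed

lemma concentrated_pull: "concentrated k f \<Longrightarrow> concentrated k (pull X \<phi> f)"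
 by (auto simp: concentrated_def pull_def fun_eq_iff)

subsection \<open>The class of a map to the punctured plane\<close>

abbreviation punct :: "complex topology" where "punct \<equiv> top_of_set (- {0})"

text \<open>The plane cut along the nonpositive real ray and, below, along the nonnegative one. The
  two star-shaped open sets cover the punctured plane and meet in two disjoint half planes, which is
  the shape needed for Mayer--Vietoris.\<close>

definition slit :: "complex set" where "slit = - \<real>\<^sub>\<le>\<^sub>0"

definition cslit :: "complex set" where "cslit = - \<real>\<^sub>\<ge>\<^sub>0"

lemma slit_cover:
 "slit \<union> cslit = - {0}" "slit \<inter> cslit = {z. Im z > 0} \<union> {z. Im z < 0}"
 by (auto simp: complex_nonpos_Reals_iff complex_nonneg_Reals_iff complex_eq_iff slit_def cslit_def)

lemma open_slit: "open slit" "open cslit"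
 by (simp_all add: slit_def cslit_def closed_nonpos_Reals_complex closed_nonneg_Reals_complex open_Compl)

lemma starlike_slit: "starlike slit" "starlike cslit"
proof -
 have "\<real>\<^sub>\<le>\<^sub>0 = complex_of_real ` {..0}" "\<real>\<^sub>\<ge>\<^sub>0 = complex_of_real ` {0..}"
  by (auto simp: nonpos_Reals_def nonneg_Reals_def)
 then show "starlike slit" "starlike cslit"
  unfolding slit_def cslit_def by (metis starlike_slotted_complex_plane_left, metis starlike_slotted_complex_plane_right)
qed

text \<open>A generator w of the first cohomology of the punctured plane, normalised as a cochain:
  it is zero on \<open>slit\<close>, and its primitive b on \<open>cslit\<close> jumps from 0 on the
  upper to 1 on the lower half plane.\<close>

definition winds :: "complex cochain \<Rightarrow> complex cochain \<Rightarrow> bool" where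
 "winds w b \<longleftrightarrow> w \<in> cocycles punct \<and> concentrated 1 w \<and> pull (top_of_set slit) id w = 0 \<and>
  b \<in> cochains (top_of_set cslit) \<and> pull (top_of_set cslit) id w = coboundary (top_of_set cslit) b \<and>
  pull (top_of_set {z. Im z > 0}) id b = 0 \<and>
  pull (top_of_set {z. Im z < 0}) id b = one_cochain (top_of_set {z. Im z < 0})"

text \<open>The class is obtained from the Mayer--Vietoris connecting map, applied to the indicator function of the lower half plane.\<close>

lemma winds_exist: "\<exists>w b. winds w b"
proof -
 let ?P = "{z. Im z > 0}" and ?N = "{z. Im z < 0}"
 let ?W = "top_of_set (slit \<inter> cslit)" and ?V = "top_of_set cslit"
 have sub: "?P \<subseteq> slit \<inter> cslit" "?N \<subseteq> slit \<inter> cslit" "slit \<subseteq> - {0}" "cslit \<subseteq> - {0}" using slit_cover by blast+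
 have o: "openin (top_of_set T) S" if "open S" "S \<subseteq> T" for S T :: "complex set" using that by (simp add: open_subset)
 interpret W: open_cover ?W ?P ?N
 proof
  show "openin ?W ?P" "openin ?W ?N" using sub by (intro o open_halfspace_Im_lt open_halfspace_Im_gt; simp)+
 qed (simp add: slit_cover)
 have tt: "subtopology (top_of_set T) S = top_of_set S" if "S \<subseteq> T" for S T :: "complex set"
  using that by (simp add: subtopology_subtopology Int_absorb1)
 have eP: "W.XU = top_of_set ?P" and eN: "W.XV = top_of_set ?N" by (rule tt[OF sub(1)], rule tt[OF sub(2)])
 \<comment> \<open>The half planes are disjoint, so zero on one and the unit on the other glue to a
   cocycle, the indicator function of the lower half plane.\<close>
 have "pull W.XW id (0 :: complex cochain) = pull W.XW id (one_cochain (top_of_set ?N))"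
 proof -
  have "topspace W.XW = {}" by auto
  then show ?thesis using singular_simplex_empty[of W.XW] by (auto simp: pull_def intro!: ext)
 qed
 then obtain c where c: "c \<in> cocycles ?W" "pull (top_of_set ?P) id c = 0" "pull (top_of_set ?N) id c = one_cochain (top_of_set ?N)"
  using W.glue_cocycles[of 0 "one_cochain (top_of_set ?N)"] by (auto simp: eP eN)
 interpret open_cover punct cslit slit
 proof
  show "openin punct cslit" "openin punct slit" using sub open_slit by (simp_all only: o)
  show "cslit \<union> slit = topspace punct" using slit_cover(1) by (simp add: Un_commute)
 qed
 have e: "XU = ?V" "XV = top_of_set slit" "XW = ?W" using sub(3,4) by (simp_all add: tt Int_commute le_infI1)
 obtain w where w: "w \<in> cocycles punct" "pull ?V id w = coboundary ?V c" "pull (top_of_set slit) id w = 0"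
  using connecting[of c] c(1) unfolding e by metis
 have "c \<in> cochains ?V" using cochains_extend[of c euclidean] c(1) by (auto simp: cocycles_iff)
 then have "winds (part 1 w) (part 0 c)" using w c part_coboundary_Suc[of 0 ?V c] part_concentrated[of 0 "one_cochain (top_of_set ?N)" 0]
  by (simp add: winds_def flip: part_pull) (simp add: concentrated_def one_cochain_def)
 then show ?thesis by blast
qed

definition punct_class :: "complex cochain" where "punct_class = (SOME w. \<exists>b. winds w b)"

lemma punct_class: "\<exists>b. winds punct_class b" unfolding punct_class_def using winds_exist by (rule someI_ex)

text \<open>The winding number class of f. As the pullback of one fixed cochain it is natural on the
  nose, and it vanishes as a cochain when f takes values in \<open>slit\<close>.\<close>

definition wind_cochain :: "'a topology \<Rightarrow> ('a \<Rightarrow> complex) \<Rightarrow> 'a cochain" where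
 "wind_cochain X f = pull X f punct_class"

lemma concentrated_wind [simp]: "concentrated 1 (wind_cochain X f)" "concentrated (Suc 0) (wind_cochain X f)"
 using punct_class concentrated_pull by (auto simp: winds_def wind_cochain_def)

lemma pull_wind_cochain:
 assumes "continuous_map X Y \<phi>"
 shows "pull X \<phi> (wind_cochain Y f) = wind_cochain X (f \<circ> \<phi>)" unfolding wind_cochain_def by (rule pull_pull[OF assms])

lemma wind_cochain_cong:
 assumes "\<And>x. x \<in> topspace X \<Longrightarrow> f x = g x"
 shows "wind_cochain X f = wind_cochain X g" unfolding wind_cochain_def using assms by (rule pull_cong)

lemma continuous_map_euclidean_iff:
 "continuous_map X euclidean f \<longleftrightarrow> (\<forall>x\<in>topspace X. (f \<longlongrightarrow> f x) (atin X x))"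
 by (simp add: continuous_map_atin)

locale nonzero_map =
 fixes X :: "'a topology" and f :: "'a \<Rightarrow> complex"
 assumes cont: "continuous_map X euclidean f" and nz: "\<And>x. x \<in> topspace X \<Longrightarrow> f x \<noteq> 0"
begin

lemma into_punct: "continuous_map X punct f" using cont nz by (auto simp: continuous_map_in_subtopology)

lemma wind_cochain_cocycle: "wind_cochain X f \<in> cocycles X"
 using punct_class pull_cocycles[OF into_punct] by (auto simp: winds_def wind_cochain_def)

lemma wind_cochain_slit:
 assumes "\<And>x. x \<in> topspace X \<Longrightarrow> f x \<in> slit"
 shows "wind_cochain X f = 0"
proof -
 have "continuous_map X (top_of_set slit) f" using cont assms by (auto simp: continuous_map_in_subtopology)
 from pull_pull[OF this, of id punct_class] show ?thesis using punct_class by (auto simp: winds_def wind_cochain_def)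
qed

end

section \<open>A Leray--Hirsch theorem for trivial plane bundles with disjoint graphs removed, and
  the Arnold relations\<close>

section \<open>Complements of graphs in a plane bundle\<close>

text \<open>The cohomology of M is a free right module over that of B with basis 1 and the classes
  of \<omega> j, expressed by representatives: spanning in the second clause, independence in the
  third.\<close>

definition fibre_basis :: "'b topology \<Rightarrow> 'm topology \<Rightarrow> ('m \<Rightarrow> 'b) \<Rightarrow> nat \<Rightarrow> (nat \<Rightarrow> 'm cochain) \<Rightarrow> bool" where
 "fibre_basis B M \<pi> m \<omega> \<longleftrightarrow> (\<forall>j<m. \<omega> j \<in> cocycles M) \<and>
  (\<forall>f\<in>cocycles M. \<exists>\<beta>\<in>cocycles B. \<exists>\<gamma>. (\<forall>j<m. \<gamma> j \<in> cocycles B) \<and>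
    f - (pull M \<pi> \<beta> + (\<Sum>j<m. cup_product M (\<omega> j) (pull M \<pi> (\<gamma> j)))) \<in> coboundaries M) \<and>
  (\<forall>\<beta>\<in>cocycles B. \<forall>\<gamma>. (\<forall>j<m. \<gamma> j \<in> cocycles B) \<longrightarrow>
    pull M \<pi> \<beta> + (\<Sum>j<m. cup_product M (\<omega> j) (pull M \<pi> (\<gamma> j))) \<in> coboundaries M \<longrightarrow>
    \<beta> \<in> coboundaries B \<and> (\<forall>j<m. \<gamma> j \<in> coboundaries B))"

text \<open>In the fibre coordinate \<open>u\<close> the graph of s becomes the zero section. The
  space \<open>over Z\<close> is then the bundle with fibre Z, and \<open>sec p\<close> is its
  section at \<open>u\<close> = p.\<close>

locale plane_section =
 fixes B :: "'b topology" and s :: "'b \<Rightarrow> complex"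
 assumes cont_s: "continuous_map B euclidean s"
begin

abbreviation E where "E \<equiv> prod_topology B (euclidean :: complex topology)"

definition u :: "'b \<times> complex \<Rightarrow> complex" where "u e = snd e - s (fst e)"

definition dom :: "complex set \<Rightarrow> ('b \<times> complex) set" where "dom Z = {e \<in> topspace E. u e \<in> Z}"

abbreviation over :: "complex set \<Rightarrow> ('b \<times> complex) topology" where "over Z \<equiv> subtopology E (dom Z)"

definition sec :: "complex \<Rightarrow> 'b \<Rightarrow> 'b \<times> complex" where "sec p b = (b, s b + p)"

lemma cont_u: "continuous_map E euclidean u"
proof -
 have "continuous_map E euclidean (\<lambda>e. s (fst e))"
  using continuous_map_compose[OF continuous_map_fst cont_s] by (simp add: comp_def)
 moreover have "continuous_map E euclidean (snd :: 'b \<times> complex \<Rightarrow> complex)" by (rule continuous_map_snd)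
 ultimately show ?thesis unfolding u_def[abs_def] by (auto simp: continuous_map_euclidean_iff intro!: tendsto_intros)
qed

lemma open_dom: "open Z \<Longrightarrow> openin E (dom Z)" unfolding dom_def by (rule openin_continuous_map_preimage[OF cont_u]) simp

lemma dom_subset: "dom Z \<subseteq> topspace E" and dom_mono: "Z' \<subseteq> Z \<Longrightarrow> dom Z' \<subseteq> dom Z"
 and dom_Int: "dom Z \<inter> dom Z' = dom (Z \<inter> Z')" and dom_Un: "dom Z \<union> dom Z' = dom (Z \<union> Z')"
 by (auto simp: dom_def)

lemma topspace_over [simp]: "topspace (over Z) = dom Z" using dom_subset by (auto simp: topspace_subtopology)

lemma over_over: "Z' \<subseteq> Z \<Longrightarrow> subtopology (over Z) (dom Z') = over Z'"
 using dom_mono[of Z' Z] by (simp add: subtopology_subtopology Int_absorb1)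

lemma cont_fst: "continuous_map (over Z) B fst" by (intro continuous_map_from_subtopology continuous_map_fst)

lemma cont_id: "Z' \<subseteq> Z \<Longrightarrow> continuous_map (over Z') (over Z) id" by (intro continuous_map_id_subtopology dom_mono)

lemma cont_sec: "p \<in> Z \<Longrightarrow> continuous_map B (over Z) (sec p)"
proof -
 assume "p \<in> Z"
 have "continuous_map B euclidean (\<lambda>b. s b + p)" using cont_s by (auto simp: continuous_map_euclidean_iff intro!: tendsto_intros)
 then have "continuous_map B E (sec p)" unfolding sec_def[abs_def] by (intro continuous_map_pairedI) auto
 with \<open>p \<in> Z\<close> show ?thesis by (auto simp: continuous_map_in_subtopology sec_def dom_def u_def)
qed

lemma openin_over: "open Z' \<Longrightarrow> Z' \<subseteq> Z \<Longrightarrow> openin (over Z) (dom Z')"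
 unfolding openin_subtopology using open_dom[of Z'] dom_mono[of Z' Z] by (intro exI[of _ "dom Z'"]) auto

lemma pull_id_over: "Z' \<subseteq> Z \<Longrightarrow> pull (over Z') id (pull (over Z) \<psi> f) = pull (over Z') \<psi> f"
 by (simp add: pull_pull[OF cont_id])

lemma pull_sec_id: "p \<in> Z \<Longrightarrow> pull B (sec p) (pull (over Z) id f) = pull B (sec p) f"
 by (simp add: pull_pull[OF cont_sec])

lemma pull_sec_fst: "p \<in> Z \<Longrightarrow> \<beta> \<in> cochains B \<Longrightarrow> pull B (sec p) (pull (over Z) fst \<beta>) = \<beta>"
 unfolding pull_pull[OF cont_sec] by (intro pull_id) (auto simp: sec_def)

text \<open>The straight-line contraction of every fibre to p. It fixes the section pointwise, hence
  is a homotopy of pairs.\<close>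

lemma starlike_homotopic:
 assumes p: "p \<in> Z" and seg: "\<And>z. z \<in> Z \<Longrightarrow> closed_segment p z \<subseteq> Z"
 shows "homotopic_with (\<lambda>h. h \<in> sec p ` topspace B \<rightarrow> sec p ` topspace B) (over Z) (over Z) id (sec p \<circ> fst)"
proof -
 let ?P = "prod_topology (top_of_set {0..1::real}) (over Z)"
 define k where "k t z = (1 - t) *\<^sub>R z + t *\<^sub>R p" for t :: real and z :: complex
 have k: "k t z \<in> Z" if "t \<in> {0..1}" "z \<in> Z" for t z
  using seg[OF that(2)] that(1) unfolding closed_segment_commute[of p] by (force simp: k_def in_segment)
 define h where "h x = (fst (snd x), s (fst (snd x)) + k (fst x) (u (snd x)))" for x :: "real \<times> ('b \<times> complex)"
 have c1: "continuous_map ?P (over Z) snd" by (rule continuous_map_snd)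
 have c2: "continuous_map ?P B (fst \<circ> snd)" using continuous_map_compose[OF c1 cont_fst] .
 have c: "continuous_map ?P euclidean (s \<circ> (fst \<circ> snd))" "continuous_map ?P euclidean (u \<circ> snd)" "continuous_map ?P euclideanreal fst"
  using continuous_map_compose[OF c2 cont_s] continuous_map_compose[OF c1 continuous_map_from_subtopology[OF cont_u]]
  by (auto intro: continuous_map_into_fulltopology continuous_map_fst)
 have "continuous_map ?P euclidean (\<lambda>x. s (fst (snd x)) + k (fst x) (u (snd x)))"
  using c unfolding continuous_map_euclidean_iff comp_def k_def by (auto intro!: tendsto_intros)
 then have "continuous_map ?P E h" unfolding h_def using c2 by (intro continuous_map_pairedI) (simp_all add: comp_def)
 then have ch: "continuous_map ?P (over Z) h" using k by (auto simp: continuous_map_in_subtopology h_def dom_def u_def)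
 show ?thesis
 proof (subst homotopic_with)
  fix h k :: "'b \<times> complex \<Rightarrow> 'b \<times> complex" assume hk: "\<And>x. x \<in> topspace (over Z) \<Longrightarrow> h x = k x"
  have "sec p ` topspace B \<subseteq> topspace (over Z)" using continuous_map_image_subset_topspace[OF cont_sec[OF p]] by auto
  with hk have "h x = k x" if "x \<in> sec p ` topspace B" for x using that by blast
  then show "(h \<in> sec p ` topspace B \<rightarrow> sec p ` topspace B) = (k \<in> sec p ` topspace B \<rightarrow> sec p ` topspace B)"
   unfolding Pi_iff by metis
 next
  show "\<exists>h. continuous_map ?P (over Z) h \<and> (\<forall>x\<in>topspace (over Z). h (0, x) = id x) \<and>
    (\<forall>x\<in>topspace (over Z). h (1, x) = (sec p \<circ> fst) x) \<and>
    (\<forall>t\<in>{0..1}. (\<lambda>x. h (t, x)) \<in> sec p ` topspace B \<rightarrow> sec p ` topspace B)"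
   using ch by (intro exI[of _ h]) (auto simp: h_def k_def dom_def u_def sec_def algebra_simps simp flip: scaleR_left.add)
 qed
qed

text \<open>The star centre q may differ from p. The formula at q, pulled back along
  \<open>sec p\<close>, shows that both sections induce the same class on B.\<close>

lemma starlike_mod:
 assumes "starlike Z" "p \<in> Z" "f \<in> cocycles (over Z)"
 shows "f - pull (over Z) fst (pull B (sec p) f) \<in> coboundaries (over Z)"
proof -
 obtain q where q: "q \<in> Z" "\<And>z. z \<in> Z \<Longrightarrow> closed_segment q z \<subseteq> Z" using assms(1) by (auto simp: starlike_def)
 have 1: "f - pull (over Z) fst (pull B (sec q) f) \<in> coboundaries (over Z)"
  using section_retraction_mod[OF cont_fst cont_sec _ starlike_homotopic assms(3), of q] q by (simp add: sec_def)
 have "pull B (sec p) f - pull B (sec q) f \<in> coboundaries B"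
  using pull_coboundaries[OF cont_sec[OF assms(2)] 1] pull_sec_fst[OF assms(2) pull_cochains[OF cocyclesD[OF assms(3)]]]
  by (simp add: pull_diff)
 from coboundaries_diff[OF 1 pull_coboundaries[OF cont_fst this]] show ?thesis by (simp add: pull_diff)
qed

lemma starlike_coboundary:
 assumes "starlike Z" "p \<in> Z" "f \<in> cocycles (over Z)" "pull B (sec p) f \<in> coboundaries B"
 shows "f \<in> coboundaries (over Z)"
 using coboundaries_add[OF starlike_mod[OF assms(1-3)] pull_coboundaries[OF cont_fst assms(4)]] by simp

lemma nonzero_map_over:
 assumes "0 \<notin> Z" shows "nonzero_map (over Z) u"
 using assms by unfold_locales (auto simp: dom_def intro: continuous_map_from_subtopology[OF cont_u])

text \<open>Mayer--Vietoris for the two slit planes U and V, which meet in the half planes P and N.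
  All four are star-shaped, so a class over any of them is determined by its restriction to the
  section at \<i> or -\<i>; the coefficient of \<omega> measures how the values on P and on N
  differ.\<close>

lemma fibre_basis_one_graph:
 "fibre_basis B (over (- {0})) fst 1 (\<lambda>_. wind_cochain (over (- {0})) u)"
proof -
 let ?M = "over (- {0})"
 define U V W P N where "U = slit" and "V = cslit" and "W = slit \<inter> cslit" and "P = {z. Im z > 0}" and "N = {z. Im z < 0}"
 note defs = this
 define \<omega> where "\<omega> = wind_cochain ?M u"
 have oU: "open U" and oV: "open V" and oP: "open P" and oN: "open N" and UV: "U \<union> V = - {0}" and W: "W = P \<union> N"
  unfolding defs using slit_cover open_slit by (auto simp: open_halfspace_Im_lt open_halfspace_Im_gt)
 have W_def: "W = U \<inter> V" by (simp add: defs)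
 have nr: "U \<subseteq> - {0}" "V \<subseteq> - {0}" "W \<subseteq> - {0}" using UV W_def by blast+
 have PV: "P \<subseteq> V" "N \<subseteq> V" "P \<subseteq> W" "N \<subseteq> W" "W \<subseteq> V" "W \<subseteq> U" "P \<subseteq> U" "N \<subseteq> U"
  using W W_def by blast+
 interpret open_cover ?M "dom U" "dom V"
 proof
  show "openin ?M (dom U)" "openin ?M (dom V)" by (rule openin_over[OF oU nr(1)], rule openin_over[OF oV nr(2)])
  show "dom U \<union> dom V = topspace ?M" unfolding dom_Un UV by (rule topspace_over[symmetric])
 qed
 have XU: "XU = over U" and XV: "XV = over V" and XW: "XW = over W" using over_over nr by (simp_all only: dom_Int W_def)
 have i: "\<i> \<in> P" and mi: "- \<i> \<in> N" by (simp_all add: defs)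
 then have i: "\<i> \<in> U" "\<i> \<in> V" "\<i> \<in> W" "\<i> \<in> P" "\<i> \<in> - {0}" and mi: "- \<i> \<in> U" "- \<i> \<in> V" "- \<i> \<in> W" "- \<i> \<in> N" "- \<i> \<in> - {0}"
  using PV nr by blast+
 have cU: "starlike U" and cV: "starlike V" unfolding defs by (rule starlike_slit)+
 have cP: "starlike P" and cN: "starlike N"
  using i(4) mi(4) unfolding defs by (blast intro: convex_imp_starlike convex_halfspace_Im_gt convex_halfspace_Im_lt)+
 interpret uM: nonzero_map ?M u by (rule nonzero_map_over) simp
 obtain b where b: "winds punct_class b" using punct_class by blast
 define b0 where "b0 = pull (over V) u b"
 have cu: "continuous_map (over Z) (top_of_set Z) u" for Z
  using continuous_map_from_subtopology[OF cont_u] by (auto simp: continuous_map_in_subtopology dom_def)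
 have pu: "pull (over Z) u c = pull (over Z) u (pull (top_of_set Z) id c)" for Z c by (simp add: pull_pull[OF cu])
 have pi: "pull (over Z) id (pull (over Z') u c) = pull (over Z) u c" if "Z \<subseteq> Z'" for Z Z' and c :: "complex cochain"
  by (simp add: pull_pull[OF cont_id[OF that]])
 have \<omega>: "\<omega> \<in> cocycles ?M" unfolding \<omega>_def by (rule uM.wind_cochain_cocycle)
 have \<omega>U: "pull (over U) id \<omega> = 0"
  using b unfolding \<omega>_def wind_cochain_def pi[OF nr(1)] by (subst pu) (simp add: winds_def defs)
 have \<omega>V: "pull (over V) id \<omega> = coboundary (over V) b0" using b unfolding \<omega>_def wind_cochain_def pi[OF nr(2)] b0_def
  by (subst pu) (simp add: winds_def defs flip: pull_coboundary[OF cu])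
 have b0P: "pull (over P) id b0 = 0" using b unfolding b0_def pi[OF PV(1)] by (subst pu) (simp add: winds_def defs)
 have b0N: "pull (over N) id b0 = one_cochain (over N)"
  using b unfolding b0_def pi[OF PV(2)] by (subst pu) (simp add: winds_def defs pull_one[OF cu, unfolded defs])
 have b0i: "pull B (sec \<i>) b0 = 0" using pull_sec_id[OF i(4), of b0] by (simp add: b0P)
 have b0mi: "pull B (sec (- \<i>)) b0 = one_cochain B"
  using pull_sec_id[OF mi(4), of b0] by (simp add: b0N pull_one[OF cont_sec[OF mi(4)]])
 have b0c: "b0 \<in> cochains (over V)" using b by (auto simp: b0_def winds_def defs)
 have b0_cup: "cup_product (over V) (coboundary (over V) b0) (pull (over V) fst \<gamma>) =
   coboundary (over V) (cup_product (over V) b0 (pull (over V) fst \<gamma>))" if "\<gamma> \<in> cocycles B" for \<gamma>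
  using pull_cocycles[OF cont_fst that] by (simp add: cup_leibniz cocycles_iff)
 have \<omega>\<gamma>U: "pull (over U) id (cup_product ?M \<omega> (pull ?M fst \<gamma>)) = 0" for \<gamma>
  by (simp add: pull_cup[OF cont_id[OF nr(1)]] \<omega>U)
 have \<omega>\<gamma>V: "pull (over V) id (cup_product ?M \<omega> (pull ?M fst \<gamma>)) =
  coboundary (over V) (cup_product (over V) b0 (pull (over V) fst \<gamma>))" if "\<gamma> \<in> cocycles B" for \<gamma>
  by (simp only: pull_cup[OF cont_id[OF nr(2)]] \<omega>V pull_id_over[OF nr(2)] b0_cup[OF that])
 have ex: "\<exists>\<beta>\<in>cocycles B. \<exists>\<gamma>\<in>cocycles B. f - (pull ?M fst \<beta> + cup_product ?M \<omega> (pull ?M fst \<gamma>)) \<in> coboundaries ?M"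
  if f: "f \<in> cocycles ?M" for f
 proof -
  \<comment> \<open>\<omega> vanishes on the section at \<i>, so this section reads off the part of
    f that comes from B.\<close>
  define \<beta> where "\<beta> = pull B (sec \<i>) f"
  have \<beta>: "\<beta> \<in> cocycles B" unfolding \<beta>_def by (rule pull_cocycles[OF cont_sec[OF i(5)] f])
  define f1 where "f1 = f - pull ?M fst \<beta>"
  have f1: "f1 \<in> cocycles ?M" unfolding f1_def by (intro cocycles_diff f pull_cocycles[OF cont_fst \<beta>])
  have sf1: "pull B (sec \<i>) f1 = 0" using cocyclesD[OF \<beta>] by (simp add: f1_def pull_diff pull_sec_fst i flip: \<beta>_def)
  have "pull (over U) id f1 \<in> coboundaries (over U)"
   using i by (intro starlike_coboundary[OF cU i(1)] pull_cocycles[OF cont_id[OF nr(1)] f1]) (simp add: pull_sec_id sf1)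
  then obtain a0 where a0: "a0 \<in> cochains (over U)" "pull (over U) id f1 = coboundary (over U) a0" by (auto simp: coboundaries_def)
  have "pull (over V) id f1 \<in> coboundaries (over V)"
   using i by (intro starlike_coboundary[OF cV i(2)] pull_cocycles[OF cont_id[OF nr(2)] f1]) (simp add: pull_sec_id sf1)
  then obtain b1 where b1: "b1 \<in> cochains (over V)" "pull (over V) id f1 = coboundary (over V) b1" by (auto simp: coboundaries_def)
  have da0: "coboundary (over W) (pull (over W) id a0) = pull (over W) id f1"
   by (simp only: pull_coboundary[OF cont_id[OF PV(6)], symmetric] a0(2)[symmetric] pull_id_over[OF PV(6)])
  have db1: "coboundary (over W) (pull (over W) id b1) = pull (over W) id f1"
   by (simp only: pull_coboundary[OF cont_id[OF PV(5)], symmetric] b1(2)[symmetric] pull_id_over[OF PV(5)])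
  \<comment> \<open>The difference of the two primitives on the intersection is the Mayer--Vietoris
    obstruction. It remains to make it trivial over P and over N.\<close>
  define w where "w = pull (over W) id a0 - pull (over W) id b1"
  have w: "w \<in> cocycles (over W)" using a0 b1 by (simp add: w_def cocycles_iff coboundary_diff da0 db1)
  \<comment> \<open>The value over P is absorbed into the primitive on U, which is free up to
    cocycles from B.\<close>
  define \<gamma>0 where "\<gamma>0 = pull B (sec \<i>) w"
  have \<gamma>0: "\<gamma>0 \<in> cocycles B" unfolding \<gamma>0_def by (rule pull_cocycles[OF cont_sec[OF i(3)] w])
  define a where "a = a0 - pull (over U) fst \<gamma>0"
  define w' where "w' = w - pull (over W) fst \<gamma>0"
  have w': "w' \<in> cocycles (over W)" unfolding w'_def by (intro cocycles_diff w pull_cocycles[OF cont_fst \<gamma>0])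
  define \<gamma> where "\<gamma> = pull B (sec (- \<i>)) w'"
  have \<gamma>: "\<gamma> \<in> cocycles B" unfolding \<gamma>_def by (rule pull_cocycles[OF cont_sec[OF mi(3)] w'])
  define b where "b = b1 + cup_product (over V) b0 (pull (over V) fst \<gamma>)"
  \<comment> \<open>The remaining value \<gamma> over N is cancelled by b0 \<gamma>, since b0 is 0
    over P and 1 over N. This changes f1 by a multiple of \<omega>; the coefficient of \<omega> in f
    itself is therefore -\<gamma>.\<close>
  define f2 where "f2 = f1 + cup_product ?M \<omega> (pull ?M fst \<gamma>)"
  have f2: "f2 \<in> cocycles ?M" unfolding f2_def by (intro cocycles_add f1 cup_cocycles \<omega> pull_cocycles[OF cont_fst \<gamma>])
  have ac: "a \<in> cochains (over U)" using a0 cocyclesD[OF \<gamma>0] by (simp add: a_def)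
  have bc: "b \<in> cochains (over V)" using b1 b0c cocyclesD[OF \<gamma>] by (simp add: b_def)
  have f2U: "pull (over U) id f2 = coboundary (over U) a" using pull_cocycles[OF cont_fst \<gamma>0, of U]
   by (simp add: f2_def pull_add \<omega>\<gamma>U a0 a_def coboundary_diff cocycles_iff)
  have f2V: "pull (over V) id f2 = coboundary (over V) b"
   by (simp only: f2_def pull_add \<omega>\<gamma>V[OF \<gamma>] b1 b_def coboundary_add)
  define w2 where "w2 = pull (over W) id a - pull (over W) id b"
  have w2: "w2 \<in> cocycles (over W)"
  proof -
   have "coboundary (over W) (pull (over W) id a) = pull (over W) id f2"
    by (simp only: pull_coboundary[OF cont_id[OF PV(6)], symmetric] f2U[symmetric] pull_id_over[OF PV(6)])
   moreover have "coboundary (over W) (pull (over W) id b) = pull (over W) id f2"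
    by (simp only: pull_coboundary[OF cont_id[OF PV(5)], symmetric] f2V[symmetric] pull_id_over[OF PV(5)])
   ultimately show ?thesis using ac bc by (simp add: w2_def cocycles_iff coboundary_diff)
  qed
  have w2': "w2 = w' - cup_product (over W) (pull (over W) id b0) (pull (over W) fst \<gamma>)"
   by (simp only: w2_def a_def b_def w'_def w_def pull_diff pull_add pull_id_over[OF PV(6)]
     pull_cup[OF cont_id[OF PV(5)]] pull_id_over[OF PV(5)]) (simp add: algebra_simps)
  have "pull (over P) id w2 \<in> coboundaries (over P)"
  proof (rule starlike_coboundary[OF cP i(4) pull_cocycles[OF cont_id[OF PV(3)] w2]])
   have "pull (over P) id w2 = pull (over P) id w'"
    by (simp only: w2' pull_diff pull_cup[OF cont_id[OF PV(3)]] pull_id_over[OF PV(3)] b0P cup_zero_left diff_zero)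
   moreover have "pull B (sec \<i>) w' = 0"
    using cocyclesD[OF \<gamma>0] i(3) by (simp only: w'_def pull_diff pull_sec_fst \<gamma>0_def[symmetric] diff_self)
   ultimately show "pull B (sec \<i>) (pull (over P) id w2) \<in> coboundaries B" using i by (simp add: pull_sec_id)
  qed
  moreover have "pull (over N) id w2 \<in> coboundaries (over N)"
  proof (rule starlike_coboundary[OF cN mi(4) pull_cocycles[OF cont_id[OF PV(4)] w2]])
   have "pull (over N) id w2 = pull (over N) id w' - pull (over N) fst \<gamma>" using cocyclesD[OF \<gamma>]
    by (simp only: w2' pull_diff pull_cup[OF cont_id[OF PV(4)]] pull_id_over[OF PV(4)] b0N cup_one_left pull_cochains)
   then show "pull B (sec (- \<i>)) (pull (over N) id w2) \<in> coboundaries B"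
    using mi cocyclesD[OF \<gamma>] by (simp add: pull_diff pull_sec_id pull_sec_fst flip: \<gamma>_def)
  qed
  moreover have "dom P \<inter> dom N = {}" "dom P \<union> dom N = topspace (over W)" by (auto simp: dom_def W P_def N_def)
  moreover have "openin (over W) (dom P)" "openin (over W) (dom N)" by (rule openin_over[OF oP PV(3)], rule openin_over[OF oN PV(4)])
  ultimately have "w2 \<in> coboundaries (over W)"
   using disjoint_union_coboundary[of "over W" "dom P" "dom N" w2] w2 over_over[OF PV(3)] over_over[OF PV(4)] by simp
  then have "f2 \<in> coboundaries ?M" using f2U f2V ac bc by (intro coboundary_if_cover[OF f2, of a b]) (simp_all only: XU XV XW w2_def)
  moreover have "f2 = f - (pull ?M fst \<beta> + cup_product ?M \<omega> (pull ?M fst (- \<gamma>)))"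
   by (simp add: f2_def f1_def pull_minus cup_minus_right)
  ultimately show ?thesis using \<beta> cocycles_uminus[OF \<gamma>] by metis
 qed
 have un: "\<beta> \<in> coboundaries B \<and> \<gamma> \<in> coboundaries B"
  if \<beta>: "\<beta> \<in> cocycles B" and \<gamma>: "\<gamma> \<in> cocycles B"
   and g: "pull ?M fst \<beta> + cup_product ?M \<omega> (pull ?M fst \<gamma>) \<in> coboundaries ?M" for \<beta> \<gamma>
 proof -
  \<comment> \<open>On this section \<open>u\<close> is constantly \<i>, a point of
    \<open>slit\<close>.\<close>
  have "pull B (sec \<i>) \<omega> = 0"
  proof -
   have "nonzero_map B (u \<circ> sec \<i>)" by unfold_locales (auto simp: u_def sec_def comp_def)
   then show ?thesis unfolding \<omega>_def pull_wind_cochain[OF cont_sec[OF i(5)]]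
    using i(1) by (intro nonzero_map.wind_cochain_slit) (auto simp: u_def sec_def defs)
  qed
  then have "pull B (sec \<i>) (pull ?M fst \<beta> + cup_product ?M \<omega> (pull ?M fst \<gamma>)) = \<beta>"
   using cocyclesD[OF \<beta>] i by (simp add: pull_add pull_sec_fst pull_cup[OF cont_sec])
  then have \<beta>b: "\<beta> \<in> coboundaries B" using pull_coboundaries[OF cont_sec[OF i(5)] g] by simp
  from coboundaries_diff[OF g pull_coboundaries[OF cont_fst this]]
  obtain e where e: "e \<in> cochains ?M" "cup_product ?M \<omega> (pull ?M fst \<gamma>) = coboundary ?M e"
   by (auto simp: coboundaries_def)
  \<comment> \<open>Over V this difference of two primitives is closed, so its values at \<i> and
    -\<i> are cohomologous; over U the same holds for e. The values of b0 \<gamma> at the two points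
    are 0 and \<gamma>, and comparison gives \<gamma> = 0 in cohomology.\<close>
  define q where "q = cup_product (over V) b0 (pull (over V) fst \<gamma>) - pull (over V) id e"
  have eU: "pull (over U) id e \<in> cocycles (over U)"
   using e(1) \<omega>\<gamma>U[of \<gamma>] by (simp add: cocycles_iff e(2) pull_coboundary[OF cont_id[OF nr(1)]])
  have q: "q \<in> cocycles (over V)" using e(1) b0c cocyclesD[OF \<gamma>] \<omega>\<gamma>V[OF \<gamma>]
   by (simp add: q_def cocycles_iff coboundary_diff e(2) pull_coboundary[OF cont_id[OF nr(2)]])
  define p' where "p' = pull B (sec \<i>) e"
  have "pull (over U) id e - pull (over U) fst p' \<in> coboundaries (over U)"
   using starlike_mod[OF cU i(1) eU] i by (simp add: pull_sec_id p'_def)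
  from pull_coboundaries[OF cont_sec[OF mi(1)] this]
  have 1: "pull B (sec (- \<i>)) e - p' \<in> coboundaries B" using mi e(1) by (simp add: pull_diff pull_sec_id pull_sec_fst p'_def)
  have p'c: "p' \<in> cochains B" using e(1) by (simp add: p'_def)
  have qi: "pull B (sec \<i>) q = - p'" using i by (simp add: q_def pull_diff pull_cup[OF cont_sec] b0i pull_sec_id p'_def)
  from pull_coboundaries[OF cont_sec[OF mi(2)] starlike_mod[OF cV i(2) q]]
  have "pull B (sec (- \<i>)) q + p' \<in> coboundaries B"
   using p'c by (simp only: qi pull_diff pull_minus pull_add pull_sec_fst[OF mi(2)] diff_minus_eq_add)
  moreover have "pull B (sec (- \<i>)) q = \<gamma> - pull B (sec (- \<i>)) e"
   using mi cocyclesD[OF \<gamma>] by (simp add: q_def pull_diff pull_cup[OF cont_sec] b0mi pull_sec_id pull_sec_fst cup_one_left)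
  ultimately have "\<gamma> - pull B (sec (- \<i>)) e + p' \<in> coboundaries B" by simp
  from coboundaries_add[OF this 1] \<beta>b show ?thesis by simp
 qed
 have one: "(\<Sum>j<1. F j) = F 0" for F :: "nat \<Rightarrow> ('b \<times> complex) cochain" by (simp add: lessThan_Suc)
 show ?thesis unfolding fibre_basis_def \<omega>_def[symmetric] one
 proof (intro conjI allI ballI impI)
  fix f assume "f \<in> cocycles ?M"
  from ex[OF this] obtain \<beta> \<gamma> where "\<beta> \<in> cocycles B" "\<gamma> \<in> cocycles B"
   "f - (pull ?M fst \<beta> + cup_product ?M \<omega> (pull ?M fst \<gamma>)) \<in> coboundaries ?M" by blast
  then show "\<exists>\<beta>\<in>cocycles B. \<exists>\<gamma>. (\<forall>j<1. \<gamma> j \<in> cocycles B) \<and>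
    f - (pull ?M fst \<beta> + cup_product ?M \<omega> (pull ?M fst (\<gamma> 0))) \<in> coboundaries ?M"
   by (intro bexI[of _ \<beta>] exI[of _ "\<lambda>_. \<gamma>"]) auto
 next
  fix \<beta> and \<gamma> :: "nat \<Rightarrow> 'b cochain"
  assume "\<beta> \<in> cocycles B" "\<forall>j<1. \<gamma> j \<in> cocycles B"
   "pull ?M fst \<beta> + cup_product ?M \<omega> (pull ?M fst (\<gamma> 0)) \<in> coboundaries ?M"
  then have "\<beta> \<in> coboundaries B \<and> \<gamma> 0 \<in> coboundaries B" by (intro un) auto
  then show "\<beta> \<in> coboundaries B" "\<And>j. j < 1 \<Longrightarrow> \<gamma> j \<in> coboundaries B" by auto
 qed (rule \<omega>)
qed

lemma one_graph_expand:
 assumes "f \<in> cocycles (over (- {0}))"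
 obtains \<beta> \<gamma> where "\<beta> \<in> cocycles B" "\<gamma> \<in> cocycles B"
  "f - (pull (over (- {0})) fst \<beta> + cup_product (over (- {0})) (wind_cochain (over (- {0})) u) (pull (over (- {0})) fst \<gamma>))
   \<in> coboundaries (over (- {0}))"
proof -
 note fibre_basis_one_graph[unfolded fibre_basis_def, THEN conjunct2, THEN conjunct1, rule_format, OF assms]
 then obtain \<beta> and \<gamma> :: "nat \<Rightarrow> 'b cochain" where "\<beta> \<in> cocycles B" "\<forall>j<1. \<gamma> j \<in> cocycles B"
  "f - (pull (over (- {0})) fst \<beta> + (\<Sum>j<1. cup_product (over (- {0})) (wind_cochain (over (- {0})) u) (pull (over (- {0})) fst (\<gamma> j))))
   \<in> coboundaries (over (- {0}))" by (elim bexE exE conjE)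
 then show thesis by (intro that[of \<beta> "\<gamma> 0"]) simp_all
qed

end

text \<open>A closed cochain of degree zero on the punctured plane is constant. This is read off
  from the fibre basis over a one-point base: coboundaries and multiples of the winding class have
  no part in degree zero.\<close>

lemma degree_zero_pull:
 assumes c: "c \<in> cocycles punct" "concentrated 0 c" and f: "continuous_map X punct f" and g: "continuous_map X punct g"
 shows "pull X f c = pull X g c"
proof -
 interpret plane_section "top_of_set {0 :: complex}" "\<lambda>_. 0" by unfold_locales simp
 let ?M = "over (- {0})"
 have snd: "continuous_map ?M punct snd"
  by (auto simp: continuous_map_in_subtopology dom_def u_def intro: continuous_map_from_subtopology continuous_map_snd)
 have "pull ?M snd c \<in> cocycles ?M" by (rule pull_cocycles[OF snd c(1)])
 then obtain \<beta> \<gamma> where "pull ?M snd c - (pull ?M fst \<beta> + cup_product ?M (wind_cochain ?M u) (pull ?M fst \<gamma>)) \<in> coboundaries ?M"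
  by (rule one_graph_expand)
 then obtain h where "pull ?M snd c - (pull ?M fst \<beta> + cup_product ?M (wind_cochain ?M u) (pull ?M fst \<gamma>)) = coboundary ?M h"
  by (auto simp: coboundaries_def)
 from arg_cong[OF this, of "part 0"] have eq: "pull ?M snd c = pull ?M fst (part 0 \<beta>)" using part_concentrated[OF c(2), of 0]
  by (simp add: part_diff part_add part_sum part_pull part_cup_0 part_coboundary_0)
 have "pull X f c = pull X (\<lambda>_. 0) (part 0 \<beta>)" if f: "continuous_map X punct f" for f
 proof -
  have \<iota>: "continuous_map X ?M (\<lambda>x. (0, f x))"
   using f by (auto simp: continuous_map_in_subtopology continuous_map_pairwise comp_def dom_def u_def)
  show ?thesis using arg_cong[OF eq, of "pull X (\<lambda>x. (0, f x))"] by (simp add: pull_pull[OF \<iota>] comp_def)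
 qed
 then show ?thesis using f g by metis
qed

text \<open>By naturality it suffices to take for f and g the coordinates x and y of a product of
  two punctured planes. There the difference \<open>D\<close> is b + [y] c with b and c from the
  first factor. It vanishes as a cochain on y = 1 and on x = 1; the former shows that b bounds and
  the latter that [y] c bounds.\<close>

lemma wind_cochain_mult:
 assumes "nonzero_map X f" "nonzero_map X g"
 shows "wind_cochain X (\<lambda>x. f x * g x) - (wind_cochain X f + wind_cochain X g) \<in> coboundaries X"
proof -
 interpret plane_section punct "\<lambda>_. 0" by unfold_locales simp
 let ?M = "over (- {0})" and ?w = "wind_cochain punct (\<lambda>z. z)"
 have M: "fst e \<noteq> 0 \<and> snd e \<noteq> 0" if "e \<in> topspace ?M" for e using that by (auto simp: dom_def u_def)
 have fs: "continuous_map ?M euclidean fst" "continuous_map ?M euclidean snd"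
  using continuous_map_into_fulltopology[OF cont_fst] by (auto intro: continuous_map_from_subtopology continuous_map_snd)
 have m: "nonzero_map Y (\<lambda>x. p x * q x)" if "nonzero_map Y p" "nonzero_map Y q" for Y :: "'y topology" and p q
  using that by (auto simp: nonzero_map_def continuous_map_euclidean_iff intro!: tendsto_intros)
 have n: "nonzero_map ?M fst" "nonzero_map ?M snd" using fs M unfolding nonzero_map_def by blast+
 have nz: "nonzero_map ?M fst" "nonzero_map ?M snd" "nonzero_map ?M (\<lambda>e. fst e * snd e)" "nonzero_map punct (\<lambda>z. z)" "nonzero_map punct (\<lambda>_. 1)"
  by (rule n, rule n, rule m[OF n]) (simp_all add: nonzero_map_def continuous_map_from_subtopology continuous_map_id[unfolded id_def])
 have w1: "wind_cochain punct (\<lambda>_. 1) = 0" by (rule nonzero_map.wind_cochain_slit[OF nz(5)]) (simp add: slit_def)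
 have into: "continuous_map Y ?M (\<lambda>x. (p x, q x))" if "nonzero_map Y p" "nonzero_map Y q" for Y :: "'y topology" and p q
  using nonzero_map.into_punct[OF that(1)] nonzero_map.into_punct[OF that(2)] nonzero_map.nz[OF that(2)]
  by (auto simp: continuous_map_in_subtopology continuous_map_pairwise comp_def dom_def u_def)
 define D where "D = wind_cochain ?M (\<lambda>e. fst e * snd e) - (wind_cochain ?M fst + wind_cochain ?M snd)"
 have pD: "pull Y (\<lambda>x. (p x, q x)) D = wind_cochain Y (\<lambda>x. p x * q x) - (wind_cochain Y p + wind_cochain Y q)"
  if "nonzero_map Y p" "nonzero_map Y q" for Y :: "'y topology" and p q
  unfolding D_def by (simp add: pull_diff pull_add pull_wind_cochain[OF into[OF that]] comp_def)
 have "D \<in> cocycles ?M" unfolding D_def using nz by (intro cocycles_diff cocycles_add) (simp_all add: nonzero_map.wind_cochain_cocycle)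
 then obtain \<beta> \<gamma> where bg: "\<beta> \<in> cocycles punct" "\<gamma> \<in> cocycles punct"
  "D - (pull ?M fst \<beta> + cup_product ?M (wind_cochain ?M u) (pull ?M fst \<gamma>)) \<in> coboundaries ?M" by (rule one_graph_expand)
 \<comment> \<open>\<open>D\<close> has degree one, so only these homogeneous parts of its
   coefficients matter; c, being of degree zero, is constant.\<close>
 define b c where "b = part 1 \<beta>" and "c = part 0 \<gamma>"
 have bc: "b \<in> cocycles punct" "c \<in> cocycles punct" "concentrated 0 c" using bg by (simp_all add: b_def c_def)
 define F where "F = pull ?M fst b + cup_product ?M (wind_cochain ?M snd) (pull ?M fst c)"
 have "wind_cochain ?M u = wind_cochain ?M snd" by (rule wind_cochain_cong) (simp add: u_def)
 moreover have "part 1 D = D" by (simp only: D_def part_diff part_add part_concentrated[OF concentrated_wind(1)] simp_thms if_True)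
 ultimately have DF: "D - F \<in> coboundaries ?M" using part_coboundaries[OF bg(3), of 1] part_cup_Suc[of "wind_cochain ?M snd" 0 ?M]
  by (simp add: part_diff part_add part_pull F_def b_def c_def)
 have DF': "pull punct (\<lambda>x. (p x, q x)) F \<in> coboundaries punct"
  if "nonzero_map punct p" "nonzero_map punct q" "pull punct (\<lambda>x. (p x, q x)) D = 0" for p q
  using coboundaries_uminus[OF pull_coboundaries[OF into[OF that(1,2)] DF]] that(3) by (simp add: pull_diff)
 have pF: "pull punct (\<lambda>x. (p x, q x)) F = pull punct p b + cup_product punct (wind_cochain punct q) (pull punct p c)"
  if "nonzero_map punct p" "nonzero_map punct q" for p q
  unfolding F_def using into[OF that] by (simp add: pull_add pull_cup pull_wind_cochain pull_pull comp_def)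
 have "pull punct (\<lambda>z. z) b = b" using bc(1) by (intro pull_id) (simp_all add: cocycles_iff)
 then have b: "b \<in> coboundaries punct" using DF'[OF nz(4,5)] by (simp add: pF pD nz w1)
 have k: "continuous_map punct punct (\<lambda>_. 1)" by (rule nonzero_map.into_punct[OF nz(5)])
 have "pull punct (\<lambda>_. 1) b + cup_product punct ?w (pull punct (\<lambda>_. 1) c) \<in> coboundaries punct"
  using DF'[OF nz(5,4)] by (simp add: pF pD nz w1)
 from coboundaries_diff[OF this pull_coboundaries[OF k b]]
 have "cup_product punct ?w (pull punct (\<lambda>_. 1) c) \<in> coboundaries punct" by simp
 from pull_coboundaries[OF nonzero_map.into_punct[OF nz(2)] this]
 have "cup_product ?M (wind_cochain ?M snd) (pull ?M (\<lambda>_. 1) c) \<in> coboundaries ?M"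
  using nonzero_map.into_punct[OF nz(2)] by (simp add: pull_cup pull_wind_cochain pull_pull comp_def)
 moreover have "pull ?M (\<lambda>_. 1) c = pull ?M fst c"
  using nonzero_map.into_punct[OF nz(1)] by (intro degree_zero_pull[OF bc(2,3)]) auto
 ultimately have "F \<in> coboundaries ?M" using pull_coboundaries[OF cont_fst b] by (simp add: F_def coboundaries_add)
 from coboundaries_add[OF DF this] have "D \<in> coboundaries ?M" by simp
 from pull_coboundaries[OF into[OF assms] this] show ?thesis by (simp add: pD assms)
qed

lemma fibre_basis_trivial:
 fixes B :: "'b topology"
 shows "fibre_basis B (prod_topology B (euclidean :: complex topology)) fst 0 \<omega>"
proof -
 interpret plane_section B "\<lambda>_. 0" by unfold_locales simp
 have E: "over UNIV = E" by (simp add: dom_def flip: topspace_prod_topology)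
 have cs: "continuous_map B E (sec 0)" using cont_sec[of 0 UNIV] by (simp add: E)
 have ps: "pull B (sec 0) (pull E fst \<beta>) = \<beta>" if "\<beta> \<in> cochains B" for \<beta>
  using pull_sec_fst[of 0 UNIV \<beta>] that by (simp add: E)
 have "\<exists>\<beta>\<in>cocycles B. f - pull E fst \<beta> \<in> coboundaries E" if "f \<in> cocycles E" for f
  using starlike_mod[OF starlike_UNIV UNIV_I, of f] that pull_cocycles[OF cs that] by (auto simp: E)
 moreover have "\<beta> \<in> coboundaries B" if "\<beta> \<in> cocycles B" "pull E fst \<beta> \<in> coboundaries E" for \<beta>
  using pull_coboundaries[OF cs that(2)] ps[OF cocyclesD[OF that(1)]] by simp
 ultimately show ?thesis by (simp add: fibre_basis_def)
qed

text \<open>The total space E has the cohomology of B, and this injects into the cohomology of the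
  set A. Hence the connecting map vanishes, and the cohomology of the intersection is the sum of
  those of A and V with the two copies of H(B) identified.\<close>

lemma fibre_basis_Int:
 fixes B :: "'b topology"
 defines "E \<equiv> prod_topology B (euclidean :: complex topology)"
 assumes A: "openin E A" and V: "openin E V" and AV: "A \<union> V = topspace E"
  and fA: "fibre_basis B (subtopology E A) fst m \<omega>"
  and fV: "fibre_basis B (subtopology E V) fst 1 (\<lambda>_. w)"
 shows "fibre_basis B (subtopology E (A \<inter> V)) fst (Suc m)
  (\<lambda>j. pull (subtopology E (A \<inter> V)) id (if j < m then \<omega> j else w))"
proof -
 interpret open_cover E A V using A V AV by unfold_locales
 have fE: "fibre_basis B E fst 0 \<omega>" unfolding E_def by (rule fibre_basis_trivial)
 have cE: "continuous_map E B fst" unfolding E_def by (rule continuous_map_fst)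
 have cfst: "continuous_map (subtopology E S) B fst" for S unfolding E_def by (intro continuous_map_from_subtopology continuous_map_fst)
 have \<omega>: "\<omega> j \<in> cocycles XU" if "j < m" for j using fA that by (simp add: fibre_basis_def)
 have w: "w \<in> cocycles XV" using fV by (simp add: fibre_basis_def)
 let ?\<omega> = "\<lambda>j. pull XW id (if j < m then \<omega> j else w)"
 define SU where "SU \<beta> \<gamma> = pull XU fst \<beta> + (\<Sum>j<m. cup_product XU (\<omega> j) (pull XU fst (\<gamma> j)))" for \<beta> and \<gamma> :: "nat \<Rightarrow> _"
 have SU: "SU \<beta> \<gamma> \<in> cocycles XU" if "\<beta> \<in> cocycles B" "\<And>j. j < m \<Longrightarrow> \<gamma> j \<in> cocycles B" for \<beta> \<gamma>
  unfolding SU_def using that \<omega> by (intro cocycles_add cocycles_sum cup_cocycles pull_cocycles[OF cfst]) auto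
 have SU_diff: "SU (\<beta> - \<beta>') \<gamma> = SU \<beta> \<gamma> - pull XU fst \<beta>'" for \<beta> \<beta>' \<gamma>
  by (simp add: SU_def pull_diff algebra_simps)
 have SUW: "pull XW id (SU \<beta> \<gamma>) = pull XW fst \<beta> + (\<Sum>j<m. cup_product XW (?\<omega> j) (pull XW fst (\<gamma> j)))" for \<beta> \<gamma>
  unfolding SU_def by (simp add: pull_add pull_sum pull_cup[OF contUW] pull_pull[OF contUW])
 have exA: "\<exists>\<beta>\<in>cocycles B. \<exists>\<gamma>. (\<forall>j<m. \<gamma> j \<in> cocycles B) \<and> f - SU \<beta> \<gamma> \<in> coboundaries XU" if "f \<in> cocycles XU" for f
  using fA that by (simp add: fibre_basis_def SU_def)
 have unA: "\<beta> \<in> coboundaries B \<and> (\<forall>j<m. \<gamma> j \<in> coboundaries B)"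
  if "\<beta> \<in> cocycles B" "\<And>j. j < m \<Longrightarrow> \<gamma> j \<in> cocycles B" "SU \<beta> \<gamma> \<in> coboundaries XU" for \<beta> \<gamma>
  using fA that unfolding fibre_basis_def SU_def by blast
 define SV where "SV \<beta> \<gamma> = pull XV fst \<beta> + cup_product XV w (pull XV fst \<gamma>)" for \<beta> \<gamma>
 have SV: "SV \<beta> \<gamma> \<in> cocycles XV" if "\<beta> \<in> cocycles B" "\<gamma> \<in> cocycles B" for \<beta> \<gamma>
  unfolding SV_def using that w by (intro cocycles_add cup_cocycles pull_cocycles[OF cfst]) auto
 have SVW: "pull XW id (SV \<beta> \<gamma>) = pull XW fst \<beta> + cup_product XW (?\<omega> m) (pull XW fst \<gamma>)" for \<beta> \<gamma>
  unfolding SV_def by (simp add: pull_add pull_cup[OF contVW] pull_pull[OF contVW])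
 have exV: "\<exists>\<beta>\<in>cocycles B. \<exists>\<gamma>\<in>cocycles B. f - SV \<beta> \<gamma> \<in> coboundaries XV" if "f \<in> cocycles XV" for f
  using fV that unfolding fibre_basis_def SV_def by (fastforce simp: lessThan_Suc)
 have unV: "\<beta> \<in> coboundaries B \<and> \<gamma> \<in> coboundaries B"
  if "\<beta> \<in> cocycles B" "\<gamma> \<in> cocycles B" "SV \<beta> \<gamma> \<in> coboundaries XV" for \<beta> \<gamma>
 proof -
  have "\<forall>\<beta>\<in>cocycles B. \<forall>\<gamma>. (\<forall>j<1::nat. \<gamma> j \<in> cocycles B) \<longrightarrow> SV \<beta> (\<gamma> 0) \<in> coboundaries XV \<longrightarrow>
    \<beta> \<in> coboundaries B \<and> (\<forall>j<1. \<gamma> j \<in> coboundaries B)"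
   using fV unfolding fibre_basis_def SV_def by (simp add: lessThan_Suc)
  from this[rule_format, of \<beta> "\<lambda>_. \<gamma>"] that show ?thesis by auto
 qed
 have exE: "\<exists>\<beta>\<in>cocycles B. f - pull E fst \<beta> \<in> coboundaries E" if "f \<in> cocycles E" for f
  using fE that by (simp add: fibre_basis_def)
 have "\<exists>\<beta>\<in>cocycles B. \<exists>\<gamma>. (\<forall>j<Suc m. \<gamma> j \<in> cocycles B) \<and>
   f - (pull XW fst \<beta> + (\<Sum>j<Suc m. cup_product XW (?\<omega> j) (pull XW fst (\<gamma> j)))) \<in> coboundaries XW"
  if f: "f \<in> cocycles XW" for f
 proof -
  \<comment> \<open>The image g of f under the connecting map comes from B and becomes trivial on A,
    so by independence over A it is trivial and has a primitive h.\<close>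
  obtain g where g: "g \<in> cocycles E" "pull XU id g = coboundary XU f" "pull XV id g = 0" using connecting[OF f] .
  have fU: "f \<in> cochains XU" using cochains_extend[OF cocyclesD[OF f]] by simp
  obtain \<beta> where \<beta>: "\<beta> \<in> cocycles B" and g\<beta>: "g - pull E fst \<beta> \<in> coboundaries E" using exE[OF g(1)] by blast
  have "coboundary XU f - pull XU fst \<beta> \<in> coboundaries XU"
   using pull_coboundaries[OF contU g\<beta>] by (simp add: pull_diff g pull_pull[OF contU])
  from coboundaries_diff[OF coboundariesI[OF fU refl] this]
  have "SU \<beta> (\<lambda>_. 0) \<in> coboundaries XU" by (simp add: SU_def)
  with unA[of \<beta> "\<lambda>_. 0"] \<beta> have "\<beta> \<in> coboundaries B" by simp
  from coboundaries_add[OF g\<beta> pull_coboundaries[OF cE this]]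
  obtain h where h: "h \<in> cochains E" "g = coboundary E h" by (auto simp: coboundaries_def)
  \<comment> \<open>Correcting by h makes both parts closed: f is the sum of f - h, closed on A, and
    h, closed on V, and each of them has a known expansion.\<close>
  have p: "f - pull XU id h \<in> cocycles XU" using fU h g by (simp add: cocycles_iff coboundary_diff flip: pull_coboundary[OF contU])
  have q: "pull XV id h \<in> cocycles XV" using h g by (simp add: cocycles_iff flip: pull_coboundary[OF contV])
  obtain \<beta>1 \<gamma>1 where 1: "\<beta>1 \<in> cocycles B" "\<And>j. j < m \<Longrightarrow> \<gamma>1 j \<in> cocycles B"
   "f - pull XU id h - SU \<beta>1 \<gamma>1 \<in> coboundaries XU" using exA[OF p] by blast
  obtain \<beta>2 \<gamma>2 where 2: "\<beta>2 \<in> cocycles B" "\<gamma>2 \<in> cocycles B"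
   "pull XV id h - SV \<beta>2 \<gamma>2 \<in> coboundaries XV" using exV[OF q] by blast
  have fW: "pull XW id f = f" by (rule pull_subtopology_self[OF cocyclesD[OF f]])
  have "f - pull XW id h - pull XW id (SU \<beta>1 \<gamma>1) + (pull XW id h - pull XW id (SV \<beta>2 \<gamma>2)) \<in> coboundaries XW"
   using coboundaries_add[OF pull_coboundaries[OF contUW 1(3)] pull_coboundaries[OF contVW 2(3)]]
   by (simp add: pull_diff fW pull_pull[OF contUW] pull_pull[OF contVW])
  moreover have "f - pull XW id h - pull XW id (SU \<beta>1 \<gamma>1) + (pull XW id h - pull XW id (SV \<beta>2 \<gamma>2)) =
   f - (pull XW fst (\<beta>1 + \<beta>2) + (\<Sum>j<Suc m. cup_product XW (?\<omega> j) (pull XW fst ((\<gamma>1(m := \<gamma>2)) j))))"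
   unfolding SUW SVW by (simp add: pull_add algebra_simps)
  ultimately show ?thesis
   using 1 2 by (intro bexI[of _ "\<beta>1 + \<beta>2"] exI[of _ "\<gamma>1(m := \<gamma>2)"]) (auto simp: less_Suc_eq)
 qed
 moreover have "\<beta> \<in> coboundaries B \<and> (\<forall>j<Suc m. \<gamma> j \<in> coboundaries B)"
  if \<beta>: "\<beta> \<in> cocycles B" and \<gamma>: "\<And>j. j < Suc m \<Longrightarrow> \<gamma> j \<in> cocycles B"
   and e: "pull XW fst \<beta> + (\<Sum>j<Suc m. cup_product XW (?\<omega> j) (pull XW fst (\<gamma> j))) \<in> coboundaries XW" for \<beta> \<gamma>
 proof -
  \<comment> \<open>The assumed relation says that a class on A and a class on V agree on the
    intersection. They glue to a class on E, which comes from B, and independence on A and on V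
    applies.\<close>
  have "pull XW id (SU \<beta> \<gamma>) - pull XW id (SV 0 (- \<gamma> m)) \<in> coboundaries XW"
   using e unfolding SUW SVW by (simp add: pull_minus cup_minus_right algebra_simps)
  then obtain F where F: "F \<in> cocycles E" "pull XU id F - SU \<beta> \<gamma> \<in> coboundaries XU" "pull XV id F = SV 0 (- \<gamma> m)"
   using glue_cocycles_mod[OF SU SV, of \<beta> \<gamma> 0 "- \<gamma> m"] \<beta> \<gamma> by (metis cocycles_uminus cocycles_zero lessI less_SucI)
  obtain \<beta>' where \<beta>': "\<beta>' \<in> cocycles B" and F\<beta>: "F - pull E fst \<beta>' \<in> coboundaries E" using exE[OF F(1)] by blast
  have "SU (\<beta> - \<beta>') \<gamma> \<in> coboundaries XU" using coboundaries_diff[OF pull_coboundaries[OF contU F\<beta>] F(2)]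
   by (simp add: pull_diff pull_pull[OF contU] SU_diff)
  with unA[of "\<beta> - \<beta>'" \<gamma>] \<beta> \<beta>' \<gamma> have u1: "\<beta> - \<beta>' \<in> coboundaries B" "\<forall>j<m. \<gamma> j \<in> coboundaries B" by auto
  have "SV (- \<beta>') (- \<gamma> m) \<in> coboundaries XV" using pull_coboundaries[OF contV F\<beta>]
   by (simp add: pull_diff pull_pull[OF contV] F(3) SV_def pull_minus)
  with unV[of "- \<beta>'" "- \<gamma> m"] \<beta>' \<gamma> have u2: "- \<beta>' \<in> coboundaries B" "- \<gamma> m \<in> coboundaries B" by auto
  have "\<beta> \<in> coboundaries B" using coboundaries_diff[OF u1(1) u2(1)] by simp
  moreover have "\<gamma> m \<in> coboundaries B" using coboundaries_uminus[OF u2(2)] by simp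
  ultimately show ?thesis using u1(2) by (auto simp: less_Suc_eq)
 qed
 moreover have "\<forall>j<Suc m. ?\<omega> j \<in> cocycles XW" using \<omega> w pull_cocycles[OF contUW] pull_cocycles[OF contVW] by auto
 ultimately show ?thesis unfolding fibre_basis_def by blast
qed

text \<open>Induction on the number of graphs. A new graph is disjoint from the old ones, so its
  complement and the complement of the old graphs together cover the whole bundle.\<close>

theorem fibre_basis_graph_complement:
 fixes B :: "'b topology" and s :: "nat \<Rightarrow> 'b \<Rightarrow> complex"
 defines "E \<equiv> prod_topology B (euclidean :: complex topology)"
 assumes cont: "\<And>j. j < m \<Longrightarrow> continuous_map B euclidean (s j)"
  and disj: "\<And>i j b. i < m \<Longrightarrow> j < m \<Longrightarrow> i \<noteq> j \<Longrightarrow> b \<in> topspace B \<Longrightarrow> s i b \<noteq> s j b"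
 shows "fibre_basis B (subtopology E {e \<in> topspace E. \<forall>j<m. snd e \<noteq> s j (fst e)}) fst m
  (\<lambda>j. wind_cochain (subtopology E {e \<in> topspace E. \<forall>j<m. snd e \<noteq> s j (fst e)}) (\<lambda>e. snd e - s j (fst e)))"
  and "openin E {e \<in> topspace E. \<forall>j<m. snd e \<noteq> s j (fst e)}"
proof -
 let ?A = "\<lambda>m. {e \<in> topspace E. \<forall>j<m. snd e \<noteq> s j (fst e)}"
 let ?F = "\<lambda>m. fibre_basis B (subtopology E (?A m)) fst m (\<lambda>j. wind_cochain (subtopology E (?A m)) (\<lambda>e. snd e - s j (fst e)))"
 have "?F m \<and> openin E (?A m)" using cont disj
 proof (induction m)
  case 0
  have "?A 0 = topspace E" by auto
  then show ?case using fibre_basis_trivial[of B] by (simp only: subtopology_topspace openin_topspace) (simp add: E_def)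
 next
  case (Suc m)
  then have IH: "?F m" "openin E (?A m)" by auto
  interpret plane_section B "s m" using Suc.prems by unfold_locales auto
  have dom: "dom (- {0}) = {e \<in> topspace E. snd e \<noteq> s m (fst e)}" by (auto simp: dom_def u_def E_def)
  have V: "openin E (dom (- {0}))" using open_dom[of "- {0}"] by (simp add: E_def open_Compl)
  have "snd e \<noteq> s j (fst e)" if "e \<in> topspace E" "snd e = s m (fst e)" "j < m" for e j
   using Suc.prems(2)[of j m "fst e"] that by (auto simp: E_def)
  then have "?A m \<union> dom (- {0}) = topspace E" unfolding dom by blast
  from fibre_basis_Int[OF IH(2)[unfolded E_def] V[unfolded E_def] this[unfolded E_def] IH(1)[unfolded E_def] fibre_basis_one_graph]
  have fb: "fibre_basis B (subtopology E (?A m \<inter> dom (- {0}))) fst (Suc m)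
   (\<lambda>j. pull (subtopology E (?A m \<inter> dom (- {0}))) id (if j < m then wind_cochain (subtopology E (?A m)) (\<lambda>e. snd e - s j (fst e))
     else wind_cochain (over (- {0})) u))" unfolding E_def .
  have eq: "?A m \<inter> dom (- {0}) = ?A (Suc m)" by (auto simp: dom less_Suc_eq)
  have ww: "pull (subtopology E (?A (Suc m))) id (if j < m then wind_cochain (subtopology E (?A m)) (\<lambda>e. snd e - s j (fst e))
     else wind_cochain (over (- {0})) u) = wind_cochain (subtopology E (?A (Suc m))) (\<lambda>e. snd e - s j (fst e))" if "j < Suc m" for j
  proof (cases "j < m")
   case True
   have "continuous_map (subtopology E (?A (Suc m))) (subtopology E (?A m)) id" by (rule continuous_map_id_subtopology) auto
   then show ?thesis using True by (simp add: pull_wind_cochain)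
  next
   case False
   then have "j = m" using that by simp
   have "continuous_map (subtopology E (?A (Suc m))) (over (- {0})) id"
    unfolding E_def[symmetric] by (rule continuous_map_id_subtopology) (use eq in auto)
   then show ?thesis using False \<open>j = m\<close> by (simp add: pull_wind_cochain u_def[abs_def])
  qed
  have oA: "openin E (?A (Suc m))" using openin_Int[OF IH(2) V] unfolding eq .
  have cong: "fibre_basis B M \<pi> n \<omega>'" if "fibre_basis B M \<pi> n \<omega>" "\<And>j. j < n \<Longrightarrow> \<omega> j = \<omega>' j"
   for M :: "('b \<times> complex) topology" and \<pi> n \<omega> \<omega>'
  proof -
   have eqs: "(\<Sum>j<n. cup_product M (\<omega> j) (F j)) = (\<Sum>j<n. cup_product M (\<omega>' j) (F j))" for F
    using that(2) by (intro sum.cong) auto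
   have "(\<forall>j<n. \<omega> j \<in> cocycles M) = (\<forall>j<n. \<omega>' j \<in> cocycles M)" using that(2) by simp
   with that(1) show ?thesis unfolding fibre_basis_def eqs by simp
  qed
  show ?case using cong[OF fb[unfolded eq] ww] oA by blast
 qed
 then show "?F m" "openin E (?A m)" by auto
qed

lemma fibre_basis_homeomorphic:
 assumes \<phi>: "continuous_map M M' \<phi>" and \<psi>: "continuous_map M' M \<psi>"
  and \<phi>\<psi>: "\<And>x. x \<in> topspace M' \<Longrightarrow> \<phi> (\<psi> x) = x" and \<psi>\<phi>: "\<And>x. x \<in> topspace M \<Longrightarrow> \<psi> (\<phi> x) = x"
  and fb: "fibre_basis B M' \<pi> m \<omega>"
 shows "fibre_basis B M (\<pi> \<circ> \<phi>) m (\<lambda>j. pull M \<phi> (\<omega> j))"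
proof -
 define S where "S \<beta> \<gamma> = pull M' \<pi> \<beta> + (\<Sum>j<m. cup_product M' (\<omega> j) (pull M' \<pi> (\<gamma> j)))" for \<beta> and \<gamma> :: "nat \<Rightarrow> _"
 have eq: "pull M \<phi> (S \<beta> \<gamma>) = pull M (\<pi> \<circ> \<phi>) \<beta> + (\<Sum>j<m. cup_product M (pull M \<phi> (\<omega> j)) (pull M (\<pi> \<circ> \<phi>) (\<gamma> j)))" for \<beta> \<gamma>
  unfolding S_def by (simp add: pull_add pull_sum pull_cup[OF \<phi>] pull_pull[OF \<phi>])
 have inv1: "pull M \<phi> (pull M' \<psi> f) = f" if "f \<in> cochains M" for f
  unfolding pull_pull[OF \<phi>] using that \<psi>\<phi> by (intro pull_id) auto
 have inv2: "pull M' \<psi> (pull M \<phi> f) = pull M' id f" for f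
  unfolding pull_pull[OF \<psi>] using \<phi>\<psi> by (intro pull_cong) auto
 have id: "pull M' id f \<in> coboundaries M' \<Longrightarrow> f \<in> cochains M' \<Longrightarrow> f \<in> coboundaries M'" for f
  by (simp add: pull_id)
 have fb': "(\<forall>j<m. \<omega> j \<in> cocycles M')"
  "\<And>f. f\<in>cocycles M' \<Longrightarrow> \<exists>\<beta>\<in>cocycles B. \<exists>\<gamma>. (\<forall>j<m. \<gamma> j \<in> cocycles B) \<and> f - S \<beta> \<gamma> \<in> coboundaries M'"
  "\<And>\<beta> \<gamma>. \<beta>\<in>cocycles B \<Longrightarrow> (\<forall>j<m. \<gamma> j \<in> cocycles B) \<Longrightarrow> S \<beta> \<gamma> \<in> coboundaries M' \<Longrightarrow>
    \<beta> \<in> coboundaries B \<and> (\<forall>j<m. \<gamma> j \<in> coboundaries B)"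
  using fb unfolding fibre_basis_def S_def by blast+
 show ?thesis unfolding fibre_basis_def eq[symmetric]
 proof (intro conjI ballI allI impI)
  show "pull M \<phi> (\<omega> j) \<in> cocycles M" if "j < m" for j using fb'(1) that pull_cocycles[OF \<phi>] by blast
 next
  fix f assume f: "f \<in> cocycles M"
  obtain \<beta> \<gamma> where *: "\<beta>\<in>cocycles B" "\<forall>j<m. \<gamma> j \<in> cocycles B" "pull M' \<psi> f - S \<beta> \<gamma> \<in> coboundaries M'"
   using fb'(2)[OF pull_cocycles[OF \<psi> f]] by blast
  have "f - pull M \<phi> (S \<beta> \<gamma>) \<in> coboundaries M"
   using pull_coboundaries[OF \<phi> *(3)] cocyclesD[OF f] by (simp add: pull_diff inv1)
  with * show "\<exists>\<beta>\<in>cocycles B. \<exists>\<gamma>. (\<forall>j<m. \<gamma> j \<in> cocycles B) \<and> f - pull M \<phi> (S \<beta> \<gamma>) \<in> coboundaries M" by blast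
 next
  fix \<beta> \<gamma> assume \<beta>: "\<beta> \<in> cocycles B" and \<gamma>: "\<forall>j<m. \<gamma> j \<in> cocycles B" and e: "pull M \<phi> (S \<beta> \<gamma>) \<in> coboundaries M"
  have "S \<beta> \<gamma> \<in> cochains M'"
   unfolding S_def using \<beta> \<gamma> fb'(1) by (auto intro!: cochains_add cochains_sum cochains_cup dest!: cocyclesD)
  then have "S \<beta> \<gamma> \<in> coboundaries M'" using pull_coboundaries[OF \<psi> e] by (simp add: inv2 id)
  from fb'(3)[OF \<beta> \<gamma> this] show "\<beta> \<in> coboundaries B" "\<And>j. j < m \<Longrightarrow> \<gamma> j \<in> coboundaries B" by auto
 qed
qed

subsection \<open>The Arnold relation\<close>

text \<open>f maps into the plane without 0 and 1, a bundle over a point with two graphs removed. In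
  degree two all coefficients of the fibre basis have positive degree, so they bound on a point, and
  every class of degree two vanishes.\<close>

lemma wind_product_punctured_plane:
 assumes f: "nonzero_map M f" and f1: "nonzero_map M (\<lambda>x. f x - 1)"
 shows "cup_product M (wind_cochain M f) (wind_cochain M (\<lambda>x. f x - 1)) \<in> coboundaries M"
proof -
 define B where "B = discrete_topology {()}"
 have pt: "topspace B = {()}" by (auto simp: B_def)
 let ?s = "\<lambda>j b. of_nat j :: complex"
 let ?E = "prod_topology B (euclidean :: complex topology)"
 let ?M = "subtopology ?E {e \<in> topspace ?E. \<forall>j<2. snd e \<noteq> ?s j (fst e)}"
 let ?\<omega> = "\<lambda>j. wind_cochain ?M (\<lambda>e. snd e - ?s j (fst e))"
 have fb: "fibre_basis B ?M fst 2 ?\<omega>" by (rule fibre_basis_graph_complement(1)) auto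
 have \<omega>: "?\<omega> j \<in> cocycles ?M" if "j < 2" for j using fb that by (simp add: fibre_basis_def)
 have cf: "continuous_map ?M B fst" by (intro continuous_map_from_subtopology continuous_map_fst)
 let ?f = "cup_product ?M (?\<omega> 0) (?\<omega> 1)"
 have "?f \<in> cocycles ?M" by (intro cup_cocycles \<omega>) auto
 then obtain \<beta> \<gamma> where \<beta>: "\<beta> \<in> cocycles B" and \<gamma>: "\<And>j. j < 2 \<Longrightarrow> \<gamma> j \<in> cocycles B"
  and e: "?f - (pull ?M fst \<beta> + (\<Sum>j<2. cup_product ?M (?\<omega> j) (pull ?M fst (\<gamma> j)))) \<in> coboundaries ?M"
  using fb unfolding fibre_basis_def by blast
 have deg: "part 2 ?f = ?f" using concentrated_cup[of 1 "?\<omega> 0" 1 "?\<omega> 1" ?M] by (simp add: part_concentrated numeral_2_eq_2)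
 have "part 2 (?f - (pull ?M fst \<beta> + (\<Sum>j<2. cup_product ?M (?\<omega> j) (pull ?M fst (\<gamma> j))))) \<in> coboundaries ?M"
  using e by simp
 then have "?f - (pull ?M fst (part 2 \<beta>) + (\<Sum>j<2. cup_product ?M (?\<omega> j) (pull ?M fst (part 1 (\<gamma> j))))) \<in> coboundaries ?M"
 proof -
  have "part 2 (cup_product ?M (?\<omega> j) g) = cup_product ?M (?\<omega> j) (part 1 g)" for j g
   using part_cup_Suc[OF concentrated_wind(1), of 1] by (simp add: numeral_2_eq_2)
  moreover have "part 1 (?\<omega> j) = ?\<omega> j" for j using part_concentrated[OF concentrated_wind(1), of 1] by simp
  ultimately show "?f - (pull ?M fst (part 2 \<beta>) + (\<Sum>j<2. cup_product ?M (?\<omega> j) (pull ?M fst (part 1 (\<gamma> j))))) \<in> coboundaries ?M"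
   if "part 2 (?f - (pull ?M fst \<beta> + (\<Sum>j<2. cup_product ?M (?\<omega> j) (pull ?M fst (\<gamma> j))))) \<in> coboundaries ?M"
   using that by (simp only: part_diff deg part_add part_sum part_pull)
 qed
 moreover have "pull ?M fst (part 2 \<beta>) \<in> coboundaries ?M"
  using \<beta> by (intro pull_coboundaries[OF cf] point_cocycle_coboundary[where n=2, OF pt]) auto
 moreover have "(\<Sum>j<2. cup_product ?M (?\<omega> j) (pull ?M fst (part 1 (\<gamma> j)))) \<in> coboundaries ?M"
  using \<gamma> \<omega> by (intro coboundaries_sum cup_coboundary_right pull_coboundaries[OF cf]
    point_cocycle_coboundary[where n=1, OF pt _ concentrated_part]) auto
 ultimately have "?f - (pull ?M fst (part 2 \<beta>) + (\<Sum>j<2. cup_product ?M (?\<omega> j) (pull ?M fst (part 1 (\<gamma> j))))) +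
  (pull ?M fst (part 2 \<beta>) + (\<Sum>j<2. cup_product ?M (?\<omega> j) (pull ?M fst (part 1 (\<gamma> j))))) \<in> coboundaries ?M"
  by (intro coboundaries_add)
 then have F: "?f \<in> coboundaries ?M" unfolding diff_add_cancel .
 define \<phi> where "\<phi> x = ((), f x)" for x
 have "continuous_map M ?E \<phi>" unfolding \<phi>_def using f by (intro continuous_map_pairedI) (auto simp: nonzero_map_def B_def)
 moreover have "f x \<noteq> 0" "f x - 1 \<noteq> 0" if "x \<in> topspace M" for x using that f f1 by (auto simp: nonzero_map_def)
 ultimately have \<phi>: "continuous_map M ?M \<phi>" using pt by (auto simp: continuous_map_in_subtopology \<phi>_def less_2_cases_iff)
 from pull_coboundaries[OF this F] show ?thesis
  unfolding pull_cup[OF \<phi>] pull_wind_cochain[OF \<phi>] by (simp add: comp_def \<phi>_def)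
qed

lemma nonzero_map_divide:
 assumes "nonzero_map M f" "nonzero_map M g" shows "nonzero_map M (\<lambda>x. f x / g x)"
 using assms by (auto simp: nonzero_map_def continuous_map_euclidean_iff intro!: tendsto_intros)

text \<open>Division by h reduces the relation to [p] [p - 1] = 0 for p = f/h: since f = h p and g =
  h (p - 1), the classes of f and g are [h] + [p] and [h] + [p - 1].\<close>

lemma arnold_relation:
 assumes f: "nonzero_map M f" and g: "nonzero_map M g" and h: "nonzero_map M h"
  and fgh: "\<And>x. x \<in> topspace M \<Longrightarrow> f x - g x = h x"
 shows "cup_product M (wind_cochain M f) (wind_cochain M g) -
  (cup_product M (wind_cochain M f) (wind_cochain M h) - cup_product M (wind_cochain M g) (wind_cochain M h)) \<in> coboundaries M"
proof -
 define p where "p x = f x / h x" for x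
 have hz: "h x \<noteq> 0" if "x \<in> topspace M" for x using h that by (simp add: nonzero_map_def)
 have p: "nonzero_map M p" unfolding p_def by (rule nonzero_map_divide[OF f h])
 have gh: "p x - 1 = g x / h x" if "x \<in> topspace M" for x using hz[OF that] fgh[OF that] by (simp add: p_def field_simps)
 have q: "nonzero_map M (\<lambda>x. p x - 1)"
 proof -
  have "continuous_map M euclidean (\<lambda>x. p x - 1)"
   using p by (auto simp: nonzero_map_def continuous_map_euclidean_iff intro!: tendsto_intros)
  then show ?thesis using nonzero_map_divide[OF g h] gh by (simp add: nonzero_map_def)
 qed
 let ?c = "cup_product M"
 define F G H P Q where "F = wind_cochain M f" "G = wind_cochain M g" "H = wind_cochain M h"
  "P = wind_cochain M p" "Q = wind_cochain M (\<lambda>x. p x - 1)"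
 note defs = F_G_H_P_Q_def
 have coc: "F \<in> cocycles M" "G \<in> cocycles M" "H \<in> cocycles M" "P \<in> cocycles M" "Q \<in> cocycles M"
  unfolding defs using f g h p q by (simp_all add: nonzero_map.wind_cochain_cocycle)
 have conc: "concentrated 1 H" "concentrated 1 Q" unfolding defs by simp_all
 have "wind_cochain M (\<lambda>x. h x * p x) = F" unfolding defs by (rule wind_cochain_cong) (simp add: p_def hz)
 with wind_cochain_mult[OF h p] have e1: "F - (H + P) \<in> coboundaries M" by (simp add: defs)
 have "wind_cochain M (\<lambda>x. h x * (p x - 1)) = G" unfolding defs by (rule wind_cochain_cong) (simp add: gh hz)
 with wind_cochain_mult[OF h q] have e2: "G - (H + Q) \<in> coboundaries M" by (simp add: defs)
 have PQ: "?c P Q \<in> coboundaries M" unfolding defs by (rule wind_product_punctured_plane[OF p q])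
 have HH: "?c H H \<in> coboundaries M" by (rule cup_square_coboundary[OF coc(3) conc(1)])
 have HQ: "?c H Q + ?c Q H \<in> coboundaries M" by (rule cup_anticommute_coboundary[OF coc(3) conc(1) coc(5) conc(2)])
 \<comment> \<open>The leading terms replace F by H + P and G by H + Q. After the replacement F G -
   F H + G H becomes H H + (H Q + Q H) + P Q, in which each summand bounds.\<close>
 have "?c (F - (H + P)) G + ?c (H + P) (G - (H + Q)) - ?c (F - (H + P)) H + ?c (G - (H + Q)) H
  + (?c H H + (?c H Q + ?c Q H) + ?c P Q) \<in> coboundaries M"
  using coc by (intro coboundaries_add coboundaries_diff PQ HH HQ cup_coboundary_left[OF e1] cup_coboundary_left[OF e2]
    cup_coboundary_right[OF _ e2]) auto
 moreover have "?c (F - (H + P)) G + ?c (H + P) (G - (H + Q)) - ?c (F - (H + P)) H + ?c (G - (H + Q)) H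
  + (?c H H + (?c H Q + ?c Q H) + ?c P Q) = ?c F G - (?c F H - ?c G H)"
  by (simp add: cup_add_left cup_add_right cup_diff_left cup_diff_right algebra_simps)
 ultimately show ?thesis by (simp add: defs)
qed

section \<open>Chains of left ideals with linear generators: free graded pieces and a linear
  resolution\<close>

section \<open>Koszul flags\<close>

context graded_ring
begin

lemma gr_closed: "a \<in> gr k \<Longrightarrow> a \<in> carrier R" using additive_subgroup.a_subset[OF gr_subgroup] by blast

lemma gr_zero [simp]: "\<zero> \<in> gr k" by (rule additive_subgroup.zero_closed[OF gr_subgroup])

lemma gr_add: "a \<in> gr k \<Longrightarrow> b \<in> gr k \<Longrightarrow> a \<oplus> b \<in> gr k"
 by (rule additive_subgroup.a_closed[OF gr_subgroup])

lemma gr_a_inv: "a \<in> gr k \<Longrightarrow> \<ominus> a \<in> gr k" by (rule additive_subgroup.a_inv_closed[OF gr_subgroup])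

definition comp :: "'a \<Rightarrow> nat \<Rightarrow> 'a" where
 "comp a = (THE f. (\<forall>k. f k \<in> gr k) \<and> finite {k. f k \<noteq> \<zero>} \<and> a = (\<Oplus>k\<in>{k. f k \<noteq> \<zero>}. f k))"

lemma comp_props:
 assumes "a \<in> carrier R"
 shows "comp a k \<in> gr k" "finite {k. comp a k \<noteq> \<zero>}" "a = (\<Oplus>k\<in>{k. comp a k \<noteq> \<zero>}. comp a k)"
 using theI'[OF direct_sum[OF assms]] unfolding comp_def by blast+

lemma finsum_support:
 assumes "finite K" "{k. f k \<noteq> \<zero>} \<subseteq> K" "\<And>k. f k \<in> carrier R"
 shows "(\<Oplus>k\<in>{k. f k \<noteq> \<zero>}. f k) = (\<Oplus>k\<in>K. f k)"
 using assms by (intro add.finprod_mono_neutral_cong_left) auto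

lemma comp_unique:
 assumes f: "\<And>k. f k \<in> gr k" and K: "finite K" "\<And>k. k \<notin> K \<Longrightarrow> f k = \<zero>" and a: "a = (\<Oplus>k\<in>K. f k)"
 shows "comp a = f"
proof -
 have fc: "f k \<in> carrier R" for k using f gr_closed by blast
 have sub: "{k. f k \<noteq> \<zero>} \<subseteq> K" using K by auto
 have "a \<in> carrier R" unfolding a using fc by (intro finsum_closed) auto
 from direct_sum[OF this] show ?thesis unfolding comp_def
  by (rule the1_equality) (use f finsum_support[OF K(1) sub fc] finite_subset[OF sub K(1)] a in auto)
qed

lemma comp_closed [simp]: "a \<in> carrier R \<Longrightarrow> comp a k \<in> carrier R" using comp_props(1) gr_closed by blast

lemma comp_gr: "a \<in> gr j \<Longrightarrow> comp a k = (if k = j then a else \<zero>)"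
 using comp_unique[of "\<lambda>k. if k = j then a else \<zero>" "{j}" a] gr_closed[of a j] by simp

lemma comp_zero [simp]: "comp \<zero> k = \<zero>" using comp_gr[of \<zero> 0 k] by simp

lemma comp_add:
 assumes "a \<in> carrier R" "b \<in> carrier R"
 shows "comp (a \<oplus> b) k = comp a k \<oplus> comp b k"
proof -
 let ?K = "{k. comp a k \<noteq> \<zero>} \<union> {k. comp b k \<noteq> \<zero>}"
 have K: "finite ?K" using assms comp_props(2) by auto
 have "a = (\<Oplus>k\<in>?K. comp a k)" "b = (\<Oplus>k\<in>?K. comp b k)" using comp_props(3)[OF assms(1)] comp_props(3)[OF assms(2)]
   finsum_support[OF K, of "comp a"] finsum_support[OF K, of "comp b"] assms by auto
 then have "a \<oplus> b = (\<Oplus>k\<in>?K. comp a k \<oplus> comp b k)" using assms finsum_addf[of "comp a" ?K "comp b"] by auto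
 then have "comp (a \<oplus> b) = (\<lambda>k. comp a k \<oplus> comp b k)"
  using assms K by (intro comp_unique[of _ ?K]) (auto intro: gr_add comp_props(1))
 then show ?thesis by simp
qed

lemma comp_a_inv:
 assumes "a \<in> carrier R" shows "comp (\<ominus> a) k = \<ominus> comp a k"
proof -
 have "comp (a \<oplus> \<ominus> a) k = comp a k \<oplus> comp (\<ominus> a) k" using assms by (intro comp_add) auto
 then have "comp a k \<oplus> comp (\<ominus> a) k = \<zero>" using assms by (simp add: r_neg)
 then show ?thesis using assms by (metis add.inv_comm add.inv_equality a_inv_closed comp_closed)
qed

lemma comp_minus:
 "a \<in> carrier R \<Longrightarrow> b \<in> carrier R \<Longrightarrow> comp (a \<ominus> b) k = comp a k \<ominus> comp b k"
 by (simp add: a_minus_def comp_add comp_a_inv)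

lemma comp_mult_gr1:
 assumes a: "a \<in> carrier R" and b: "b \<in> gr 1"
 shows "comp (a \<otimes> b) (Suc k) = comp a k \<otimes> b" "comp (a \<otimes> b) 0 = \<zero>"
proof -
 let ?K = "{k. comp a k \<noteq> \<zero>}"
 let ?f = "\<lambda>k. case k of 0 \<Rightarrow> \<zero> | Suc j \<Rightarrow> comp a j \<otimes> b"
 have bc: "b \<in> carrier R" using b gr_closed by blast
 have "a \<otimes> b = (\<Oplus>k\<in>?K. comp a k) \<otimes> b" using comp_props(3)[OF a] by simp
 also have "\<dots> = (\<Oplus>k\<in>?K. comp a k \<otimes> b)" using a bc comp_props(2)[OF a] by (intro finsum_ldistr) auto
 also have "\<dots> = (\<Oplus>k\<in>Suc ` ?K. ?f k)" using a bc by (subst finsum_reindex) auto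
 finally have *: "a \<otimes> b = (\<Oplus>k\<in>Suc ` ?K. ?f k)" .
 have "comp (a \<otimes> b) = ?f"
 proof (rule comp_unique[OF _ _ _ *])
  show "?f k \<in> gr k" for k using mult_gr[OF comp_props(1)[OF a] b] by (cases k) auto
  show "finite (Suc ` ?K)" using comp_props(2)[OF a] by simp
  show "?f k = \<zero>" if "k \<notin> Suc ` ?K" for k using that bc by (cases k) auto
 qed
 then show "comp (a \<otimes> b) (Suc k) = comp a k \<otimes> b" "comp (a \<otimes> b) 0 = \<zero>" by auto
qed

lemma int_gr0: "[(z::int)] \<cdot> \<one> \<in> gr 0"
proof -
 have "additive_subgroup (gr 0) R" by (rule gr_subgroup)
 then have "subgroup (gr 0) (add_monoid R)" by (simp add: additive_subgroup_def)
 from add.subgroup_int_pow_closed[OF this one_gr] show ?thesis by (simp add: add_pow_def)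
qed

definition pos :: "'a set" where "pos = {a \<in> carrier R. comp a 0 = \<zero>}"

lemma pos_closed: "a \<in> pos \<Longrightarrow> a \<in> carrier R" by (simp add: pos_def)

end

text \<open>The left ideal generated by \<open>x 0\<close>, ..., \<open>x (m - 1)\<close>, built one
  generator at a time because the inductions run along the flag.\<close>

primrec lspan :: "('a, 'r) ring_scheme \<Rightarrow> (nat \<Rightarrow> 'a) \<Rightarrow> nat \<Rightarrow> 'a set" where
 "lspan R x 0 = {\<zero>\<^bsub>R\<^esub>}"
| "lspan R x (Suc m) = {u \<oplus>\<^bsub>R\<^esub> a \<otimes>\<^bsub>R\<^esub> x m | u a. u \<in> lspan R x m \<and> a \<in> carrier R}"

context ring
begin

lemma lspan_closed:
 assumes "\<And>i. i < m \<Longrightarrow> x i \<in> carrier R" "u \<in> lspan R x m" shows "u \<in> carrier R"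
 using assms by (induction m arbitrary: u) auto

lemma lspan_zero: "(\<And>i. i < m \<Longrightarrow> x i \<in> carrier R) \<Longrightarrow> \<zero> \<in> lspan R x m"
proof (induction m)
 case (Suc m)
 then have "\<zero> = \<zero> \<oplus> \<zero> \<otimes> x m" by simp
 with Suc show ?case by fastforce
qed simp

lemma lspan_add:
 assumes "\<And>i. i < m \<Longrightarrow> x i \<in> carrier R" "u \<in> lspan R x m" "v \<in> lspan R x m"
 shows "u \<oplus> v \<in> lspan R x m" using assms
proof (induction m arbitrary: u v)
 case (Suc m)
 obtain u' a v' b where uv: "u = u' \<oplus> a \<otimes> x m" "v = v' \<oplus> b \<otimes> x m" "u' \<in> lspan R x m" "v' \<in> lspan R x m"
  "a \<in> carrier R" "b \<in> carrier R" using Suc.prems by auto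
 have c: "u' \<in> carrier R" "v' \<in> carrier R" "x m \<in> carrier R" using uv(3,4) Suc.prems(1) lspan_closed[of m x] by auto
 have "u \<oplus> v = (u' \<oplus> v') \<oplus> (a \<oplus> b) \<otimes> x m" using uv c by (simp add: l_distr a_ac)
 with Suc uv show ?case by auto
qed simp

lemma lspan_lmult:
 assumes "\<And>i. i < m \<Longrightarrow> x i \<in> carrier R" "u \<in> lspan R x m" "r \<in> carrier R"
 shows "r \<otimes> u \<in> lspan R x m" using assms
proof (induction m arbitrary: u)
 case (Suc m)
 obtain u' a where u: "u = u' \<oplus> a \<otimes> x m" "u' \<in> lspan R x m" "a \<in> carrier R" using Suc.prems by auto
 have c: "u' \<in> carrier R" "x m \<in> carrier R" using u(2) Suc.prems(1) lspan_closed[of m x] by auto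
 have "r \<otimes> u = r \<otimes> u' \<oplus> (r \<otimes> a) \<otimes> x m" using u c Suc.prems by (simp add: r_distr m_assoc)
 with Suc u show ?case by auto
qed simp

lemma lspan_a_inv:
 assumes "\<And>i. i < m \<Longrightarrow> x i \<in> carrier R" "u \<in> lspan R x m" shows "\<ominus> u \<in> lspan R x m"
proof -
 have "(\<ominus> \<one>) \<otimes> u \<in> lspan R x m" using assms by (intro lspan_lmult) auto
 then show ?thesis using lspan_closed[OF assms] by (simp add: l_minus)
qed

lemma lspan_mono_Suc:
 assumes "\<And>i. i < Suc m \<Longrightarrow> x i \<in> carrier R" "u \<in> lspan R x m" shows "u \<in> lspan R x (Suc m)"
proof -
 have "u = u \<oplus> \<zero> \<otimes> x m" using assms lspan_closed[of m x u] by simp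
 with assms(2) show ?thesis by auto
qed

lemma lspan_mono:
 assumes "\<And>i. i < m \<Longrightarrow> x i \<in> carrier R" "k \<le> m" "u \<in> lspan R x k" shows "u \<in> lspan R x m"
 using assms(2,1,3)
proof (induction rule: dec_induct)
 case (step j)
 then have "u \<in> lspan R x j" by auto
 then show ?case using step.prems by (intro lspan_mono_Suc) auto
qed

lemma lspan_gen:
 assumes "\<And>i. i < m \<Longrightarrow> x i \<in> carrier R" "i < m" shows "x i \<in> lspan R x m"
proof (rule lspan_mono[OF assms(1)])
 show "Suc i \<le> m" using assms by simp
 have "x i = \<zero> \<oplus> \<one> \<otimes> x i" using assms by simp
 moreover have "\<zero> \<in> lspan R x i" using assms by (intro lspan_zero) auto
 ultimately show "x i \<in> lspan R x (Suc i)" by fastforce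
qed

end

text \<open>A Koszul filtration whose ideals form a single chain. As the colon ideals are members of
  that chain, a number \<open>c i\<close> suffices to record each of them; it may exceed i.\<close>

definition koszul_flag :: "('a, 'r) ring_scheme \<Rightarrow> 'a set \<Rightarrow> nat \<Rightarrow> (nat \<Rightarrow> 'a) \<Rightarrow> (nat \<Rightarrow> nat) \<Rightarrow> bool" where
 "koszul_flag R I n x c \<longleftrightarrow> (\<forall>i<n. x i \<in> carrier R \<and> c i \<le> n) \<and> lspan R x n = I \<and>
  (\<forall>i<n. \<forall>a\<in>carrier R. a \<otimes>\<^bsub>R\<^esub> x i \<in> lspan R x i \<longleftrightarrow> a \<in> lspan R x (c i))"

locale graded_flag = graded_ring R gr for R (structure) and gr +
 fixes n :: nat and x :: "nat \<Rightarrow> 'a" and c :: "nat \<Rightarrow> nat"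
 assumes gr0: "bij_betw (\<lambda>z::int. [z] \<cdot> \<one>) UNIV (gr 0)"
  and x_gr: "i < n \<Longrightarrow> x i \<in> gr 1"
  and flag: "koszul_flag R pos n x c"
begin

lemma x_closed: "i < n \<Longrightarrow> x i \<in> carrier R" using x_gr gr_closed by blast

lemma c_le: "i < n \<Longrightarrow> c i \<le> n" using flag by (simp add: koszul_flag_def)

lemma colon: "i < n \<Longrightarrow> a \<in> carrier R \<Longrightarrow> a \<otimes> x i \<in> lspan R x i \<longleftrightarrow> a \<in> lspan R x (c i)"
 using flag by (simp add: koszul_flag_def)

lemma lspan_full: "lspan R x n = pos" using flag by (simp add: koszul_flag_def)

lemma x_closed_le: "m \<le> n \<Longrightarrow> i < m \<Longrightarrow> x i \<in> carrier R" using x_closed by simp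

lemma lspan_closed': "m \<le> n \<Longrightarrow> u \<in> lspan R x m \<Longrightarrow> u \<in> carrier R"
 by (rule lspan_closed[of m x]) (auto simp: x_closed)

lemma int_eq_zero:
 fixes z :: int
 assumes "[z] \<cdot> \<one> = \<zero>" shows "z = 0"
proof -
 have "[z] \<cdot> \<one> = [(0::int)] \<cdot> \<one>" using assms by (simp add: add_pow_def)
 with gr0 show "z = 0" by (auto simp: bij_betw_def inj_on_def)
qed

lemma gr0_int: "a \<in> gr 0 \<Longrightarrow> \<exists>z::int. a = [z] \<cdot> \<one>" using gr0 by (auto simp: bij_betw_def)

lemma comp_lspan:
 assumes "m \<le> n" "u \<in> lspan R x m" shows "comp u k \<in> lspan R x m" using assms
proof (induction m arbitrary: u)
 case (Suc m)
 obtain v a where u: "u = v \<oplus> a \<otimes> x m" "v \<in> lspan R x m" "a \<in> carrier R" using Suc.prems by auto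
 have cl: "v \<in> carrier R" "x m \<in> gr 1" "x m \<in> carrier R"
  using u(2) Suc.prems(1) lspan_closed'[of m v] x_gr[of m] x_closed[of m] by auto
 have IH: "comp v k \<in> lspan R x m" using Suc u by auto
 show ?case
 proof (cases k)
  case 0
  have "comp u k = comp v k" using u cl by (simp add: comp_add comp_mult_gr1 0)
  then show ?thesis using lspan_mono_Suc[OF x_closed_le[OF Suc.prems(1)] IH] by simp
 next
  case (Suc j)
  have "comp u k = comp v k \<oplus> comp a j \<otimes> x m" using u cl by (simp add: comp_add comp_mult_gr1 Suc)
  moreover have "comp a j \<in> carrier R" using u(3) by simp
  ultimately show ?thesis using IH unfolding lspan.simps by blast
 qed
qed simp

lemma lspan_pos: "m \<le> n \<Longrightarrow> u \<in> lspan R x m \<Longrightarrow> u \<in> pos"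
 using lspan_mono[of n x m u] x_closed lspan_full by blast

lemma gr_Suc_pos: "a \<in> gr (Suc k) \<Longrightarrow> a \<in> pos" by (simp add: pos_def comp_gr gr_closed)

subsection \<open>The graded pieces\<close>

text \<open>Coefficients are counted from the end of the list, so that prepending an element does
  not shift them.\<close>

primrec zcomb :: "'a list \<Rightarrow> (nat \<Rightarrow> int) \<Rightarrow> 'a" where
 "zcomb [] k = \<zero>"
| "zcomb (b # bs) k = zcomb bs k \<oplus> [k (length bs)] \<cdot> b"

lemma zcomb_closed [simp]: "set bs \<subseteq> carrier R \<Longrightarrow> zcomb bs k \<in> carrier R" by (induction bs) auto

lemma zcomb_append:
 "set bs1 \<subseteq> carrier R \<Longrightarrow> set bs2 \<subseteq> carrier R \<Longrightarrow>
  zcomb (bs1 @ bs2) k = zcomb bs2 k \<oplus> zcomb bs1 (\<lambda>i. k (i + length bs2))" by (induction bs1) (auto simp: a_assoc)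

lemma zcomb_cong: "(\<And>i. i < length bs \<Longrightarrow> k i = k' i) \<Longrightarrow> zcomb bs k = zcomb bs k'" by (induction bs) auto

lemma zcomb_mult:
 "set bs \<subseteq> carrier R \<Longrightarrow> y \<in> carrier R \<Longrightarrow> zcomb (map (\<lambda>b. b \<otimes> y) bs) k = zcomb bs k \<otimes> y"
 by (induction bs) (auto simp: l_distr add_pow_ldistr_int)

lemma zcomb_in: "additive_subgroup H R \<Longrightarrow> set bs \<subseteq> H \<Longrightarrow> zcomb bs k \<in> H"
proof (induction bs)
 case (Cons b bs)
 have "subgroup H (add_monoid R)" using Cons.prems(1) by (simp add: additive_subgroup_def)
 from add.subgroup_int_pow_closed[OF this, of b "k (length bs)"] Cons
 show ?case by (auto intro!: additive_subgroup.a_closed simp: add_pow_def)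
qed (simp add: additive_subgroup.zero_closed)

lemma zcomb_add:
 "set bs \<subseteq> carrier R \<Longrightarrow> zcomb bs (\<lambda>i. k i + l i) = zcomb bs k \<oplus> zcomb bs l"
 by (induction bs) (auto simp: add.int_pow_mult a_ac)

text \<open>The members of \<open>bs\<close> represent a basis, over the integers, of the quotient
  of V by U.\<close>

definition zbasis :: "'a set \<Rightarrow> 'a set \<Rightarrow> 'a list \<Rightarrow> bool" where
 "zbasis V U bs \<longleftrightarrow> set bs \<subseteq> V \<and> (\<forall>v\<in>V. \<exists>k. v \<ominus> zcomb bs k \<in> U) \<and>
  (\<forall>k. zcomb bs k \<in> U \<longrightarrow> (\<forall>i<length bs. k i = 0))"

lemma zbasis_append:
 assumes V: "V \<subseteq> carrier R" and W: "W \<subseteq> V" and U: "additive_subgroup U R" "U \<subseteq> W"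
  and WV: "additive_subgroup W R" and 1: "zbasis V W bs1" and 2: "zbasis W U bs2"
 shows "zbasis V U (bs1 @ bs2)"
proof -
 have c1: "set bs1 \<subseteq> carrier R" and c2: "set bs2 \<subseteq> carrier R" using 1 2 V W by (auto simp: zbasis_def)
 have W2: "zcomb bs2 k \<in> W" for k using zcomb_in[OF WV] 2 by (simp add: zbasis_def)
 have "\<exists>k. v \<ominus> zcomb (bs1 @ bs2) k \<in> U" if v: "v \<in> V" for v
 proof -
  obtain k1 where k1: "v \<ominus> zcomb bs1 k1 \<in> W" using 1 v by (auto simp: zbasis_def)
  obtain k2 where k2: "v \<ominus> zcomb bs1 k1 \<ominus> zcomb bs2 k2 \<in> U" using 2 k1 by (auto simp: zbasis_def)
  let ?k = "\<lambda>i. if i < length bs2 then k2 i else k1 (i - length bs2)"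
  have "zcomb bs2 ?k = zcomb bs2 k2" by (rule zcomb_cong) simp
  then have "zcomb (bs1 @ bs2) ?k = zcomb bs2 k2 \<oplus> zcomb bs1 k1" using c1 c2 by (simp add: zcomb_append)
  moreover have "v \<in> carrier R" using v V by auto
  ultimately have eq: "v \<ominus> zcomb (bs1 @ bs2) ?k = v \<ominus> zcomb bs1 k1 \<ominus> zcomb bs2 k2"
   using c1 c2 by (simp add: a_minus_def minus_add a_ac)
  show ?thesis by (rule exI[of _ ?k]) (simp only: eq k2)
 qed
 moreover have "\<forall>i<length (bs1 @ bs2). k i = 0" if k: "zcomb (bs1 @ bs2) k \<in> U" for k
 proof -
  let ?k = "\<lambda>i. k (i + length bs2)"
  have eq: "zcomb (bs1 @ bs2) k = zcomb bs2 k \<oplus> zcomb bs1 ?k" using c1 c2 by (simp add: zcomb_append)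
  have "zcomb bs1 ?k = \<ominus> zcomb bs2 k \<oplus> zcomb (bs1 @ bs2) k" unfolding eq using c1 c2 by (simp add: r_neg1)
  then have "zcomb bs1 ?k \<in> W" using W2 k U(2) additive_subgroup.a_closed[OF WV] additive_subgroup.a_inv_closed[OF WV] by auto
  with 1 have k1: "\<forall>i<length bs1. k (i + length bs2) = 0" unfolding zbasis_def by blast
  then have "zcomb bs1 ?k = zcomb bs1 (\<lambda>_. 0)" by (intro zcomb_cong) auto
  moreover have "zcomb bs1 (\<lambda>_. 0) = \<zero>" using c1 by (induction bs1) (auto simp: add_pow_def)
  ultimately have "zcomb bs2 k \<in> U" using k eq c2 by simp
  with 2 have k2: "\<forall>i<length bs2. k i = 0" by (simp add: zbasis_def)
  show ?thesis
  proof (intro allI impI)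
   fix i assume "i < length (bs1 @ bs2)"
   then show "k i = 0" using k1[rule_format, of "i - length bs2"] k2 by (cases "i < length bs2") auto
  qed
 qed
 ultimately show ?thesis using 1 2 W by (auto simp: zbasis_def)
qed

lemma lspan_subgroup: "m \<le> n \<Longrightarrow> additive_subgroup (lspan R x m \<inter> gr k) R"
proof -
 assume m: "m \<le> n"
 have "subgroup (lspan R x m \<inter> gr k) (add_monoid R)" by (rule add.subgroupI)
   (auto simp: gr_closed lspan_add[OF x_closed_le[OF m]] gr_add
    lspan_a_inv[OF x_closed_le[OF m]] gr_a_inv intro!: exI[of _ \<zero>] lspan_zero[OF x_closed_le[OF m]]
    simp flip: a_inv_def)
 then show ?thesis by (simp add: additive_subgroup_def)
qed

text \<open>Freeness of the graded pieces is proved for all quotients by ideals of the flag at once.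
  Multiplication by \<open>x m\<close> identifies the quotient by the first \<open>c m\<close>
  generators, in degree k, with the quotient of two consecutive ideals in degree k + 1, which is
  what closes the induction.\<close>

lemma graded_zbasis: "m \<le> n \<Longrightarrow> \<exists>bs. zbasis (gr k) (lspan R x m \<inter> gr k) bs"
proof (induction k arbitrary: m)
 case 0
 have "zbasis (gr 0) (lspan R x m \<inter> gr 0) [\<one>]" unfolding zbasis_def
 proof (intro conjI ballI allI impI)
  show "set [\<one>] \<subseteq> gr 0" using one_gr by simp
  fix v assume "v \<in> gr 0"
  then obtain z :: int where "v = [z] \<cdot> \<one>" using gr0_int by blast
  then have "v \<ominus> zcomb [\<one>] (\<lambda>_. z) = \<zero>" by (simp add: r_neg a_minus_def)
  then show "\<exists>k. v \<ominus> zcomb [\<one>] k \<in> lspan R x m \<inter> gr 0"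
   using lspan_zero[OF x_closed_le[OF 0]] by (intro exI[of _ "\<lambda>_. z"]) auto
 next
  fix k i assume *: "zcomb [\<one>] k \<in> lspan R x m \<inter> gr 0" and i: "i < length [\<one>]"
  then have "[k 0] \<cdot> \<one> \<in> pos" using lspan_pos[OF 0] by simp
  then have "[k 0] \<cdot> \<one> = \<zero>" using comp_gr[OF int_gr0, of "k 0" 0] by (simp add: pos_def)
  then show "k i = 0" using i int_eq_zero by simp
 qed
 then show ?case by blast
next
 case (Suc k)
 \<comment> \<open>Downward induction on m: in positive degree the quotient by the full ideal, at m
   = n, is zero.\<close>
 show ?case using Suc.prems
 proof (induction m rule: inc_induct)
  case base
  have "zbasis (gr (Suc k)) (lspan R x n \<inter> gr (Suc k)) []"
   unfolding zbasis_def lspan_full using gr_Suc_pos gr_closed by (auto simp: a_minus_def)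
  then show ?case by blast
 next
  case (step m)
  then obtain bs1 where bs1: "zbasis (gr (Suc k)) (lspan R x (Suc m) \<inter> gr (Suc k)) bs1" by blast
  have m: "m < n" using step by simp
  then obtain bs where bs: "zbasis (gr k) (lspan R x (c m) \<inter> gr k) bs" using Suc.IH c_le by blast
  have bc: "set bs \<subseteq> carrier R" using bs gr_closed by (auto simp: zbasis_def)
  have xm: "x m \<in> gr 1" "x m \<in> carrier R" using m x_gr x_closed by auto
  \<comment> \<open>The colon condition makes multiplication by \<open>x m\<close> well defined and
    injective on the quotient by the first \<open>c m\<close> generators.\<close>
  have "zbasis (lspan R x (Suc m) \<inter> gr (Suc k)) (lspan R x m \<inter> gr (Suc k)) (map (\<lambda>b. b \<otimes> x m) bs)"
   unfolding zbasis_def zcomb_mult[OF bc xm(2)]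
  proof (intro conjI ballI allI impI)
   show "set (map (\<lambda>b. b \<otimes> x m) bs) \<subseteq> lspan R x (Suc m) \<inter> gr (Suc k)"
   proof
    fix y assume "y \<in> set (map (\<lambda>b. b \<otimes> x m) bs)"
    then obtain b where b: "b \<in> set bs" "y = b \<otimes> x m" by auto
    have "x m \<in> lspan R x (Suc m)" using m by (intro lspan_gen x_closed_le[of "Suc m"]) auto
    then have "y \<in> lspan R x (Suc m)" using b bc m unfolding b(2) by (intro lspan_lmult x_closed_le[of "Suc m"]) auto
    moreover have "b \<in> gr k" using b bs by (auto simp: zbasis_def)
    ultimately show "y \<in> lspan R x (Suc m) \<inter> gr (Suc k)" using mult_gr[of b k "x m" 1] xm b by simp
   qed
  next
   fix w assume w: "w \<in> lspan R x (Suc m) \<inter> gr (Suc k)"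
   then obtain u a where ua: "w = u \<oplus> a \<otimes> x m" "u \<in> lspan R x m" "a \<in> carrier R" by auto
   have u: "u \<in> carrier R" using ua(2) lspan_closed'[of m u] m by auto
   have "w = comp w (Suc k)" using w comp_gr[of w "Suc k" "Suc k"] by auto
   also have "\<dots> = comp u (Suc k) \<oplus> comp a k \<otimes> x m" using ua u xm by (simp add: comp_add comp_mult_gr1)
   finally have w': "w = comp u (Suc k) \<oplus> comp a k \<otimes> x m" .
   obtain l where l: "comp a k \<ominus> zcomb bs l \<in> lspan R x (c m)"
    using bs comp_props(1)[OF ua(3), of k] unfolding zbasis_def by blast
   have "(comp a k \<ominus> zcomb bs l) \<otimes> x m \<in> lspan R x m" using l colon[OF m] ua bc by simp
   then have "comp u (Suc k) \<oplus> (comp a k \<ominus> zcomb bs l) \<otimes> x m \<in> lspan R x m"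
    using comp_lspan[of m u "Suc k"] ua m by (intro lspan_add x_closed_le[of m]) auto
   moreover have "comp u (Suc k) \<oplus> (comp a k \<ominus> zcomb bs l) \<otimes> x m = w \<ominus> zcomb bs l \<otimes> x m"
    using u ua bc xm by (subst w') (simp add: a_minus_def l_distr l_minus a_assoc)
   moreover have "w \<ominus> zcomb bs l \<otimes> x m \<in> gr (Suc k)"
   proof -
    have "zcomb bs l \<in> gr k" using bs by (intro zcomb_in[OF gr_subgroup]) (auto simp: zbasis_def)
    then show ?thesis using w mult_gr[of "zcomb bs l" k "x m" 1] xm by (auto simp: a_minus_def intro: gr_add gr_a_inv)
   qed
   ultimately show "\<exists>l. w \<ominus> zcomb bs l \<otimes> x m \<in> lspan R x m \<inter> gr (Suc k)" by auto
  next
   fix l i assume *: "zcomb bs l \<otimes> x m \<in> lspan R x m \<inter> gr (Suc k)" and i: "i < length (map (\<lambda>b. b \<otimes> x m) bs)"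
   then have "zcomb bs l \<in> lspan R x (c m)" using colon[OF m] bc by simp
   moreover have "zcomb bs l \<in> gr k" using bs by (intro zcomb_in[OF gr_subgroup]) (auto simp: zbasis_def)
   ultimately show "l i = 0" using bs i by (simp add: zbasis_def)
  qed
  from zbasis_append[OF _ _ lspan_subgroup _ lspan_subgroup bs1 this]
  show ?case using m gr_closed lspan_mono_Suc[OF x_closed_le[of "Suc m"]] by (intro exI) fastforce
 qed
qed

lemma gr_free: "\<exists>N::nat. (add_monoid R)\<lparr>carrier := gr k\<rparr> \<cong> free_Abelian_group {..<N}"
proof -
 obtain bs where bs: "zbasis (gr k) ({\<zero>} \<inter> gr k) bs" using graded_zbasis[of 0 k] by auto
 let ?G = "(add_monoid R)\<lparr>carrier := gr k\<rparr>" and ?F = "free_Abelian_group {..<length bs}"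
 have bc: "set bs \<subseteq> carrier R" using bs gr_closed by (auto simp: zbasis_def)
 define h where "h w = zcomb bs (Poly_Mapping.lookup w)" for w :: "nat \<Rightarrow>\<^sub>0 int"
 have h: "h w \<in> gr k" for w unfolding h_def using bs by (intro zcomb_in[OF gr_subgroup]) (auto simp: zbasis_def)
 have h_add: "h (v + w) = h v \<oplus> h w" for v w unfolding h_def by (simp add: lookup_add zcomb_add[OF bc] plus_poly_mapping.rep_eq)
 have hom: "h \<in> hom ?F ?G" using h h_add by (auto simp: hom_def)
 have grp: "group ?G" using gr_subgroup[of k] add.subgroup_imp_group by (simp add: additive_subgroup_def)
 have "group_hom ?F ?G h" using hom grp by (simp add: group_hom_def group_hom_axioms_def)
 moreover have "w = 0" if "h w = \<zero>" "Poly_Mapping.keys w \<subseteq> {..<length bs}" for w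
 proof (rule poly_mapping_eqI)
  fix i
  have "\<forall>i<length bs. Poly_Mapping.lookup w i = 0" using bs that(1) unfolding zbasis_def h_def by fastforce
  then show "Poly_Mapping.lookup w i = Poly_Mapping.lookup 0 i" using that(2) by (cases "i < length bs") (auto simp: in_keys_iff)
 qed
 ultimately have inj: "inj_on h (carrier ?F)" by (subst group_hom.inj_on_one_iff) auto
 have "gr k \<subseteq> h ` carrier ?F"
 proof
  fix v assume v: "v \<in> gr k"
  then obtain l where l: "v \<ominus> zcomb bs l = \<zero>" using bs by (fastforce simp: zbasis_def)
  define w where "w = (\<Sum>i<length bs. frag_cmul (l i) (frag_of i))"
  have "Poly_Mapping.lookup w i = (if i < length bs then l i else 0)" for i
   by (simp add: w_def lookup_sum if_distrib[of "\<lambda>y. _ * y"] cong: if_cong)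
  then have "h w = zcomb bs l" "w \<in> carrier ?F" unfolding h_def by (auto intro!: zcomb_cong simp: in_keys_iff split: if_splits)
  moreover have "v = zcomb bs l" using l gr_closed[OF v] bc by simp
  ultimately show "v \<in> h ` carrier ?F" by (metis imageI)
 qed
 then have "h \<in> iso ?F ?G" using hom inj h by (auto simp: iso_def bij_betw_def)
 then have "?F \<cong> ?G" by (auto simp: is_iso_def)
 then show ?thesis using group.iso_sym[OF group_free_Abelian_group] by blast
qed

subsection \<open>The linear resolution\<close>

text \<open>A list of vectors with the newest member first; the member with \<open>t\<close> predecessors has the coefficient \<open>a t\<close>.\<close>

primrec vcomb :: "(nat \<Rightarrow> 'a) list \<Rightarrow> (nat \<Rightarrow> 'a) \<Rightarrow> nat \<Rightarrow> 'a" where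
 "vcomb [] a = (\<lambda>j. \<zero>)"
| "vcomb (g # gs) a = (\<lambda>j. vcomb gs a j \<oplus> a (length gs) \<otimes> g j)"

definition vectors :: "(nat \<Rightarrow> 'a) list \<Rightarrow> bool" where
 "vectors gs \<longleftrightarrow> (\<forall>g\<in>set gs. \<forall>j. g j \<in> carrier R)"

definition coeffs :: "nat \<Rightarrow> (nat \<Rightarrow> 'a) set" where
 "coeffs N = {a. (\<forall>t. a t \<in> carrier R) \<and> (\<forall>t\<ge>N. a t = \<zero>)}"

lemma vcomb_cong: "(\<And>t. t < length gs \<Longrightarrow> a t = b t) \<Longrightarrow> vcomb gs a = vcomb gs b" by (induction gs) auto

lemma vcomb_closed: "vectors gs \<Longrightarrow> (\<And>t. t < length gs \<Longrightarrow> a t \<in> carrier R) \<Longrightarrow> vcomb gs a j \<in> carrier R"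
 by (induction gs) (auto simp: vectors_def)

lemma vcomb_add:
 assumes "vectors gs" "\<And>t. t < length gs \<Longrightarrow> a t \<in> carrier R" "\<And>t. t < length gs \<Longrightarrow> b t \<in> carrier R"
 shows "vcomb gs (\<lambda>t. a t \<oplus> b t) j = vcomb gs a j \<oplus> vcomb gs b j" using assms
proof (induction gs)
 case (Cons g gs)
 then have v: "vectors gs" "g j \<in> carrier R" "vcomb gs a j \<in> carrier R" "vcomb gs b j \<in> carrier R"
  by (auto simp: vectors_def intro!: vcomb_closed)
 with Cons show ?case by (simp add: l_distr a_ac)
qed simp

lemma vcomb_lmult:
 assumes "vectors gs" "\<And>t. t < length gs \<Longrightarrow> a t \<in> carrier R" "r \<in> carrier R"
 shows "vcomb gs (\<lambda>t. r \<otimes> a t) j = r \<otimes> vcomb gs a j" using assms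
proof (induction gs)
 case (Cons g gs)
 then have v: "vectors gs" "g j \<in> carrier R" "vcomb gs a j \<in> carrier R" by (auto simp: vectors_def intro!: vcomb_closed)
 with Cons show ?case by (simp add: r_distr m_assoc)
qed simp

lemma vcomb_a_inv:
 assumes "vectors gs" "\<And>t. t < length gs \<Longrightarrow> a t \<in> carrier R"
 shows "vcomb gs (\<lambda>t. \<ominus> a t) j = \<ominus> vcomb gs a j"
proof -
 have "vcomb gs (\<lambda>t. \<ominus> a t) = vcomb gs (\<lambda>t. (\<ominus> \<one>) \<otimes> a t)"
  using assms by (intro vcomb_cong) (simp add: l_minus)
 then show ?thesis using vcomb_lmult[OF assms, where r="\<ominus> \<one>"] vcomb_closed[OF assms] by (simp add: l_minus)
qed

lemma comp_vcomb:
 assumes "\<forall>g\<in>set gs. \<forall>j. g j \<in> gr 1" "\<And>t. t < length gs \<Longrightarrow> a t \<in> carrier R"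
 shows "comp (vcomb gs a j) (Suc k) = vcomb gs (\<lambda>t. comp (a t) k) j" using assms
proof (induction gs)
 case (Cons g gs)
 then have v: "g j \<in> gr 1" "vectors gs" by (auto simp: vectors_def intro!: gr_closed[of _ "Suc 0"])
 moreover have "g j \<in> carrier R" using gr_closed[OF v(1)] .
 moreover have "vcomb gs a j \<in> carrier R" using Cons.prems v by (intro vcomb_closed) auto
 ultimately show ?case using Cons by (simp add: comp_add comp_mult_gr1)
qed simp

definition vspan :: "(nat \<Rightarrow> 'a) list \<Rightarrow> (nat \<Rightarrow> 'a) set" where
 "vspan gs = vcomb gs ` coeffs (length gs)"

lemma vspanI: "(\<And>t. t < length gs \<Longrightarrow> a t \<in> carrier R) \<Longrightarrow> vcomb gs a \<in> vspan gs"
 unfolding vspan_def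
 by (rule image_eqI[of _ _ "\<lambda>t. if t < length gs then a t else \<zero>"]) (auto simp: coeffs_def intro: vcomb_cong)

lemma vspan_Cons:
 "vspan (g # gs) = {\<lambda>j. v j \<oplus> a \<otimes> g j | v a. v \<in> vspan gs \<and> a \<in> carrier R}"
proof (intro equalityI subsetI)
 fix w assume "w \<in> vspan (g # gs)"
 then obtain a where a: "a \<in> coeffs (Suc (length gs))" "w = vcomb (g # gs) a" by (auto simp: vspan_def)
 then have "vcomb gs a \<in> vspan gs" "a (length gs) \<in> carrier R" by (auto intro: vspanI simp: coeffs_def)
 with a(2) show "w \<in> {\<lambda>j. v j \<oplus> a \<otimes> g j | v a. v \<in> vspan gs \<and> a \<in> carrier R}" by auto
next
 fix w assume "w \<in> {\<lambda>j. v j \<oplus> a \<otimes> g j | v a. v \<in> vspan gs \<and> a \<in> carrier R}"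
 then obtain b a where *: "w = (\<lambda>j. vcomb gs b j \<oplus> a \<otimes> g j)" "b \<in> coeffs (length gs)" "a \<in> carrier R"
  by (auto simp: vspan_def)
 let ?b = "b(length gs := a)"
 have "vcomb gs ?b = vcomb gs b" by (rule vcomb_cong) auto
 then have "w = vcomb (g # gs) ?b" using * by simp
 moreover have "vcomb (g # gs) ?b \<in> vspan (g # gs)" using * by (intro vspanI) (auto simp: coeffs_def)
 ultimately show "w \<in> vspan (g # gs)" by simp
qed

definition syzygies :: "(nat \<Rightarrow> 'a) list \<Rightarrow> (nat \<Rightarrow> 'a) set" where
 "syzygies gs = {a \<in> coeffs (length gs). vcomb gs a = (\<lambda>j. \<zero>)}"

text \<open>The analogue of a flag for submodules of a free module. The number paired with a vector
  tells which ideal of the flag is its annihilator modulo the vectors that were added before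
  it.\<close>

primrec linear_list :: "((nat \<Rightarrow> 'a) \<times> nat) list \<Rightarrow> bool" where
 "linear_list [] \<longleftrightarrow> True"
| "linear_list (p # ps) \<longleftrightarrow> linear_list ps \<and> (\<forall>j. fst p j \<in> gr 1) \<and> snd p \<le> n \<and>
  (\<forall>a\<in>carrier R. (\<lambda>j. a \<otimes> fst p j) \<in> vspan (map fst ps) \<longleftrightarrow> a \<in> lspan R x (snd p))"

lemma linear_list_gr: "linear_list ps \<Longrightarrow> g \<in> set (map fst ps) \<Longrightarrow> g j \<in> gr 1" by (induction ps) auto

lemma linear_list_vectors: "linear_list ps \<Longrightarrow> vectors (map fst ps)"
 using linear_list_gr gr_closed unfolding vectors_def by blast

text \<open>The last coefficients of the syzygies of \<open>p # ps\<close> form the annihilator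
  recorded with p, an ideal of the flag, and those with last coefficient zero are the syzygies of
  \<open>ps\<close>. Each generator \<open>x l\<close> of the annihilator lifts to a linear syzygy,
  and the lifts inherit the colon ideals of the flag, so the syzygies again form such a
  list.\<close>

lemma linear_list_syzygies:
 "linear_list ps \<Longrightarrow> \<exists>qs. linear_list qs \<and> vspan (map fst qs) = syzygies (map fst ps)"
proof (induction ps)
 case Nil
 show ?case by (intro exI[of _ "[]"]) (auto simp: vspan_def syzygies_def coeffs_def image_def fun_eq_iff)
next
 case (Cons p ps)
 obtain g s where p: "p = (g, s)" by (cases p)
 let ?gs = "map fst ps"
 define N where "N = length ps"
 have g: "g j \<in> gr 1" "g j \<in> carrier R" for j using Cons.prems gr_closed by (auto simp: p)
 have s: "s \<le> n" and lin: "linear_list ps" using Cons.prems by (auto simp: p)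
 have ann: "(\<lambda>j. a \<otimes> g j) \<in> vspan ?gs \<longleftrightarrow> a \<in> lspan R x s" if "a \<in> carrier R" for a
  using Cons.prems that by (simp add: p)
 have vs: "vectors ?gs" by (rule linear_list_vectors[OF lin])
 have vgs: "vectors (g # ?gs)" using vs g by (simp add: vectors_def)
 let ?S = "syzygies (g # ?gs)"
 have S: "a \<in> ?S \<longleftrightarrow> (\<forall>t. a t \<in> carrier R) \<and> (\<forall>t>N. a t = \<zero>) \<and> (\<forall>j. vcomb ?gs a j \<oplus> a N \<otimes> g j = \<zero>)" for a
  by (auto simp: syzygies_def coeffs_def fun_eq_iff N_def Suc_le_eq)
 have S_lmult: "(\<lambda>t. r \<otimes> a t) \<in> ?S" if "a \<in> ?S" "r \<in> carrier R" for r a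
  using that vcomb_lmult[OF vgs, of a r] by (auto simp: syzygies_def coeffs_def)
 have S_add: "(\<lambda>t. a t \<oplus> b t) \<in> ?S" if "a \<in> ?S" "b \<in> ?S" for a b
  using that vcomb_add[OF vgs, of a b] by (auto simp: syzygies_def coeffs_def)
 have "\<exists>h. (\<forall>j. h j \<in> gr 1) \<and> h \<in> ?S \<and> h N = x l" if l: "l < s" for l
 proof -
  have xl: "x l \<in> gr 1" "x l \<in> carrier R" using l s x_gr x_closed by auto
  have "x l \<in> lspan R x s" using l s by (intro lspan_gen x_closed_le) auto
  then have "(\<lambda>j. x l \<otimes> g j) \<in> vspan ?gs" using ann xl by simp
  then obtain b where b: "b \<in> coeffs N" "vcomb ?gs b = (\<lambda>j. x l \<otimes> g j)" by (auto simp: vspan_def N_def)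
  have bt: "b t \<in> carrier R" for t using b by (simp add: coeffs_def)
  \<comment> \<open>In degree two the relation expressing \<open>x l\<close> times g involves just
    the degree one components of the coefficients b, so it can be made linear.\<close>
  have b1: "vcomb ?gs (\<lambda>t. comp (b t) 1) j = x l \<otimes> g j" for j
  proof -
   have "vcomb ?gs (\<lambda>t. comp (b t) 1) j = comp (vcomb ?gs b j) (Suc 1)"
    using linear_list_gr[OF lin] bt by (subst comp_vcomb) auto
   also have "\<dots> = x l \<otimes> g j"
    using comp_gr[of "x l \<otimes> g j" 2 2] mult_gr[OF xl(1) g(1)] by (simp add: b(2) numeral_2_eq_2)
   finally show ?thesis .
  qed
  define h where "h = (\<lambda>t. if t < N then \<ominus> comp (b t) 1 else if t = N then x l else \<zero>)"
  have h1: "h j \<in> gr 1" for j unfolding h_def using xl comp_props(1)[OF bt] gr_a_inv by auto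
  have "vcomb ?gs h = vcomb ?gs (\<lambda>t. \<ominus> comp (b t) 1)" by (rule vcomb_cong) (simp add: h_def N_def)
  then have "vcomb ?gs h j = \<ominus> (x l \<otimes> g j)" for j using b1 vcomb_a_inv[OF vs, of "\<lambda>t. comp (b t) 1"] bt by simp
  then have "h \<in> ?S" unfolding S using xl g bt by (auto simp: h_def l_neg)
  then show ?thesis using h1 by (intro exI[of _ h]) (simp add: h_def)
 qed
 then obtain h where h: "\<And>l j. l < s \<Longrightarrow> h l j \<in> gr 1" "\<And>l. l < s \<Longrightarrow> h l \<in> ?S" "\<And>l. l < s \<Longrightarrow> h l N = x l"
  by metis
 \<comment> \<open>These modules interpolate, along the flag, between the syzygies of
   \<open>ps\<close> and all syzygies.\<close>
 have "\<exists>qs. linear_list qs \<and> vspan (map fst qs) = {a \<in> ?S. a N \<in> lspan R x l}" if "l \<le> s" for l using that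
 proof (induction l)
  case 0
  obtain qs where qs: "linear_list qs" "vspan (map fst qs) = syzygies ?gs" using Cons.IH[OF lin] by blast
  have "syzygies ?gs = {a \<in> ?S. a N = \<zero>}"
  proof (intro equalityI subsetI)
   fix a assume "a \<in> syzygies ?gs"
   then show "a \<in> {a \<in> ?S. a N = \<zero>}" unfolding S using g by (auto simp: syzygies_def coeffs_def N_def)
  next
   fix a assume a: "a \<in> {a \<in> ?S. a N = \<zero>}"
   then have "a t \<in> carrier R" for t by (simp add: S)
   then have "vcomb ?gs a j \<in> carrier R" for j by (intro vcomb_closed[OF vs])
   moreover have "vcomb ?gs a j \<oplus> a N \<otimes> g j = \<zero>" "a N = \<zero>" for j using a unfolding S by blast+
   ultimately have "vcomb ?gs a j = \<zero>" for j using g by (metis l_null r_zero)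
   moreover have "a t = \<zero>" if "N \<le> t" for t using a that by (cases "t = N") (auto simp: S)
   moreover have "a t \<in> carrier R" for t using a by (simp add: S)
   ultimately show "a \<in> syzygies ?gs" unfolding syzygies_def coeffs_def by (auto simp: N_def)
  qed
  then show ?case using qs by auto
 next
  case (Suc l)
  then obtain qs where qs: "linear_list qs" "vspan (map fst qs) = {a \<in> ?S. a N \<in> lspan R x l}" by auto
  have l: "l < s" "l < n" using Suc.prems s by auto
  \<comment> \<open>Membership of a multiple of \<open>h l\<close> in the previous module is decided
    by its last coefficient, a multiple of \<open>x l\<close>. So the annihilator of
    \<open>h l\<close> is the colon ideal of \<open>x l\<close>.\<close>
  have "linear_list ((h l, c l) # qs)" using qs h[OF l(1)] colon[OF l(2)] c_le[OF l(2)] S_lmult by simp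
  moreover have "vspan (map fst ((h l, c l) # qs)) = {a \<in> ?S. a N \<in> lspan R x (Suc l)}"
   unfolding list.map fst_conv vspan_Cons qs(2)
  proof (intro equalityI subsetI)
   fix w assume "w \<in> {\<lambda>j. v j \<oplus> a \<otimes> h l j | v a. v \<in> {a \<in> ?S. a N \<in> lspan R x l} \<and> a \<in> carrier R}"
   then obtain v a where va: "w = (\<lambda>j. v j \<oplus> a \<otimes> h l j)" "v \<in> ?S" "v N \<in> lspan R x l" "a \<in> carrier R" by blast
   have "w \<in> ?S" unfolding va(1) using S_add[OF va(2) S_lmult[OF h(2)[OF l(1)] va(4)]] .
   moreover have "w N = v N \<oplus> a \<otimes> x l" by (simp add: va h(3)[OF l(1)])
   ultimately show "w \<in> {a \<in> ?S. a N \<in> lspan R x (Suc l)}" using va by auto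
  next
   fix w assume "w \<in> {a \<in> ?S. a N \<in> lspan R x (Suc l)}"
   then obtain u a where ua: "w \<in> ?S" "w N = u \<oplus> a \<otimes> x l" "u \<in> lspan R x l" "a \<in> carrier R" by auto
   define v where "v = (\<lambda>j. w j \<oplus> (\<ominus> a) \<otimes> h l j)"
   have v: "v \<in> ?S" unfolding v_def by (intro S_add ua S_lmult h l) (simp add: ua)
   have cl: "u \<in> carrier R" "x l \<in> carrier R" "w j \<in> carrier R" "h l j \<in> carrier R" for j
    using ua(1,3) l lspan_closed'[of l u] x_closed h(2)[OF l(1)] by (auto simp: S)
   have "v N = u" using ua cl by (simp add: v_def h(3)[OF l(1)] l_minus a_assoc r_neg)
   moreover have "w = (\<lambda>j. v j \<oplus> a \<otimes> h l j)" using ua cl by (simp add: v_def l_minus a_assoc l_neg)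
   ultimately show "w \<in> {\<lambda>j. v j \<oplus> a \<otimes> h l j | v a. v \<in> {a \<in> ?S. a N \<in> lspan R x l} \<and> a \<in> carrier R}"
    using v ua by blast
  qed
  ultimately show ?case by blast
 qed
 from this[OF order_refl] obtain qs where qs: "linear_list qs" "vspan (map fst qs) = {a \<in> ?S. a N \<in> lspan R x s}" by blast
 \<comment> \<open>A syzygy expresses its last coefficient times g by the earlier vectors, which
   places that coefficient in the annihilator; hence the largest module of the interpolation is
   everything.\<close>
 have "a N \<in> lspan R x s" if a: "a \<in> ?S" for a
 proof -
  have cl: "a t \<in> carrier R" for t using a by (simp add: S)
  have vc: "vcomb ?gs a j \<in> carrier R" for j by (rule vcomb_closed[OF vs]) (rule cl)
  have "a N \<otimes> g j = vcomb ?gs (\<lambda>t. \<ominus> a t) j" for j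
  proof -
   have "vcomb ?gs a j \<oplus> a N \<otimes> g j = \<zero>" using a by (simp add: S)
   then have "a N \<otimes> g j = \<ominus> vcomb ?gs a j" using vc cl g by (metis a_comm m_closed minus_equality)
   then show ?thesis using vcomb_a_inv[OF vs] cl by simp
  qed
  then have "(\<lambda>j. a N \<otimes> g j) = vcomb ?gs (\<lambda>t. \<ominus> a t)" by blast
  moreover have "vcomb ?gs (\<lambda>t. \<ominus> a t) \<in> vspan ?gs" using cl by (intro vspanI) auto
  ultimately show ?thesis using ann cl by metis
 qed
 then have "vspan (map fst qs) = ?S" using qs by auto
 with qs(1) show ?case by (auto simp: p)
qed

text \<open>The generators of the augmentation ideal, as vectors of a free module of rank one,
  together with their colon ideals. This is where the resolution starts.\<close>

primrec flag_list :: "nat \<Rightarrow> ((nat \<Rightarrow> 'a) \<times> nat) list" where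
 "flag_list 0 = []"
| "flag_list (Suc m) = ((\<lambda>j. if j = 0 then x m else \<zero>), c m) # flag_list m"

lemma vspan_flag_list:
 "m \<le> n \<Longrightarrow> vspan (map fst (flag_list m)) = {v. v 0 \<in> lspan R x m \<and> (\<forall>j>0. v j = \<zero>)}"
proof (induction m)
 case 0
 have "coeffs 0 = {\<lambda>_. \<zero>}" by (auto simp: coeffs_def)
 then have "vspan [] = {\<lambda>_. \<zero>}" by (simp add: vspan_def)
 moreover have "{v. v 0 = \<zero> \<and> (\<forall>j>0. v j = \<zero>)} = {\<lambda>_::nat. \<zero>}"
 proof -
  have "v = (\<lambda>_. \<zero>)" if "v 0 = \<zero>" "\<forall>j>0. v j = \<zero>" for v :: "nat \<Rightarrow> 'a"
  proof
   show "v j = \<zero>" for j using that by (cases "j = 0") auto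
  qed
  then show ?thesis by blast
 qed
 ultimately show ?case by simp
next
 case (Suc m)
 have xm: "x m \<in> carrier R" using Suc.prems x_closed by simp
 have IH: "vspan (map fst (flag_list m)) = {v. v 0 \<in> lspan R x m \<and> (\<forall>j>0. v j = \<zero>)}" using Suc by simp
 show ?case unfolding flag_list.simps list.map fst_conv vspan_Cons IH
 proof (intro equalityI subsetI)
  fix w :: "nat \<Rightarrow> 'a" assume "w \<in> {v. v 0 \<in> lspan R x (Suc m) \<and> (\<forall>j>0. v j = \<zero>)}"
  then obtain u a where ua: "w 0 = u \<oplus> a \<otimes> x m" "u \<in> lspan R x m" "a \<in> carrier R" "\<forall>j>0. w j = \<zero>" by auto
  let ?v = "\<lambda>j. if j = 0 then u else \<zero>"
  have "w = (\<lambda>j. ?v j \<oplus> a \<otimes> (if j = 0 then x m else \<zero>))"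
  proof
   show "w j = ?v j \<oplus> a \<otimes> (if j = 0 then x m else \<zero>)" for j
   proof (cases "j = 0")
    case False
    then have "0 < j" by simp
    then have "w j = \<zero>" using ua(4) by blast
    then show ?thesis using False ua by simp
   qed (use ua in simp)
  qed
  with ua show "w \<in> {\<lambda>j. v j \<oplus> a \<otimes> (if j = 0 then x m else \<zero>) | v a.
    v \<in> {v. v 0 \<in> lspan R x m \<and> (\<forall>j>0. v j = \<zero>)} \<and> a \<in> carrier R}"
   by (intro CollectI exI[of _ ?v] exI[of _ a]) auto
 next
  fix w :: "nat \<Rightarrow> 'a" assume "w \<in> {\<lambda>j. v j \<oplus> a \<otimes> (if j = 0 then x m else \<zero>) | v a.
    v \<in> {v. v 0 \<in> lspan R x m \<and> (\<forall>j>0. v j = \<zero>)} \<and> a \<in> carrier R}"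
  then obtain v a where va: "w = (\<lambda>j::nat. v j \<oplus> a \<otimes> (if j = 0 then x m else \<zero>))" "v 0 \<in> lspan R x m"
   "\<forall>j>0. v j = \<zero>" "a \<in> carrier R" by blast
  then have "w 0 \<in> lspan R x (Suc m)" by auto
  moreover have "\<forall>j>0. w j = \<zero>" using va by simp
  ultimately show "w \<in> {v. v 0 \<in> lspan R x (Suc m) \<and> (\<forall>j>0. v j = \<zero>)}" by blast
 qed
qed

lemma linear_flag_list: "m \<le> n \<Longrightarrow> linear_list (flag_list m)"
proof (induction m)
 case (Suc m)
 then show ?case using x_gr[of m] c_le[of m] vspan_flag_list[of m] colon[of m] by (auto simp: if_distrib cong: if_cong)
qed simp

subsection \<open>Koszulness\<close>

text \<open>As a span this is only a left ideal. Closure under right multiplication follows since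
  every ring element is an integer plus an element of \<open>pos\<close>, and integers commute with
  everything.\<close>

lemma pos_ideal: "ideal pos R"
proof (rule idealI[OF ring_axioms])
 note la = lspan_add[of n x, OF x_closed] and lm = lspan_lmult[of n x, OF x_closed]
 show "subgroup pos (add_monoid R)" unfolding lspan_full[symmetric] by (rule add.subgroupI)
   (auto simp: lspan_closed'[OF order_refl] lspan_add[OF x_closed] lspan_a_inv[OF x_closed] intro!: exI[of _ \<zero>] lspan_zero[OF x_closed]
    simp flip: a_inv_def)
 show l: "r \<otimes> p \<in> pos" if "p \<in> pos" "r \<in> carrier R" for p r using that lm unfolding lspan_full[symmetric] by blast
 show "p \<otimes> r \<in> pos" if p: "p \<in> pos" and r: "r \<in> carrier R" for p r
 proof -
  obtain z :: int where z: "comp r 0 = [z] \<cdot> \<one>" using gr0_int comp_props(1)[OF r] by blast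
  let ?r = "r \<ominus> [z] \<cdot> \<one>"
  have "comp ?r 0 = [z] \<cdot> \<one> \<ominus> [z] \<cdot> \<one>" using r comp_gr[OF int_gr0, of z 0] by (simp add: comp_minus z)
  then have "?r \<in> pos" using r by (simp add: pos_def)
  then have 1: "p \<otimes> ?r \<in> pos" using p pos_closed by (intro l)
  have 2: "[z] \<cdot> \<one> \<otimes> p \<in> pos" using p by (intro l) auto
  have "[z] \<cdot> \<one> \<otimes> p = p \<otimes> [z] \<cdot> \<one>"
   using pos_closed[OF p] by (simp add: add_pow_ldistr_int add_pow_rdistr_int)
  then have "p \<otimes> r = p \<otimes> ?r \<oplus> [z] \<cdot> \<one> \<otimes> p"
   using pos_closed[OF p] r by (simp add: a_minus_def r_distr r_minus a_assoc l_neg)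
  then show ?thesis using 1 2 la unfolding lspan_full[symmetric] by simp
 qed
qed

text \<open>Identifies the ideal that occurs in the definition of \<open>augmentation\<close>, so
  that the augmentation can be computed from the component in degree zero.\<close>

lemma pos_Idl: "Idl (\<Union>k\<in>{0<..}. gr k) = pos"
proof
 have sub: "(\<Union>k\<in>{0<..}. gr k) \<subseteq> pos" using gr_Suc_pos by (auto dest!: gr0_implies_Suc)
 then show "Idl (\<Union>k\<in>{0<..}. gr k) \<subseteq> pos" by (rule genideal_minimal[OF pos_ideal])
 have cl: "(\<Union>k\<in>{0<..}. gr k) \<subseteq> carrier R" using gr_closed by auto
 interpret J: ideal "Idl (\<Union>k\<in>{0<..}. gr k)" R by (rule genideal_ideal[OF cl])
 have "x i \<in> Idl (\<Union>k\<in>{0<..}. gr k)" if "i < n" for i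
  using genideal_self[OF cl] x_gr[OF that] by (blast intro: zero_less_one)
 then have "lspan R x m \<subseteq> Idl (\<Union>k\<in>{0<..}. gr k)" if "m \<le> n" for m
  using that by (induction m) (auto intro!: J.a_closed J.I_l_closed)
 then show "pos \<subseteq> Idl (\<Union>k\<in>{0<..}. gr k)" using lspan_full by blast
qed

lemma augmentation_eq:
 assumes a: "a \<in> carrier R" and z: "comp a 0 = [z] \<cdot> \<one>"
 shows "augmentation R gr a = z" unfolding augmentation_def pos_Idl
proof (rule the_equality)
 have eq: "comp (a \<ominus> [w] \<cdot> \<one>) 0 = [z] \<cdot> \<one> \<ominus> [w] \<cdot> \<one>" for w :: int
  using a comp_gr[OF int_gr0, of w 0] by (simp add: comp_minus z)
 then show "a \<ominus> [z] \<cdot> \<one> \<in> pos" using a by (simp add: pos_def r_neg a_minus_def)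
 fix w :: int assume "a \<ominus> [w] \<cdot> \<one> \<in> pos"
 then have "[z] \<cdot> \<one> \<ominus> [w] \<cdot> \<one> = \<zero>" using eq[of w] by (simp add: pos_def)
 then have "[z] \<cdot> \<one> = [w] \<cdot> \<one>" by simp
 then show "w = z" using gr0 by (auto simp: bij_betw_def inj_on_def)
qed

lemma augmentation_int: "augmentation R gr ([z] \<cdot> \<one>) = z" using comp_gr[OF int_gr0, of z 0] by (intro augmentation_eq) auto

lemma augmentation_eq_0: "a \<in> carrier R \<Longrightarrow> augmentation R gr a = 0 \<longleftrightarrow> a \<in> pos"
proof -
 assume a: "a \<in> carrier R"
 obtain z :: int where z: "comp a 0 = [z] \<cdot> \<one>" using gr0_int comp_props(1)[OF a] by blast
 have "[z] \<cdot> \<one> = \<zero> \<longleftrightarrow> z = 0" using int_eq_zero by (auto simp: add_pow_def)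
 then show ?thesis using augmentation_eq[OF a z] a z by (simp add: pos_def)
qed

lemma augmentation_gr1: "a \<in> gr 1 \<Longrightarrow> augmentation R gr a = 0"
 using augmentation_eq_0[of a] gr_Suc_pos[of a 0] gr_closed by simp

lemma vcomb_finsum:
 assumes "vectors gs" "\<And>t. a t \<in> carrier R"
 shows "vcomb gs a j = (\<Oplus>b\<in>{..<length gs}. a b \<otimes> (rev gs ! b) j)" using assms(1)
proof (induction gs)
 case (Cons g gs)
 have v: "vectors gs" "g j \<in> carrier R" using Cons.prems by (auto simp: vectors_def)
 have cl: "(rev gs ! b) j \<in> carrier R" if "b < length gs" for b using v(1) that nth_mem[of b "rev gs"] by (auto simp: vectors_def)
 have eq: "(\<Oplus>b\<in>{..<length gs}. a b \<otimes> (rev gs ! b) j) = (\<Oplus>b\<in>{..<length gs}. a b \<otimes> ((rev gs @ [g]) ! b) j)"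
  using cl assms(2) by (intro finsum_cong') (auto simp: nth_append)
 have "(\<Oplus>b\<in>insert (length gs) {..<length gs}. a b \<otimes> ((rev gs @ [g]) ! b) j) =
   a (length gs) \<otimes> ((rev gs @ [g]) ! length gs) j \<oplus> (\<Oplus>b\<in>{..<length gs}. a b \<otimes> ((rev gs @ [g]) ! b) j)"
  using cl v assms(2) by (intro finsum_insert) (auto simp: nth_append)
 moreover have "vcomb gs a j \<in> carrier R" by (intro vcomb_closed v assms)
 moreover have "((rev gs @ [g]) ! length gs) j = g j" using nth_append_length[of "rev gs" g "[]"] by simp
 ultimately show ?case using Cons.IH[OF v(1)] v assms(2) by (simp add: eq lessThan_Suc a_comm)
qed simp

lemma free_module_map_vcomb:
 assumes gs: "vectors gs" and f: "f \<in> free_module R {..<length gs}"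
 shows "free_module_map R (\<lambda>b. rev gs ! b) f = vcomb gs f"
proof
 fix j
 have f': "f t \<in> carrier R" "t \<ge> length gs \<Longrightarrow> f t = \<zero>" for t using f by (auto simp: free_module_def)
 have cl: "(rev gs ! b) j \<in> carrier R" if "b < length gs" for b using gs that nth_mem[of b "rev gs"] by (auto simp: vectors_def)
 have sub: "{b. f b \<noteq> \<zero>} \<subseteq> {..<length gs}" using f'(2) by (auto simp: not_le[symmetric])
 have "(\<Oplus>b\<in>{b. f b \<noteq> \<zero>}. f b \<otimes> (rev gs ! b) j) = (\<Oplus>b\<in>{..<length gs}. f b \<otimes> (rev gs ! b) j)"
  using cl f' sub by (intro add.finprod_mono_neutral_cong_left) auto
 then show "free_module_map R (\<lambda>b. rev gs ! b) f j = vcomb gs f j" using f' by (simp add: free_module_map_def vcomb_finsum[OF gs])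
qed

lemma free_module_coeffs: "free_module R {..<N} = coeffs N"
proof -
 have "finite {t. a t \<noteq> \<zero>}" if "\<forall>t\<ge>N. a t = \<zero>" for a :: "nat \<Rightarrow> 'a"
 proof (rule finite_subset[of _ "{..<N}"])
  show "{t. a t \<noteq> \<zero>} \<subseteq> {..<N}" using that by (auto simp: not_le[symmetric])
 qed simp
 then show ?thesis by (auto simp: free_module_def coeffs_def)
qed

lemma scalar_coeffs:
 assumes "A \<subseteq> carrier R" shows "{v :: nat \<Rightarrow> 'a. v 0 \<in> A \<and> (\<forall>j>0. v j = \<zero>)} = {v \<in> coeffs 1. v 0 \<in> A}"
proof -
 have "v t \<in> carrier R" if "v 0 \<in> A" "\<forall>j>0. v j = \<zero>" for v :: "nat \<Rightarrow> 'a" and t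
  using that assms by (cases t) auto
 then show ?thesis by (auto simp: coeffs_def Suc_le_eq)
qed

text \<open>Iterated syzygies of the flag give a free resolution whose differentials have entries of
  degree one. The i-th module is therefore generated in degree i, and after tensoring with the
  integers nothing is left off the diagonal.\<close>

theorem flag_Koszul: "Koszul R gr"
proof -
 have "\<exists>F. \<forall>i. (linear_list (F i) \<and> (i = 0 \<longrightarrow> F i = flag_list n)) \<and> vspan (map fst (F (Suc i))) = syzygies (map fst (F i))"
 proof (rule dependent_nat_choice)
  show "\<exists>ps. linear_list ps \<and> (0 = (0::nat) \<longrightarrow> ps = flag_list n)" using linear_flag_list[OF order_refl] by blast
  show "\<exists>qs. (linear_list qs \<and> (Suc i = 0 \<longrightarrow> qs = flag_list n)) \<and> vspan (map fst qs) = syzygies (map fst ps)"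
   if "linear_list ps \<and> (i = 0 \<longrightarrow> ps = flag_list n)" for ps i using linear_list_syzygies that by simp
 qed
 then obtain F where F: "\<And>i. linear_list (F i)" "F 0 = flag_list n"
  "\<And>i. vspan (map fst (F (Suc i))) = syzygies (map fst (F i))" by metis
 define gs where "gs i = map fst (F i)" for i
 have vs: "vectors (gs i)" for i unfolding gs_def by (rule linear_list_vectors[OF F(1)])
 have g1: "(rev (gs i) ! b) j \<in> gr 1" if "b < length (gs i)" for i b j
  using linear_list_gr[OF F(1)[of i]] nth_mem[of b "rev (gs i)"] that by (auto simp: gs_def)
 \<comment> \<open>The index is shifted by one: module 0 has rank one and covers the integers, and
   the vectors \<open>gs k\<close> are the images of the basis of module k + 1.\<close>
 define B :: "nat \<Rightarrow> nat set" where "B i = (case i of 0 \<Rightarrow> {..<1} | Suc k \<Rightarrow> {..<length (gs k)})" for i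
 define D where "D i b = rev (gs i) ! b" for i b
 define wt :: "nat \<Rightarrow> nat \<Rightarrow> nat" where "wt i b = i" for i b
 define e :: "nat \<Rightarrow> int" where "e b = 1" for b
 have fm: "free_module_map R (D i) f = vcomb (gs i) f" if "f \<in> free_module R (B (Suc i))" for i f
  using free_module_map_vcomb[OF vs[of i], of f] that by (simp add: D_def[abs_def] B_def)
 have im: "free_module_map R (D i) ` free_module R (B (Suc i)) = vspan (gs i)" for i
  unfolding vspan_def free_module_coeffs[symmetric] using fm[of _ i] by (auto simp: B_def image_def)
 have ker: "{f \<in> free_module R (B (Suc i)). free_module_map R (D i) f = (\<lambda>_. \<zero>)} = syzygies (gs i)" for i
  unfolding syzygies_def free_module_coeffs[symmetric] using fm[of _ i] by (auto simp: B_def)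
 have supp: "vspan (gs i) \<subseteq> free_module R (B i)" for i
 proof (cases i)
  case 0
  then show ?thesis using vspan_flag_list[of n] scalar_coeffs[of "lspan R x n"] lspan_closed'[of n]
   by (auto simp: gs_def F(2) B_def free_module_coeffs)
 next
  case (Suc k)
  then show ?thesis using F(3)[of k] by (auto simp: gs_def[symmetric] B_def free_module_coeffs syzygies_def)
 qed
 have Dspan: "D i b \<in> vspan (gs i)" if "b < length (gs i)" for i b
 proof -
  have f: "(\<lambda>t. if t = b then \<one> else \<zero>) \<in> coeffs (length (gs i))" (is "?f \<in> _") using that by (auto simp: coeffs_def)
  have cl: "(rev (gs i) ! t) j \<in> carrier R" if "t < length (gs i)" for t j using g1[OF that] gr_closed by blast
  have "vcomb (gs i) ?f j = D i b j" for j
  proof -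
   have "vcomb (gs i) ?f j = (\<Oplus>t\<in>{..<length (gs i)}. ?f t \<otimes> (rev (gs i) ! t) j)" by (rule vcomb_finsum[OF vs]) auto
   also have "\<dots> = (\<Oplus>t\<in>{..<length (gs i)}. if b = t then (rev (gs i) ! t) j else \<zero>)"
    using cl by (intro finsum_cong') auto
   also have "\<dots> = D i b j" using that cl unfolding D_def by (intro finsum_singleton) auto
   finally show ?thesis .
  qed
  then have "D i b = vcomb (gs i) ?f" by auto
  then show ?thesis using f by (auto simp: vspan_def)
 qed
 have ti: "to_int_map R gr e f = augmentation R gr (f 0)" if "f \<in> free_module R (B 0)" for f
 proof -
  have "f b = \<zero>" if "b \<noteq> 0" for b using that \<open>f \<in> _\<close> by (simp add: free_module_def B_def)
  then have "{b. f b \<noteq> \<zero>} \<subseteq> {0}" by blast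
  then have "{b. f b \<noteq> \<zero>} = (if f 0 = \<zero> then {} else {0})" by (cases "f 0 = \<zero>") (simp_all, blast+)
  moreover have "augmentation R gr \<zero> = 0" using augmentation_eq_0[of \<zero>] by (simp add: pos_def)
  ultimately show ?thesis by (simp add: to_int_map_def e_def)
 qed
 have "graded_free_resolution R gr B wt D e" unfolding graded_free_resolution_def
 proof (intro conjI allI ballI impI)
  fix i b assume b: "b \<in> B (Suc i)"
  then have bl: "b < length (gs i)" by (simp add: B_def)
  have "D i b j \<in> gr 1" for j unfolding D_def by (rule g1[OF bl])
  then show "D i b \<in> free_module_part R gr (B i) (wt i) (wt (Suc i) b)"
   using Dspan[OF bl] supp[of i] by (auto simp: free_module_part_def wt_def)
 next
  have "\<exists>f\<in>free_module R (B 0). to_int_map R gr e f = z" for z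
  proof -
   let ?f = "\<lambda>b::nat. if b = 0 then [z] \<cdot> \<one> else \<zero>"
   have f: "?f \<in> free_module R (B 0)" by (simp add: B_def free_module_coeffs coeffs_def)
   with ti[OF this] show ?thesis by (intro bexI[of _ ?f]) (auto simp: augmentation_int)
  qed
  then show "to_int_map R gr e ` free_module R (B 0) = UNIV" by (metis (no_types, lifting) UNIV_eq_I imageI)
 next
  have "{f \<in> free_module R (B 0). to_int_map R gr e f = 0} = {f \<in> free_module R (B 0). f 0 \<in> pos}"
  proof -
   have "f 0 \<in> carrier R" if "f \<in> free_module R (B 0)" for f using that by (auto simp: free_module_def)
   then show ?thesis using ti augmentation_eq_0 by auto
  qed
  also have "\<dots> = {v. v 0 \<in> lspan R x n \<and> (\<forall>j>0. v j = \<zero>)}"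
   using pos_closed scalar_coeffs[of pos] by (auto simp: B_def free_module_coeffs lspan_full)
  also have "\<dots> = vspan (gs 0)" by (simp add: gs_def F(2) vspan_flag_list)
  also have "\<dots> = free_module_map R (D 0) ` free_module R (B 1)" using im[of 0] by simp
  finally show "{f \<in> free_module R (B 0). to_int_map R gr e f = 0} = free_module_map R (D 0) ` free_module R (B 1)" .
 next
  fix i
  show "{f \<in> free_module R (B (Suc i)). free_module_map R (D i) f = (\<lambda>_. \<zero>)} =
   free_module_map R (D (Suc i)) ` free_module R (B (Suc (Suc i)))" unfolding ker im using F(3)[of i] by (simp add: gs_def)
 qed (simp add: wt_def)
 moreover have "trivial_group (Tor R gr B wt D i j)" if ij: "i \<noteq> j" for i j
 proof -
  let ?F = "tensored_part B wt"
  have c0: "carrier (?F i j) = {0}" using ij by (auto simp: tensored_part_def wt_def)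
  \<comment> \<open>For j = i + 1 the source of the differential need not be zero. Its image is,
    because entries of degree one have augmentation zero.\<close>
  have aug0: "augmentation R gr (D i b k) = 0" if "b \<in> B (Suc i)" for b k
   using g1[of b i k] that by (intro augmentation_gr1) (auto simp: D_def B_def)
  have t0: "tensored_map R gr (D k) 0 = 0" for k by (simp add: tensored_map_def)
  have "tensored_map R gr (D i) z = 0" if "z \<in> carrier (?F (Suc i) j)" for z
  proof -
   have "Poly_Mapping.keys z \<subseteq> B (Suc i)" using that by (auto simp: tensored_part_def)
   then show ?thesis unfolding tensored_map_def frag_extend_def using aug0 by (auto intro!: sum.neutral)
  qed
  moreover have "0 \<in> carrier (?F (Suc i) j)" by (simp add: tensored_part_def)
  ultimately have im0: "tensored_map R gr (D i) ` carrier (?F (Suc i) j) = {0}" using t0 by force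
  have cyc: "tor_cycles R gr B wt D i j = {0}" using c0 t0 by (auto simp: tor_cycles_def)
  let ?G = "(?F i j)\<lparr>carrier := {0}\<rparr>"
  have grp: "group (?F i j)" by (simp add: tensored_part_def)
  have one: "\<one>\<^bsub>?F i j\<^esub> = 0" by (simp add: tensored_part_def)
  have G: "group ?G" using group.subgroup_imp_group[OF grp group.triv_subgroup[OF grp]] by (simp add: one)
  have n: "normal {0} ?G" using group.one_is_normal[OF G] one by simp
  have "carrier (?G Mod {0}) = {{0}}" using group.coset_mult_one[OF G, of "{0}"] one by (auto simp: FactGroup_def RCOSETS_def)
  moreover have "group (?G Mod {0})" by (rule normal.factorgroup_is_group[OF n])
  ultimately have "trivial_group (?G Mod {0})" by (simp add: trivial_group_def FactGroup_def)
  then show ?thesis by (simp add: Tor_def cyc im0)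
 qed
 ultimately have "\<exists>(B :: nat \<Rightarrow> nat set) wt D e. graded_free_resolution R gr B wt D e \<and>
   (\<forall>i j. i \<noteq> j \<longrightarrow> trivial_group (Tor R gr B wt D i j))" by blast
 then show ?thesis unfolding Koszul_def using graded_ring_axioms gr0 gr_free by blast
qed

end

section \<open>Words in degree one elements, the exterior algebra, and the relations generated in
  degree two\<close>

section \<open>Quadratic presentation\<close>

definition word_mult :: "('a list \<Rightarrow>\<^sub>0 int) \<Rightarrow> ('a list \<Rightarrow>\<^sub>0 int) \<Rightarrow> ('a list \<Rightarrow>\<^sub>0 int)" (infixl "\<star>" 70) where
 "x \<star> y = frag_extend (\<lambda>u. frag_extend (\<lambda>v. frag_of (u @ v)) y) x"

lemma frag_extend_fun_diff: "frag_extend (\<lambda>u. f u - g u) x = frag_extend f x - frag_extend g x"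
 using subset_UNIV by (induction x rule: frag_induction) (auto simp: frag_extend_diff)

lemma frag_extend_fun_add: "frag_extend (\<lambda>u. f u + g u) x = frag_extend f x + frag_extend g x"
 using subset_UNIV by (induction x rule: frag_induction) (auto simp: frag_extend_diff)

lemma word_mult_of [simp]: "frag_of u \<star> frag_of v = frag_of (u @ v)" by (simp add: word_mult_def)

lemma word_mult_zero [simp]: "0 \<star> y = 0" "x \<star> 0 = 0" by (simp_all add: word_mult_def frag_extend_eq_0)

lemma word_mult_diff_left: "(a - b) \<star> y = a \<star> y - b \<star> y"
 and word_mult_add_left: "(a + b) \<star> y = a \<star> y + b \<star> y" by (simp_all add: word_mult_def frag_extend_diff frag_extend_add)

lemma word_mult_diff_right: "x \<star> (a - b) = x \<star> a - x \<star> b"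
 and word_mult_add_right: "x \<star> (a + b) = x \<star> a + x \<star> b"
 by (simp_all add: word_mult_def frag_extend_diff frag_extend_add frag_extend_fun_diff frag_extend_fun_add)

lemma word_mult_cmul_left: "frag_cmul k x \<star> y = frag_cmul k (x \<star> y)" by (simp add: word_mult_def frag_extend_cmul)

lemma word_mult_assoc: "(x \<star> y) \<star> z = x \<star> (y \<star> z)"
proof -
 have 1: "(frag_of u \<star> frag_of v) \<star> z = frag_of u \<star> (frag_of v \<star> z)" for u v :: "'a list" and z
  using subset_UNIV by (induction z rule: frag_induction) (auto simp: word_mult_diff_right)
 have 2: "(frag_of u \<star> y) \<star> z = frag_of u \<star> (y \<star> z)" for u :: "'a list" and y z using subset_UNIV
  by (induction y rule: frag_induction) (simp_all only: 1 word_mult_diff_right word_mult_diff_left word_mult_zero)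
 show ?thesis using subset_UNIV by (induction x rule: frag_induction) (simp_all only: 2 word_mult_diff_left word_mult_zero)
qed

lemma word_mult_one: "frag_of [] \<star> y = y" "y \<star> frag_of [] = y" using frag_expansion[of y] by (simp_all add: word_mult_def)

lemma keys_word_mult:
 "Poly_Mapping.keys (x \<star> y) \<subseteq> {u @ v | u v. u \<in> Poly_Mapping.keys x \<and> v \<in> Poly_Mapping.keys y}"
proof
 fix w assume "w \<in> Poly_Mapping.keys (x \<star> y)"
 then obtain u where u: "u \<in> Poly_Mapping.keys x" "w \<in> Poly_Mapping.keys (frag_extend (\<lambda>v. frag_of (u @ v)) y)"
  unfolding word_mult_def using keys_frag_extend by fastforce
 then obtain v where "v \<in> Poly_Mapping.keys y" "w \<in> Poly_Mapping.keys (frag_of (u @ v))" using keys_frag_extend by fastforce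
 with u show "w \<in> {u @ v | u v. u \<in> Poly_Mapping.keys x \<and> v \<in> Poly_Mapping.keys y}" by (auto simp: keys_frag_of)
qed

lemma free_ring_sel [simp]:
 "carrier (free_ring S) = {c. Poly_Mapping.keys c \<subseteq> lists S}" "x \<otimes>\<^bsub>free_ring S\<^esub> y = x \<star> y"
 "\<one>\<^bsub>free_ring S\<^esub> = frag_of []" "\<zero>\<^bsub>free_ring S\<^esub> = 0" "x \<oplus>\<^bsub>free_ring S\<^esub> y = x + y"
 by (simp_all add: free_ring_def word_mult_def)

lemma word_mult_closed:
 assumes "Poly_Mapping.keys x \<subseteq> lists S" "Poly_Mapping.keys y \<subseteq> lists S"
 shows "Poly_Mapping.keys (x \<star> y) \<subseteq> lists S" using keys_word_mult[of x y] assms by fastforce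

lemma ring_free_ring: "ring (free_ring S)"
proof (rule ringI)
 show "abelian_group (free_ring S)"
 proof (rule abelian_groupI)
  show "x \<oplus>\<^bsub>free_ring S\<^esub> y \<in> carrier (free_ring S)" if "x \<in> carrier (free_ring S)" "y \<in> carrier (free_ring S)" for x y
   using that keys_add[of x y] by auto
  show "\<exists>y\<in>carrier (free_ring S). y \<oplus>\<^bsub>free_ring S\<^esub> x = \<zero>\<^bsub>free_ring S\<^esub>" if "x \<in> carrier (free_ring S)" for x
   using that by (intro bexI[of _ "- x"]) auto
 qed (auto simp: add_ac)
 show "monoid (free_ring S)"
 proof (rule monoidI)
  show "x \<otimes>\<^bsub>free_ring S\<^esub> y \<in> carrier (free_ring S)" if "x \<in> carrier (free_ring S)" "y \<in> carrier (free_ring S)" for x y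
   using word_mult_closed that by simp
 qed (simp_all add: word_mult_assoc word_mult_one keys_frag_of)
qed (auto simp: word_mult_add_left word_mult_add_right)

lemma free_ring_a_inv: "x \<in> carrier (free_ring S) \<Longrightarrow> \<ominus>\<^bsub>free_ring S\<^esub> x = - x"
proof -
 interpret F: ring "free_ring S" by (rule ring_free_ring)
 assume "x \<in> carrier (free_ring S)"
 then show ?thesis by (intro F.minus_equality) auto
qed

context ring
begin

definition monomial :: "'a list \<Rightarrow> 'a" where "monomial w = foldr (\<otimes>) w \<one>"

lemma monomial_simps [simp]: "monomial [] = \<one>" "monomial (v # w) = v \<otimes> monomial w" by (simp_all add: monomial_def)

lemma monomial_closed: "w \<in> lists (carrier R) \<Longrightarrow> monomial w \<in> carrier R" by (induction w) auto

lemma monomial_append: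
 "u \<in> lists (carrier R) \<Longrightarrow> v \<in> lists (carrier R) \<Longrightarrow> monomial (u @ v) = monomial u \<otimes> monomial v"
 by (induction u) (auto simp: m_assoc monomial_closed)

abbreviation words :: "('a list \<Rightarrow>\<^sub>0 int) set" where
 "words \<equiv> {x. Poly_Mapping.keys x \<subseteq> lists (carrier R)}"

lemma eval_words_superset:
 assumes "finite A" "Poly_Mapping.keys x \<subseteq> A" "A \<subseteq> lists (carrier R)"
 shows "eval_words R x = (\<Oplus>w\<in>A. [Poly_Mapping.lookup x w] \<cdot> monomial w)" unfolding eval_words_def monomial_def[symmetric]
proof (rule add.finprod_mono_neutral_cong_left[OF assms(1,2)])
 show "[Poly_Mapping.lookup x w] \<cdot> monomial w = \<zero>" if "w \<in> A - Poly_Mapping.keys x" for w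
  using that by (simp add: in_keys_iff add_pow_def)
 show "(\<lambda>w. [Poly_Mapping.lookup x w] \<cdot> monomial w) \<in> A \<rightarrow> carrier R"
  using add.int_pow_closed[OF monomial_closed] assms(3) by (auto simp: add_pow_def)
qed simp

lemma eval_words_closed:
 assumes "x \<in> words" shows "eval_words R x \<in> carrier R"
proof -
 have "[z] \<cdot> monomial w \<in> carrier R" if "w \<in> Poly_Mapping.keys x" for w and z :: int
 proof -
  have "monomial w \<in> carrier R" using that assms monomial_closed by blast
  then show ?thesis by simp
 qed
 then show ?thesis using assms by (subst eval_words_superset[of "Poly_Mapping.keys x"]) (auto intro!: finsum_closed)
qed

lemma eval_words_add:
 assumes "x \<in> words" "y \<in> words"
 shows "eval_words R (x + y) = eval_words R x \<oplus> eval_words R y"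
proof -
 let ?A = "Poly_Mapping.keys x \<union> Poly_Mapping.keys y"
 have A: "finite ?A" "?A \<subseteq> lists (carrier R)" using assms by auto
 have m: "monomial w \<in> carrier R" if "w \<in> ?A" for w using that A monomial_closed by blast
 have "eval_words R (x + y) = (\<Oplus>w\<in>?A. [Poly_Mapping.lookup (x + y) w] \<cdot> monomial w)"
  using A keys_add[of x y] by (intro eval_words_superset) auto
 also have "\<dots> = (\<Oplus>w\<in>?A. [Poly_Mapping.lookup x w] \<cdot> monomial w \<oplus> [Poly_Mapping.lookup y w] \<cdot> monomial w)"
  using m by (intro finsum_cong') (auto simp: lookup_add add.int_pow_mult)
 also have "\<dots> = (\<Oplus>w\<in>?A. [Poly_Mapping.lookup x w] \<cdot> monomial w) \<oplus> (\<Oplus>w\<in>?A. [Poly_Mapping.lookup y w] \<cdot> monomial w)"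
  using m by (intro finsum_addf) auto
 also have "\<dots> = eval_words R x \<oplus> eval_words R y"
  using eval_words_superset[OF A(1) _ A(2), of x] eval_words_superset[OF A(1) _ A(2), of y] by simp
 finally show ?thesis .
qed

lemma eval_words_zero [simp]: "eval_words R 0 = \<zero>" by (simp add: eval_words_def)

lemma eval_words_of [simp]: "w \<in> lists (carrier R) \<Longrightarrow> eval_words R (frag_of w) = monomial w"
 using monomial_closed[of w] by (simp add: eval_words_def keys_frag_of monomial_def[symmetric])

lemma words_uminus: "x \<in> words \<Longrightarrow> - x \<in> words" by simp

lemma words_diff: "x \<in> words \<Longrightarrow> y \<in> words \<Longrightarrow> x - y \<in> words" using keys_diff[of x y] by blast

lemma words_cmul: "x \<in> words \<Longrightarrow> frag_cmul k x \<in> words" using keys_cmul[of k x] by blast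

lemma words_mult: "x \<in> words \<Longrightarrow> y \<in> words \<Longrightarrow> x \<star> y \<in> words" using word_mult_closed by blast

lemma words_sum: "(\<And>i. i \<in> I \<Longrightarrow> f i \<in> words) \<Longrightarrow> (\<Sum>i\<in>I. f i) \<in> words"
 using keys_sum[of f I] by blast

lemma eval_words_uminus:
 assumes "x \<in> words" shows "eval_words R (- x) = \<ominus> eval_words R x"
proof -
 have "eval_words R (- x) \<oplus> eval_words R x = \<zero>" using eval_words_add[OF words_uminus[OF assms] assms] by simp
 then show ?thesis using eval_words_closed[OF assms] eval_words_closed[OF words_uminus[OF assms]] by (simp add: minus_equality)
qed

lemma eval_words_diff:
 assumes "x \<in> words" "y \<in> words" shows "eval_words R (x - y) = eval_words R x \<ominus> eval_words R y"
 using eval_words_add[OF assms(1) words_uminus[OF assms(2)]] by (simp add: eval_words_uminus[OF assms(2)] a_minus_def)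

lemma eval_words_sum:
 fixes N :: nat
 assumes "\<And>i. i < N \<Longrightarrow> f i \<in> words"
 shows "eval_words R (\<Sum>i<N. f i) = (\<Oplus>i\<in>{..<N}. eval_words R (f i))" using assms
proof (induction N)
 case (Suc N)
 have "(\<Oplus>i\<in>insert N {..<N}. eval_words R (f i)) = eval_words R (f N) \<oplus> (\<Oplus>i\<in>{..<N}. eval_words R (f i))"
  using Suc.prems eval_words_closed by (intro finsum_insert) auto
 moreover have "(\<Oplus>i\<in>{..<N}. eval_words R (f i)) \<in> carrier R" using Suc.prems eval_words_closed by (intro finsum_closed) auto
 moreover have "(\<Sum>i<N. f i) \<in> words" using Suc.prems by (intro words_sum) auto
 ultimately show ?case
  using Suc eval_words_add[of "\<Sum>i<N. f i" "f N"] eval_words_closed[of "f N"] by (simp add: lessThan_Suc a_comm add.commute[of "f N"])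
qed simp

lemma eval_words_mult:
 assumes "x \<in> words" "y \<in> words" shows "eval_words R (x \<star> y) = eval_words R x \<otimes> eval_words R y"
proof -
 have 1: "y \<in> words \<and> eval_words R (frag_of u \<star> y) = monomial u \<otimes> eval_words R y"
  if u: "u \<in> lists (carrier R)" and y: "Poly_Mapping.keys y \<subseteq> lists (carrier R)" for u y using y
 proof (induction y rule: frag_induction)
  case (one v)
  have "u @ v \<in> lists (carrier R)" using u one by simp
  then show ?case using u one by (simp add: monomial_append keys_frag_of)
 next
  case (diff a b)
  have fu: "frag_of u \<in> words" using u by (simp add: keys_frag_of)
  have m: "frag_of u \<star> a \<in> words" "frag_of u \<star> b \<in> words" using diff fu words_mult by blast+
  have "a \<in> words" "b \<in> words" using diff by auto
  then show ?case
   using diff eval_words_diff[OF m] eval_words_closed[of a] eval_words_closed[of b] monomial_closed[OF u] words_diff[of a b]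
   by (simp add: word_mult_diff_right eval_words_diff a_minus_def r_distr r_minus)
 qed (use monomial_closed[OF u] in simp)
 have "x \<in> words \<and> eval_words R (x \<star> y) = eval_words R x \<otimes> eval_words R y" using assms(1)[simplified]
 proof (induction x rule: frag_induction)
  case (one u)
  then show ?case using 1[OF one] assms(2) by (simp add: keys_frag_of)
 next
  case (diff a b)
  have m: "a \<star> y \<in> words" "b \<star> y \<in> words" using diff assms(2) words_mult by blast+
  have "a \<in> words" "b \<in> words" using diff by auto
  then show ?case
   using diff eval_words_diff[OF m] eval_words_closed[of a] eval_words_closed[of b] eval_words_closed[OF assms(2)] words_diff[of a b]
   by (simp add: word_mult_diff_left eval_words_diff a_minus_def l_distr l_minus)
 qed (use eval_words_closed[OF assms(2)] in simp)
 then show ?thesis by simp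
qed

lemma eval_words_cmul:
 assumes "x \<in> words" shows "eval_words R (frag_cmul k x) = [k] \<cdot> eval_words R x"
proof -
 let ?P = "\<lambda>k. eval_words R (frag_cmul k x) = [k] \<cdot> eval_words R x"
 have x: "eval_words R x \<in> carrier R" by (rule eval_words_closed[OF assms])
 have *: "eval_words R (frag_cmul (int m) x) = [int m] \<cdot> eval_words R x" for m
 proof (induction m)
  case (Suc m)
  have "frag_cmul (int (Suc m)) x = frag_cmul (int m) x + x" by (simp add: frag_cmul_distrib add.commute)
  then have "eval_words R (frag_cmul (int (Suc m)) x) = [int m] \<cdot> eval_words R x \<oplus> eval_words R x"
   using Suc eval_words_add[OF words_cmul[OF assms] assms] by simp
  also have "\<dots> = [int m] \<cdot> eval_words R x \<oplus> [(1::int)] \<cdot> eval_words R x" using x by simp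
  also have "\<dots> = [(int m + 1)] \<cdot> eval_words R x" using x by (simp only: add.int_pow_mult)
  finally show ?case by (simp add: add.commute)
 qed (simp add: add_pow_def)
 show ?thesis
 proof (cases "k \<ge> 0")
  case True
  then show ?thesis using *[of "nat k"] by simp
 next
  case False
  then have *: "eval_words R (frag_cmul (- k) x) = [(- k)] \<cdot> eval_words R x" using *[of "nat (- k)"] by simp
  have "frag_cmul k x = - frag_cmul (- k) x" by simp
  then have "eval_words R (frag_cmul k x) = \<ominus> ([(- k)] \<cdot> eval_words R x)"
   using eval_words_uminus[OF words_cmul[OF assms], of "- k"] * by metis
  then show ?thesis using x by (simp add: add.int_pow_neg)
 qed
qed

end

locale exterior_flag = graded_flag +
 assumes square_gr1: "v \<in> gr 1 \<Longrightarrow> v \<otimes> v = \<zero>"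
begin

abbreviation "G \<equiv> (add_monoid R)\<lparr>carrier := gr 1\<rparr>"
abbreviation "F \<equiv> free_ring (gr 1)"
abbreviation "J \<equiv> exterior_ideal G"
abbreviation "E \<equiv> exterior_algebra G"

text \<open>The abstract form of \<open>cup_map\<close>; likewise \<open>quadratic_ideal\<close>
  becomes \<open>cup_kernel_ideal\<close> when the ring is a cohomology ring.\<close>

definition eval_class :: "('a list \<Rightarrow>\<^sub>0 int) set \<Rightarrow> 'a" where
 "eval_class C = the_elem (eval_words R ` C)"

definition quadratic_ideal :: "('a list \<Rightarrow>\<^sub>0 int) set set" where
 "quadratic_ideal = Idl\<^bsub>E\<^esub> {C \<in> exterior_power G 2. eval_class C = \<zero>}"

lemma letters_closed: "lists (gr 1) \<subseteq> lists (carrier R)" using gr_closed by (intro lists_mono) auto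

lemma F_words: "y \<in> carrier F \<Longrightarrow> y \<in> words" using letters_closed by auto

lemma relations_closed: "exterior_relations G \<subseteq> carrier F"
proof -
 have "Poly_Mapping.keys (frag_of [v \<oplus> w] - frag_of [v] - frag_of [w]) \<subseteq> lists (gr 1)"
  if "v \<in> gr 1" "w \<in> gr 1" for v w
 proof -
  have "Poly_Mapping.keys (frag_of [v \<oplus> w] - frag_of [v] - frag_of [w]) \<subseteq> {[v \<oplus> w], [v], [w]}"
   using keys_diff[of "frag_of [v \<oplus> w] - frag_of [v]" "frag_of [w]"] keys_diff[of "frag_of [v \<oplus> w]" "frag_of [v]"]
   unfolding keys_frag_of by blast
  also have "\<dots> \<subseteq> lists (gr 1)" using that gr_add[OF that] by simp
  finally show ?thesis .
 qed
 then show ?thesis by (auto simp: exterior_relations_def keys_frag_of)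
qed

sublocale F: ring F by (rule ring_free_ring)

lemma J_eq: "J = Idl\<^bsub>F\<^esub> (exterior_relations G)" by (simp add: exterior_ideal_def)

sublocale J: ideal J F unfolding J_eq by (rule F.genideal_ideal[OF relations_closed])

lemma eval_hom: "eval_words R \<in> ring_hom F R"
 using F_words eval_words_closed eval_words_add eval_words_mult by (intro ring_hom_memI) auto

sublocale ev: ring_hom_ring F R "eval_words R" by (intro ring_hom_ringI2 F.ring_axioms ring_axioms eval_hom)

lemma eval_J: "y \<in> J \<Longrightarrow> eval_words R y = \<zero>"
proof -
 have "exterior_relations G \<subseteq> a_kernel F R (eval_words R)"
 proof
  fix y assume "y \<in> exterior_relations G"
  then consider (lin) v w where "v \<in> gr 1" "w \<in> gr 1" "y = frag_of [v \<oplus> w] - frag_of [v] - frag_of [w]"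
   | (sq) v where "v \<in> gr 1" "y = frag_of [v, v]" by (auto simp: exterior_relations_def)
  then have "eval_words R y = \<zero>"
  proof cases
   case lin
   have cl: "v \<in> carrier R" "w \<in> carrier R" using lin gr_closed by blast+
   have w1: "frag_of [v \<oplus> w] \<in> words" "frag_of [v] \<in> words" "frag_of [w] \<in> words" using cl by (auto simp: keys_frag_of)
   show ?thesis unfolding lin(3) eval_words_diff[OF words_diff[OF w1(1,2)] w1(3)] eval_words_diff[OF w1(1,2)]
    using cl by (simp add: a_minus_def a_ac r_neg r_neg1) (metis a_ac(1) a_ac(2) a_inv_closed add.m_closed cl minus_add r_neg)
  next
   case sq
   then show ?thesis using square_gr1 gr_closed[of v 1] by simp
  qed
  moreover have "y \<in> carrier F" using \<open>y \<in> exterior_relations G\<close> relations_closed by blast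
  ultimately show "y \<in> a_kernel F R (eval_words R)" unfolding a_kernel_def' by blast
 qed
 then have "J \<subseteq> a_kernel F R (eval_words R)" unfolding J_eq by (rule F.genideal_minimal[OF ev.kernel_is_ideal])
 then show "y \<in> J \<Longrightarrow> eval_words R y = \<zero>" unfolding a_kernel_def' by blast
qed

lemma coset_eq: "J +>\<^bsub>F\<^esub> z = {y + z | y. y \<in> J}" by (auto simp: a_r_coset_def')

lemma eval_class_coset:
 assumes "z \<in> carrier F" shows "eval_class (J +>\<^bsub>F\<^esub> z) = eval_words R z"
proof -
 have "eval_words R (y + z) = eval_words R z" if "y \<in> J" for y
 proof -
  have y: "y \<in> carrier F" using that J.a_subset by blast
  show ?thesis using eval_words_add[OF F_words[OF y] F_words[OF assms]] eval_J[OF that] eval_words_closed[OF F_words[OF assms]] by simp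
 qed
 moreover have "0 \<in> J" using J.zero_closed by simp
 ultimately have "eval_words R ` (J +>\<^bsub>F\<^esub> z) = {eval_words R z}" unfolding coset_eq by force
 then show ?thesis by (simp add: eval_class_def)
qed

lemma E_quot: "E = F Quot J" by (simp add: exterior_algebra_def)

lemma E_carrier: "carrier E = {J +>\<^bsub>F\<^esub> x | x. x \<in> carrier F}" unfolding E_quot by (auto simp: FactRing_def A_RCOSETS_def')

lemma E_cases:
 assumes "C \<in> carrier E" obtains z where "z \<in> carrier F" "C = J +>\<^bsub>F\<^esub> z" using assms unfolding E_carrier by blast

sublocale E: ring E unfolding E_quot by (rule J.quotient_is_ring)

sublocale q: ring_hom_ring F E "(+>\<^bsub>F\<^esub>) J" unfolding E_quot by (rule J.rcos_ring_hom_ring)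

lemma eval_class_hom: "eval_class \<in> ring_hom E R"
proof (rule ring_hom_memI)
 fix C D assume "C \<in> carrier E" "D \<in> carrier E"
 then obtain x y where xy: "x \<in> carrier F" "y \<in> carrier F" "C = J +>\<^bsub>F\<^esub> x" "D = J +>\<^bsub>F\<^esub> y" by (metis E_cases)
 have "C \<otimes>\<^bsub>E\<^esub> D = J +>\<^bsub>F\<^esub> (x \<otimes>\<^bsub>F\<^esub> y)" "C \<oplus>\<^bsub>E\<^esub> D = J +>\<^bsub>F\<^esub> (x \<oplus>\<^bsub>F\<^esub> y)"
  using xy q.hom_mult q.hom_add by simp_all
 then show "eval_class (C \<otimes>\<^bsub>E\<^esub> D) = eval_class C \<otimes> eval_class D" "eval_class (C \<oplus>\<^bsub>E\<^esub> D) = eval_class C \<oplus> eval_class D"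
  using xy eval_class_coset F.m_closed[OF xy(1,2)] F.a_closed[OF xy(1,2)] ev.hom_mult[OF xy(1,2)] ev.hom_add[OF xy(1,2)] by simp_all
next
 show "eval_class C \<in> carrier R" if "C \<in> carrier E" for C by (rule E_cases[OF that]) (simp only: eval_class_coset ev.hom_closed)
 have "\<one>\<^bsub>E\<^esub> = J +>\<^bsub>F\<^esub> \<one>\<^bsub>F\<^esub>" using q.hom_one by simp
 then show "eval_class \<one>\<^bsub>E\<^esub> = \<one>" using eval_class_coset[OF F.one_closed] ev.hom_one by simp
qed

sublocale ec: ring_hom_ring E R eval_class by (intro ring_hom_ringI2 E.ring_axioms ring_axioms eval_class_hom)

text \<open>The preimage of the quadratic ideal in the free ring. Congruences are handled here, on
  combinations of words, and not in the iterated quotient.\<close>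

definition I0 :: "('a list \<Rightarrow>\<^sub>0 int) set" where
 "I0 = {y \<in> carrier F. J +>\<^bsub>F\<^esub> y \<in> quadratic_ideal}"

lemma power_closed: "exterior_power G k \<subseteq> carrier E"
proof
 fix C assume "C \<in> exterior_power G k"
 then obtain z where z: "C = J +>\<^bsub>F\<^esub> z" "Poly_Mapping.keys z \<subseteq> lists (gr 1)"
  unfolding exterior_power_def exterior_class_def by auto
 have "z \<in> carrier F" using z(2) by simp
 then show "C \<in> carrier E" unfolding E_carrier z(1) by blast
qed

sublocale Q: ideal quadratic_ideal E unfolding quadratic_ideal_def using power_closed by (intro E.genideal_ideal) auto

lemma quadratic_kernel: "quadratic_ideal \<subseteq> a_kernel E R eval_class" unfolding quadratic_ideal_def
proof (rule E.genideal_minimal[OF ec.kernel_is_ideal])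
 show "{C \<in> exterior_power G 2. eval_class C = \<zero>} \<subseteq> a_kernel E R eval_class"
  using power_closed unfolding a_kernel_def' by blast
qed

sublocale I0: ideal I0 F unfolding I0_def by (rule q.ideal_vimage[OF Q.ideal_axioms])

lemma I0_add: "a \<in> I0 \<Longrightarrow> b \<in> I0 \<Longrightarrow> a + b \<in> I0" using I0.a_closed by simp

lemma I0_closed: "a \<in> I0 \<Longrightarrow> a \<in> carrier F" using I0.a_subset by blast

lemma I0_uminus: "a \<in> I0 \<Longrightarrow> - a \<in> I0" using I0.a_inv_closed free_ring_a_inv[OF I0_closed] by metis

lemma I0_diff: "a \<in> I0 \<Longrightarrow> b \<in> I0 \<Longrightarrow> a - b \<in> I0" using I0_add[of a "- b"] I0_uminus by simp

lemma I0_zero: "0 \<in> I0" using I0.zero_closed by simp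

lemma I0_sum: "(\<And>i. i \<in> A \<Longrightarrow> f i \<in> I0) \<Longrightarrow> (\<Sum>i\<in>A. f i) \<in> I0"
 by (induction A rule: infinite_finite_induct) (auto intro: I0_add I0_zero)

lemma I0_lmult: "a \<in> I0 \<Longrightarrow> b \<in> carrier F \<Longrightarrow> b \<star> a \<in> I0" using I0.I_l_closed by simp

lemma I0_rmult: "a \<in> I0 \<Longrightarrow> b \<in> carrier F \<Longrightarrow> a \<star> b \<in> I0" using I0.I_r_closed by simp

lemma J_I0: "J \<subseteq> I0"
proof
 fix y assume y: "y \<in> J"
 then have "y \<in> carrier F" using J.a_subset by blast
 moreover have "J +>\<^bsub>F\<^esub> y = \<zero>\<^bsub>E\<^esub>" using J.a_rcos_const[OF y] unfolding E_quot FactRing_def by simp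
 ultimately show "y \<in> I0" using Q.zero_closed unfolding I0_def by simp
qed

definition Fdeg :: "nat \<Rightarrow> ('a list \<Rightarrow>\<^sub>0 int) set" where
 "Fdeg k = {y. \<forall>w\<in>Poly_Mapping.keys y. w \<in> lists (gr 1) \<and> length w = k}"

lemma Fdeg_closed: "y \<in> Fdeg k \<Longrightarrow> y \<in> carrier F" by (auto simp: Fdeg_def)

lemma Fdeg_words: "y \<in> Fdeg k \<Longrightarrow> y \<in> words" by (rule F_words[OF Fdeg_closed])

lemma Fdeg_diff: "a \<in> Fdeg k \<Longrightarrow> b \<in> Fdeg k \<Longrightarrow> a - b \<in> Fdeg k"
 using keys_diff[of a b] by (auto simp: Fdeg_def)

lemma Fdeg_cmul: "a \<in> Fdeg k \<Longrightarrow> frag_cmul z a \<in> Fdeg k" using keys_cmul[of z a] by (auto simp: Fdeg_def)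

lemma Fdeg_mult: "a \<in> Fdeg k \<Longrightarrow> b \<in> Fdeg l \<Longrightarrow> a \<star> b \<in> Fdeg (k + l)"
 using keys_word_mult[of a b] by (fastforce simp: Fdeg_def)

lemma Fdeg_of: "v \<in> gr 1 \<Longrightarrow> frag_of [v] \<in> Fdeg 1" by (simp add: Fdeg_def keys_frag_of)

lemma eval_Fdeg: "y \<in> Fdeg k \<Longrightarrow> eval_words R y \<in> gr k"
proof -
 assume "y \<in> Fdeg k"
 then have "Poly_Mapping.keys y \<subseteq> {w. w \<in> lists (gr 1) \<and> length w = k}" by (auto simp: Fdeg_def)
 then have "y \<in> words \<and> eval_words R y \<in> gr k"
 proof (induction y rule: frag_induction)
  case (one w)
  have "monomial w \<in> gr (length w)" if "w \<in> lists (gr 1)" for w using that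
  proof (induction w)
   case (Cons v w)
   then show ?case using mult_gr[of v 1 "monomial w" "length w"] by simp
  qed (simp add: one_gr)
  then have m: "monomial w \<in> gr k" using one by blast
  have "w \<in> lists (carrier R)" using one letters_closed by blast
  then show ?case using m by (simp add: keys_frag_of)
 next
  case (diff a b)
  then show ?case using words_diff[of a b] eval_words_diff[of a b] by (auto simp: a_minus_def intro: gr_add gr_a_inv)
 qed simp
 then show ?thesis ..
qed

lemma quadratic_I0:
 assumes "y \<in> Fdeg 2" "eval_words R y = \<zero>" shows "y \<in> I0"
proof -
 have y: "y \<in> carrier F" by (rule Fdeg_closed[OF assms(1)])
 have "J +>\<^bsub>F\<^esub> y \<in> {C \<in> exterior_power G 2. eval_class C = \<zero>}"
  using eval_class_coset[OF y] assms by (auto simp: exterior_power_def exterior_class_def Fdeg_def)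
 moreover have "{C \<in> exterior_power G 2. eval_class C = \<zero>} \<subseteq> carrier E" using power_closed by blast
 ultimately show ?thesis using E.genideal_self y unfolding I0_def quadratic_ideal_def by blast
qed

lemma linear_J:
 assumes "v \<in> gr 1" "w \<in> gr 1" shows "frag_of [v \<oplus> w] - frag_of [v] - frag_of [w] \<in> I0"
proof -
 have "frag_of [v \<oplus> w] - frag_of [v] - frag_of [w] \<in> exterior_relations G" using assms by (auto simp: exterior_relations_def)
 then have "frag_of [v \<oplus> w] - frag_of [v] - frag_of [w] \<in> J" unfolding J_eq using F.genideal_self[OF relations_closed] by blast
 then show ?thesis using J_I0 by blast
qed

lemma letter_zero: "frag_of [\<zero>] \<in> I0" using I0_uminus[OF linear_J[of \<zero> \<zero>]] by simp

text \<open>In the free ring the letter of a multiple of v and the multiple of the letter of v are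
  distinct elements; the additivity relations identify them.\<close>

lemma letter_int_mult:
 assumes v: "v \<in> gr 1" shows "frag_of [[(z::int)] \<cdot> v] - frag_cmul z (frag_of [v]) \<in> I0"
proof -
 have vc: "v \<in> carrier R" by (rule gr_closed[OF v])
 have gz: "[z] \<cdot> v \<in> gr 1" for z :: int
 proof -
  have "subgroup (gr 1) (add_monoid R)" using gr_subgroup[of 1] by (simp add: additive_subgroup_def)
  from add.subgroup_int_pow_closed[OF this v] show ?thesis by (simp add: add_pow_def)
 qed
 have nat: "frag_of [[int m] \<cdot> v] - frag_cmul (int m) (frag_of [v]) \<in> I0" for m
 proof (induction m)
  case 0
  then show ?case using letter_zero by (simp add: add_pow_def)
 next
  case (Suc m)
  have eq: "[int (Suc m)] \<cdot> v = [int m] \<cdot> v \<oplus> v"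
  proof -
   have "[(int m + 1)] \<cdot> v = [int m] \<cdot> v \<oplus> [(1::int)] \<cdot> v" using vc by (simp only: add.int_pow_mult)
   then show ?thesis using vc by (simp add: add.commute)
  qed
  have c: "frag_cmul (int (Suc m)) (frag_of [v]) = frag_cmul (int m) (frag_of [v]) + frag_of [v]"
   by (simp add: frag_cmul_distrib add.commute)
  have "(frag_of [[int m] \<cdot> v \<oplus> v] - frag_of [[int m] \<cdot> v] - frag_of [v]) +
   (frag_of [[int m] \<cdot> v] - frag_cmul (int m) (frag_of [v])) \<in> I0" by (intro I0_add Suc linear_J gz v)
  then show ?case unfolding eq c by (simp add: algebra_simps)
 qed
 show ?thesis
 proof (cases "z \<ge> 0")
  case True
  then show ?thesis using nat[of "nat z"] by simp
 next
  case False
  define m where "m = nat (- z)"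
  then have z: "z = - int m" using False by simp
  have "[z] \<cdot> v \<oplus> [int m] \<cdot> v = \<zero>"
  proof -
   have "[(z + int m)] \<cdot> v = [z] \<cdot> v \<oplus> [int m] \<cdot> v" using vc by (simp only: add.int_pow_mult)
   then show ?thesis by (simp add: z add_pow_def)
  qed
  then have "frag_of [\<zero>] - frag_of [[z] \<cdot> v] - frag_of [[int m] \<cdot> v] \<in> I0"
   using linear_J[OF gz[of z] gz[of "int m"]] by simp
  then have "frag_of [\<zero>] - (frag_of [\<zero>] - frag_of [[z] \<cdot> v] - frag_of [[int m] \<cdot> v]) -
   (frag_of [[int m] \<cdot> v] - frag_cmul (int m) (frag_of [v])) \<in> I0" by (rule I0_diff[OF I0_diff[OF letter_zero] nat])
  then show ?thesis by (simp add: z)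
 qed
qed

text \<open>Combinations of \<open>x 0, \<dots>, x (m - 1)\<close> with homogeneous coefficients of degree \<open>k\<close>, as elements of the free ring.
 Since each \<open>x j \<otimes> x m\<close> with \<open>j < c m\<close> is a combination of the \<open>x i\<close> with \<open>i < m\<close> by a quadratic relation, any
 relation among the \<open>x i\<close> follows from the quadratic ones, by induction on the degree.\<close>

primrec lin :: "nat \<Rightarrow> nat \<Rightarrow> ('a list \<Rightarrow>\<^sub>0 int) set" where
 "lin k 0 = {0}"
| "lin k (Suc m) = {u + f \<star> frag_of [x m] | u f. u \<in> lin k m \<and> f \<in> Fdeg k}"

lemma lin_SucI: "u \<in> lin k m \<Longrightarrow> f \<in> Fdeg k \<Longrightarrow> u + f \<star> frag_of [x m] \<in> lin k (Suc m)" by auto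

lemma lin_SucE:
 assumes "y \<in> lin k (Suc m)" obtains u f where "y = u + f \<star> frag_of [x m]" "u \<in> lin k m" "f \<in> Fdeg k" using assms by auto

lemma lin_diff: "y \<in> lin k m \<Longrightarrow> y' \<in> lin k m \<Longrightarrow> y - y' \<in> lin k m"
proof (induction m arbitrary: y y')
 case (Suc m)
 obtain u f where y: "y = u + f \<star> frag_of [x m]" "u \<in> lin k m" "f \<in> Fdeg k" by (rule lin_SucE[OF Suc.prems(1)])
 obtain u' f' where y': "y' = u' + f' \<star> frag_of [x m]" "u' \<in> lin k m" "f' \<in> Fdeg k" by (rule lin_SucE[OF Suc.prems(2)])
 have "y - y' = (u - u') + (f - f') \<star> frag_of [x m]" by (simp add: y y' word_mult_diff_left)
 then show ?case using lin_SucI[OF Suc.IH[OF y(2) y'(2)] Fdeg_diff[OF y(3) y'(3)]] by simp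
qed simp

lemma lin_zero: "0 \<in> lin k m" by (induction m) (auto simp: Fdeg_def intro!: exI[of _ 0])

lemma lin_add: "y \<in> lin k m \<Longrightarrow> y' \<in> lin k m \<Longrightarrow> y + y' \<in> lin k m"
 using lin_diff[OF _ lin_diff[OF lin_zero], of y k m y'] by simp

lemma lin_mult: "g \<in> Fdeg j \<Longrightarrow> y \<in> lin k m \<Longrightarrow> g \<star> y \<in> lin (j + k) m"
proof (induction m arbitrary: y)
 case (Suc m)
 obtain u f where y: "y = u + f \<star> frag_of [x m]" "u \<in> lin k m" "f \<in> Fdeg k" by (rule lin_SucE[OF Suc.prems(2)])
 have "g \<star> y = g \<star> u + (g \<star> f) \<star> frag_of [x m]" by (simp add: y word_mult_add_right word_mult_assoc)
 then show ?case using lin_SucI[OF Suc.IH[OF Suc.prems(1) y(2)] Fdeg_mult[OF Suc.prems(1) y(3)]] by simp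
qed simp

lemma eval_mult_x:
 assumes "m < n" "f \<in> Fdeg k"
 shows "f \<star> frag_of [x m] \<in> Fdeg (Suc k)" "eval_words R (f \<star> frag_of [x m]) = eval_words R f \<otimes> x m"
 using Fdeg_mult[OF assms(2) Fdeg_of[OF x_gr[OF assms(1)]]] x_closed[OF assms(1)]
  eval_words_mult[OF Fdeg_words[OF assms(2)] Fdeg_words[OF Fdeg_of[OF x_gr[OF assms(1)]]]] by simp_all

lemma lin_eval: "m \<le> n \<Longrightarrow> y \<in> lin k m \<Longrightarrow> y \<in> Fdeg (Suc k) \<and> eval_words R y \<in> lspan R x m"
proof (induction m arbitrary: y)
 case (Suc m)
 obtain u f where y: "y = u + f \<star> frag_of [x m]" "u \<in> lin k m" "f \<in> Fdeg k" by (rule lin_SucE[OF Suc.prems(2)])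
 have m: "m < n" "m \<le> n" using Suc.prems by auto
 have u: "u \<in> Fdeg (Suc k)" "eval_words R u \<in> lspan R x m" using Suc.IH[OF m(2) y(2)] by auto
 note f = eval_mult_x[OF m(1) y(3)]
 have "eval_words R y = eval_words R u \<oplus> eval_words R f \<otimes> x m"
  using eval_words_add[OF Fdeg_words[OF u(1)] Fdeg_words[OF f(1)]] f(2) y(1) by simp
 moreover have "y \<in> Fdeg (Suc k)" using Fdeg_diff[OF u(1) Fdeg_diff[OF _ f(1)], of 0] y(1) by (simp add: Fdeg_def)
 ultimately show ?case using u(2) eval_words_closed[OF Fdeg_words[OF y(3)]] by auto
qed (simp add: Fdeg_def)

lemma lin_surj:
 assumes surj: "\<And>a. a \<in> gr k \<Longrightarrow> \<exists>y\<in>Fdeg k. eval_words R y = a"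
 shows "m \<le> n \<Longrightarrow> a \<in> lspan R x m \<Longrightarrow> a \<in> gr (Suc k) \<Longrightarrow> \<exists>y\<in>lin k m. eval_words R y = a"
proof (induction m arbitrary: a)
 case (Suc m)
 obtain u b where ub: "a = u \<oplus> b \<otimes> x m" "u \<in> lspan R x m" "b \<in> carrier R" using Suc.prems by auto
 have m: "m \<le> n" "m < n" using Suc.prems by auto
 have cl: "u \<in> carrier R" "x m \<in> gr 1" "x m \<in> carrier R" using lspan_closed'[OF m(1) ub(2)] x_gr[OF m(2)] x_closed[OF m(2)] by auto
 have "a = comp a (Suc k)" using comp_gr[OF Suc.prems(3), of "Suc k"] by simp
 also have "\<dots> = comp u (Suc k) \<oplus> comp b k \<otimes> x m" using ub cl by (simp add: comp_add comp_mult_gr1)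
 finally have a: "a = comp u (Suc k) \<oplus> comp b k \<otimes> x m" .
 obtain y where y: "y \<in> lin k m" "eval_words R y = comp u (Suc k)"
  using Suc.IH[OF m(1) comp_lspan[OF m(1) ub(2)] comp_props(1)[OF cl(1)]] by blast
 obtain f where f: "f \<in> Fdeg k" "eval_words R f = comp b k" using surj comp_props(1)[OF ub(3)] by blast
 have "y \<in> Fdeg (Suc k)" using lin_eval[OF m(1) y(1)] by simp
 then have "eval_words R (y + f \<star> frag_of [x m]) = a"
  using eval_words_add[OF Fdeg_words Fdeg_words] eval_mult_x[OF m(2) f(1)] y(2) f(2) a by simp
 then show ?case using lin_SucI[OF y(1) f(1)] by blast
qed simp

text \<open>The ring is generated in degree one: a homogeneous element of positive degree lies in
  the left ideal of all \<open>x i\<close>, with coefficients of one degree less.\<close>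

lemma gr_surj: "a \<in> gr k \<Longrightarrow> \<exists>y\<in>Fdeg k. eval_words R y = a"
proof (induction k arbitrary: a)
 case 0
 then obtain z :: int where z: "a = [z] \<cdot> \<one>" using gr0_int by blast
 have "frag_of [] \<in> Fdeg 0" by (simp add: Fdeg_def keys_frag_of)
 then have "frag_cmul z (frag_of []) \<in> Fdeg 0" by (rule Fdeg_cmul)
 moreover have "eval_words R (frag_cmul z (frag_of [])) = a" using eval_words_cmul[of "frag_of []" z] by (simp add: z keys_frag_of)
 ultimately show ?case by blast
next
 case (Suc k)
 have "a \<in> lspan R x n" using gr_Suc_pos[OF Suc.prems] lspan_full by simp
 then show ?case using lin_surj[OF Suc.IH order_refl _ Suc.prems] lin_eval[OF order_refl] by blast
qed

lemma letter_expand: "m \<le> n \<Longrightarrow> v \<in> lspan R x m \<Longrightarrow> v \<in> gr 1 \<Longrightarrow> \<exists>y\<in>lin 0 m. frag_of [v] - y \<in> I0"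
proof (induction m arbitrary: v)
 case 0
 then show ?case using letter_zero by simp
next
 case (Suc m)
 obtain u a where ua: "v = u \<oplus> a \<otimes> x m" "u \<in> lspan R x m" "a \<in> carrier R" using Suc.prems by auto
 have m: "m \<le> n" "m < n" using Suc.prems by auto
 have cl: "u \<in> carrier R" "x m \<in> gr 1" "x m \<in> carrier R" using lspan_closed'[OF m(1) ua(2)] x_gr[OF m(2)] x_closed[OF m(2)] by auto
 obtain z :: int where z: "comp a 0 = [z] \<cdot> \<one>" using gr0_int comp_props(1)[OF ua(3)] by blast
 have "v = comp v (Suc 0)" using comp_gr[OF Suc.prems(3), of 1] by simp
 also have "\<dots> = comp u 1 \<oplus> comp a 0 \<otimes> x m" using ua cl by (simp add: comp_add comp_mult_gr1)
 also have "comp a 0 \<otimes> x m = [z] \<cdot> x m" using cl by (simp add: z add_pow_ldistr_int)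
 finally have v: "v = comp u 1 \<oplus> [z] \<cdot> x m" .
 have u1: "comp u 1 \<in> lspan R x m" "comp u 1 \<in> gr 1" using comp_props(1)[OF cl(1)] comp_lspan[OF m(1) ua(2)] by auto
 obtain y where y: "y \<in> lin 0 m" "frag_of [comp u 1] - y \<in> I0" using Suc.IH[OF m(1) u1] by blast
 have gz: "[z] \<cdot> x m \<in> gr 1"
 proof -
  have "subgroup (gr 1) (add_monoid R)" using gr_subgroup[of 1] by (simp add: additive_subgroup_def)
  from add.subgroup_int_pow_closed[OF this cl(2)] show ?thesis by (simp add: add_pow_def)
 qed
 have "(frag_of [comp u 1 \<oplus> [z] \<cdot> x m] - frag_of [comp u 1] - frag_of [[z] \<cdot> x m]) +
   (frag_of [comp u 1] - y) + (frag_of [[z] \<cdot> x m] - frag_cmul z (frag_of [x m])) \<in> I0"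
  by (intro I0_add linear_J u1 gz y letter_int_mult cl)
 then have "frag_of [v] - (y + frag_cmul z (frag_of []) \<star> frag_of [x m]) \<in> I0" by (simp add: v word_mult_cmul_left algebra_simps)
 moreover have "frag_cmul z (frag_of []) \<in> Fdeg 0" by (intro Fdeg_cmul) (simp add: Fdeg_def keys_frag_of)
 ultimately show ?case using lin_SucI[OF y(1)] by blast
qed

lemma Fdeg_expand:
 assumes "y \<in> Fdeg (Suc k)" shows "\<exists>y'\<in>lin k n. y - y' \<in> I0"
proof -
 have "Poly_Mapping.keys y \<subseteq> {w. w \<in> lists (gr 1) \<and> length w = Suc k}" using assms by (auto simp: Fdeg_def)
 then show ?thesis
 proof (induction y rule: frag_induction)
  case zero
  show ?case using lin_zero I0_zero by (intro bexI[of _ 0]) simp_all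
 next
  case (one w)
  then obtain u v where w: "w = u @ [v]" by (metis (mono_tags, lifting) length_Suc_conv_rev mem_Collect_eq)
  have v: "v \<in> gr 1" and u: "frag_of u \<in> Fdeg k" using one w by (auto simp: Fdeg_def keys_frag_of)
  have "v \<in> lspan R x n" using gr_Suc_pos[of v 0] v lspan_full by simp
  then obtain y where y: "y \<in> lin 0 n" "frag_of [v] - y \<in> I0" using letter_expand[OF order_refl _ v] by blast
  have "frag_of w - frag_of u \<star> y \<in> I0" using I0_lmult[OF y(2) Fdeg_closed[OF u]] by (simp add: w word_mult_diff_right)
  then show ?case using lin_mult[OF u y(1)] by auto
 next
  case (diff a b)
  then obtain a' b' where "a' \<in> lin k n" "b' \<in> lin k n" "a - a' \<in> I0" "b - b' \<in> I0" by blast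
  then show ?case using lin_diff[of a' k n b'] I0_diff[of "a - a'" "b - b'"] by (intro bexI[of _ "a' - b'"]) (simp_all add: algebra_simps)
 qed
qed

lemma I0_eval: "y \<in> I0 \<Longrightarrow> eval_words R y = \<zero>"
 using quadratic_kernel eval_class_coset I0_closed unfolding I0_def a_kernel_def' by auto

lemma eval_I0_cong:
 assumes "y \<in> Fdeg k" "y' \<in> Fdeg k" "y - y' \<in> I0" shows "eval_words R y = eval_words R y'"
proof -
 have "eval_words R y' = eval_words R y \<ominus> eval_words R (y - y')"
  using eval_words_diff[OF Fdeg_words[OF assms(1)] Fdeg_words[OF Fdeg_diff[OF assms(1,2)]]] by simp
 then show ?thesis using I0_eval[OF assms(3)] eval_words_closed[OF Fdeg_words[OF assms(1)]] by (simp add: a_minus_def)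
qed

lemma lin_reduce: "m < n \<Longrightarrow> j \<le> c m \<Longrightarrow> f \<in> lin k j \<Longrightarrow> \<exists>y\<in>lin (Suc k) m. f \<star> frag_of [x m] - y \<in> I0"
proof (induction j arbitrary: f)
 case 0
 then show ?case using lin_zero I0_zero by (intro bexI[of _ 0]) simp_all
next
 case (Suc j)
 obtain u g where f: "f = u + g \<star> frag_of [x j]" "u \<in> lin k j" "g \<in> Fdeg k" by (rule lin_SucE[OF Suc.prems(3)])
 have m: "m < n" "m \<le> n" "j < n" "j < c m" using Suc.prems c_le[of m] by auto
 obtain y where y: "y \<in> lin (Suc k) m" "u \<star> frag_of [x m] - y \<in> I0" using Suc.IH[OF m(1) _ f(2)] m(4) by auto
 have "x j \<in> lspan R x (c m)" using x_closed c_le[OF m(1)] by (intro lspan_gen m) simp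
 then have l: "x j \<otimes> x m \<in> lspan R x m" using colon[OF m(1) x_closed[OF m(3)]] by simp
 have xj: "frag_of [x j] \<in> Fdeg 1" by (rule Fdeg_of[OF x_gr[OF m(3)]])
 have "x j \<otimes> x m \<in> gr (Suc 1)" using mult_gr[OF x_gr[OF m(3)] x_gr[OF m(1)]] by (simp add: numeral_2_eq_2)
 then obtain q where q: "q \<in> lin 1 m" "eval_words R q = x j \<otimes> x m" using lin_surj[OF gr_surj m(2) l] by blast
 note e = eval_mult_x[OF m(1) xj]
 have q2: "q \<in> Fdeg (Suc 1)" using lin_eval[OF m(2) q(1)] by simp
 \<comment> \<open>Here the kernel in degree two enters: the product of the two generators, and its
   rewriting q in terms of earlier last letters, have the same value.\<close>
 have "frag_of [x j] \<star> frag_of [x m] - q \<in> I0"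
 proof (rule quadratic_I0)
  show "frag_of [x j] \<star> frag_of [x m] - q \<in> Fdeg 2" using Fdeg_diff[OF e(1) q2] by (simp add: numeral_2_eq_2)
  show "eval_words R (frag_of [x j] \<star> frag_of [x m] - q) = \<zero>"
   using eval_words_diff[OF Fdeg_words[OF e(1)] Fdeg_words[OF q2]] e(2) q(2) x_closed[OF m(3)] x_closed[OF m(1)]
   by (simp add: r_neg a_minus_def)
 qed
 from I0_add[OF y(2) I0_lmult[OF this Fdeg_closed[OF f(3)]]]
 have "f \<star> frag_of [x m] - (y + g \<star> q) \<in> I0"
  by (simp only: f(1) word_mult_add_left word_mult_diff_right word_mult_assoc) (simp add: algebra_simps)
 moreover have "g \<star> q \<in> lin (Suc k) m" using lin_mult[OF f(3) q(1)] by simp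
 ultimately show ?case using lin_add[OF y(1)] by blast
qed

text \<open>If u + f \<open>x m\<close> has value zero, the value of f lies in the colon ideal of
  \<open>x m\<close>. The term f \<open>x m\<close> can then be rewritten, modulo quadratic
  relations, by generators before \<open>x m\<close>, and m drops by one.\<close>

lemma lin_kernel:
 assumes ker: "\<And>y. y \<in> Fdeg k \<Longrightarrow> eval_words R y = \<zero> \<Longrightarrow> y \<in> I0"
 shows "m \<le> n \<Longrightarrow> y \<in> lin k m \<Longrightarrow> eval_words R y = \<zero> \<Longrightarrow> y \<in> I0"
proof (induction m arbitrary: y)
 case 0
 then show ?case using I0_zero by simp
next
 case (Suc m)
 obtain u f where y: "y = u + f \<star> frag_of [x m]" "u \<in> lin k m" "f \<in> Fdeg k" by (rule lin_SucE[OF Suc.prems(2)])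
 have m: "m < n" "m \<le> n" using Suc.prems by auto
 have u: "u \<in> Fdeg (Suc k)" "eval_words R u \<in> lspan R x m" using lin_eval[OF m(2) y(2)] by auto
 have fc: "eval_words R f \<in> carrier R" "eval_words R f \<in> gr k" using eval_words_closed[OF Fdeg_words[OF y(3)]] eval_Fdeg[OF y(3)] by auto
 note e = eval_mult_x[OF m(1) y(3)]
 have "eval_words R f \<otimes> x m \<oplus> eval_words R u = \<zero>"
  using eval_words_add[OF Fdeg_words[OF u(1)] Fdeg_words[OF e(1)]] e(2) y(1) Suc.prems(3)
   fc(1) x_closed[OF m(1)] lspan_closed'[OF m(2) u(2)] by (simp add: a_comm)
 then have "eval_words R f \<otimes> x m = \<ominus> eval_words R u"
  using fc(1) x_closed[OF m(1)] lspan_closed'[OF m(2) u(2)] by (intro minus_equality[symmetric]) auto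
 then have "eval_words R f \<otimes> x m \<in> lspan R x m" using lspan_a_inv[OF x_closed_le[OF m(2)] u(2)] by simp
 then have fs: "eval_words R f \<in> lspan R x (c m)" using colon[OF m(1) fc(1)] by simp
 have "\<exists>y'\<in>lin k m. f \<star> frag_of [x m] - y' \<in> I0"
 proof (cases k)
  case 0
  \<comment> \<open>In degree zero the colon ideal contains no nonzero element, since all ideals of
    the flag have positive degree.\<close>
  have "eval_words R f = \<zero>" using comp_gr[OF fc(2), of 0] lspan_pos[OF c_le[OF m(1)] fs] 0 by (simp add: pos_def)
  then have "f \<star> frag_of [x m] \<in> I0" by (intro I0_rmult ker y Fdeg_closed[OF Fdeg_of] x_gr m)
  then show ?thesis using lin_zero by (intro bexI[of _ 0]) simp_all
 next
  case (Suc k')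
  \<comment> \<open>By the hypothesis in degree k only the value of f matters. So f may be exchanged
    for an f' that ends in generators of the colon ideal, and each of these reduces against
    \<open>x m\<close>.\<close>
  obtain f' where f': "f' \<in> lin k' (c m)" "eval_words R f' = eval_words R f"
   using lin_surj[OF gr_surj c_le[OF m(1)] fs] fc(2) Suc by blast
  have fd: "f' \<in> Fdeg k" using lin_eval[OF c_le[OF m(1)] f'(1)] Suc by simp
  have "eval_words R (f - f') = \<zero>"
   using eval_words_diff[OF Fdeg_words[OF y(3)] Fdeg_words[OF fd]] f'(2) fc(1) by (simp add: r_neg a_minus_def)
  then have 1: "(f - f') \<star> frag_of [x m] \<in> I0" by (intro I0_rmult ker Fdeg_diff y fd Fdeg_closed[OF Fdeg_of] x_gr m)
  obtain y' where y': "y' \<in> lin k m" "f' \<star> frag_of [x m] - y' \<in> I0" using lin_reduce[OF m(1) order_refl f'(1)] Suc by blast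
  have "f \<star> frag_of [x m] - y' \<in> I0" using I0_add[OF 1 y'(2)] by (simp add: word_mult_diff_left)
  then show ?thesis using y'(1) by blast
 qed
 then obtain y' where y': "y' \<in> lin k m" "f \<star> frag_of [x m] - y' \<in> I0" by blast
 have uy: "u + y' \<in> lin k m" by (rule lin_add[OF y(2) y'(1)])
 have d: "y - (u + y') \<in> I0" using y'(2) y(1) by simp
 have "y \<in> Fdeg (Suc k)" "u + y' \<in> Fdeg (Suc k)" using lin_eval[OF Suc.prems(1,2)] lin_eval[OF m(2) uy] by auto
 then have "u + y' \<in> I0" using Suc.IH[OF m(2) uy] eval_I0_cong[OF _ _ d] Suc.prems(3) by simp
 then show ?case using I0_add[OF d] by fastforce
qed

lemma homogeneous_I0: "y \<in> Fdeg k \<Longrightarrow> eval_words R y = \<zero> \<Longrightarrow> y \<in> I0"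
proof (induction k arbitrary: y)
 case 0
 have "Poly_Mapping.keys y \<subseteq> {[]}" using 0 by (auto simp: Fdeg_def)
 then have y: "y = frag_cmul (Poly_Mapping.lookup y []) (frag_of [])" by (intro poly_mapping_eqI) (auto simp: in_keys_iff subset_iff)
 have "eval_words R (frag_cmul (Poly_Mapping.lookup y []) (frag_of [])) = [Poly_Mapping.lookup y []] \<cdot> \<one>"
  using eval_words_cmul[of "frag_of []"] by (simp add: keys_frag_of)
 then have "[Poly_Mapping.lookup y []] \<cdot> \<one> = \<zero>" using 0(2) y by metis
 then have "Poly_Mapping.lookup y [] = 0" by (rule int_eq_zero)
 then show ?case using y I0_zero by simp
next
 case (Suc k)
 obtain y' where y': "y' \<in> lin k n" "y - y' \<in> I0" using Fdeg_expand[OF Suc.prems(1)] by blast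
 have "y' \<in> Fdeg (Suc k)" using lin_eval[OF order_refl y'(1)] by simp
 then have "eval_words R y' = \<zero>" using eval_I0_cong[OF Suc.prems(1) _ y'(2)] Suc.prems(2) by simp
 then have "y' \<in> I0" using lin_kernel[of k n y'] Suc.IH y'(1) by blast
 then show ?case using I0_add[OF y'(2)] by fastforce
qed

definition Fpart :: "nat \<Rightarrow> ('a list \<Rightarrow>\<^sub>0 int) \<Rightarrow> ('a list \<Rightarrow>\<^sub>0 int)" where
 "Fpart k y = frag_extend (\<lambda>w. if length w = k then frag_of w else 0) y"

lemma Fpart_Fdeg: "y \<in> carrier F \<Longrightarrow> Fpart k y \<in> Fdeg k"
 using keys_frag_extend[of "\<lambda>w. if length w = k then frag_of w else 0" y]
 by (fastforce simp: Fpart_def Fdeg_def keys_frag_of split: if_splits)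

lemma Fpart_sum:
 assumes "\<And>w. w \<in> Poly_Mapping.keys y \<Longrightarrow> length w < M" shows "y = (\<Sum>k<M. Fpart k y)"
proof -
 have "Poly_Mapping.keys y \<subseteq> {w. length w < M}" using assms by auto
 then show ?thesis
 proof (induction y rule: frag_induction)
  case (one w)
  have "(\<Sum>k<M. Fpart k (frag_of w)) = (\<Sum>k<M. if length w = k then frag_of w else 0)" by (simp add: Fpart_def)
  then show ?case using one by simp
 next
  case (diff a b)
  then show ?case by (simp add: Fpart_def frag_extend_diff sum_subtractf)
 qed (simp add: Fpart_def)
qed

lemma kernel_I0:
 assumes y: "y \<in> carrier F" "eval_words R y = \<zero>" shows "y \<in> I0"
proof -
 obtain M where M: "\<And>w. w \<in> Poly_Mapping.keys y \<Longrightarrow> length w < M"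
  using finite_nat_set_iff_bounded[of "length ` Poly_Mapping.keys y"] by auto
 have d: "Fpart k y \<in> Fdeg k" for k by (rule Fpart_Fdeg[OF y(1)])
 have g: "eval_words R (Fpart k y) \<in> gr k" for k by (rule eval_Fdeg[OF d])
 have "\<zero> = (\<Oplus>k\<in>{..<M}. eval_words R (Fpart k y))"
  using eval_words_sum[of M "\<lambda>k. Fpart k y"] Fdeg_words[OF d] Fpart_sum[OF M] y(2) by simp
 also have "\<dots> = (\<Oplus>k\<in>{..<M}. if k < M then eval_words R (Fpart k y) else \<zero>)"
  using eval_words_closed[OF Fdeg_words[OF d]] by (intro finsum_cong') auto
 \<comment> \<open>The values of the homogeneous parts add up to zero, so each of them is zero by
   uniqueness of homogeneous components.\<close>
 finally have "comp \<zero> = (\<lambda>k. if k < M then eval_words R (Fpart k y) else \<zero>)"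
  using g by (intro comp_unique[of _ "{..<M}"]) auto
 then have "eval_words R (Fpart k y) = \<zero>" if "k < M" for k using comp_zero[of k] that by simp
 then have "Fpart k y \<in> I0" if "k < M" for k using homogeneous_I0[OF d] that by blast
 then have "(\<Sum>k<M. Fpart k y) \<in> I0" by (intro I0_sum) auto
 then show ?thesis using Fpart_sum[OF M] by simp
qed

theorem quadratic_presentation:
 "\<exists>\<phi> \<in> ring_iso (E Quot quadratic_ideal) R.
  \<forall>v\<in>gr 1. \<phi> (quadratic_ideal +>\<^bsub>E\<^esub> exterior_class G (frag_of [v])) = v"
proof -
 have ker: "a_kernel E R eval_class = quadratic_ideal"
 proof
  show "quadratic_ideal \<subseteq> a_kernel E R eval_class" by (rule quadratic_kernel)
  show "a_kernel E R eval_class \<subseteq> quadratic_ideal"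
  proof
   fix C assume "C \<in> a_kernel E R eval_class"
   then obtain y where y: "y \<in> carrier F" "C = J +>\<^bsub>F\<^esub> y" "eval_class C = \<zero>"
    unfolding a_kernel_def' by (metis (mono_tags, lifting) E_cases mem_Collect_eq)
   then have "eval_words R y = \<zero>" using eval_class_coset by simp
   then have "y \<in> I0" using kernel_I0 y by blast
   then show "C \<in> quadratic_ideal" by (simp add: I0_def y)
  qed
 qed
 have "\<exists>C\<in>carrier E. eval_class C = a" if a: "a \<in> carrier R" for a
 proof -
  let ?K = "{k. comp a k \<noteq> \<zero>}"
  obtain Y where Y: "\<And>k. Y k \<in> Fdeg k" "\<And>k. eval_words R (Y k) = comp a k" using gr_surj[OF comp_props(1)[OF a]] by metis
  obtain M where M: "\<And>k. k \<in> ?K \<Longrightarrow> k < M" using comp_props(2)[OF a] finite_nat_set_iff_bounded by auto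
  have "a = (\<Oplus>k\<in>{..<M}. comp a k)" using comp_props(3)[OF a] finsum_support[of "{..<M}" "comp a"] M a by auto
  also have "\<dots> = eval_words R (\<Sum>k<M. Y k)" using eval_words_sum[of M Y] Fdeg_words[OF Y(1)] Y(2) by simp
  finally have "eval_words R (\<Sum>k<M. Y k) = a" ..
  moreover have "(\<Sum>k<M. Y k) \<in> carrier F" using Fdeg_closed[OF Y(1)] keys_sum[of Y "{..<M}"] by fastforce
  ultimately show ?thesis using eval_class_coset unfolding E_carrier by blast
 qed
 then have surj: "eval_class ` carrier E = carrier R" using ec.hom_closed by (auto simp: image_def)
 have iso: "(\<lambda>X. the_elem (eval_class ` X)) \<in> ring_iso (E Quot quadratic_ideal) R"
  using ec.FactRing_iso_set[OF surj] ker by simp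
 have "the_elem (eval_class ` (quadratic_ideal +>\<^bsub>E\<^esub> exterior_class G (frag_of [v]))) = v" if v: "v \<in> gr 1" for v
 proof -
  let ?C = "exterior_class G (frag_of [v])"
  have f: "frag_of [v] \<in> carrier F" using v by (simp add: keys_frag_of)
  have C: "?C = J +>\<^bsub>F\<^esub> frag_of [v]" by (simp add: exterior_class_def)
  have CE: "?C \<in> carrier E" unfolding C E_carrier using f by blast
  have "eval_class ?C = v" unfolding C eval_class_coset[OF f] using gr_closed[OF v] by simp
  then show ?thesis using ec.the_elem_simp[OF CE] unfolding ker by (simp only:)
 qed
 then show ?thesis by (intro bexI[OF _ iso] ballI)
qed

end

section \<open>Extension of a flag from the base to the complement of disjoint graphs\<close>

section \<open>Flags of cocycles\<close>

declare plus_fun_apply [simp del] zero_fun_apply [simp del] minus_apply [simp del] uminus_apply [simp del]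

definition coh :: "'a topology \<Rightarrow> 'a cochain \<Rightarrow> 'a cochain \<Rightarrow> bool" where
 "coh X f g \<longleftrightarrow> f - g \<in> coboundaries X"

lemma coh_refl [simp]: "coh X f f" by (simp add: coh_def)

lemma coh_sym: "coh X f g \<Longrightarrow> coh X g f" using coboundaries_uminus[of "f - g" X] by (simp add: coh_def)

lemma coh_trans [trans]: "coh X f g \<Longrightarrow> coh X g h \<Longrightarrow> coh X f h"
 using coboundaries_add[of "f - g" X "g - h"] by (simp add: coh_def)

lemma coh_eq_trans [trans]: "f = g \<Longrightarrow> coh X g h \<Longrightarrow> coh X f h" "coh X f g \<Longrightarrow> g = h \<Longrightarrow> coh X f h"
 by simp_all

lemma coh_add: "coh X f g \<Longrightarrow> coh X f' g' \<Longrightarrow> coh X (f + f') (g + g')"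
 using coboundaries_add[of "f - g" X "f' - g'"] by (simp add: coh_def algebra_simps)

lemma coh_uminus: "coh X f g \<Longrightarrow> coh X (- f) (- g)" using coboundaries_uminus[of "f - g" X] by (simp add: coh_def)

lemma coh_diff: "coh X f g \<Longrightarrow> coh X f' g' \<Longrightarrow> coh X (f - f') (g - g')"
 using coh_add[of X f g "- f'" "- g'"] coh_uminus[of X f' g'] by simp

lemma coh_sum: "(\<And>i. i \<in> I \<Longrightarrow> coh X (f i) (g i)) \<Longrightarrow> coh X (\<Sum>i\<in>I. f i) (\<Sum>i\<in>I. g i)"
 by (induction I rule: infinite_finite_induct) (auto intro: coh_add)

lemma coh_zero: "coh X f 0 \<longleftrightarrow> f \<in> coboundaries X" by (simp add: coh_def)

lemma cocycles_coh: "f \<in> cocycles X \<Longrightarrow> coh X f g \<Longrightarrow> g \<in> cocycles X"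
 using cocycles_diff[of f X "f - g"] coboundaries_cocycles[of "f - g" X] by (simp add: coh_def)

lemma coh_cup_left: "coh X f g \<Longrightarrow> h \<in> cocycles X \<Longrightarrow> coh X (cup_product X f h) (cup_product X g h)"
 using cup_coboundary_left[of "f - g" X h] by (simp add: coh_def cup_diff_left)

lemma coh_cup_right: "coh X f g \<Longrightarrow> h \<in> cocycles X \<Longrightarrow> coh X (cup_product X h f) (cup_product X h g)"
 using cup_coboundary_right[of h X "f - g"] by (simp add: coh_def cup_diff_right)

lemma coh_part: "coh X f g \<Longrightarrow> coh X (part k f) (part k g)"
 using part_coboundaries[of "f - g" X k] by (simp add: coh_def part_diff)

lemma coh_part_0: "coh X f g \<Longrightarrow> part 0 f = part 0 g"
proof -
 assume "coh X f g"
 then obtain e where "f - g = coboundary X e" unfolding coh_def coboundaries_def by blast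
 then have "part 0 (f - g) = 0" using part_coboundary_0[of X e] by simp
 then show "part 0 f = part 0 g" unfolding part_diff by simp
qed

lemma cup_sum_left: "cup_product X (\<Sum>i\<in>I. f i) h = (\<Sum>i\<in>I. cup_product X (f i) h)"
 by (induction I rule: infinite_finite_induct) (auto simp: cup_add_left)

lemma cup_sum_right: "cup_product X h (\<Sum>i\<in>I. f i) = (\<Sum>i\<in>I. cup_product X h (f i))"
 by (induction I rule: infinite_finite_induct) (auto simp: cup_add_right)

lemma concentrated_eq: "concentrated k f \<Longrightarrow> part k f = f" by (simp add: part_concentrated)

lemma concentrated_zero: "concentrated k 0" by (simp add: concentrated_def zero_fun_def)

lemma part_cup_right_Suc:
 assumes "concentrated 1 g"
 shows "part (Suc k) (cup_product X f g) = cup_product X (part k f) g"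
proof (rule ext, rule ext)
 fix n \<sigma>
 have g: "g j = (\<lambda>\<sigma>. 0)" if "j \<noteq> 1" for j using assms that by (simp add: concentrated_def)
 have "(\<Sum>p\<le>n. part k f p (front_face p \<sigma>) * g (n - p) (back_face p (n - p) \<sigma>)) =
  (if n = Suc k then \<Sum>p\<le>n. f p (front_face p \<sigma>) * g (n - p) (back_face p (n - p) \<sigma>) else 0)"
  by (cases "n = Suc k") (auto simp: part_def g intro!: sum.cong sum.neutral)
 then show "part (Suc k) (cup_product X f g) n \<sigma> = cup_product X (part k f) g n \<sigma>" by (simp add: part_def cup_product_def)
qed

lemma part_0_cup: "part 0 (cup_product X f g) = cup_product X (part 0 f) (part 0 g)"
proof (rule ext, rule ext)
 fix n \<sigma>
 have "(\<Sum>p\<le>n. part 0 f p (front_face p \<sigma>) * part 0 g (n - p) (back_face p (n - p) \<sigma>)) =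
  (if n = 0 then \<Sum>p\<le>n. f p (front_face p \<sigma>) * g (n - p) (back_face p (n - p) \<sigma>) else 0)"
  by (cases "n = 0") (auto simp: part_def intro!: sum.neutral)
 then show "part 0 (cup_product X f g) n \<sigma> = cup_product X (part 0 f) (part 0 g) n \<sigma>" by (simp add: part_def cup_product_def)
qed

definition const_cochain :: "'a topology \<Rightarrow> int \<Rightarrow> 'a cochain" where
 "const_cochain X z = (\<lambda>n \<sigma>. z * one_cochain X n \<sigma>)"

lemma const_cochain_0 [simp]: "const_cochain X 0 = 0" by (simp add: const_cochain_def zero_cochain)

lemma const_cochain_1: "const_cochain X 1 = one_cochain X" by (simp add: const_cochain_def)

lemma const_cochain_add: "const_cochain X (a + b) = const_cochain X a + const_cochain X b"
 by (auto simp: const_cochain_def fun_eq_iff algebra_simps plus_fun_apply)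

lemma const_cochain_minus: "const_cochain X (- a) = - const_cochain X a" by (auto simp: const_cochain_def fun_eq_iff uminus_apply)

lemma const_cochain_cocycle [simp]: "const_cochain X z \<in> cocycles X"
proof (induction z rule: int_induct[where k = 0])
 case (step2 i)
 then show ?case using const_cochain_add[of X i "- 1"] by (simp add: const_cochain_minus const_cochain_1)
qed (simp_all add: const_cochain_add const_cochain_1)

lemma concentrated_const [simp]: "concentrated 0 (const_cochain X z)" by (simp add: concentrated_def const_cochain_def one_cochain_def)

lemma part_const [simp]: "part 0 (const_cochain X z) = const_cochain X z" by (rule concentrated_eq) simp

lemma pull_const: "continuous_map X Y \<phi> \<Longrightarrow> pull X \<phi> (const_cochain Y z) = const_cochain X z"
proof (intro ext)
 fix n \<sigma> assume \<phi>: "continuous_map X Y \<phi>"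
 have "pull X \<phi> (one_cochain Y) n \<sigma> = one_cochain X n \<sigma>" by (simp add: pull_one[OF \<phi>])
 then show "pull X \<phi> (const_cochain Y z) n \<sigma> = const_cochain X z n \<sigma>"
  by (cases "singular_simplex n X \<sigma>") (auto simp: const_cochain_def pull_def one_cochain_def)
qed

lemma cup_const_left:
 assumes "f \<in> cochains X" shows "cup_product X (const_cochain X z) f = (\<lambda>n \<sigma>. z * f n \<sigma>)"
proof -
 have "cup_product X (const_cochain X z) f = (\<lambda>n \<sigma>. z * cup_product X (one_cochain X) f n \<sigma>)"
  by (auto simp: cup_product_def const_cochain_def fun_eq_iff sum_distrib_left mult.assoc)
 then show ?thesis using assms by (simp add: cup_one_left)
qed

lemma cup_const_right:
 assumes "f \<in> cochains X" shows "cup_product X f (const_cochain X z) = (\<lambda>n \<sigma>. z * f n \<sigma>)"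
proof -
 have "cup_product X f (const_cochain X z) = (\<lambda>n \<sigma>. z * cup_product X f (one_cochain X) n \<sigma>)"
  by (auto simp: cup_product_def const_cochain_def fun_eq_iff sum_distrib_left mult_ac)
 then show ?thesis using assms by (simp add: cup_one_right)
qed

lemma const_cochain_eq_0: "topspace X \<noteq> {} \<Longrightarrow> const_cochain X z = 0 \<longleftrightarrow> z = 0"
proof
 assume "topspace X \<noteq> {}" and z: "const_cochain X z = 0"
 then obtain p where "p \<in> topspace X" by blast
 then have "singular_simplex 0 X (restrict (\<lambda>_. p) (standard_simplex 0))" by (simp add: singular_simplex_def)
 then have "const_cochain X z 0 (restrict (\<lambda>_. p) (standard_simplex 0)) = z" by (simp add: const_cochain_def one_cochain_def)
 then show "z = 0" unfolding z by (simp add: zero_fun_apply)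
qed simp

lemma cochain_parts:
 assumes "f \<in> cochains X" shows "f = (\<Sum>k | f k \<noteq> (\<lambda>\<sigma>. 0). part k f)"
proof (rule ext, rule ext)
 fix n \<sigma>
 have fin: "finite {k. f k \<noteq> (\<lambda>\<sigma>. 0)}" using assms by (simp add: cochains_def)
 have "(\<Sum>k | f k \<noteq> (\<lambda>\<sigma>. 0). part k f) n \<sigma> = (\<Sum>k | f k \<noteq> (\<lambda>\<sigma>. 0). if k = n then f n \<sigma> else 0)"
  unfolding sum_fun_apply by (rule sum.cong) (auto simp: part_def)
 then show "f n \<sigma> = (\<Sum>k | f k \<noteq> (\<lambda>\<sigma>. 0). part k f) n \<sigma>" using fin by auto
qed

text \<open>The set of cocycles whose classes lie in the left ideal \<open>lspan\<close> of the
  cohomology ring. Starting from all coboundaries makes it closed under change of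
  representative.\<close>

primrec cspan :: "'a topology \<Rightarrow> (nat \<Rightarrow> 'a cochain) \<Rightarrow> nat \<Rightarrow> 'a cochain set" where
 "cspan X \<xi> 0 = coboundaries X"
| "cspan X \<xi> (Suc k) = {u + cup_product X a (\<xi> k) | u a. u \<in> cspan X \<xi> k \<and> a \<in> cocycles X}"

text \<open>The form of \<open>koszul_flag\<close> for representatives. Nonemptiness and constancy
  of closed cochains of degree zero make the degree zero part a copy of the integers, as Koszulness
  demands.\<close>

definition cochain_flag :: "'a topology \<Rightarrow> nat \<Rightarrow> (nat \<Rightarrow> 'a cochain) \<Rightarrow> (nat \<Rightarrow> nat) \<Rightarrow> bool" where
 "cochain_flag X n \<xi> c \<longleftrightarrow> topspace X \<noteq> {} \<and>
  (\<forall>f\<in>cocycles X. \<exists>z. part 0 f = const_cochain X z) \<and>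
  (\<forall>i<n. \<xi> i \<in> cocycles X \<and> concentrated 1 (\<xi> i) \<and> c i \<le> n) \<and>
  cspan X \<xi> n = {f \<in> cocycles X. part 0 f = 0} \<and>
  (\<forall>i<n. \<forall>a\<in>cocycles X. cup_product X a (\<xi> i) \<in> cspan X \<xi> i \<longleftrightarrow> a \<in> cspan X \<xi> (c i))"

lemma cspan_SucI: "u \<in> cspan X \<xi> k \<Longrightarrow> a \<in> cocycles X \<Longrightarrow> u + cup_product X a (\<xi> k) \<in> cspan X \<xi> (Suc k)"
 unfolding cspan.simps by blast

lemma cspan_SucE:
 assumes "f \<in> cspan X \<xi> (Suc k)"
 obtains u a where "f = u + cup_product X a (\<xi> k)" "u \<in> cspan X \<xi> k" "a \<in> cocycles X"
 using assms unfolding cspan.simps by blast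

lemma cspan_cocycles:
 assumes "\<And>i. i < k \<Longrightarrow> \<xi> i \<in> cocycles X" "u \<in> cspan X \<xi> k" shows "u \<in> cocycles X" using assms
proof (induction k arbitrary: u)
 case (Suc k)
 then obtain u' a where "u = u' + cup_product X a (\<xi> k)" "u' \<in> cspan X \<xi> k" "a \<in> cocycles X" by auto
 then show ?case using Suc cup_cocycles[of a X "\<xi> k"] by simp
qed (simp add: coboundaries_cocycles)

lemma cspan_add_coboundary: "u \<in> cspan X \<xi> k \<Longrightarrow> v \<in> coboundaries X \<Longrightarrow> u + v \<in> cspan X \<xi> k"
proof (induction k arbitrary: u)
 case (Suc k)
 then obtain u' a where "u = u' + cup_product X a (\<xi> k)" "u' \<in> cspan X \<xi> k" "a \<in> cocycles X" by auto
 moreover from this have "u + v = (u' + v) + cup_product X a (\<xi> k)" by simp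
 ultimately show ?case using Suc.IH[of u'] Suc.prems(2) unfolding cspan.simps by blast
qed simp

lemma cspan_coh: "u \<in> cspan X \<xi> k \<Longrightarrow> coh X u v \<Longrightarrow> v \<in> cspan X \<xi> k"
 using cspan_add_coboundary[of u X \<xi> k "v - u"] coh_sym[of X u v] by (simp add: coh_def)

locale fibre_flag =
 fixes B :: "'b topology" and M :: "'m topology" and \<pi> :: "'m \<Rightarrow> 'b" and m :: nat and \<omega> :: "nat \<Rightarrow> 'm cochain"
  and n :: nat and \<xi> :: "nat \<Rightarrow> 'b cochain" and c :: "nat \<Rightarrow> nat"
 assumes flagB: "cochain_flag B n \<xi> c"
  and cont: "continuous_map M B \<pi>"
  and fb: "fibre_basis B M \<pi> m \<omega>"
  and \<omega>1: "j < m \<Longrightarrow> concentrated 1 (\<omega> j)"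
  and arnold: "i < m \<Longrightarrow> j < m \<Longrightarrow> i \<noteq> j \<Longrightarrow> \<exists>\<theta>\<in>cocycles B. part 0 \<theta> = 0 \<and>
   coh M (cup_product M (\<omega> i) (\<omega> j)) (cup_product M (\<omega> i) (pull M \<pi> \<theta>) - cup_product M (\<omega> j) (pull M \<pi> \<theta>))"
begin

abbreviation h :: "'b cochain \<Rightarrow> 'm cochain" where "h \<equiv> pull M \<pi>"
abbreviation cupM :: "'m cochain \<Rightarrow> 'm cochain \<Rightarrow> 'm cochain" (infixl "\<diamondop>" 70) where "cupM \<equiv> cup_product M"

definition elt :: "'b cochain \<Rightarrow> (nat \<Rightarrow> 'b cochain) \<Rightarrow> 'm cochain" where
 "elt \<beta> \<gamma> = h \<beta> + (\<Sum>j<m. \<omega> j \<diamondop> h (\<gamma> j))"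

lemma \<omega>_cocycle: "j < m \<Longrightarrow> \<omega> j \<in> cocycles M" using fb by (simp add: fibre_basis_def)

lemma h_cocycle: "\<beta> \<in> cocycles B \<Longrightarrow> h \<beta> \<in> cocycles M" using pull_cocycles[OF cont] .

lemma h_cup: "h (cup_product B f g) = h f \<diamondop> h g" by (rule pull_cup[OF cont])

lemma elt_cocycle: "\<beta> \<in> cocycles B \<Longrightarrow> (\<And>j. j < m \<Longrightarrow> \<gamma> j \<in> cocycles B) \<Longrightarrow> elt \<beta> \<gamma> \<in> cocycles M"
 unfolding elt_def by (intro cocycles_add cocycles_sum cup_cocycles h_cocycle \<omega>_cocycle) auto

lemma elt_add: "elt \<beta> \<gamma> + elt \<beta>' \<gamma>' = elt (\<beta> + \<beta>') (\<lambda>j. \<gamma> j + \<gamma>' j)"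
 by (simp add: elt_def pull_add cup_add_right sum.distrib algebra_simps)

lemma elt_diff: "elt \<beta> \<gamma> - elt \<beta>' \<gamma>' = elt (\<beta> - \<beta>') (\<lambda>j. \<gamma> j - \<gamma>' j)"
 by (simp add: elt_def pull_diff cup_diff_right sum_subtractf algebra_simps)

lemma elt_cup_h: "elt \<beta> \<gamma> \<diamondop> h x = elt (cup_product B \<beta> x) (\<lambda>j. cup_product B (\<gamma> j) x)"
 by (simp add: elt_def cup_add_left cup_sum_left h_cup cup_assoc)

lemma elt_exists:
 assumes "f \<in> cocycles M"
 obtains \<beta> \<gamma> where "\<beta> \<in> cocycles B" "\<And>j. j < m \<Longrightarrow> \<gamma> j \<in> cocycles B" "coh M f (elt \<beta> \<gamma>)"
 using fb assms unfolding fibre_basis_def coh_def elt_def by blast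

lemma elt_zero:
 assumes "\<beta> \<in> cocycles B" "\<And>j. j < m \<Longrightarrow> \<gamma> j \<in> cocycles B" "elt \<beta> \<gamma> \<in> coboundaries M"
 shows "\<beta> \<in> coboundaries B" "\<And>j. j < m \<Longrightarrow> \<gamma> j \<in> coboundaries B"
 using fb assms unfolding fibre_basis_def elt_def by blast+

lemma elt_coboundary:
 assumes "\<beta> \<in> coboundaries B" "\<And>j. j < m \<Longrightarrow> \<gamma> j \<in> coboundaries B"
 shows "elt \<beta> \<gamma> \<in> coboundaries M" unfolding elt_def using assms
 by (intro coboundaries_add coboundaries_sum cup_coboundary_right \<omega>_cocycle pull_coboundaries[OF cont]) auto

text \<open>Cocycles on M described by their coefficients in the fibre basis. Every ideal of the
  extended flag turns out to have this form.\<close>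

definition coefs :: "'b cochain set \<Rightarrow> (nat \<Rightarrow> 'b cochain set) \<Rightarrow> 'm cochain set" where
 "coefs S T = {f \<in> cocycles M. \<exists>\<beta>\<in>S. \<exists>\<gamma>. (\<forall>j<m. \<gamma> j \<in> T j) \<and> coh M f (elt \<beta> \<gamma>)}"

definition saturated :: "'b cochain set \<Rightarrow> bool" where
 "saturated S \<longleftrightarrow> S \<subseteq> cocycles B \<and> (\<forall>u v. u \<in> S \<longrightarrow> coh B u v \<longrightarrow> v \<in> S)"

text \<open>Coefficients are unique up to coboundaries and the sets are closed under cohomologous
  change, so membership can be tested on any one expansion.\<close>

lemma coefs_elt:
 assumes S: "saturated S" "\<And>j. j < m \<Longrightarrow> saturated (T j)"
  and \<beta>: "\<beta> \<in> cocycles B" "\<And>j. j < m \<Longrightarrow> \<gamma> j \<in> cocycles B" and f: "coh M f (elt \<beta> \<gamma>)"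
 shows "f \<in> coefs S T \<longleftrightarrow> \<beta> \<in> S \<and> (\<forall>j<m. \<gamma> j \<in> T j)"
proof
 assume "f \<in> coefs S T"
 then obtain \<beta>' \<gamma>' where b: "\<beta>' \<in> S" "\<And>j. j < m \<Longrightarrow> \<gamma>' j \<in> T j" "coh M f (elt \<beta>' \<gamma>')"
  by (auto simp: coefs_def)
 have c: "\<beta>' \<in> cocycles B" "\<And>j. j < m \<Longrightarrow> \<gamma>' j \<in> cocycles B" using b S by (auto simp: saturated_def)
 have "coh M (elt \<beta>' \<gamma>') (elt \<beta> \<gamma>)" using b(3) f coh_sym coh_trans by blast
 then have *: "elt (\<beta>' - \<beta>) (\<lambda>j. \<gamma>' j - \<gamma> j) \<in> coboundaries M" by (simp add: coh_def elt_diff)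
 have "coh B \<beta>' \<beta>" "\<And>j. j < m \<Longrightarrow> coh B (\<gamma>' j) (\<gamma> j)"
  unfolding coh_def using elt_zero[OF _ _ *] c \<beta> by auto
 then show "\<beta> \<in> S \<and> (\<forall>j<m. \<gamma> j \<in> T j)" using b S unfolding saturated_def by blast
next
 assume *: "\<beta> \<in> S \<and> (\<forall>j<m. \<gamma> j \<in> T j)"
 have "f \<in> cocycles M"
  using cocycles_add[OF coboundaries_cocycles[of "f - elt \<beta> \<gamma>"] elt_cocycle[of \<beta> \<gamma>]] f \<beta> by (simp add: coh_def)
 then show "f \<in> coefs S T" using * f by (auto simp: coefs_def)
qed

lemma coefs_cases:
 assumes "f \<in> coefs S T" "saturated S" "\<And>j. j < m \<Longrightarrow> saturated (T j)"
 obtains \<beta> \<gamma> where "\<beta> \<in> S" "\<And>j. j < m \<Longrightarrow> \<gamma> j \<in> T j" "\<beta> \<in> cocycles B" "\<And>j. j < m \<Longrightarrow> \<gamma> j \<in> cocycles B"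
  "coh M f (elt \<beta> \<gamma>)" "f \<in> cocycles M" using assms unfolding coefs_def saturated_def by blast

abbreviation P where "P \<equiv> {f \<in> cocycles B. part 0 f = 0}"

lemma flag:
 "topspace B \<noteq> {}"
 "f \<in> cocycles B \<Longrightarrow> \<exists>z. part 0 f = const_cochain B z"
 "i < n \<Longrightarrow> \<xi> i \<in> cocycles B" "i < n \<Longrightarrow> concentrated 1 (\<xi> i)" "i < n \<Longrightarrow> c i \<le> n"
 "cspan B \<xi> n = P"
 "i < n \<Longrightarrow> a \<in> cocycles B \<Longrightarrow> cup_product B a (\<xi> i) \<in> cspan B \<xi> i \<longleftrightarrow> a \<in> cspan B \<xi> (c i)"
 using flagB unfolding cochain_flag_def by blast+

lemma saturated_P: "saturated P" unfolding saturated_def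
proof (intro conjI allI impI)
 fix u v assume u: "u \<in> P" and uv: "coh B u v"
 then show "v \<in> P" using cocycles_coh[OF _ uv] coh_part_0[OF uv] by simp
qed auto

lemma saturated_cspan:
 assumes "k \<le> n" shows "saturated (cspan B \<xi> k)" unfolding saturated_def
proof (intro conjI allI impI subsetI)
 have "\<xi> i \<in> cocycles B" if "i < k" for i using that assms flag(3) by simp
 then show "u \<in> cocycles B" if "u \<in> cspan B \<xi> k" for u by (rule cspan_cocycles[OF _ that])
qed (rule cspan_coh)

lemma saturated_cocycles: "saturated (cocycles B)" unfolding saturated_def using cocycles_coh by blast

definition gens :: "nat \<Rightarrow> 'm cochain" where "gens i = (if i < n then h (\<xi> i) else \<omega> (i - n))"

text \<open>A generator from B keeps its colon ideal because the cohomology of M is free over that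
  of B. A fibre class is multiplied into the preceding ideal exactly by the classes of positive
  degree, which form the full ideal of length n + m.\<close>

definition colons :: "nat \<Rightarrow> nat" where "colons i = (if i < n then c i else n + m)"

text \<open>Coefficients stand to the right of the fibre classes, so right multiplication by a class
  from B acts on each coefficient separately.\<close>

lemma cspan_gens_le: "k \<le> n \<Longrightarrow> cspan M gens k = coefs (cspan B \<xi> k) (\<lambda>_. cspan B \<xi> k)"
proof (induction k)
 case 0
 have sat: "saturated (coboundaries B)" using saturated_cspan[of 0] by simp
 show ?case
 proof (intro equalityI subsetI)
  fix f assume "f \<in> cspan M gens 0"
  then have f: "coh M f (elt 0 (\<lambda>_. 0))" by (simp add: coh_def elt_def)
  show "f \<in> coefs (cspan B \<xi> 0) (\<lambda>_. cspan B \<xi> 0)" using coefs_elt[OF sat sat, of "0" "\<lambda>_. 0"] f by simp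
 next
  fix f assume "f \<in> coefs (cspan B \<xi> 0) (\<lambda>_. cspan B \<xi> 0)"
  then have "f \<in> coefs (coboundaries B) (\<lambda>_. coboundaries B)" by simp
  then show "f \<in> cspan M gens 0"
  proof (rule coefs_cases[OF _ sat sat])
   fix \<beta> \<gamma> assume "\<beta> \<in> coboundaries B" "\<And>j. j < m \<Longrightarrow> \<gamma> j \<in> coboundaries B" and f: "coh M f (elt \<beta> \<gamma>)"
   then have "elt \<beta> \<gamma> \<in> coboundaries M" by (intro elt_coboundary)
   then have "coh M f 0" using coh_trans[OF f] coh_zero by blast
   then show ?thesis by (simp add: coh_zero)
  qed
 qed
next
 case (Suc k)
 have k: "k < n" "k \<le> n" using Suc.prems by auto
 have sat: "saturated (cspan B \<xi> k)" and satS: "saturated (cspan B \<xi> (Suc k))" using saturated_cspan Suc.prems k by blast+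
 have gk: "gens k = h (\<xi> k)" using k by (simp add: gens_def)
 have \<xi>k: "h (\<xi> k) \<in> cocycles M" using h_cocycle flag(3) k by blast
 show ?case
 proof (intro equalityI subsetI)
  fix f assume "f \<in> cspan M gens (Suc k)"
  then obtain u a where f: "f = u + a \<diamondop> h (\<xi> k)" "u \<in> cspan M gens k" "a \<in> cocycles M" by (auto simp: gk)
  have u: "u \<in> coefs (cspan B \<xi> k) (\<lambda>_. cspan B \<xi> k)" using f(2) Suc.IH k by simp
  obtain \<beta> \<gamma> where b: "\<beta> \<in> cspan B \<xi> k" "\<And>j. j < m \<Longrightarrow> \<gamma> j \<in> cspan B \<xi> k"
    "\<beta> \<in> cocycles B" "\<And>j. j < m \<Longrightarrow> \<gamma> j \<in> cocycles B" "coh M u (elt \<beta> \<gamma>)"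
   by (rule coefs_cases[OF u sat sat]) blast
  obtain \<beta>' \<gamma>' where b': "\<beta>' \<in> cocycles B" "\<And>j. j < m \<Longrightarrow> \<gamma>' j \<in> cocycles B" "coh M a (elt \<beta>' \<gamma>')"
   using elt_exists[OF f(3)] by blast
  have "coh M f (elt \<beta> \<gamma> + elt \<beta>' \<gamma>' \<diamondop> h (\<xi> k))"
   unfolding f(1) by (intro coh_add b coh_cup_left b' \<xi>k)
  then have fe: "coh M f (elt (\<beta> + cup_product B \<beta>' (\<xi> k)) (\<lambda>j. \<gamma> j + cup_product B (\<gamma>' j) (\<xi> k)))"
   by (simp add: elt_cup_h elt_add)
  have S: "\<beta> + cup_product B \<beta>' (\<xi> k) \<in> cspan B \<xi> (Suc k)"
   "\<And>j. j < m \<Longrightarrow> \<gamma> j + cup_product B (\<gamma>' j) (\<xi> k) \<in> cspan B \<xi> (Suc k)" using b b' by (blast intro: cspan_SucI)+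
  show "f \<in> coefs (cspan B \<xi> (Suc k)) (\<lambda>_. cspan B \<xi> (Suc k))"
   using coefs_elt[OF satS satS _ _ fe] S satS unfolding saturated_def by blast
 next
  fix f assume f: "f \<in> coefs (cspan B \<xi> (Suc k)) (\<lambda>_. cspan B \<xi> (Suc k))"
  obtain \<beta> \<gamma> where b: "\<beta> \<in> cspan B \<xi> (Suc k)" "\<And>j. j < m \<Longrightarrow> \<gamma> j \<in> cspan B \<xi> (Suc k)" "coh M f (elt \<beta> \<gamma>)"
   by (rule coefs_cases[OF f satS satS]) blast
  obtain u a where ua: "\<beta> = u + cup_product B a (\<xi> k)" "u \<in> cspan B \<xi> k" "a \<in> cocycles B"
   by (rule cspan_SucE[OF b(1)])
  have "\<exists>u a. \<gamma> j = u + cup_product B a (\<xi> k) \<and> u \<in> cspan B \<xi> k \<and> a \<in> cocycles B" if "j < m" for j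
   by (rule cspan_SucE[OF b(2)[OF that]]) blast
  then obtain u' a' where ua': "\<And>j. j < m \<Longrightarrow> \<gamma> j = u' j + cup_product B (a' j) (\<xi> k)"
   "\<And>j. j < m \<Longrightarrow> u' j \<in> cspan B \<xi> k" "\<And>j. j < m \<Longrightarrow> a' j \<in> cocycles B" by metis
  have uc: "u \<in> cocycles B" "\<And>j. j < m \<Longrightarrow> u' j \<in> cocycles B" using sat ua(2) ua'(2) unfolding saturated_def by blast+
  have "elt \<beta> \<gamma> = elt (u + cup_product B a (\<xi> k)) (\<lambda>j. u' j + cup_product B (a' j) (\<xi> k))"
   unfolding elt_def ua(1) by (simp add: ua'(1))
  also have "\<dots> = elt u u' + elt a a' \<diamondop> h (\<xi> k)" by (simp add: elt_cup_h elt_add)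
  finally have e: "elt \<beta> \<gamma> = elt u u' + elt a a' \<diamondop> gens k" by (simp add: gk)
  have "elt u u' \<in> cspan M gens k" using coefs_elt[OF sat sat uc coh_refl] ua(2) ua'(2) Suc.IH k by simp
  then have "elt \<beta> \<gamma> \<in> cspan M gens (Suc k)" unfolding e by (intro cspan_SucI elt_cocycle ua(3) ua'(3))
  then show "f \<in> cspan M gens (Suc k)" using b(3) cspan_coh coh_sym by blast
 qed
qed

text \<open>The one case of graded commutativity that is needed. Classes of B in positive degree are
  sums of products ending in generators of degree one, and these anticommute with w; so w passes
  such a class by induction on its degree. Only existence of a coefficient \<beta>' on the other
  side is used, not its sign.\<close>

lemma homogeneous_commute:
 assumes w: "w \<in> cocycles M" "concentrated 1 w"
 shows "\<beta> \<in> cocycles B \<Longrightarrow> concentrated k \<beta> \<Longrightarrow>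
  \<exists>\<beta>'\<in>cocycles B. concentrated k \<beta>' \<and> (k = 0 \<longrightarrow> \<beta>' = \<beta>) \<and> coh M (h \<beta> \<diamondop> w) (w \<diamondop> h \<beta>')"
proof (induction k arbitrary: \<beta>)
 case 0
 then obtain z where "\<beta> = const_cochain B z" using flag(2) concentrated_eq by metis
 then have "h \<beta> = const_cochain M z" using pull_const[OF cont] by simp
 then have "h \<beta> \<diamondop> w = w \<diamondop> h \<beta>" using w by (simp add: cup_const_left cup_const_right cocyclesD)
 then show ?case using 0 by (intro bexI[of _ \<beta>]) auto
next
 case (Suc k)
 note outer = Suc.IH
 \<comment> \<open>Inside the induction on the degree runs one along the flag of B, which splits off
   one generator \<xi> i at a time and leaves a factor of smaller degree.\<close>
 have main: "\<exists>\<beta>'\<in>cocycles B. concentrated (Suc k) \<beta>' \<and> coh M (h (part (Suc k) \<beta>) \<diamondop> w) (w \<diamondop> h \<beta>')"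
  if "i \<le> n" "\<beta> \<in> cspan B \<xi> i" for i \<beta> using that
 proof (induction i arbitrary: \<beta>)
  case 0
  then have "h (part (Suc k) \<beta>) \<diamondop> w \<in> coboundaries M"
   by (intro cup_coboundary_left pull_coboundaries[OF cont] part_coboundaries w) simp
  then show ?case by (intro bexI[of _ 0]) (simp_all add: coh_zero concentrated_zero)
 next
  case (Suc i)
  obtain u a where ua: "\<beta> = u + cup_product B a (\<xi> i)" "u \<in> cspan B \<xi> i" "a \<in> cocycles B"
   by (rule cspan_SucE[OF Suc.prems(2)])
  have i: "i < n" "i \<le> n" using Suc.prems by auto
  have \<xi>: "\<xi> i \<in> cocycles B" "concentrated 1 (\<xi> i)" using flag(3,4)[OF i(1)] .
  have \<xi>h: "h (\<xi> i) \<in> cocycles M" "concentrated 1 (h (\<xi> i))" using h_cocycle[OF \<xi>(1)] concentrated_pull[OF \<xi>(2)] .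
  obtain u' where u': "u' \<in> cocycles B" "concentrated (Suc k) u'" "coh M (h (part (Suc k) u) \<diamondop> w) (w \<diamondop> h u')"
   using Suc.IH[OF i(2) ua(2)] by blast
  have pa: "part k a \<in> cocycles B" using ua(3) by simp
  obtain a' where a': "a' \<in> cocycles B" "concentrated k a'" "coh M (h (part k a) \<diamondop> w) (w \<diamondop> h a')"
   using outer[OF pa concentrated_part] by blast
  have ac: "coh M (h (\<xi> i) \<diamondop> w) (- (w \<diamondop> h (\<xi> i)))"
   using cup_anticommute_coboundary[OF \<xi>h w] by (simp add: coh_def)
  have "h (part (Suc k) \<beta>) \<diamondop> w = h (part (Suc k) u) \<diamondop> w + h (part k a) \<diamondop> (h (\<xi> i) \<diamondop> w)"
   unfolding ua(1) part_add part_cup_right_Suc[OF \<xi>(2)] pull_add h_cup cup_add_left cup_assoc ..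
  also have "coh M \<dots> (w \<diamondop> h u' + h (part k a) \<diamondop> (- (w \<diamondop> h (\<xi> i))))"
   by (intro coh_add u' coh_cup_right ac h_cocycle pa)
  also have "\<dots> = w \<diamondop> h u' - (h (part k a) \<diamondop> w) \<diamondop> h (\<xi> i)"
   by (simp add: cup_minus_right cup_assoc)
  also have "coh M \<dots> (w \<diamondop> h u' - (w \<diamondop> h a') \<diamondop> h (\<xi> i))"
   by (intro coh_diff coh_refl coh_cup_left a' \<xi>h)
  also have "\<dots> = w \<diamondop> h (u' - cup_product B a' (\<xi> i))" by (simp add: cup_assoc h_cup pull_diff cup_diff_right)
  finally have fin: "coh M (h (part (Suc k) \<beta>) \<diamondop> w) (w \<diamondop> h (u' - cup_product B a' (\<xi> i)))" .
  have "concentrated (Suc k) (cup_product B a' (\<xi> i))" using concentrated_cup[OF a'(2) \<xi>(2)] by simp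
  then have "concentrated (Suc k) (u' - cup_product B a' (\<xi> i))" using u'(2) by (simp add: concentrated_def fun_eq_iff minus_apply)
  moreover have "u' - cup_product B a' (\<xi> i) \<in> cocycles B" using u'(1) cup_cocycles[OF a'(1) \<xi>(1)] by simp
  ultimately show ?case using fin by blast
 qed
 have "part 0 \<beta> = 0" using Suc.prems(2) by (simp add: part_concentrated)
 then have "\<beta> \<in> cspan B \<xi> n" using Suc.prems(1) flag(6) by simp
 from main[OF order_refl this] show ?case using concentrated_eq[OF Suc.prems(2)] by auto
qed

lemma commute:
 assumes w: "w \<in> cocycles M" "concentrated 1 w" and \<beta>: "\<beta> \<in> cocycles B"
 obtains \<beta>' where "\<beta>' \<in> cocycles B" "part 0 \<beta>' = part 0 \<beta>" "coh M (h \<beta> \<diamondop> w) (w \<diamondop> h \<beta>')"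
proof -
 have "\<exists>\<beta>'\<in>cocycles B. concentrated k \<beta>' \<and> (k = 0 \<longrightarrow> \<beta>' = part k \<beta>) \<and> coh M (h (part k \<beta>) \<diamondop> w) (w \<diamondop> h \<beta>')" for k
  by (rule homogeneous_commute[OF w]) (use \<beta> in simp_all)
 then obtain b where b: "\<And>k. b k \<in> cocycles B" "\<And>k. concentrated k (b k)" "b 0 = part 0 \<beta>"
  "\<And>k. coh M (h (part k \<beta>) \<diamondop> w) (w \<diamondop> h (b k))" by metis
 let ?K = "insert 0 {k. \<beta> k \<noteq> (\<lambda>\<sigma>. 0)}"
 have fin: "finite ?K" using cocyclesD[OF \<beta>] by (simp add: cochains_def)
 have "\<beta> = (\<Sum>k | \<beta> k \<noteq> (\<lambda>\<sigma>. 0). part k \<beta>)" by (rule cochain_parts[OF cocyclesD[OF \<beta>]])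
 also have "\<dots> = (\<Sum>k\<in>?K. part k \<beta>)"
  using fin by (intro sum.mono_neutral_left) (auto simp: part_def fun_eq_iff zero_fun_apply)
 finally have e: "\<beta> = (\<Sum>k\<in>?K. part k \<beta>)" .
 show thesis
 proof
  show "(\<Sum>k\<in>?K. b k) \<in> cocycles B" by (intro cocycles_sum b)
  have "part 0 (\<Sum>k\<in>?K. b k) = (\<Sum>k\<in>?K. if k = 0 then b 0 else 0)"
   unfolding part_sum by (rule sum.cong[OF refl]) (auto simp: part_concentrated[OF b(2)])
  then show "part 0 (\<Sum>k\<in>?K. b k) = part 0 \<beta>" using fin b(3) by (simp only: sum.delta) simp
  have "coh M (\<Sum>k\<in>?K. h (part k \<beta>) \<diamondop> w) (\<Sum>k\<in>?K. w \<diamondop> h (b k))" by (intro coh_sum b)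
  then have "coh M (h (\<Sum>k\<in>?K. part k \<beta>) \<diamondop> w) (w \<diamondop> h (\<Sum>k\<in>?K. b k))"
   unfolding pull_sum cup_sum_left cup_sum_right .
  then show "coh M (h \<beta> \<diamondop> w) (w \<diamondop> h (\<Sum>k\<in>?K. b k))" using e by metis
 qed
qed


text \<open>Conditions on the coefficients for the ideal generated by all generators from B and the
  first k fibre classes: the first k coefficients are arbitrary, all others have positive
  degree.\<close>

definition free_upto :: "nat \<Rightarrow> nat \<Rightarrow> 'b cochain set" where
 "free_upto k j = (if j < k then cocycles B else P)"

abbreviation Q where "Q k \<equiv> coefs P (free_upto k)"

lemma saturated_free_upto: "saturated (free_upto k j)" by (simp add: free_upto_def saturated_P saturated_cocycles)

lemma Q_elt:
 assumes "\<beta> \<in> cocycles B" "\<And>j. j < m \<Longrightarrow> \<gamma> j \<in> cocycles B" "coh M f (elt \<beta> \<gamma>)"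
 shows "f \<in> Q k \<longleftrightarrow> part 0 \<beta> = 0 \<and> (\<forall>j<m. k \<le> j \<longrightarrow> part 0 (\<gamma> j) = 0)"
proof -
 have "f \<in> Q k \<longleftrightarrow> \<beta> \<in> P \<and> (\<forall>j<m. \<gamma> j \<in> free_upto k j)"
  by (rule coefs_elt[OF saturated_P saturated_free_upto assms])
 also have "\<dots> \<longleftrightarrow> part 0 \<beta> = 0 \<and> (\<forall>j<m. k \<le> j \<longrightarrow> part 0 (\<gamma> j) = 0)"
  using assms(1,2) unfolding free_upto_def by (auto simp: not_less)
 finally show ?thesis .
qed

lemma Q_coh: "f \<in> Q k \<Longrightarrow> coh M f g \<Longrightarrow> g \<in> Q k"
 unfolding coefs_def using cocycles_coh coh_sym coh_trans by blast

lemma Q_cocycle: "f \<in> Q k \<Longrightarrow> f \<in> cocycles M" by (simp add: coefs_def)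

lemma Q_mono:
 assumes "f \<in> Q k" "k \<le> l" shows "f \<in> Q l"
proof -
 obtain \<beta> \<gamma> where "\<beta> \<in> cocycles B" "\<And>j. j < m \<Longrightarrow> \<gamma> j \<in> cocycles B" "coh M f (elt \<beta> \<gamma>)"
  using elt_exists[OF Q_cocycle[OF assms(1)]] by blast
 with assms show ?thesis using Q_elt[of \<beta> \<gamma> f k] Q_elt[of \<beta> \<gamma> f l] by auto
qed

lemma Q_add:
 assumes "f \<in> Q k" "g \<in> Q k" shows "f + g \<in> Q k"
proof -
 obtain \<beta> \<gamma> where 1: "\<beta> \<in> cocycles B" "\<And>j. j < m \<Longrightarrow> \<gamma> j \<in> cocycles B" "coh M f (elt \<beta> \<gamma>)"
  using elt_exists[OF Q_cocycle[OF assms(1)]] by blast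
 obtain \<beta>' \<gamma>' where 2: "\<beta>' \<in> cocycles B" "\<And>j. j < m \<Longrightarrow> \<gamma>' j \<in> cocycles B" "coh M g (elt \<beta>' \<gamma>')"
  using elt_exists[OF Q_cocycle[OF assms(2)]] by blast
 have "coh M (f + g) (elt (\<beta> + \<beta>') (\<lambda>j. \<gamma> j + \<gamma>' j))" using coh_add[OF 1(3) 2(3)] by (simp add: elt_add)
 then show ?thesis
  using Q_elt[OF 1, of k] Q_elt[OF 2, of k] Q_elt[of "\<beta> + \<beta>'" "\<lambda>j. \<gamma> j + \<gamma>' j" "f + g" k] 1 2 assms
  by (simp add: part_add)
qed

lemma Q_uminus:
 assumes "f \<in> Q k" shows "- f \<in> Q k"
proof -
 obtain \<beta> \<gamma> where 1: "\<beta> \<in> cocycles B" "\<And>j. j < m \<Longrightarrow> \<gamma> j \<in> cocycles B" "coh M f (elt \<beta> \<gamma>)"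
  using elt_exists[OF Q_cocycle[OF assms(1)]] by blast
 have "- elt \<beta> \<gamma> = elt (- \<beta>) (\<lambda>j. - \<gamma> j)" using elt_diff[of 0 "\<lambda>_. 0" \<beta> \<gamma>] by (simp add: elt_def)
 then have "coh M (- f) (elt (- \<beta>) (\<lambda>j. - \<gamma> j))" using coh_uminus[OF 1(3)] by simp
 then show ?thesis using Q_elt[OF 1, of k] Q_elt[of "- \<beta>" "\<lambda>j. - \<gamma> j" "- f" k] 1 assms by (simp add: part_minus)
qed

lemma Q_sum: "(\<And>i. i \<in> I \<Longrightarrow> f i \<in> Q k) \<Longrightarrow> (\<Sum>i\<in>I. f i) \<in> Q k"
proof (induction I rule: infinite_finite_induct)
 case (insert x F)
 then show ?case using Q_add[of "f x" k "sum f F"] by simp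
qed (use Q_elt[of 0 "\<lambda>_. 0" 0 k] in \<open>simp_all add: elt_def\<close>)

lemma Q_term:
 assumes "j < m" "x \<in> cocycles B" "part 0 x = 0 \<or> j < k" shows "\<omega> j \<diamondop> h x \<in> Q k"
proof -
 have "elt 0 (\<lambda>i. if i = j then x else 0) = (\<Sum>i<m. if i = j then \<omega> j \<diamondop> h x else 0)"
  unfolding elt_def by (simp add: if_distrib cong: if_cong)
 then have "elt 0 (\<lambda>i. if i = j then x else 0) = \<omega> j \<diamondop> h x" using assms(1) by simp
 then show ?thesis using Q_elt[of 0 "\<lambda>i. if i = j then x else 0" "\<omega> j \<diamondop> h x" k] assms by auto
qed

text \<open>By the Arnold relation, or by the vanishing of squares if i = j, a product of two fibre
  classes has only coefficients of positive degree from B.\<close>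

lemma omega_omega_Q:
 assumes i: "i < m" "j < m" and x: "x \<in> cocycles B" shows "\<omega> i \<diamondop> h x \<diamondop> \<omega> j \<in> Q 0"
proof -
 obtain x' where x': "x' \<in> cocycles B" "coh M (h x \<diamondop> \<omega> j) (\<omega> j \<diamondop> h x')"
  using commute[OF \<omega>_cocycle[OF i(2)] \<omega>1[OF i(2)] x] by blast
 have hx: "h x \<in> cocycles M" "h x' \<in> cocycles M" using h_cocycle x x' by auto
 have e: "coh M (\<omega> i \<diamondop> h x \<diamondop> \<omega> j) ((\<omega> i \<diamondop> \<omega> j) \<diamondop> h x')"
  unfolding cup_assoc by (intro coh_cup_right x' \<omega>_cocycle i)
 have "(\<omega> i \<diamondop> \<omega> j) \<diamondop> h x' \<in> Q 0"
 proof (cases "i = j")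
  case True
  have sq: "coh M ((\<omega> i \<diamondop> \<omega> j) \<diamondop> h x') (0 \<diamondop> h x')"
   unfolding True using cup_square_coboundary[OF \<omega>_cocycle[OF i(2)] \<omega>1[OF i(2)]]
   by (intro coh_cup_left hx) (simp add: coh_zero)
  have "0 \<diamondop> h x' \<in> Q 0" using Q_sum[of "{}" _ 0] by simp
  then show ?thesis using Q_coh coh_sym[OF sq] by blast
 next
  case False
  obtain \<theta> where \<theta>: "\<theta> \<in> cocycles B" "part 0 \<theta> = 0" "coh M (\<omega> i \<diamondop> \<omega> j) (\<omega> i \<diamondop> h \<theta> - \<omega> j \<diamondop> h \<theta>)"
   using arnold[OF i False] by blast
  let ?y = "cup_product B \<theta> x'"
  have y: "?y \<in> cocycles B" "part 0 ?y = 0" using cup_cocycles[OF \<theta>(1) x'(1)] \<theta>(2) by (simp_all add: part_0_cup)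
  have "coh M ((\<omega> i \<diamondop> \<omega> j) \<diamondop> h x') ((\<omega> i \<diamondop> h \<theta> - \<omega> j \<diamondop> h \<theta>) \<diamondop> h x')"
   by (intro coh_cup_left \<theta> hx)
  also have "(\<omega> i \<diamondop> h \<theta> - \<omega> j \<diamondop> h \<theta>) \<diamondop> h x' = \<omega> i \<diamondop> h ?y + - (\<omega> j \<diamondop> h ?y)"
   by (simp add: cup_diff_left cup_assoc h_cup)
  finally show ?thesis using Q_coh[OF Q_add[OF Q_term[OF i(1) y(1)] Q_uminus[OF Q_term[OF i(2) y(1)]]]] y(2) coh_sym by blast
 qed
 then show ?thesis using Q_coh coh_sym[OF e] by blast
qed

lemma elt_omega:
 assumes i: "i < m" and b: "\<beta> \<in> cocycles B" "\<And>j. j < m \<Longrightarrow> \<gamma> j \<in> cocycles B" and k: "part 0 \<beta> = 0 \<or> i < k"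
 shows "elt \<beta> \<gamma> \<diamondop> \<omega> i \<in> Q k"
proof -
 obtain \<beta>' where b': "\<beta>' \<in> cocycles B" "part 0 \<beta>' = part 0 \<beta>" "coh M (h \<beta> \<diamondop> \<omega> i) (\<omega> i \<diamondop> h \<beta>')"
  using commute[OF \<omega>_cocycle[OF i] \<omega>1[OF i] b(1)] by blast
 have "h \<beta> \<diamondop> \<omega> i \<in> Q k" using Q_coh[OF Q_term[OF i b'(1)] coh_sym[OF b'(3)]] k b'(2) by simp
 moreover have "(\<Sum>j<m. \<omega> j \<diamondop> h (\<gamma> j) \<diamondop> \<omega> i) \<in> Q k"
  by (intro Q_sum Q_mono[OF omega_omega_Q]) (use i b in auto)
 ultimately show ?thesis unfolding elt_def cup_add_left cup_sum_left by (rule Q_add)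
qed

lemma cspan_gens_ge: "k \<le> m \<Longrightarrow> cspan M gens (n + k) = Q k"
proof (induction k)
 case 0
 have "free_upto 0 = (\<lambda>_. P)" by (rule ext) (simp add: free_upto_def)
 then show ?case using cspan_gens_le[OF order_refl] unfolding flag(6) by simp
next
 case (Suc k)
 have k: "k < m" using Suc.prems by simp
 have gk: "gens (n + k) = \<omega> k" by (simp add: gens_def)
 show ?case
 proof (intro equalityI subsetI)
  fix f assume "f \<in> cspan M gens (n + Suc k)"
  then have "f \<in> cspan M gens (Suc (n + k))" by simp
  then obtain u a where f: "f = u + a \<diamondop> \<omega> k" "u \<in> cspan M gens (n + k)" "a \<in> cocycles M"
   unfolding gk[symmetric] by (rule cspan_SucE)
  have u: "u \<in> Q (Suc k)" using f(2) Suc Q_mono[of u k "Suc k"] by simp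
  obtain \<beta> \<gamma> where b: "\<beta> \<in> cocycles B" "\<And>j. j < m \<Longrightarrow> \<gamma> j \<in> cocycles B" "coh M a (elt \<beta> \<gamma>)"
   using elt_exists[OF f(3)] by blast
  have "elt \<beta> \<gamma> \<diamondop> \<omega> k \<in> Q (Suc k)" by (rule elt_omega[OF k b(1,2)]) auto
  then have "a \<diamondop> \<omega> k \<in> Q (Suc k)" using Q_coh coh_sym[OF coh_cup_left[OF b(3) \<omega>_cocycle[OF k]]] by blast
  then show "f \<in> Q (Suc k)" unfolding f(1) by (rule Q_add[OF u])
 next
  fix f assume f: "f \<in> Q (Suc k)"
  obtain \<beta> \<gamma> where b: "\<beta> \<in> cocycles B" "\<And>j. j < m \<Longrightarrow> \<gamma> j \<in> cocycles B" "coh M f (elt \<beta> \<gamma>)"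
   using elt_exists[OF Q_cocycle[OF f]] by blast
  have p: "part 0 \<beta> = 0" "\<And>j. j < m \<Longrightarrow> Suc k \<le> j \<Longrightarrow> part 0 (\<gamma> j) = 0" using Q_elt[OF b, of "Suc k"] f by auto
  \<comment> \<open>Allowing the coefficient of \<omega> k to be arbitrary adds only an integer in
    degree zero, that is, an integral multiple of the new generator.\<close>
  obtain z where z: "part 0 (\<gamma> k) = const_cochain B z" using flag(2) b(2)[OF k] by blast
  let ?\<gamma> = "\<lambda>j. \<gamma> j - (if j = k then const_cochain B z else 0)"
  let ?a = "const_cochain M z"
  have c: "const_cochain M z \<diamondop> \<omega> k = \<omega> k \<diamondop> h (const_cochain B z)"
   using \<omega>_cocycle[OF k] by (simp add: pull_const[OF cont] cup_const_left cup_const_right cocyclesD)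
  have "elt 0 (\<lambda>j. if j = k then const_cochain B z else 0) = (\<Sum>i<m. if i = k then \<omega> k \<diamondop> h (const_cochain B z) else 0)"
   unfolding elt_def by (simp add: if_distrib cong: if_cong)
  then have "elt 0 (\<lambda>j. if j = k then const_cochain B z else 0) = const_cochain M z \<diamondop> \<omega> k" using k c by simp
  then have e: "elt \<beta> \<gamma> = elt \<beta> ?\<gamma> + const_cochain M z \<diamondop> gens (n + k)"
   unfolding gk using elt_add[of \<beta> ?\<gamma> 0 "\<lambda>j. if j = k then const_cochain B z else 0"] by simp
  have "elt \<beta> ?\<gamma> \<in> Q k"
   using Q_elt[of \<beta> ?\<gamma> "elt \<beta> ?\<gamma>" k] b p z by (auto simp: part_diff Suc_le_eq)
  then have "elt \<beta> ?\<gamma> \<in> cspan M gens (n + k)" using Suc by simp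
  then have "elt \<beta> \<gamma> \<in> cspan M gens (Suc (n + k))" unfolding e by (intro cspan_SucI) simp_all
  then have "f \<in> cspan M gens (Suc (n + k))" by (rule cspan_coh[OF _ coh_sym[OF b(3)]])
  then show "f \<in> cspan M gens (n + Suc k)" by (simp only: add_Suc_right)
 qed
qed

lemma part_0_elt: "part 0 (elt \<beta> \<gamma>) = h (part 0 \<beta>)"
proof -
 have "part 0 (\<omega> j \<diamondop> h (\<gamma> j)) = 0" if "j < m" for j using part_cup_0[OF \<omega>1[OF that]] .
 then show ?thesis by (simp add: elt_def part_add part_sum part_pull)
qed

lemma h_part_0:
 assumes "\<beta> \<in> cocycles B" "h (part 0 \<beta>) = 0" shows "part 0 \<beta> = 0"
proof -
 have "elt (part 0 \<beta>) (\<lambda>_. 0) \<in> coboundaries M" using assms by (simp add: elt_def)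
 then have "part 0 \<beta> \<in> coboundaries B" using elt_zero(1)[of "part 0 \<beta>" "\<lambda>_. 0"] assms by simp
 then have "part 0 (part 0 \<beta>) = part 0 0" by (intro coh_part_0) (simp add: coh_zero)
 then show ?thesis using concentrated_eq[OF concentrated_part, of 0 \<beta>] by simp
qed

lemma Q_m: "Q m = {f \<in> cocycles M. part 0 f = 0}"
proof -
 have "f \<in> Q m \<longleftrightarrow> part 0 f = 0" if f: "f \<in> cocycles M" for f
 proof -
  obtain \<beta> \<gamma> where b: "\<beta> \<in> cocycles B" "\<And>j. j < m \<Longrightarrow> \<gamma> j \<in> cocycles B" "coh M f (elt \<beta> \<gamma>)"
   using elt_exists[OF f] by blast
  have "part 0 f = h (part 0 \<beta>)" using coh_part_0[OF b(3)] part_0_elt by simp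
  then have "part 0 f = 0 \<longleftrightarrow> part 0 \<beta> = 0" using h_part_0[OF b(1)] by auto
  then show ?thesis using Q_elt[OF b, of m] by auto
 qed
 then show ?thesis using Q_cocycle by auto
qed

text \<open>Classes of positive degree multiply \<omega> k into the ideal since products of fibre
  classes do not create coefficients of degree zero. The degree zero part of a is an integer z, and
  z \<omega> k lies in the ideal only for z = 0, by uniqueness of coefficients.\<close>

lemma omega_colon:
 assumes k: "k < m" and a: "a \<in> cocycles M" shows "a \<diamondop> \<omega> k \<in> Q k \<longleftrightarrow> part 0 a = 0"
proof -
 have *: "f \<diamondop> \<omega> k \<in> Q k" if f: "f \<in> cocycles M" "part 0 f = 0" for f
 proof -
  obtain \<beta> \<gamma> where b: "\<beta> \<in> cocycles B" "\<And>j. j < m \<Longrightarrow> \<gamma> j \<in> cocycles B" "coh M f (elt \<beta> \<gamma>)"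
   using elt_exists[OF f(1)] by blast
  have "h (part 0 \<beta>) = 0" using coh_part_0[OF b(3)] part_0_elt f(2) by simp
  then have "elt \<beta> \<gamma> \<diamondop> \<omega> k \<in> Q k" using h_part_0[OF b(1)] by (intro elt_omega k b) auto
  then show ?thesis using Q_coh coh_sym[OF coh_cup_left[OF b(3) \<omega>_cocycle[OF k]]] by blast
 qed
 obtain z where z: "part 0 a = const_cochain M z"
 proof -
  obtain \<beta> \<gamma> where b: "\<beta> \<in> cocycles B" "coh M a (elt \<beta> \<gamma>)" using elt_exists[OF a] by blast
  obtain z where "part 0 \<beta> = const_cochain B z" using flag(2) b(1) by blast
  then show thesis using that coh_part_0[OF b(2)] part_0_elt pull_const[OF cont] by simp
 qed
 have "part 0 a = 0" if "a \<diamondop> \<omega> k \<in> Q k"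
 proof -
  have "part 0 (a - const_cochain M z) = 0" using z by (simp add: part_diff)
  then have "(a - const_cochain M z) \<diamondop> \<omega> k \<in> Q k" using a by (intro *) simp_all
  from Q_add[OF that Q_uminus[OF this]] have "const_cochain M z \<diamondop> \<omega> k \<in> Q k" by (simp add: cup_diff_left)
  moreover have "const_cochain M z \<diamondop> \<omega> k = \<omega> k \<diamondop> h (const_cochain B z)"
   using \<omega>_cocycle[OF k] by (simp add: pull_const[OF cont] cup_const_left cup_const_right cocyclesD)
  moreover have "elt 0 (\<lambda>j. if j = k then const_cochain B z else 0) = (\<Sum>i<m. if i = k then \<omega> k \<diamondop> h (const_cochain B z) else 0)"
   unfolding elt_def by (simp add: if_distrib cong: if_cong)
  ultimately have "elt 0 (\<lambda>j. if j = k then const_cochain B z else 0) \<in> Q k" using k by simp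
  then have "part 0 (const_cochain B z) = 0" using Q_elt[of 0 "\<lambda>j. if j = k then const_cochain B z else 0" _ k] k by auto
  then have "h (const_cochain B z) = 0" by simp
  then show ?thesis using z pull_const[OF cont] by simp
 qed
 then show ?thesis using *[OF a] by blast
qed

theorem flag_extension: "cochain_flag M (n + m) gens colons" unfolding cochain_flag_def
proof (intro conjI allI ballI impI)
 show "topspace M \<noteq> {}"
 proof
  assume "topspace M = {}"
  then have "\<not> singular_simplex p M \<sigma>" for p \<sigma> unfolding singular_simplex_def using nonempty_standard_simplex[of p]
   by (auto simp: continuous_map_def Pi_iff)
  \<comment> \<open>Pullback is injective on closed cochains of degree zero, so an empty M would
    kill the unit of the nonempty B.\<close>
  then have "h (part 0 (one_cochain B)) = 0" by (simp add: pull_def zero_fun_def)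
  then have "part 0 (one_cochain B) = 0" by (intro h_part_0) simp_all
  then show False using const_cochain_eq_0[OF flag(1), of 1] by (simp add: const_cochain_1[symmetric])
 qed
next
 fix f assume f: "f \<in> cocycles M"
 obtain \<beta> \<gamma> where b: "\<beta> \<in> cocycles B" "coh M f (elt \<beta> \<gamma>)" using elt_exists[OF f] by blast
 obtain z where "part 0 \<beta> = const_cochain B z" using flag(2) b(1) by blast
 then show "\<exists>z. part 0 f = const_cochain M z" using coh_part_0[OF b(2)] part_0_elt pull_const[OF cont] by metis
next
 show "gens i \<in> cocycles M" if "i < n + m" for i using that h_cocycle[OF flag(3)] \<omega>_cocycle by (auto simp: gens_def)
 show "concentrated 1 (gens i)" if "i < n + m" for i using that concentrated_pull[OF flag(4)] \<omega>1 by (auto simp: gens_def)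
 show "colons i \<le> n + m" if "i < n + m" for i using that flag(5)[of i] by (auto simp: colons_def)
 show "cspan M gens (n + m) = {f \<in> cocycles M. part 0 f = 0}" using cspan_gens_ge[of m] Q_m by simp
next
 fix i a assume i: "i < n + m" and a: "a \<in> cocycles M"
 show "a \<diamondop> gens i \<in> cspan M gens i \<longleftrightarrow> a \<in> cspan M gens (colons i)"
 proof (cases "i < n")
  case True
  have g: "gens i = h (\<xi> i)" and c: "colons i = c i" using True by (simp_all add: gens_def colons_def)
  have le: "i \<le> n" "c i \<le> n" using True flag(5) by auto
  obtain \<beta> \<gamma> where b: "\<beta> \<in> cocycles B" "\<And>j. j < m \<Longrightarrow> \<gamma> j \<in> cocycles B" "coh M a (elt \<beta> \<gamma>)"
   using elt_exists[OF a] by blast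
  have \<xi>: "\<xi> i \<in> cocycles B" by (rule flag(3)[OF True])
  have "coh M (a \<diamondop> h (\<xi> i)) (elt (cup_product B \<beta> (\<xi> i)) (\<lambda>j. cup_product B (\<gamma> j) (\<xi> i)))"
   unfolding elt_cup_h[symmetric] by (intro coh_cup_left b h_cocycle \<xi>)
  then have "a \<diamondop> h (\<xi> i) \<in> cspan M gens i \<longleftrightarrow>
   cup_product B \<beta> (\<xi> i) \<in> cspan B \<xi> i \<and> (\<forall>j<m. cup_product B (\<gamma> j) (\<xi> i) \<in> cspan B \<xi> i)"
   unfolding cspan_gens_le[OF le(1)] by (intro coefs_elt saturated_cspan[OF le(1)] cup_cocycles b \<xi>)
  also have "\<dots> \<longleftrightarrow> \<beta> \<in> cspan B \<xi> (c i) \<and> (\<forall>j<m. \<gamma> j \<in> cspan B \<xi> (c i))"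
   using flag(7)[OF True] b by simp
  also have "\<dots> \<longleftrightarrow> a \<in> cspan M gens (c i)" unfolding cspan_gens_le[OF le(2)]
   by (rule coefs_elt[symmetric, OF saturated_cspan[OF le(2)] saturated_cspan[OF le(2)] b])
  finally show ?thesis unfolding g c .
 next
  case False
  then obtain k where k: "i = n + k" "k < m" using i by (metis add_less_cancel_left le_Suc_ex not_le)
  have g: "gens i = \<omega> k" and c: "colons i = n + m" using k by (simp_all add: gens_def colons_def)
  have "a \<diamondop> \<omega> k \<in> cspan M gens (n + k) \<longleftrightarrow> a \<in> cspan M gens (n + m)"
   using omega_colon[OF k(2) a] cspan_gens_ge[of k] cspan_gens_ge[of m] Q_m k a by simp
  then show ?thesis unfolding k(1) g[unfolded k(1)] c[unfolded k(1)] .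
 qed
qed

end


section \<open>Passage from cocycles to the graded ring of classes, and the induction step for
  towers\<close>

section \<open>The cohomology ring as a graded ring\<close>

abbreviation (input) "HR \<equiv> cohomology_ring"

lemma cochain_ring_sel [simp]:
 "carrier (cochain_ring X) = cochains X" "x \<otimes>\<^bsub>cochain_ring X\<^esub> y = cup_product X x y"
 "\<one>\<^bsub>cochain_ring X\<^esub> = one_cochain X" "\<zero>\<^bsub>cochain_ring X\<^esub> = 0" "x \<oplus>\<^bsub>cochain_ring X\<^esub> y = x + y"
 by (simp_all add: cochain_ring_def one_cochain_def zero_cochain plus_fun_def)

lemma cocycle_ring_sel [simp]:
 "carrier (cocycle_ring X) = cocycles X" "x \<otimes>\<^bsub>cocycle_ring X\<^esub> y = cup_product X x y"
 "\<one>\<^bsub>cocycle_ring X\<^esub> = one_cochain X" "\<zero>\<^bsub>cocycle_ring X\<^esub> = 0" "x \<oplus>\<^bsub>cocycle_ring X\<^esub> y = x + y"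
 using cochain_ring_sel[of X] by (simp_all add: cocycle_ring_def)

lemma ring_cocycle_ring: "ring (cocycle_ring X)"
proof (rule ringI)
 show "abelian_group (cocycle_ring X)"
 proof (rule abelian_groupI)
  show "\<exists>y\<in>carrier (cocycle_ring X). y \<oplus>\<^bsub>cocycle_ring X\<^esub> x = \<zero>\<^bsub>cocycle_ring X\<^esub>" if "x \<in> carrier (cocycle_ring X)" for x
   using that by (intro bexI[of _ "- x"]) simp_all
 qed (simp_all add: add_ac)
 show "monoid (cocycle_ring X)" by (rule monoidI) (simp_all add: cup_cocycles cup_assoc cup_one_left cup_one_right cocyclesD)
qed (simp_all add: cup_add_left cup_add_right)

lemma ideal_coboundaries: "ideal (coboundaries X) (cocycle_ring X)"
proof (rule idealI[OF ring_cocycle_ring])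
 interpret ring "cocycle_ring X" by (rule ring_cocycle_ring)
 show "subgroup (coboundaries X) (add_monoid (cocycle_ring X))"
 proof (rule add.subgroupI)
  show "coboundaries X \<noteq> {}" using coboundaries_zero by blast
  fix a assume a: "a \<in> coboundaries X"
  then have "\<ominus>\<^bsub>cocycle_ring X\<^esub> a = - a" by (intro minus_equality) (simp_all add: coboundaries_cocycles)
  then show "\<ominus>\<^bsub>cocycle_ring X\<^esub> a \<in> coboundaries X" using a by simp
 qed (auto simp: coboundaries_cocycles)
qed (auto simp: cup_coboundary_left cup_coboundary_right)

definition cls :: "'a topology \<Rightarrow> 'a cochain \<Rightarrow> 'a cochain set" where
 "cls X f = coboundaries X +>\<^bsub>cocycle_ring X\<^esub> f"

lemma cls_altdef: "cls X f = {g + f | g. g \<in> coboundaries X}" by (auto simp: cls_def a_r_coset_def')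

lemma cls_eq_iff: "cls X f = cls X g \<longleftrightarrow> coh X f g"
proof
 assume "cls X f = cls X g"
 moreover have "0 + f \<in> cls X f" using coboundaries_zero unfolding cls_altdef by blast
 ultimately obtain e where "0 + f = e + g" "e \<in> coboundaries X" unfolding cls_altdef by blast
 then show "coh X f g" by (simp add: coh_def)
next
 have sub: "cls X f \<subseteq> cls X g" if "coh X f g" for f g
 proof
  fix y assume "y \<in> cls X f"
  then obtain e where "y = e + f" "e \<in> coboundaries X" unfolding cls_altdef by blast
  then have "y = (e + (f - g)) + g" "e + (f - g) \<in> coboundaries X" using that by (simp_all add: coh_def)
  then show "y \<in> cls X g" unfolding cls_altdef by blast
 qed
 show "coh X f g \<Longrightarrow> cls X f = cls X g" using sub[of f g] sub[of g f] coh_sym by blast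
qed

context
 fixes X :: "'a topology"
begin

interpretation J: ideal "coboundaries X" "cocycle_ring X" by (rule ideal_coboundaries)

lemma cohomology_carrier: "carrier (HR X) = cls X ` cocycles X" by (auto simp: cohomology_ring_def FactRing_def A_RCOSETS_def' cls_def)

lemma ring_cohomology: "ring (HR X)" unfolding cohomology_ring_def by (rule J.quotient_is_ring)

lemma cls_hom: "cls X \<in> ring_hom (cocycle_ring X) (HR X)" unfolding cls_def cohomology_ring_def by (rule J.rcos_ring_hom)

lemma cls_simps:
 "f \<in> cocycles X \<Longrightarrow> cls X f \<in> carrier (HR X)"
 "f \<in> cocycles X \<Longrightarrow> g \<in> cocycles X \<Longrightarrow> cls X f \<otimes>\<^bsub>HR X\<^esub> cls X g = cls X (cup_product X f g)"
 "f \<in> cocycles X \<Longrightarrow> g \<in> cocycles X \<Longrightarrow> cls X f \<oplus>\<^bsub>HR X\<^esub> cls X g = cls X (f + g)"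
 "\<one>\<^bsub>HR X\<^esub> = cls X (one_cochain X)" using ring_hom_memE[OF cls_hom] by simp_all

lemma cls_zero: "\<zero>\<^bsub>HR X\<^esub> = cls X 0" using ring_hom_zero[OF cls_hom ring_cocycle_ring ring_cohomology] by simp

lemma cls_eq_zero: "cls X f = \<zero>\<^bsub>HR X\<^esub> \<longleftrightarrow> f \<in> coboundaries X"
 by (simp add: cls_zero cls_eq_iff coh_zero)

lemma cohomology_part_altdef: "cohomology_part X k = cls X ` {f \<in> cocycles X. concentrated k f}"
 by (auto simp: cohomology_part_def concentrated_def cls_def)

interpretation H: ring "HR X" by (rule ring_cohomology)

lemma cls_uminus: "f \<in> cocycles X \<Longrightarrow> \<ominus>\<^bsub>HR X\<^esub> cls X f = cls X (- f)"
 by (rule H.minus_equality) (simp_all add: cls_simps cls_zero)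

lemma cls_sum:
 assumes "\<And>k. k \<in> K \<Longrightarrow> f k \<in> cocycles X" "finite K"
 shows "(\<Oplus>\<^bsub>HR X\<^esub>k\<in>K. cls X (f k)) = cls X (\<Sum>k\<in>K. f k)" using assms(2,1)
proof (induction K rule: finite_induct)
 case (insert k K)
 have "(\<Oplus>\<^bsub>HR X\<^esub>k\<in>insert k K. cls X (f k)) = cls X (f k) \<oplus>\<^bsub>HR X\<^esub> (\<Oplus>\<^bsub>HR X\<^esub>k\<in>K. cls X (f k))"
  using insert cls_simps(1) by (intro H.finsum_insert) auto
 then show ?case using insert cocycles_sum[of K f X] by (simp add: cls_simps)
qed (simp add: cls_zero)

lemma graded_ring_cohomology: "graded_ring (HR X) (cohomology_part X)"
proof (intro graded_ring.intro graded_ring_axioms.intro ring_cohomology)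
 fix k
 show "additive_subgroup (cohomology_part X k) (HR X)"
 proof (rule additive_subgroup.intro, rule H.add.subgroupI)
  show "cohomology_part X k \<subseteq> carrier (HR X)" by (auto simp: cohomology_part_altdef cohomology_carrier)
  show "cohomology_part X k \<noteq> {}" using concentrated_zero cocycles_zero unfolding cohomology_part_altdef by blast
 next
  fix a assume "a \<in> cohomology_part X k"
  then obtain f where f: "f \<in> cocycles X" "concentrated k f" "a = cls X f" by (auto simp: cohomology_part_altdef)
  have "concentrated k (- f)" using f(2) by (auto simp: concentrated_def fun_eq_iff uminus_apply)
  then show "\<ominus>\<^bsub>HR X\<^esub> a \<in> cohomology_part X k" using f cls_uminus[OF f(1)] by (auto simp: cohomology_part_altdef)
 next
  fix a b assume "a \<in> cohomology_part X k" "b \<in> cohomology_part X k"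
  then obtain f g where f: "f \<in> cocycles X" "concentrated k f" "a = cls X f" and g: "g \<in> cocycles X" "concentrated k g" "b = cls X g"
   by (auto simp: cohomology_part_altdef)
  have "concentrated k (f + g)" using f(2) g(2) by (auto simp: concentrated_def fun_eq_iff plus_fun_apply)
  then show "a \<oplus>\<^bsub>HR X\<^esub> b \<in> cohomology_part X k" using f g by (auto simp: cohomology_part_altdef cls_simps)
 qed
next
 show "\<one>\<^bsub>HR X\<^esub> \<in> cohomology_part X 0"
  using concentrated_const[of X 1] by (auto simp: cohomology_part_altdef cls_simps const_cochain_1)
next
 fix x i y j assume "x \<in> cohomology_part X i" "y \<in> cohomology_part X j"
 then show "x \<otimes>\<^bsub>HR X\<^esub> y \<in> cohomology_part X (i + j)"
  using concentrated_cup cup_cocycles by (fastforce simp: cohomology_part_altdef cls_simps)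
next
 fix x assume "x \<in> carrier (HR X)"
 then obtain f where f: "f \<in> cocycles X" "x = cls X f" by (auto simp: cohomology_carrier)
 let ?F = "\<lambda>g. (\<forall>k. g k \<in> cohomology_part X k) \<and> finite {k. g k \<noteq> \<zero>\<^bsub>HR X\<^esub>} \<and>
  x = (\<Oplus>\<^bsub>HR X\<^esub>k\<in>{k. g k \<noteq> \<zero>\<^bsub>HR X\<^esub>}. g k)"
 let ?S = "{k. f k \<noteq> (\<lambda>\<sigma>. 0)}"
 let ?C = "\<lambda>k. cls X (part k f)"
 have finS: "finite ?S" using cocyclesD[OF f(1)] by (simp add: cochains_def)
 have 0: "part k f = 0" if "k \<notin> ?S" for k using that by (auto simp: part_def fun_eq_iff zero_fun_apply)
 have sub: "{k. ?C k \<noteq> \<zero>\<^bsub>HR X\<^esub>} \<subseteq> ?S" using 0 by (auto simp: cls_zero)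
 have "(\<Oplus>\<^bsub>HR X\<^esub>k\<in>{k. ?C k \<noteq> \<zero>\<^bsub>HR X\<^esub>}. ?C k) = (\<Oplus>\<^bsub>HR X\<^esub>k\<in>?S. ?C k)"
  using finS sub f(1) by (intro H.add.finprod_mono_neutral_cong_left) (auto simp: cls_simps)
 also have "\<dots> = cls X (\<Sum>k\<in>?S. part k f)" using f(1) finS by (intro cls_sum) auto
 also have "\<dots> = x" using cochain_parts[OF cocyclesD[OF f(1)]] f(2) by simp
 finally have C: "?F ?C" using f(1) finite_subset[OF sub finS] by (auto simp: cohomology_part_altdef)
 show "\<exists>!g. ?F g"
 proof (rule ex1I[of ?F ?C, OF C])
  fix g assume g: "?F g"
  have "\<exists>f. f \<in> cocycles X \<and> concentrated k f \<and> g k = cls X f" for k using g by (force simp: cohomology_part_altdef)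
  then obtain e where e: "\<And>k. e k \<in> cocycles X" "\<And>k. concentrated k (e k)" "\<And>k. g k = cls X (e k)" by metis
  let ?K = "{k. g k \<noteq> \<zero>\<^bsub>HR X\<^esub>}"
  have "cls X f = (\<Oplus>\<^bsub>HR X\<^esub>k\<in>?K. cls X (e k))" using g f(2) e(3) by simp
  also have "\<dots> = cls X (\<Sum>k\<in>?K. e k)" using g e(1) by (intro cls_sum) auto
  finally have fe: "coh X f (\<Sum>k\<in>?K. e k)" by (simp add: cls_eq_iff)
  show "g = ?C"
  proof
   fix k
   have "coh X (part k f) (\<Sum>j\<in>?K. part k (e j))" using coh_part[OF fe, of k] by (simp add: part_sum)
   also have "(\<Sum>j\<in>?K. part k (e j)) = (\<Sum>j\<in>?K. if k = j then e k else 0)"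
    by (rule sum.cong) (auto simp: part_concentrated[OF e(2)])
   also have "\<dots> = (if k \<in> ?K then e k else 0)" using sum.delta'[of ?K k "\<lambda>_. e k"] g by blast
   also have "coh X \<dots> (e k)" using e(3)[of k] cls_eq_zero[of "e k"] coh_sym[of X "e k" 0] by (auto simp: coh_zero)
   finally show "g k = ?C k" using e(3)[of k] coh_sym by (simp add: cls_eq_iff)
  qed
 qed
qed

lemma cls_int: "[(z::int)] \<cdot>\<^bsub>HR X\<^esub> \<one>\<^bsub>HR X\<^esub> = cls X (const_cochain X z)"
proof (induction z rule: int_induct[where k = 0])
 case base
 then show ?case by (simp add: add_pow_def cls_zero)
next
 case (step1 i)
 have "[(i + 1)] \<cdot>\<^bsub>HR X\<^esub> \<one>\<^bsub>HR X\<^esub> =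
  [i] \<cdot>\<^bsub>HR X\<^esub> \<one>\<^bsub>HR X\<^esub> \<oplus>\<^bsub>HR X\<^esub> [(1::int)] \<cdot>\<^bsub>HR X\<^esub> \<one>\<^bsub>HR X\<^esub>"
  by (simp only: H.add.int_pow_mult H.one_closed)
 then show ?case using step1 by (simp add: cls_simps const_cochain_add const_cochain_1)
next
 case (step2 i)
 have "[(i - 1)] \<cdot>\<^bsub>HR X\<^esub> \<one>\<^bsub>HR X\<^esub> =
  [i] \<cdot>\<^bsub>HR X\<^esub> \<one>\<^bsub>HR X\<^esub> \<oplus>\<^bsub>HR X\<^esub> [(- 1::int)] \<cdot>\<^bsub>HR X\<^esub> \<one>\<^bsub>HR X\<^esub>"
  using H.add.int_pow_mult[OF H.one_closed, of i "- 1"] by simp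
 also have "[(- 1::int)] \<cdot>\<^bsub>HR X\<^esub> \<one>\<^bsub>HR X\<^esub> = \<ominus>\<^bsub>HR X\<^esub> \<one>\<^bsub>HR X\<^esub>"
  using H.add.int_pow_neg[OF H.one_closed, of 1] by simp
 finally show ?case using step2 const_cochain_add[of X i "- 1"] by (simp add: cls_simps cls_uminus const_cochain_minus const_cochain_1)
qed

lemma lspan_cls:
 assumes "\<And>i. i < k \<Longrightarrow> \<xi> i \<in> cocycles X"
 shows "lspan (HR X) (\<lambda>i. cls X (\<xi> i)) k = cls X ` cspan X \<xi> k" using assms
proof (induction k)
 case 0
 have "cls X ` coboundaries X = {\<zero>\<^bsub>HR X\<^esub>}"
 proof (intro equalityI subsetI)
  show "y \<in> {\<zero>\<^bsub>HR X\<^esub>}" if "y \<in> cls X ` coboundaries X" for y using that cls_eq_zero by blast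
  show "y \<in> cls X ` coboundaries X" if "y \<in> {\<zero>\<^bsub>HR X\<^esub>}" for y using that cls_zero coboundaries_zero by blast
 qed
 then show ?case by simp
next
 case (Suc k)
 have \<xi>: "\<xi> k \<in> cocycles X" using Suc.prems by simp
 have u: "u \<in> cocycles X" if "u \<in> cspan X \<xi> k" for u using cspan_cocycles[OF _ that] Suc.prems by simp
 have "lspan (HR X) (\<lambda>i. cls X (\<xi> i)) (Suc k) =
  {cls X u \<oplus>\<^bsub>HR X\<^esub> cls X a \<otimes>\<^bsub>HR X\<^esub> cls X (\<xi> k) | u a. u \<in> cspan X \<xi> k \<and> a \<in> cocycles X}"
  using Suc by (auto simp: cohomology_carrier)
 also have "\<dots> = {cls X (u + cup_product X a (\<xi> k)) | u a. u \<in> cspan X \<xi> k \<and> a \<in> cocycles X}"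
  using u \<xi> by (metis (no_types, opaque_lifting) cls_simps(2,3) cup_cocycles)
 also have "\<dots> = cls X ` cspan X \<xi> (Suc k)" by auto
 finally show ?case .
qed

lemma cls_cspan: "cls X u \<in> cls X ` cspan X \<xi> k \<longleftrightarrow> u \<in> cspan X \<xi> k"
 using cspan_coh[OF _ coh_sym] by (auto simp: cls_eq_iff)

lemma exterior_flag_if_cochain_flag:
 assumes "cochain_flag X n \<xi> c"
 shows "exterior_flag (HR X) (cohomology_part X) n (\<lambda>i. cls X (\<xi> i)) c"
proof -
 interpret G: graded_ring "HR X" "cohomology_part X" by (rule graded_ring_cohomology)
 have fl: "topspace X \<noteq> {}" "\<And>f. f \<in> cocycles X \<Longrightarrow> \<exists>z. part 0 f = const_cochain X z"
  "\<And>i. i < n \<Longrightarrow> \<xi> i \<in> cocycles X" "\<And>i. i < n \<Longrightarrow> concentrated 1 (\<xi> i)" "\<And>i. i < n \<Longrightarrow> c i \<le> n"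
  "cspan X \<xi> n = {f \<in> cocycles X. part 0 f = 0}"
  "\<And>i a. i < n \<Longrightarrow> a \<in> cocycles X \<Longrightarrow> cup_product X a (\<xi> i) \<in> cspan X \<xi> i \<longleftrightarrow> a \<in> cspan X \<xi> (c i)"
  using assms unfolding cochain_flag_def by blast+
 \<comment> \<open>There are no nonzero coboundaries in degree zero, so in that degree a class has
   just one representative.\<close>
 have coh0: "coh X f g \<longleftrightarrow> f = g" if "concentrated 0 f" "concentrated 0 g" for f g
  using coh_part_0[of X f g] concentrated_eq[OF that(1)] concentrated_eq[OF that(2)] by auto
 have comp0: "G.comp (cls X f) 0 = cls X (part 0 f)" if f: "f \<in> cocycles X" for f
 proof -
  have "cls X f = cls X (part 0 f) \<oplus>\<^bsub>HR X\<^esub> cls X (f - part 0 f)" using f by (simp add: cls_simps)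
  moreover have "G.comp (cls X (f - part 0 f)) 0 = \<zero>\<^bsub>HR X\<^esub>"
  proof -
   let ?g = "f - part 0 f"
   let ?S = "{k. ?g k \<noteq> (\<lambda>\<sigma>. 0)}"
   have g: "?g \<in> cocycles X" using f by simp
   have fin: "finite ?S" using cocyclesD[OF g] by (simp add: cochains_def)
   have 0: "0 \<notin> ?S" by (simp add: part_def minus_apply zero_fun_def)
   have "cls X ?g = (\<Oplus>\<^bsub>HR X\<^esub>k\<in>?S. cls X (part k ?g))"
    using cls_sum[of ?S "\<lambda>k. part k ?g"] fin g cochain_parts[OF cocyclesD[OF g]] by simp
   also have "\<dots> = (\<Oplus>\<^bsub>HR X\<^esub>k\<in>?S. if k \<in> ?S then cls X (part k ?g) else \<zero>\<^bsub>HR X\<^esub>)"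
    using g by (intro H.finsum_cong') (auto simp: cls_simps)
   finally have "G.comp (cls X ?g) = (\<lambda>k. if k \<in> ?S then cls X (part k ?g) else \<zero>\<^bsub>HR X\<^esub>)"
   proof (intro G.comp_unique[of _ ?S] fin)
    show "(if k \<in> ?S then cls X (part k ?g) else \<zero>\<^bsub>HR X\<^esub>) \<in> cohomology_part X k" for k
     using g G.gr_zero[of k] by (cases "k \<in> ?S") (auto simp: cohomology_part_altdef)
   qed auto
   then show ?thesis using 0 by simp
  qed
  moreover have "G.comp (cls X (part 0 f)) 0 = cls X (part 0 f)"
   using G.comp_gr[of "cls X (part 0 f)" 0] f by (auto simp: cohomology_part_altdef)
  ultimately show ?thesis using G.comp_add[of "cls X (part 0 f)" "cls X (f - part 0 f)" 0] f by (simp add: cls_simps)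
 qed
 have pos: "G.pos = cls X ` cspan X \<xi> n"
 proof -
  have "part 0 f \<in> coboundaries X \<longleftrightarrow> part 0 f = 0" for f
   using coh0[OF concentrated_part concentrated_zero, of f] by (simp add: coh_zero)
  then have "G.pos = {cls X f | f. f \<in> cocycles X \<and> part 0 f = 0}"
   unfolding G.pos_def cohomology_carrier using comp0 cls_eq_zero by (auto simp: cls_zero)
  then show ?thesis unfolding fl(6) by auto
 qed
 show ?thesis
 proof (intro exterior_flag.intro graded_flag.intro graded_flag_axioms.intro exterior_flag_axioms.intro)
  show "graded_ring (HR X) (cohomology_part X)" by (rule graded_ring_cohomology)
  show "bij_betw (\<lambda>z::int. [z] \<cdot>\<^bsub>HR X\<^esub> \<one>\<^bsub>HR X\<^esub>) UNIV (cohomology_part X 0)"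
   unfolding cls_int
  proof (rule bij_betwI')
   fix a b :: int
   have "cls X (const_cochain X a) = cls X (const_cochain X b) \<longleftrightarrow> const_cochain X (a + - b) = 0"
    unfolding const_cochain_add const_cochain_minus by (simp add: cls_eq_iff coh0)
   then show "cls X (const_cochain X a) = cls X (const_cochain X b) \<longleftrightarrow> a = b"
    using const_cochain_eq_0[OF fl(1)] by simp
  next
   show "cls X (const_cochain X a) \<in> cohomology_part X 0" for a by (auto simp: cohomology_part_altdef)
  next
   fix y assume "y \<in> cohomology_part X 0"
   then obtain f where f: "f \<in> cocycles X" "concentrated 0 f" "y = cls X f" by (auto simp: cohomology_part_altdef)
   then show "\<exists>z\<in>UNIV. y = cls X (const_cochain X z)" using fl(2)[OF f(1)] concentrated_eq[OF f(2)] by auto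
  qed
  show "cls X (\<xi> i) \<in> cohomology_part X 1" if "i < n" for i using fl(3,4)[OF that] by (auto simp: cohomology_part_altdef)
  show "koszul_flag (HR X) G.pos n (\<lambda>i. cls X (\<xi> i)) c" unfolding koszul_flag_def
  proof (intro conjI allI impI ballI)
   fix i assume i: "i < n"
   show "cls X (\<xi> i) \<in> carrier (HR X)" "c i \<le> n" using fl(3,5)[OF i] cls_simps(1) by auto
   fix a assume "a \<in> carrier (HR X)"
   then obtain f where f: "f \<in> cocycles X" "a = cls X f" by (auto simp: cohomology_carrier)
   have le: "i \<le> n" "c i \<le> n" using i fl(5) by auto
   have sp: "lspan (HR X) (\<lambda>i. cls X (\<xi> i)) k = cls X ` cspan X \<xi> k" if "k \<le> n" for k
    using that fl(3) by (intro lspan_cls) simp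
   have "a \<otimes>\<^bsub>HR X\<^esub> cls X (\<xi> i) = cls X (cup_product X f (\<xi> i))"
    using f fl(3)[OF i] by (simp add: cls_simps)
   then show "a \<otimes>\<^bsub>HR X\<^esub> cls X (\<xi> i) \<in> lspan (HR X) (\<lambda>i. cls X (\<xi> i)) i \<longleftrightarrow>
     a \<in> lspan (HR X) (\<lambda>i. cls X (\<xi> i)) (c i)"
    unfolding sp[OF le(1)] sp[OF le(2)] f(2) using fl(7)[OF i f(1)] by (simp add: cls_cspan)
  next
   show "lspan (HR X) (\<lambda>i. cls X (\<xi> i)) n = G.pos" unfolding pos by (rule lspan_cls[OF fl(3)])
  qed
  show "v \<otimes>\<^bsub>HR X\<^esub> v = \<zero>\<^bsub>HR X\<^esub>" if v: "v \<in> cohomology_part X 1" for v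
  proof -
   obtain f where f: "f \<in> cocycles X" "concentrated 1 f" "v = cls X f" using v unfolding cohomology_part_altdef by blast
   show ?thesis using cls_eq_zero[of "cup_product X f f"] cup_square_coboundary[OF f(1,2)] f by (simp add: cls_simps)
  qed
 qed
qed

end

definition flagged :: "'a topology \<Rightarrow> bool" where
 "flagged X \<longleftrightarrow> (\<exists>n \<xi> c. cochain_flag X n \<xi> c)"

theorem flagged_Koszul:
 assumes "flagged X"
 shows "Koszul (HR X) (cohomology_part X)"
  and "\<exists>\<phi> \<in> ring_iso (exterior_cohomology X Quot cup_kernel_ideal X) (HR X).
   \<forall>v \<in> cohomology_part X 1.
    \<phi> (cup_kernel_ideal X +>\<^bsub>exterior_cohomology X\<^esub> exterior_class (first_cohomology_group X) (frag_of [v])) = v"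
proof -
 obtain n \<xi> c where f: "cochain_flag X n \<xi> c" using assms by (auto simp: flagged_def)
 interpret X: exterior_flag "HR X" "cohomology_part X" n "\<lambda>i. cls X (\<xi> i)" c by (rule exterior_flag_if_cochain_flag[OF f])
 show "Koszul (HR X) (cohomology_part X)" by (rule X.flag_Koszul)
 show "\<exists>\<phi> \<in> ring_iso (exterior_cohomology X Quot cup_kernel_ideal X) (HR X).
   \<forall>v \<in> cohomology_part X 1.
    \<phi> (cup_kernel_ideal X +>\<^bsub>exterior_cohomology X\<^esub> exterior_class (first_cohomology_group X) (frag_of [v])) = v"
  using X.quadratic_presentation
  unfolding X.quadratic_ideal_def X.eval_class_def cup_kernel_ideal_def cup_map_def exterior_cohomology_def first_cohomology_group_def .
qed

text \<open>The start of the tower: the augmentation ideal is zero, and the empty flag generates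
  it.\<close>

lemma flagged_point:
 assumes X: "topspace X = {x}" shows "flagged X"
proof -
 have u: "\<sigma> = (\<lambda>y\<in>standard_simplex p. x)" if "singular_simplex p X \<sigma>" for p \<sigma>
  using that X unfolding singular_simplex_def continuous_map_def by (auto simp: fun_eq_iff Pi_iff extensional_def)
 have "\<exists>z. part 0 f = const_cochain X z" if f: "f \<in> cocycles X" for f
 proof (rule exI, intro ext)
  fix p \<sigma>
  show "part 0 f p \<sigma> = const_cochain X (f 0 (\<lambda>y\<in>standard_simplex 0. x)) p \<sigma>"
   using u[of p \<sigma>] cochainsD[OF cocyclesD[OF f], of 0 \<sigma>]
   by (cases "singular_simplex p X \<sigma>") (auto simp: part_def const_cochain_def one_cochain_def)
 qed
 moreover have "coboundaries X = {f \<in> cocycles X. part 0 f = 0}"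
 proof (intro equalityI subsetI)
  fix f assume f: "f \<in> coboundaries X"
  then show "f \<in> {f \<in> cocycles X. part 0 f = 0}" using coboundaries_cocycles coh_part_0[of X f 0] by (auto simp: coh_zero)
 next
  fix f assume f: "f \<in> {f \<in> cocycles X. part 0 f = 0}"
  have "part k f \<in> coboundaries X" for k using f point_cocycle_coboundary[OF X, of "part k f" k] by (cases "k = 0") auto
  then have "(\<Sum>k | f k \<noteq> (\<lambda>\<sigma>. 0). part k f) \<in> coboundaries X" by (intro coboundaries_sum)
  then show "f \<in> coboundaries X" using cochain_parts[OF cocyclesD[of f X]] f by simp
 qed
 ultimately have "cochain_flag X 0 (\<lambda>_. 0) (\<lambda>_. 0)" by (simp add: cochain_flag_def X)
 then show ?thesis unfolding flagged_def by blast
qed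

text \<open>The relations between the fibre classes: \<open>[f] [g] = [f] [h] - [g] [h]\<close> for \<open>h = f - g\<close>, where
 \<open>h\<close> is a difference of two of the sections, hence comes from the base.\<close>

theorem flagged_tower:
 fixes B :: "'b topology" and s :: "nat \<Rightarrow> 'b \<Rightarrow> complex" and m :: nat
 defines "M' \<equiv> subtopology (prod_topology B euclidean)
   {e \<in> topspace (prod_topology B euclidean). \<forall>j<m. snd e \<noteq> s j (fst e)}"
 assumes B: "flagged B"
  and cont: "\<And>j. j < m \<Longrightarrow> continuous_map B euclidean (s j)"
  and disj: "\<And>i j b. i < m \<Longrightarrow> j < m \<Longrightarrow> i \<noteq> j \<Longrightarrow> b \<in> topspace B \<Longrightarrow> s i b \<noteq> s j b"
  and \<phi>: "continuous_map M M' \<phi>" and \<psi>: "continuous_map M' M \<psi>"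
  and \<phi>\<psi>: "\<And>x. x \<in> topspace M' \<Longrightarrow> \<phi> (\<psi> x) = x" and \<psi>\<phi>: "\<And>x. x \<in> topspace M \<Longrightarrow> \<psi> (\<phi> x) = x"
 shows "flagged M"
proof -
 obtain n \<xi> c where fl: "cochain_flag B n \<xi> c" using B by (auto simp: flagged_def)
 let ?f = "\<lambda>j x. snd (\<phi> x) - s j (fst (\<phi> x))"
 let ?\<pi> = "fst \<circ> \<phi>"
 have contM'fst: "continuous_map M' B fst" and contM'snd: "continuous_map M' euclidean snd"
  unfolding M'_def by (auto intro: continuous_map_from_subtopology continuous_map_fst continuous_map_snd)
 have cont\<pi>: "continuous_map M B ?\<pi>" by (rule continuous_map_compose[OF \<phi> contM'fst])
 have M'top: "\<phi> x \<in> topspace M'" if "x \<in> topspace M" for x using \<phi> that by (auto simp: continuous_map_def Pi_iff)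
 have nzf: "nonzero_map M' (\<lambda>e. snd e - s j (fst e))" if j: "j < m" for j
 proof
  have "continuous_map M' euclidean (s j \<circ> fst)" by (rule continuous_map_compose[OF contM'fst cont[OF j]])
  then show "continuous_map M' euclidean (\<lambda>e. snd e - s j (fst e))"
   using contM'snd by (intro continuous_map_diff) (simp_all add: o_def)
 qed (use j in \<open>auto simp: M'_def\<close>)
 have nz: "nonzero_map M (?f j)" if j: "j < m" for j
 proof -
  interpret nonzero_map M' "\<lambda>e. snd e - s j (fst e)" by (rule nzf[OF j])
  show ?thesis
  proof
   show "continuous_map M euclidean (?f j)" using continuous_map_compose[OF \<phi> cont] by (simp add: o_def)
  qed (use nz M'top in blast)
 qed
 have "fibre_basis B M ?\<pi> m (\<lambda>j. pull M \<phi> (wind_cochain M' (\<lambda>e. snd e - s j (fst e))))" unfolding M'_def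
  by (intro fibre_basis_homeomorphic[OF \<phi>[unfolded M'_def] \<psi>[unfolded M'_def] \<phi>\<psi>[unfolded M'_def] \<psi>\<phi>]
    fibre_basis_graph_complement cont disj)
 then have fb: "fibre_basis B M ?\<pi> m (\<lambda>j. pull M \<phi> (wind_cochain M' (\<lambda>e. snd e - s j (fst e))))" .
 let ?\<omega> = "\<lambda>j. pull M \<phi> (wind_cochain M' (\<lambda>e. snd e - s j (fst e)))"
 have \<omega>: "?\<omega> j = wind_cochain M (?f j)" if "j < m" for j using pull_wind_cochain[OF \<phi>] by (simp add: o_def)
 interpret F: fibre_flag B M ?\<pi> m ?\<omega> n \<xi> c
 proof
  show "cochain_flag B n \<xi> c" by (rule fl)
  show "continuous_map M B ?\<pi>" by (rule cont\<pi>)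
  show "fibre_basis B M ?\<pi> m ?\<omega>" by (rule fb)
  show "concentrated 1 (?\<omega> j)" for j by (intro concentrated_pull concentrated_wind)
  fix i j assume ij: "i < m" "j < m" "i \<noteq> j"
  have hB: "nonzero_map B (\<lambda>b. s j b - s i b)"
   by unfold_locales (use ij disj in \<open>auto intro!: continuous_map_diff cont\<close>)
  interpret hB: nonzero_map B "\<lambda>b. s j b - s i b" by (rule hB)
  have hM: "nonzero_map M ((\<lambda>b. s j b - s i b) \<circ> ?\<pi>)"
  proof
   show "continuous_map M euclidean ((\<lambda>b. s j b - s i b) \<circ> ?\<pi>)" by (rule continuous_map_compose[OF cont\<pi> hB.cont])
   show "((\<lambda>b. s j b - s i b) \<circ> ?\<pi>) x \<noteq> 0" if "x \<in> topspace M" for x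
    using hB.nz cont\<pi> that by (auto simp: continuous_map_def Pi_iff)
  qed
  let ?\<theta> = "wind_cochain B (\<lambda>b. s j b - s i b)"
  have "pull M ?\<pi> ?\<theta> = wind_cochain M ((\<lambda>b. s j b - s i b) \<circ> ?\<pi>)" by (rule pull_wind_cochain[OF cont\<pi>])
  moreover have "coh M (cup_product M (wind_cochain M (?f i)) (wind_cochain M (?f j)))
   (cup_product M (wind_cochain M (?f i)) (wind_cochain M ((\<lambda>b. s j b - s i b) \<circ> ?\<pi>)) -
    cup_product M (wind_cochain M (?f j)) (wind_cochain M ((\<lambda>b. s j b - s i b) \<circ> ?\<pi>)))"
   unfolding coh_def by (rule arnold_relation[OF nz[OF ij(1)] nz[OF ij(2)] hM]) simp
  ultimately show "\<exists>\<theta>\<in>cocycles B. part 0 \<theta> = 0 \<and>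
   coh M (cup_product M (?\<omega> i) (?\<omega> j)) (cup_product M (?\<omega> i) (pull M ?\<pi> \<theta>) - cup_product M (?\<omega> j) (pull M ?\<pi> \<theta>))"
   using \<omega>[OF ij(1)] \<omega>[OF ij(2)] hB.wind_cochain_cocycle
   by (intro bexI[of _ ?\<theta>]) (simp_all add: part_concentrated[OF concentrated_wind(1)])
 qed
 show ?thesis using F.flag_extension unfolding flagged_def by blast
qed

section \<open>Free abelian groups, handled by splitting off infinite cyclic summands\<close>

section \<open>Lattices\<close>

text \<open>A direct sum decomposition with K as one summand and a chosen generator l of the other,
  infinite cyclic one. Stating it as a bijection provides the two coordinates of an element.\<close>

definition split_off :: "('g, 'r) monoid_scheme \<Rightarrow> 'g \<Rightarrow> 'g set \<Rightarrow> bool" where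
 "split_off G l K \<longleftrightarrow> l \<in> carrier G \<and> subgroup K G \<and>
  bij_betw (\<lambda>(n::int, k). l [^]\<^bsub>G\<^esub> n \<otimes>\<^bsub>G\<^esub> k) (UNIV \<times> K) (carrier G)"

text \<open>Free abelian of rank d. The recursive form matches the construction of tori and of
  complements, which adds one coordinate at a time.\<close>

primrec lattice :: "nat \<Rightarrow> ('g, 'r) monoid_scheme \<Rightarrow> bool" where
 "lattice 0 G \<longleftrightarrow> comm_group G \<and> carrier G = {\<one>\<^bsub>G\<^esub>}"
| "lattice (Suc d) G \<longleftrightarrow> comm_group G \<and> (\<exists>l K. split_off G l K \<and> lattice d (G\<lparr>carrier := K\<rparr>))"

lemma lattice_comm_group: "lattice d G \<Longrightarrow> comm_group G" by (cases d) auto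

lemma (in comm_group) comm_group_subgroup:
 assumes "subgroup H G" shows "comm_group (G\<lparr>carrier := H\<rparr>)"
proof (rule group.group_comm_groupI[OF subgroup_imp_group[OF assms]])
 fix x y assume "x \<in> carrier (G\<lparr>carrier := H\<rparr>)" "y \<in> carrier (G\<lparr>carrier := H\<rparr>)"
 then show "x \<otimes>\<^bsub>G\<lparr>carrier := H\<rparr>\<^esub> y = y \<otimes>\<^bsub>G\<lparr>carrier := H\<rparr>\<^esub> x"
  using subgroup.subset[OF assms] by (simp add: m_comm subset_iff)
qed

lemma (in group) split_offI:
 assumes l: "l \<in> carrier G" and K: "subgroup K G"
  and inj: "\<And>n n' k k'. k \<in> K \<Longrightarrow> k' \<in> K \<Longrightarrow> l [^] (n::int) \<otimes> k = l [^] (n'::int) \<otimes> k' \<Longrightarrow> n = n'"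
  and surj: "\<And>x. x \<in> carrier G \<Longrightarrow> \<exists>n::int. \<exists>k\<in>K. x = l [^] n \<otimes> k"
 shows "split_off G l K"
proof -
 have Kc: "k \<in> carrier G" if "k \<in> K" for k using subgroup.subset[OF K] that by blast
 have "inj_on (\<lambda>(n::int, k). l [^] n \<otimes> k) (UNIV \<times> K)"
 proof (rule inj_onI, clarify)
  fix n k n' k' assume k: "k \<in> K" "k' \<in> K" and eq: "l [^] (n::int) \<otimes> k = l [^] (n'::int) \<otimes> k'"
  then have "n = n'" by (rule inj)
  then show "n = n' \<and> k = k'" using eq k Kc l by simp
 qed
 moreover have "(\<lambda>(n::int, k). l [^] n \<otimes> k) ` (UNIV \<times> K) = carrier G"
 proof (intro equalityI subsetI)
  fix x assume "x \<in> carrier G"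
  then obtain n :: int and k where "k \<in> K" "x = l [^] n \<otimes> k" using surj by blast
  then show "x \<in> (\<lambda>(n::int, k). l [^] n \<otimes> k) ` (UNIV \<times> K)" by (intro image_eqI[of _ _ "(n, k)"]) auto
 qed (use l Kc in auto)
 ultimately show ?thesis using l K by (simp add: split_off_def bij_betw_def)
qed

locale splitting = comm_group G for G (structure) +
 fixes l :: 'a and K :: "'a set"
 assumes split: "split_off G l K"
begin

lemma l: "l \<in> carrier G" and K: "subgroup K G"
 and bij: "bij_betw (\<lambda>(n::int, k). l [^] n \<otimes> k) (UNIV \<times> K) (carrier G)" using split by (auto simp: split_off_def)

lemma K_closed: "k \<in> K \<Longrightarrow> k \<in> carrier G" using subgroup.subset[OF K] by blast

text \<open>The exponent of l and, in \<open>kp\<close>, the component in K; both are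
  homomorphisms.\<close>

definition np :: "'a \<Rightarrow> int" where "np x = fst (the_inv_into (UNIV \<times> K) (\<lambda>(n::int, k). l [^] n \<otimes> k) x)"
definition kp :: "'a \<Rightarrow> 'a" where "kp x = snd (the_inv_into (UNIV \<times> K) (\<lambda>(n::int, k). l [^] n \<otimes> k) x)"

lemma parts_eq: "k \<in> K \<Longrightarrow> np (l [^] (n::int) \<otimes> k) = n" "k \<in> K \<Longrightarrow> kp (l [^] (n::int) \<otimes> k) = k"
proof -
 assume "k \<in> K"
 then have "the_inv_into (UNIV \<times> K) (\<lambda>(n::int, k). l [^] n \<otimes> k) (l [^] n \<otimes> k) = (n, k)"
  using the_inv_into_f_f[OF bij_betw_imp_inj_on[OF bij], of "(n, k)"] by simp
 then show "np (l [^] n \<otimes> k) = n" "kp (l [^] n \<otimes> k) = k" by (simp_all add: np_def kp_def)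
qed

lemma decomp_exists: "x \<in> carrier G \<Longrightarrow> \<exists>n::int. \<exists>k\<in>K. x = l [^] n \<otimes> k"
 using bij_betw_imp_surj_on[OF bij] by (auto simp: image_def)

lemma kp_in: "x \<in> carrier G \<Longrightarrow> kp x \<in> K" and decomp: "x \<in> carrier G \<Longrightarrow> x = l [^] np x \<otimes> kp x"
 using decomp_exists parts_eq by force+

lemma parts_K: "k \<in> K \<Longrightarrow> np k = 0" "k \<in> K \<Longrightarrow> kp k = k" using parts_eq[of k 0] K_closed by auto

lemma parts_l: "np l = 1" "kp l = \<one>" using parts_eq[OF subgroup.one_closed[OF K], of 1] l by auto

lemma parts_mult:
 assumes "x \<in> carrier G" "y \<in> carrier G"
 shows "np (x \<otimes> y) = np x + np y" "kp (x \<otimes> y) = kp x \<otimes> kp y"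
proof -
 have c: "kp x \<in> carrier G" "kp y \<in> carrier G" using kp_in K_closed assms by auto
 have "x \<otimes> y = (l [^] np x \<otimes> kp x) \<otimes> (l [^] np y \<otimes> kp y)" using decomp assms by simp
 also have "\<dots> = l [^] (np x + np y) \<otimes> (kp x \<otimes> kp y)" using c l by (simp add: int_pow_mult[symmetric] m_ac)
 finally have "x \<otimes> y = l [^] (np x + np y) \<otimes> (kp x \<otimes> kp y)" .
 then show "np (x \<otimes> y) = np x + np y" "kp (x \<otimes> y) = kp x \<otimes> kp y"
  using parts_eq[of "kp x \<otimes> kp y"] kp_in assms subgroup.m_closed[OF K] by auto
qed

lemma np_hom: "np \<in> hom G integer_group" by (rule homI) (auto simp: parts_mult)

lemma kp_hom: "kp \<in> hom G (G\<lparr>carrier := K\<rparr>)" by (rule homI) (auto simp: parts_mult kp_in)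

lemma np_pow: "x \<in> carrier G \<Longrightarrow> np (x [^] (n::int)) = n * np x"
 using hom_int_pow[OF np_hom _ is_group group_integer_group, of x n] by simp

lemma pow_K: "k \<in> K \<Longrightarrow> k [^]\<^bsub>G\<lparr>carrier := K\<rparr>\<^esub> (n::int) = k [^] n"
 using int_pow_consistent[OF K] by simp

end

lemma splittingI: "comm_group G \<Longrightarrow> split_off G l K \<Longrightarrow> splitting G l K"
 by (simp add: splitting_def splitting_axioms_def)

lemma lattice_free_Abelian_group:
 assumes "comm_group G" "h \<in> iso (free_Abelian_group {..<d}) G" shows "lattice d G" using assms
proof (induction d arbitrary: G h)
 case 0
 interpret G: comm_group G by (rule 0)
 have h: "h \<in> hom (free_Abelian_group {}) G" "bij_betw h (carrier (free_Abelian_group {})) (carrier G)" using 0 by (auto simp: iso_def)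
 have "carrier (free_Abelian_group ({} :: nat set)) = {0}" by (auto simp: free_Abelian_group_def)
 then have "carrier G = {h 0}" using h(2) by (auto simp: bij_betw_def)
 moreover have "\<one>\<^bsub>G\<^esub> \<in> carrier G" using 0(1) by (simp add: G.one_closed)
 ultimately show ?case using 0(1) by auto
next
 case (Suc d)
 interpret G: comm_group G by (rule Suc.prems)
 let ?F = "free_Abelian_group {..<Suc d}" and ?S = "carrier (free_Abelian_group {..<d})"
 have h: "h \<in> hom ?F G" "inj_on h (carrier ?F)" "h ` carrier ?F = carrier G" using Suc.prems(2) by (auto simp: iso_def bij_betw_def)
 interpret h: group_hom ?F G h by (simp add: group_hom_def group_hom_axioms_def h(1) G.is_group)
 have S: "?S \<subseteq> carrier ?F" unfolding carrier_free_Abelian_group_iff subset_iff lessThan_iff using less_SucI by blast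
 have d: "frag_of d \<in> carrier ?F" by (simp add: keys_frag_of)
 have cm: "frag_cmul n (frag_of d) + c \<in> carrier ?F" if "c \<in> ?S" for n c
  using h.G.m_closed[OF h.G.int_pow_closed[OF d, of n] subsetD[OF S that]] by (simp add: keys_frag_of)
 have KS: "subgroup ?S ?F"
 proof (rule h.G.subgroupI[OF S])
  show "?S \<noteq> {}" using carrier_free_Abelian_group_iff[of 0 "{..<d}"] by fastforce
  show "inv\<^bsub>?F\<^esub> c \<in> ?S" if "c \<in> ?S" for c using that subsetD[OF S that] by simp
  show "c \<otimes>\<^bsub>?F\<^esub> c' \<in> ?S" if "c \<in> ?S" "c' \<in> ?S" for c c'
   using subset_trans[OF keys_add[of c c'], of "{..<d}"] that unfolding mult_free_Abelian_group carrier_free_Abelian_group_iff by blast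
 qed
 have eqF: "?F\<lparr>carrier := ?S\<rparr> = free_Abelian_group {..<d}" by (simp add: free_Abelian_group_def)
 let ?K = "h ` ?S"
 have K: "subgroup ?K G" by (rule h.subgroup_img_is_subgroup[OF KS])
 have pw: "h (frag_of d) [^]\<^bsub>G\<^esub> n \<otimes>\<^bsub>G\<^esub> h c = h (frag_cmul n (frag_of d) + c)" if "c \<in> ?S" for n :: int and c
 proof -
  have "h (frag_cmul n (frag_of d) + c) = h (frag_of d [^]\<^bsub>?F\<^esub> n) \<otimes>\<^bsub>G\<^esub> h c"
   using h.hom_mult[OF h.G.int_pow_closed[OF d, of n] subsetD[OF S that]] by (simp add: keys_frag_of)
  also have "h (frag_of d [^]\<^bsub>?F\<^esub> n) = h (frag_of d) [^]\<^bsub>G\<^esub> n" by (rule h.hom_int_pow[OF d])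
  finally show ?thesis by simp
 qed
 have look: "Poly_Mapping.lookup c d = 0" if "c \<in> ?S" for c using that by (auto simp: in_keys_iff)
 have "split_off G (h (frag_of d)) ?K"
 proof (rule G.split_offI[OF h.hom_closed[OF d] K])
  fix n n' :: int and k k' assume "k \<in> ?K" "k' \<in> ?K" and eq: "h (frag_of d) [^]\<^bsub>G\<^esub> n \<otimes>\<^bsub>G\<^esub> k = h (frag_of d) [^]\<^bsub>G\<^esub> n' \<otimes>\<^bsub>G\<^esub> k'"
  then obtain c c' where c: "k = h c" "k' = h c'" "c \<in> ?S" "c' \<in> ?S" by blast
  have "h (frag_cmul n (frag_of d) + c) = h (frag_cmul n' (frag_of d) + c')" using eq c pw by simp
  then have e: "frag_cmul n (frag_of d) + c = frag_cmul n' (frag_of d) + c'" using h(2) cm c unfolding inj_on_def by blast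
  from arg_cong[OF e, of "\<lambda>c. Poly_Mapping.lookup c d"] show "n = n'" using look[OF c(3)] look[OF c(4)] by (simp add: lookup_add)
 next
  fix x assume "x \<in> carrier G"
  then obtain c where c: "c \<in> carrier ?F" "x = h c" using h(3) by blast
  let ?n = "Poly_Mapping.lookup c d" let ?c = "c - frag_cmul ?n (frag_of d)"
  have "Poly_Mapping.keys ?c \<subseteq> {..<d}"
  proof
   fix i assume i: "i \<in> Poly_Mapping.keys ?c"
   then have "i \<noteq> d" by (auto simp: in_keys_iff lookup_minus)
   moreover have "i \<in> Poly_Mapping.keys c \<or> i = d"
    using i keys_diff[of c "frag_cmul ?n (frag_of d)"] keys_cmul[of ?n "frag_of d"] by (auto simp: keys_frag_of)
   ultimately show "i \<in> {..<d}" using c(1) by (auto simp: less_Suc_eq)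
  qed
  then have cS: "?c \<in> ?S" by simp
  have "x = h (frag_of d) [^]\<^bsub>G\<^esub> ?n \<otimes>\<^bsub>G\<^esub> h ?c" using pw[OF cS, of ?n] c by simp
  then show "\<exists>n::int. \<exists>k\<in>?K. x = h (frag_of d) [^]\<^bsub>G\<^esub> n \<otimes>\<^bsub>G\<^esub> k" using cS by blast
 qed
 moreover have "lattice d (G\<lparr>carrier := ?K\<rparr>)"
 proof (rule Suc.IH)
  show "comm_group (G\<lparr>carrier := ?K\<rparr>)" by (rule G.comm_group_subgroup[OF K])
  show "h \<in> iso (free_Abelian_group {..<d}) (G\<lparr>carrier := ?K\<rparr>)"
  proof (rule isoI)
   show "h \<in> hom (free_Abelian_group {..<d}) (G\<lparr>carrier := ?K\<rparr>)" using h(1) S by (auto simp: hom_def Pi_iff subset_iff)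
   show "bij_betw h ?S (carrier (G\<lparr>carrier := ?K\<rparr>))" using inj_on_subset[OF h(2) S] by (simp add: bij_betw_def)
  qed
 qed
 ultimately show ?case using Suc.prems(1) by auto
qed

text \<open>An element of H with least positive exponent of l, if there is one, generates a summand
  of H with complement in K, to which induction applies. The lemma serves the complement K of an
  admissible decomposition, which is given merely as a subgroup.\<close>

lemma lattice_subgroup:
 assumes "lattice d G" "subgroup H G" shows "\<exists>e. lattice e (G\<lparr>carrier := H\<rparr>)" using assms
proof (induction d arbitrary: G H)
 case 0
 then interpret G: comm_group G by simp
 have "H = {\<one>\<^bsub>G\<^esub>}" using 0 subgroup.subset[of H G] subgroup.one_closed[of H G] by auto
 then show ?case using G.comm_group_subgroup[OF 0(2)] by (intro exI[of _ 0]) simp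
next
 case (Suc d)
 then obtain l K where lK: "split_off G l K" "lattice d (G\<lparr>carrier := K\<rparr>)" and comm: "comm_group G" by auto
 interpret S: splitting G l K by (rule splittingI[OF comm lK(1)])
 have H: "subgroup H G" by (rule Suc.prems)
 have Hc: "x \<in> carrier G" if "x \<in> H" for x using subgroup.subset[OF H] that by blast
 have HK: "subgroup (H \<inter> K) G" by (rule S.subgroups_Inter_pair[OF H S.K])
 have "subgroup (H \<inter> K) (G\<lparr>carrier := K\<rparr>)" by (rule S.subgroup_incl[OF HK S.K]) simp
 then obtain e where e: "lattice e (G\<lparr>carrier := H \<inter> K\<rparr>)" using Suc.IH[OF lK(2)] by fastforce
 show ?case
 proof (cases "\<exists>x\<in>H. S.np x \<noteq> 0")
  case False
  have "H \<subseteq> K"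
  proof
   fix x assume x: "x \<in> H"
   then have "x = S.kp x" using S.decomp[OF Hc[OF x]] False S.K_closed[OF S.kp_in[OF Hc[OF x]]] by simp
   then show "x \<in> K" using S.kp_in[OF Hc[OF x]] by metis
  qed
  then show ?thesis using e by (metis Int_absorb2)
 next
  case True
  then obtain x0 where x0: "x0 \<in> H" "S.np x0 \<noteq> 0" by blast
  have pos: "\<exists>x\<in>H. S.np x > 0"
  proof (cases "S.np x0 > 0")
   case False
   have "x0 [^]\<^bsub>G\<^esub> (- 1 :: int) \<in> H" by (rule S.subgroup_int_pow_closed[OF H x0(1)])
   moreover have "S.np (x0 [^]\<^bsub>G\<^esub> (- 1 :: int)) > 0" using S.np_pow[OF Hc[OF x0(1)], of "- 1"] x0(2) False by simp
   ultimately show ?thesis by blast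
  qed (use x0 in blast)
  define P where "P m \<longleftrightarrow> m > 0 \<and> (\<exists>x\<in>H. S.np x = int m)" for m
  have "P (nat (S.np x))" if "x \<in> H" "S.np x > 0" for x using that by (auto simp: P_def)
  then have Pex: "\<exists>m. P m" using pos by blast
  define a where "a = (LEAST m. P m)"
  have "P a" unfolding a_def using Pex by (rule LeastI_ex)
  then obtain g where g: "g \<in> H" "S.np g = int a" "a > 0" by (auto simp: P_def)
  have min: "S.np x = 0" if x: "x \<in> H" "0 \<le> S.np x" "S.np x < int a" for x
  proof (rule ccontr)
   assume "S.np x \<noteq> 0"
   then have "P (nat (S.np x))" using x by (auto simp: P_def)
   then have "a \<le> nat (S.np x)" unfolding a_def by (rule Least_le)
   then show False using x by simp
  qed
  have pw: "g [^]\<^bsub>G\<lparr>carrier := H\<rparr>\<^esub> n = g [^]\<^bsub>G\<^esub> n" for n :: int using S.int_pow_consistent[OF H g(1)] by simp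
  have gp: "g [^]\<^bsub>G\<^esub> n \<in> H" for n :: int by (rule S.subgroup_int_pow_closed[OF H g(1)])
  have npg: "S.np (g [^]\<^bsub>G\<^esub> n \<otimes>\<^bsub>G\<^esub> k) = n * int a" if "k \<in> K" for n :: int and k
   using that S.parts_mult(1)[OF Hc[OF gp] S.K_closed] S.np_pow[OF Hc[OF g(1)]] S.parts_K g by simp
  interpret H: comm_group "G\<lparr>carrier := H\<rparr>" by (rule S.comm_group_subgroup[OF H])
  have "split_off (G\<lparr>carrier := H\<rparr>) g (H \<inter> K)"
  proof (rule H.split_offI)
   show "subgroup (H \<inter> K) (G\<lparr>carrier := H\<rparr>)" by (rule S.subgroup_incl[OF HK H]) simp
  next
   fix n n' :: int and k k' assume k: "k \<in> H \<inter> K" "k' \<in> H \<inter> K"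
    and "g [^]\<^bsub>G\<lparr>carrier := H\<rparr>\<^esub> n \<otimes>\<^bsub>G\<lparr>carrier := H\<rparr>\<^esub> k = g [^]\<^bsub>G\<lparr>carrier := H\<rparr>\<^esub> n' \<otimes>\<^bsub>G\<lparr>carrier := H\<rparr>\<^esub> k'"
   then have eq: "g [^]\<^bsub>G\<^esub> n \<otimes>\<^bsub>G\<^esub> k = g [^]\<^bsub>G\<^esub> n' \<otimes>\<^bsub>G\<^esub> k'" by (simp add: pw)
   have k2: "k \<in> K" "k' \<in> K" using k by auto
   have "n * int a = S.np (g [^]\<^bsub>G\<^esub> n \<otimes>\<^bsub>G\<^esub> k)" by (rule npg[OF k2(1), symmetric])
   also have "\<dots> = n' * int a" unfolding eq by (rule npg[OF k2(2)])
   finally have "n * int a = n' * int a" .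
   then show "n = n'" using g(3) mult_right_cancel[of "int a" n n'] by simp
  next
   fix x assume "x \<in> carrier (G\<lparr>carrier := H\<rparr>)"
   then have x: "x \<in> H" by simp
   \<comment> \<open>Division with remainder by the least positive exponent: the remainder has to be
     zero, so the rest of x lies in K.\<close>
   define q where "q = S.np x div int a"
   define k where "k = g [^]\<^bsub>G\<^esub> (- q) \<otimes>\<^bsub>G\<^esub> x"
   have kH: "k \<in> H" unfolding k_def by (intro subgroup.m_closed[OF H] gp x)
   have "S.np k = S.np x mod int a" using S.parts_mult(1)[OF Hc[OF gp] Hc[OF x], of "- q"] S.np_pow[OF Hc[OF g(1)], of "- q"] g(2)
    by (simp add: k_def q_def minus_div_mult_eq_mod[symmetric])
   then have "S.np k = 0" using g(3) by (intro min[OF kH]) simp_all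
   then have "k = S.kp k" using S.decomp[OF Hc[OF kH]] S.K_closed[OF S.kp_in[OF Hc[OF kH]]] by simp
   then have kK: "k \<in> K" using S.kp_in[OF Hc[OF kH]] by metis
   have "g [^]\<^bsub>G\<^esub> q \<otimes>\<^bsub>G\<^esub> k = x"
    using Hc[OF x] Hc[OF g(1)] by (simp add: k_def S.m_assoc[symmetric] S.int_pow_mult[symmetric])
   then show "\<exists>n::int. \<exists>k\<in>H \<inter> K. x = g [^]\<^bsub>G\<lparr>carrier := H\<rparr>\<^esub> n \<otimes>\<^bsub>G\<lparr>carrier := H\<rparr>\<^esub> k"
    using kK kH by (intro exI[of _ q] bexI[of _ k]) (simp_all add: pw)
  qed (use g in simp)
  then have "lattice (Suc e) (G\<lparr>carrier := H\<rparr>)" using e S.comm_group_subgroup[OF H] by auto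
  then show ?thesis by blast
 qed
qed

text \<open>The coordinates of x are themselves values of integral functionals. For a = 0 the lemma
  says that functionals detect nontrivial elements.\<close>

lemma lattice_divisible:
 assumes "lattice d G" "x \<in> carrier G" "\<And>\<psi>. \<psi> \<in> hom G integer_group \<Longrightarrow> a dvd \<psi> x"
 shows "\<exists>y\<in>carrier G. x = y [^]\<^bsub>G\<^esub> (a::int)" using assms
proof (induction d arbitrary: G x)
 case 0
 then interpret G: comm_group G by simp
 show ?case using 0 by (intro bexI[of _ "\<one>\<^bsub>G\<^esub>"]) auto
next
 case (Suc d)
 then obtain l K where lK: "split_off G l K" "lattice d (G\<lparr>carrier := K\<rparr>)" and comm: "comm_group G" by auto
 interpret S: splitting G l K by (rule splittingI[OF comm lK(1)])
 have x: "x \<in> carrier G" by (rule Suc.prems)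
 have "\<exists>y\<in>carrier (G\<lparr>carrier := K\<rparr>). S.kp x = y [^]\<^bsub>G\<lparr>carrier := K\<rparr>\<^esub> a"
 proof (rule Suc.IH[OF lK(2)])
  show "S.kp x \<in> carrier (G\<lparr>carrier := K\<rparr>)" using S.kp_in[OF x] by simp
  show "a dvd \<psi> (S.kp x)" if "\<psi> \<in> hom (G\<lparr>carrier := K\<rparr>) integer_group" for \<psi>
   using Suc.prems(3)[OF hom_compose[OF S.kp_hom that]] by simp
 qed
 then obtain y where y: "y \<in> K" "S.kp x = y [^]\<^bsub>G\<^esub> a" using S.pow_K by auto
 obtain q where q: "S.np x = a * q" using Suc.prems(3)[OF S.np_hom] by (auto elim: dvdE)
 have yc: "y \<in> carrier G" by (rule S.K_closed[OF y(1)])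
 have "x = l [^]\<^bsub>G\<^esub> (q * a) \<otimes>\<^bsub>G\<^esub> y [^]\<^bsub>G\<^esub> a" using S.decomp[OF x] q y(2) by (simp add: mult.commute)
 also have "\<dots> = (l [^]\<^bsub>G\<^esub> q \<otimes>\<^bsub>G\<^esub> y) [^]\<^bsub>G\<^esub> a"
  using S.l yc by (simp add: S.int_pow_distrib S.int_pow_pow)
 finally show ?case using S.l yc by (intro bexI[of _ "l [^]\<^bsub>G\<^esub> q \<otimes>\<^bsub>G\<^esub> y"]) auto
qed

lemma split_off_if_direct_sum:
 assumes G: "comm_group G" and L: "subgroup L G" and K: "subgroup K G" and LK: "L \<inter> K = {\<one>\<^bsub>G\<^esub>}" "L <#>\<^bsub>G\<^esub> K = carrier G"
  and iso: "G\<lparr>carrier := L\<rparr> \<cong> integer_group"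
 obtains l where "split_off G l K"
proof -
 interpret G: comm_group G by (rule G)
 interpret L: group "G\<lparr>carrier := L\<rparr>" by (rule G.subgroup_imp_group[OF L])
 obtain f where f: "f \<in> iso (G\<lparr>carrier := L\<rparr>) integer_group" using iso by (auto simp: is_iso_def)
 define g where "g = inv_into L f"
 have g: "g \<in> iso integer_group (G\<lparr>carrier := L\<rparr>)" using L.iso_set_sym[OF f] by (simp add: g_def)
 then have gh: "g \<in> hom integer_group (G\<lparr>carrier := L\<rparr>)" "inj g" "range g = L" by (auto simp: iso_def bij_betw_def)
 have gn: "g n = g 1 [^]\<^bsub>G\<^esub> n" for n :: int
 proof -
  have "g (1 [^]\<^bsub>integer_group\<^esub> n) = g 1 [^]\<^bsub>G\<lparr>carrier := L\<rparr>\<^esub> n"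
   by (rule hom_int_pow[OF gh(1)]) (simp_all add: L.is_group)
  then show ?thesis using G.int_pow_consistent[OF L, of "g 1" n] gh(3) by auto
 qed
 have Lc: "x \<in> carrier G" if "x \<in> L" for x using subgroup.subset[OF L] that by blast
 have Kc: "x \<in> carrier G" if "x \<in> K" for x using subgroup.subset[OF K] that by blast
 have gL: "g n \<in> L" for n using gh(3) by blast
 have "split_off G (g 1) K"
 proof (rule G.split_offI[OF Lc[OF gL] K])
  fix n n' :: int and k k' assume k: "k \<in> K" "k' \<in> K" and "g 1 [^]\<^bsub>G\<^esub> n \<otimes>\<^bsub>G\<^esub> k = g 1 [^]\<^bsub>G\<^esub> n' \<otimes>\<^bsub>G\<^esub> k'"
  then have eq: "g n \<otimes>\<^bsub>G\<^esub> k = g n' \<otimes>\<^bsub>G\<^esub> k'" by (simp only: gn[of n] gn[of n'])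
  note c = Lc[OF gL[of n]] Lc[OF gL[of n']] Kc[OF k(1)] Kc[OF k(2)]
  have "inv\<^bsub>G\<^esub> g n' \<otimes>\<^bsub>G\<^esub> g n = inv\<^bsub>G\<^esub> g n' \<otimes>\<^bsub>G\<^esub> (g n \<otimes>\<^bsub>G\<^esub> k) \<otimes>\<^bsub>G\<^esub> inv\<^bsub>G\<^esub> k" using c by (simp add: G.m_assoc)
  also have "\<dots> = k' \<otimes>\<^bsub>G\<^esub> inv\<^bsub>G\<^esub> k" unfolding eq using c by (simp add: G.m_assoc[symmetric])
  finally have e: "inv\<^bsub>G\<^esub> g n' \<otimes>\<^bsub>G\<^esub> g n = k' \<otimes>\<^bsub>G\<^esub> inv\<^bsub>G\<^esub> k" .
  have "inv\<^bsub>G\<^esub> g n' \<otimes>\<^bsub>G\<^esub> g n \<in> L" using L gL by (simp add: subgroup.m_closed subgroup.m_inv_closed)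
  moreover have "k' \<otimes>\<^bsub>G\<^esub> inv\<^bsub>G\<^esub> k \<in> K" using K k by (simp add: subgroup.m_closed subgroup.m_inv_closed)
  ultimately have "inv\<^bsub>G\<^esub> g n' \<otimes>\<^bsub>G\<^esub> g n = \<one>\<^bsub>G\<^esub>" using e LK(1) by auto
  then have "inv\<^bsub>G\<^esub> (g n) = inv\<^bsub>G\<^esub> (g n')" using c by (intro G.inv_equality) simp_all
  then have "g n = g n'" using G.inv_inj c by (auto dest: inj_onD)
  then show "n = n'" using gh(2) by (simp add: inj_eq)
 next
  fix x assume "x \<in> carrier G"
  then obtain y k where yk: "y \<in> L" "k \<in> K" "x = y \<otimes>\<^bsub>G\<^esub> k" using LK(2) unfolding set_mult_def by blast
  obtain n where "y = g n" using gh(3) yk(1) by blast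
  then show "\<exists>n::int. \<exists>k\<in>K. x = g 1 [^]\<^bsub>G\<^esub> n \<otimes>\<^bsub>G\<^esub> k" using yk by (intro exI[of _ n] bexI[of _ k]) (simp_all add: gn[of n, symmetric])
 qed
 then show thesis by (rule that)
qed

section \<open>Splitting of tori into punctured planes, and connected components of kernels of
  characters\<close>

section \<open>Complex tori\<close>

lemma group_nonzero_complex: "group nonzero_complex"
proof (rule groupI)
 show "\<exists>y\<in>carrier nonzero_complex. y \<otimes>\<^bsub>nonzero_complex\<^esub> x = \<one>\<^bsub>nonzero_complex\<^esub>" if "x \<in> carrier nonzero_complex" for x
  using that by (intro bexI[of _ "inverse x"]) (auto simp: nonzero_complex_def)
qed (auto simp: nonzero_complex_def)

lemma nonzero_complex_inv: "x \<noteq> 0 \<Longrightarrow> inv\<^bsub>nonzero_complex\<^esub> x = inverse x"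
 by (rule group.inv_equality[OF group_nonzero_complex]) (auto simp: nonzero_complex_def)

lemma nonzero_complex_int_pow: "x \<noteq> 0 \<Longrightarrow> x [^]\<^bsub>nonzero_complex\<^esub> (n::int) = x powi n"
proof -
 assume x: "x \<noteq> 0"
 have nat: "x [^]\<^bsub>nonzero_complex\<^esub> (m::nat) = x ^ m" for m by (induction m) (auto simp: nonzero_complex_def nat_pow_def)
 show ?thesis
 proof (cases n rule: int_cases2)
  case (nonneg m)
  show ?thesis unfolding nonneg int_pow_int nat power_int_of_nat ..
 next
  case (nonpos m)
  have "x [^]\<^bsub>nonzero_complex\<^esub> (- int m) = inv\<^bsub>nonzero_complex\<^esub> (x ^ m)"
   using group.int_pow_neg[OF group_nonzero_complex, of x "int m"] x by (simp only: int_pow_int nat) (simp add: nonzero_complex_def)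
  then show ?thesis unfolding nonpos using nonzero_complex_inv[of "x ^ m"] x by (simp add: power_int_minus)
 qed
qed

lemma torus_iff: "t \<in> carrier (torus G) \<longleftrightarrow> t \<in> extensional (carrier G) \<and> (\<forall>x\<in>carrier G. t x \<noteq> 0) \<and>
 (\<forall>x\<in>carrier G. \<forall>y\<in>carrier G. t (x \<otimes>\<^bsub>G\<^esub> y) = t x * t y)"
 by (auto simp: torus_def hom_def nonzero_complex_def Pi_iff)

lemma torus_nz: "t \<in> carrier (torus G) \<Longrightarrow> x \<in> carrier G \<Longrightarrow> t x \<noteq> 0"
 and torus_mult: "t \<in> carrier (torus G) \<Longrightarrow> x \<in> carrier G \<Longrightarrow> y \<in> carrier G \<Longrightarrow> t (x \<otimes>\<^bsub>G\<^esub> y) = t x * t y"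
 by (auto simp: torus_iff)

lemma torus_one: "group G \<Longrightarrow> t \<in> carrier (torus G) \<Longrightarrow> t \<one>\<^bsub>G\<^esub> = 1"
 using torus_mult[of t G "\<one>\<^bsub>G\<^esub>" "\<one>\<^bsub>G\<^esub>"] torus_nz[of t G "\<one>\<^bsub>G\<^esub>"] by (simp add: group.is_monoid)

lemma torus_pow:
 assumes "group G" "t \<in> carrier (torus G)" "x \<in> carrier G" shows "t (x [^]\<^bsub>G\<^esub> (n::int)) = t x powi n"
proof -
 have "t \<in> hom G nonzero_complex" using assms(2) by (simp add: torus_def)
 then have "t (x [^]\<^bsub>G\<^esub> n) = t x [^]\<^bsub>nonzero_complex\<^esub> n"
  by (rule hom_int_pow[OF _ assms(3,1) group_nonzero_complex])
 then show ?thesis using nonzero_complex_int_pow[OF torus_nz[OF assms(2,3)]] by simp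
qed

lemma torus_ext: "s \<in> carrier (torus G) \<Longrightarrow> t \<in> carrier (torus G) \<Longrightarrow> (\<And>x. x \<in> carrier G \<Longrightarrow> s x = t x) \<Longrightarrow> s = t"
 by (rule extensionalityI[of _ "carrier G"]) (auto simp: torus_iff)

lemma topspace_torus [simp]: "topspace (torus_topology G) = carrier (torus G)" by (auto simp: torus_topology_def torus_def PiE_def)

lemma continuous_torus_apply: "x \<in> carrier G \<Longrightarrow> continuous_map (torus_topology G) euclidean (\<lambda>t. t x)"
 unfolding torus_topology_def by (intro continuous_map_from_subtopology continuous_map_product_projection)

lemma continuous_map_into_torus:
 assumes "\<And>p. p \<in> topspace X \<Longrightarrow> f p \<in> carrier (torus G)"
  and "\<And>x. x \<in> carrier G \<Longrightarrow> continuous_map X euclidean (\<lambda>p. f p x)"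
 shows "continuous_map X (torus_topology G) f" unfolding torus_topology_def continuous_map_in_subtopology continuous_map_componentwise
 using assms by (auto simp: torus_iff)

lemma continuous_map_powi:
 fixes f :: "'a \<Rightarrow> complex"
 assumes "continuous_map X euclidean f" "\<And>p. p \<in> topspace X \<Longrightarrow> f p \<noteq> 0"
 shows "continuous_map X euclidean (\<lambda>p. f p powi n)"
 using assms unfolding continuous_map_euclidean_iff by (auto intro!: tendsto_power_int)

lemma continuous_map_times_complex:
 fixes f g :: "'a \<Rightarrow> complex"
 assumes "continuous_map X euclidean f" "continuous_map X euclidean g"
 shows "continuous_map X euclidean (\<lambda>p. f p * g p)"
 using assms unfolding continuous_map_euclidean_iff by (auto intro!: tendsto_mult)

context splitting
begin

abbreviation "\<Delta> \<equiv> G\<lparr>carrier := K\<rparr>"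
abbreviation "T \<equiv> carrier (torus G)"
abbreviation "TK \<equiv> carrier (torus \<Delta>)"

text \<open>The character with restriction b to K and value y at l. It inverts the map sending t to
  its restriction and its value at l, and so presents the torus as a product with a punctured
  plane.\<close>

definition glue :: "('a \<Rightarrow> complex) \<Rightarrow> complex \<Rightarrow> 'a \<Rightarrow> complex" where
 "glue b y = (\<lambda>x\<in>carrier G. b (kp x) * y powi np x)"

lemma restrict_torus: "t \<in> T \<Longrightarrow> restrict t K \<in> TK" using K_closed subgroup.m_closed[OF K] by (auto simp: torus_iff)

lemma group_\<Delta>: "group \<Delta>" by (rule subgroup_imp_group[OF K])

lemma glue_torus:
 assumes "b \<in> TK" "y \<noteq> 0" shows "glue b y \<in> T" unfolding torus_iff
proof (intro conjI ballI)
 fix x z assume x: "x \<in> carrier G" and z: "z \<in> carrier G"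
 show "glue b y x \<noteq> 0" using torus_nz[OF assms(1)] kp_in[OF x] assms(2) x by (simp add: glue_def)
 show "glue b y (x \<otimes> z) = glue b y x * glue b y z"
  using torus_mult[OF assms(1), of "kp x" "kp z"] kp_in[OF x] kp_in[OF z] x z assms(2)
  by (simp add: glue_def parts_mult power_int_add mult_ac)
qed (simp add: glue_def)

lemma glue_l:
 assumes "b \<in> TK" shows "glue b y l = y" using torus_one[OF group_\<Delta> assms] l by (simp add: glue_def parts_l)

lemma glue_K: "k \<in> K \<Longrightarrow> glue b y k = b k" by (simp add: glue_def K_closed parts_K)

lemma restrict_glue:
 assumes "b \<in> TK" shows "restrict (glue b y) K = b"
proof
 fix x show "restrict (glue b y) K x = b x" using assms glue_K by (cases "x \<in> K") (auto simp: torus_iff extensional_def)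
qed

lemma glue_restrict:
 assumes t: "t \<in> T" shows "glue (restrict t K) (t l) = t"
proof (rule torus_ext[OF glue_torus[OF restrict_torus[OF t] torus_nz[OF t l]] t])
 fix x assume x: "x \<in> carrier G"
 have "t x = t (l [^] np x \<otimes> kp x)" using decomp[OF x] by simp
 also have "\<dots> = t l powi np x * t (kp x)"
  using torus_mult[OF t, of "l [^] np x" "kp x"] torus_pow[OF is_group t l] K_closed[OF kp_in[OF x]] l by simp
 finally show "glue (restrict t K) (t l) x = t x" using x kp_in[OF x] by (simp add: glue_def)
qed

lemma char_apply:
 assumes "t \<in> T" "a \<in> carrier G" shows "t a = t l powi np a * t (kp a)"
proof -
 have "t a = glue (restrict t K) (t l) a" using glue_restrict[OF assms(1)] by simp
 then show ?thesis using assms(2) kp_in[OF assms(2)] by (simp add: glue_def)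
qed

lemma continuous_restrict: "continuous_map (torus_topology G) (torus_topology \<Delta>) (\<lambda>t. restrict t K)"
proof (rule continuous_map_into_torus)
 show "restrict t K \<in> TK" if "t \<in> topspace (torus_topology G)" for t using that restrict_torus by simp
 show "continuous_map (torus_topology G) euclidean (\<lambda>t. restrict t K x)" if "x \<in> carrier \<Delta>" for x
  using that continuous_torus_apply[OF K_closed] by simp
qed

lemma continuous_glue:
 assumes b: "continuous_map X (torus_topology \<Delta>) b" and y: "continuous_map X euclidean y" "\<And>p. p \<in> topspace X \<Longrightarrow> y p \<noteq> 0"
 shows "continuous_map X (torus_topology G) (\<lambda>p. glue (b p) (y p))"
proof (rule continuous_map_into_torus)
 show "glue (b p) (y p) \<in> T" if "p \<in> topspace X" for p
  using b y(2)[OF that] that by (intro glue_torus) (auto simp: continuous_map_def Pi_iff)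
 fix x assume x: "x \<in> carrier G"
 have "continuous_map X euclidean (\<lambda>p. b p (kp x))"
  using continuous_map_compose[OF b continuous_torus_apply[of "kp x" \<Delta>]] kp_in[OF x] by (simp add: o_def)
 from continuous_map_times_complex[OF this continuous_map_powi[OF y, of "np x"]]
 show "continuous_map X euclidean (\<lambda>p. glue (b p) (y p) x)" using x by (simp add: glue_def)
qed

theorem flagged_torus_tower:
 fixes m :: nat
 assumes B: "flagged (subtopology (torus_topology \<Delta>) Z)"
  and cont: "\<And>j. j < m \<Longrightarrow> continuous_map (subtopology (torus_topology \<Delta>) Z) euclidean (s j)"
  and nz: "\<And>j b. j < m \<Longrightarrow> b \<in> TK \<Longrightarrow> b \<in> Z \<Longrightarrow> s j b \<noteq> 0"
  and disj: "\<And>i j b. i < m \<Longrightarrow> j < m \<Longrightarrow> i \<noteq> j \<Longrightarrow> b \<in> TK \<Longrightarrow> b \<in> Z \<Longrightarrow> s i b \<noteq> s j b"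
 shows "flagged (subtopology (torus_topology G) {t. restrict t K \<in> Z \<and> (\<forall>j<m. t l \<noteq> s j (restrict t K))})"
proof -
 let ?B = "subtopology (torus_topology \<Delta>) Z"
 let ?M = "subtopology (torus_topology G) {t. restrict t K \<in> Z \<and> (\<forall>j<m. t l \<noteq> s j (restrict t K))}"
 \<comment> \<open>The graph with index m is the zero section: the fibre of the torus is a punctured
   plane, hence a plane with one more graph removed.\<close>
 define s' where "s' j = (if j < m then s j else (\<lambda>_. 0))" for j
 let ?S = "{e \<in> topspace (prod_topology ?B euclidean). \<forall>j<Suc m. snd e \<noteq> s' j (fst e)}"
 let ?M' = "subtopology (prod_topology ?B euclidean) ?S"
 have S: "(b, y) \<in> ?S \<longleftrightarrow> b \<in> TK \<and> b \<in> Z \<and> y \<noteq> 0 \<and> (\<forall>j<m. y \<noteq> s j b)" for b y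
  by (auto simp: s'_def less_Suc_eq)
 have topM: "topspace ?M = {t \<in> T. restrict t K \<in> Z \<and> (\<forall>j<m. t l \<noteq> s j (restrict t K))}" by auto
 have topM': "topspace ?M' = ?S" by auto
 show ?thesis
 proof (rule flagged_tower[OF B, of "Suc m" s' _ "\<lambda>t. (restrict t K, t l)" "\<lambda>e. glue (fst e) (snd e)"])
  show "continuous_map ?B euclidean (s' j)" if "j < Suc m" for j using cont by (auto simp: s'_def)
  show "s' i b \<noteq> s' j b" if "i < Suc m" "j < Suc m" "i \<noteq> j" "b \<in> topspace ?B" for i j b
   using that disj nz by (auto simp: s'_def less_Suc_eq)
  have r: "continuous_map ?M ?B (\<lambda>t. restrict t K)"
   using continuous_restrict by (auto simp: continuous_map_in_subtopology intro: continuous_map_from_subtopology)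
  have "continuous_map ?M (prod_topology ?B euclidean) (\<lambda>t. (restrict t K, t l))"
   using r continuous_torus_apply[OF l] by (intro continuous_map_pairedI) (auto intro: continuous_map_from_subtopology)
  moreover have "(restrict t K, t l) \<in> ?S" if "t \<in> topspace ?M" for t
   unfolding S using that restrict_torus[of t] torus_nz[of t G l] l by auto
  ultimately show "continuous_map ?M ?M' (\<lambda>t. (restrict t K, t l))" by (auto simp only: continuous_map_in_subtopology)
  have f: "continuous_map ?M' ?B fst" by (intro continuous_map_from_subtopology continuous_map_fst)
  have s: "continuous_map ?M' euclidean snd" by (intro continuous_map_from_subtopology continuous_map_snd)
  have f': "continuous_map ?M' (torus_topology \<Delta>) fst" using f by (simp add: continuous_map_in_subtopology)
  have sn: "snd e \<noteq> 0" if "e \<in> topspace ?M'" for e using that S[of "fst e" "snd e"] unfolding topM' by simp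
  have g: "continuous_map ?M' (torus_topology G) (\<lambda>e. glue (fst e) (snd e))" by (rule continuous_glue[OF f' s sn])
  have gl: "glue (fst e) (snd e) \<in> topspace ?M \<and> restrict (glue (fst e) (snd e)) K = fst e \<and> glue (fst e) (snd e) l = snd e"
   if "e \<in> topspace ?M'" for e
  proof -
   have e: "fst e \<in> TK" "fst e \<in> Z" "snd e \<noteq> 0" "\<forall>j<m. snd e \<noteq> s j (fst e)"
    using that S[of "fst e" "snd e"] unfolding topM' by simp_all
   show ?thesis unfolding topM using e glue_torus[OF e(1,3)] restrict_glue[OF e(1)] glue_l[OF e(1)] by simp
  qed
  show "continuous_map ?M' ?M (\<lambda>e. glue (fst e) (snd e))"
   unfolding continuous_map_in_subtopology using g gl unfolding topM by auto
  show "(restrict (glue (fst e) (snd e)) K, glue (fst e) (snd e) l) = e" if "e \<in> topspace ?M'" for e using gl[OF that] by simp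
  show "glue (fst (restrict t K, t l)) (snd (restrict t K, t l)) = t" if "t \<in> topspace ?M" for t
   using that glue_restrict[of t] by auto
 qed
qed

text \<open>Through \<open>glue\<close> the preimage is the product of C with the punctured
  plane.\<close>

lemma connectedin_preimage:
 assumes "connectedin (torus_topology \<Delta>) C"
 shows "connectedin (torus_topology G) {t \<in> T. restrict t K \<in> C}"
proof -
 let ?P = "prod_topology (torus_topology \<Delta>) (subtopology euclidean (- {0::complex}))"
 have C: "C \<subseteq> TK" using connectedin_subset_topspace[OF assms] by simp
 have cont: "continuous_map ?P (torus_topology G) (\<lambda>e. glue (fst e) (snd e))"
 proof (rule continuous_glue)
  show "continuous_map ?P (torus_topology \<Delta>) fst" by (rule continuous_map_fst)
  show "continuous_map ?P euclidean snd" using continuous_map_snd[of "torus_topology \<Delta>" "subtopology euclidean (- {0::complex})"]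
   by (simp add: continuous_map_in_subtopology)
 qed auto
 have "connected (- {0::complex})" by (rule connected_punctured_universe) simp
 then have "connectedin (subtopology euclidean (- {0::complex})) (- {0})" by (simp add: connectedin_subtopology)
 then have "connectedin ?P (C \<times> (- {0}))" using assms by (simp add: connectedin_Times)
 then have im: "connectedin (torus_topology G) ((\<lambda>e. glue (fst e) (snd e)) ` (C \<times> (- {0})))"
  by (rule connectedin_continuous_map_image[OF cont])
 have "(\<lambda>e. glue (fst e) (snd e)) ` (C \<times> (- {0})) = {t \<in> T. restrict t K \<in> C}"
 proof (intro equalityI subsetI)
  fix t assume "t \<in> (\<lambda>e. glue (fst e) (snd e)) ` (C \<times> (- {0}))"
  then obtain e where e: "e \<in> C \<times> (- {0})" and t: "t = glue (fst e) (snd e)" by blast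
  have "fst e \<in> C" "snd e \<noteq> 0" using e by auto
  with t show "t \<in> {t \<in> T. restrict t K \<in> C}" using glue_torus[of "fst e" "snd e"] restrict_glue[of "fst e" "snd e"] C by auto
 next
  fix t assume t: "t \<in> {t \<in> T. restrict t K \<in> C}"
  then show "t \<in> (\<lambda>e. glue (fst e) (snd e)) ` (C \<times> (- {0}))"
   using glue_restrict[of t] torus_nz[of t G l] l by (intro image_eqI[of _ _ "(restrict t K, t l)"]) auto
 qed
 with im show ?thesis by simp
qed

end

lemma torus_trivial:
 assumes "group G" "carrier G = {\<one>\<^bsub>G\<^esub>}" shows "carrier (torus G) = {\<lambda>x\<in>carrier G. 1}"
proof -
 interpret group G by (rule assms)
 have "t = (\<lambda>x\<in>carrier G. 1)" if t: "t \<in> carrier (torus G)" for t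
 proof (rule extensionalityI[of _ "carrier G"])
  show "t x = (\<lambda>x\<in>carrier G. 1) x" if "x \<in> carrier G" for x using torus_one[OF assms(1) t] that assms(2) by auto
 qed (use t in \<open>auto simp: torus_iff\<close>)
 moreover have "(\<lambda>x\<in>carrier G. 1) \<in> carrier (torus G)" by (auto simp: torus_iff)
 ultimately show ?thesis by blast
qed

lemma torus_one_in: "group G \<Longrightarrow> (\<lambda>x\<in>carrier G. 1) \<in> carrier (torus G)"
proof -
 assume "group G"
 then interpret group G .
 show ?thesis by (auto simp: torus_iff)
qed

lemma connected_torus: "lattice d G \<Longrightarrow> connectedin (torus_topology G) (carrier (torus G))"
proof (induction d arbitrary: G)
 case 0
 then interpret comm_group G by simp
 show ?case using torus_trivial[OF is_group] torus_one_in[OF is_group] 0 by (simp add: connectedin_sing)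
next
 case (Suc d)
 then obtain l K where lK: "split_off G l K" "lattice d (G\<lparr>carrier := K\<rparr>)" and comm: "comm_group G" by auto
 interpret S: splitting G l K by (rule splittingI[OF comm lK(1)])
 have "{t \<in> carrier (torus G). restrict t K \<in> S.TK} = carrier (torus G)" using S.restrict_torus by auto
 then show ?case using S.connectedin_preimage[OF Suc.IH[OF lK(2)]] by simp
qed

text \<open>The torus is itself a tower over a point, in which each step removes only the zero
  section.\<close>

lemma flagged_torus: "lattice d G \<Longrightarrow> flagged (torus_topology G)"
proof (induction d arbitrary: G)
 case 0
 then interpret comm_group G by simp
 show ?case using torus_trivial[OF is_group] 0 by (intro flagged_point) simp
next
 case (Suc d)
 then obtain l K where lK: "split_off G l K" "lattice d (G\<lparr>carrier := K\<rparr>)" and comm: "comm_group G" by auto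
 interpret S: splitting G l K by (rule splittingI[OF comm lK(1)])
 show ?case using S.flagged_torus_tower[of UNIV 0 undefined] Suc.IH[OF lK(2)] by simp
qed

text \<open>Logarithms chosen at the elements of a basis extend additively to a logarithm of the
  whole character.\<close>

lemma torus_log:
 assumes "lattice d G" "t \<in> carrier (torus G)"
 shows "\<exists>\<rho>. (\<forall>x\<in>carrier G. \<forall>y\<in>carrier G. \<rho> (x \<otimes>\<^bsub>G\<^esub> y) = \<rho> x + \<rho> y) \<and> (\<forall>x\<in>carrier G. t x = exp (\<rho> x))"
 using assms
proof (induction d arbitrary: G t)
 case 0
 then interpret comm_group G by simp
 show ?case using 0 torus_one[OF is_group 0(2)] by (intro exI[of _ "\<lambda>_. 0"]) auto
next
 case (Suc d)
 then obtain l K where lK: "split_off G l K" "lattice d (G\<lparr>carrier := K\<rparr>)" and comm: "comm_group G" by auto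
 interpret S: splitting G l K by (rule splittingI[OF comm lK(1)])
 obtain \<rho> where \<rho>: "\<forall>x\<in>K. \<forall>y\<in>K. \<rho> (x \<otimes>\<^bsub>G\<^esub> y) = \<rho> x + \<rho> y" "\<forall>x\<in>K. restrict t K x = exp (\<rho> x)"
  using Suc.IH[OF lK(2) S.restrict_torus[OF Suc.prems(2)]] by auto
 have "t l \<noteq> 0" by (rule torus_nz[OF Suc.prems(2) S.l])
 then have e: "exp (of_int z * Ln (t l)) = t l powi z" for z by (simp flip: exp_power_int)
 let ?L = "\<lambda>x. of_int (S.np x) * Ln (t l) + \<rho> (S.kp x)"
 have "?L (x \<otimes>\<^bsub>G\<^esub> y) = ?L x + ?L y" if "x \<in> carrier G" "y \<in> carrier G" for x y
  using that \<rho>(1) S.kp_in by (simp add: S.parts_mult ring_distribs)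
 moreover have "t x = exp (?L x)" if x: "x \<in> carrier G" for x
  using S.char_apply[OF Suc.prems(2) x] \<rho>(2) S.kp_in[OF x] by (simp add: exp_add e)
 ultimately show ?case by (intro exI[of _ ?L] conjI ballI)
qed

lemma components_maximal:
 assumes "H \<in> components G S" "connectedin (torus_topology G) C" "C \<subseteq> S" "C \<inter> H \<noteq> {}"
 shows "C \<subseteq> H" using connected_components_of_maximal[of H "subtopology (torus_topology G) S" C] assms
 by (auto simp: components_def connectedin_subtopology disjnt_def)

lemma components_connected: "H \<in> components G S \<Longrightarrow> connectedin (torus_topology G) H"
 using connectedin_connected_components_of[of H "subtopology (torus_topology G) S"] by (auto simp: components_def connectedin_subtopology)

lemma components_subset: "H \<in> components G S \<Longrightarrow> H \<subseteq> S" "H \<in> components G S \<Longrightarrow> H \<subseteq> carrier (torus G)"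
 using connected_components_of_subset[of H "subtopology (torus_topology G) S"] by (auto simp: components_def)

lemma components_nonempty: "H \<in> components G S \<Longrightarrow> H \<noteq> {}"
 using nonempty_connected_components_of by (auto simp: components_def)

lemma components_cover: "t \<in> carrier (torus G) \<Longrightarrow> t \<in> S \<Longrightarrow> \<exists>H\<in>components G S. t \<in> H"
 using Union_connected_components_of[of "subtopology (torus_topology G) S"] by (auto simp: components_def)

lemma components_eq: "H \<in> components G S \<Longrightarrow> H' \<in> components G S \<Longrightarrow> t \<in> H \<Longrightarrow> t \<in> H' \<Longrightarrow> H = H'"
 using components_maximal[of H G S H'] components_maximal[of H' G S H] components_connected components_subset by blast

lemma componentsI:
 assumes "connectedin (torus_topology G) C" "C \<subseteq> S" "C \<noteq> {}"
  and max: "\<And>D. connectedin (torus_topology G) D \<Longrightarrow> D \<subseteq> S \<Longrightarrow> C \<subseteq> D \<Longrightarrow> D \<subseteq> C"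
 shows "C \<in> components G S"
proof -
 obtain t where t: "t \<in> C" using assms(3) by blast
 then have "t \<in> carrier (torus G)" "t \<in> S" using connectedin_subset_topspace[OF assms(1)] assms(2) by auto
 then obtain H where H: "H \<in> components G S" "t \<in> H" using components_cover by blast
 have "C \<subseteq> H" using components_maximal[OF H(1) assms(1,2)] t H(2) by blast
 then have "H \<subseteq> C" using max[OF components_connected[OF H(1)]] components_subset[OF H(1)] by blast
 then show ?thesis using H \<open>C \<subseteq> H\<close> by auto
qed

lemma powi_eq_1: "(z::complex) powi n = 1 \<Longrightarrow> z ^ nat \<bar>n\<bar> = 1"
 by (cases n rule: int_cases2) (auto simp: power_int_minus)

lemma powi_2_neq_1: "n \<noteq> 0 \<Longrightarrow> (2::complex) powi n \<noteq> 1"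
 using powi_eq_1[of 2 n] power_eq_1_iff[of "2::complex" "nat \<bar>n\<bar>"] by auto

lemma finite_powi_eq_1: "n \<noteq> 0 \<Longrightarrow> finite {z::complex. z powi n = 1}"
proof (rule finite_subset)
 show "{z::complex. z powi n = 1} \<subseteq> {z. z ^ nat \<bar>n\<bar> = 1}" using powi_eq_1 by blast
 show "finite {z::complex. z ^ nat \<bar>n\<bar> = 1}" if "n \<noteq> 0" using that by (intro finite_roots_unity) simp
qed

lemma hom_nonzero:
 assumes "lattice d G" "a \<in> carrier G" "a \<noteq> \<one>\<^bsub>G\<^esub>"
 obtains \<psi> where "\<psi> \<in> hom G integer_group" "\<psi> a \<noteq> 0"
 using lattice_divisible[OF assms(1,2), of 0] assms(3) by fastforce

text \<open>If \<open>\<psi>\<close> is an integral functional with \<open>\<psi> a \<noteq> 0\<close>, two points of the kernel of \<open>a\<close> can be joined by a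
 one-parameter path as soon as the values of their logarithms at \<open>a\<close> agree modulo \<open>2 \<pi> \<i> \<psi> a\<close>.\<close>

lemma finite_components:
 assumes G: "lattice d G" and a: "a \<in> carrier G" "a \<noteq> \<one>\<^bsub>G\<^esub>"
 shows "finite (components G (char_kernel G a))"
proof -
 obtain \<psi> where \<psi>: "\<psi> \<in> hom G integer_group" "\<psi> a \<noteq> 0" by (rule hom_nonzero[OF assms])
 have "\<exists>\<rho>. t \<in> carrier (torus G) \<longrightarrow> (\<forall>x\<in>carrier G. \<forall>y\<in>carrier G. \<rho> (x \<otimes>\<^bsub>G\<^esub> y) = \<rho> x + \<rho> y) \<and> (\<forall>x\<in>carrier G. t x = exp (\<rho> x))" for t
  using torus_log[OF G] by blast
 then obtain \<rho> where \<rho>: "\<And>t x y. t \<in> carrier (torus G) \<Longrightarrow> x \<in> carrier G \<Longrightarrow> y \<in> carrier G \<Longrightarrow> \<rho> t (x \<otimes>\<^bsub>G\<^esub> y) = \<rho> t x + \<rho> t y"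
   "\<And>t x. t \<in> carrier (torus G) \<Longrightarrow> x \<in> carrier G \<Longrightarrow> t x = exp (\<rho> t x)" by metis
 have "\<exists>N::int. t \<in> char_kernel G a \<longrightarrow> \<rho> t a = 2 * of_real pi * \<i> * of_int N" for t
 proof (cases "t \<in> char_kernel G a")
  case True
  then have "exp (\<rho> t a) = 1" using \<rho>(2)[of t a] a by (simp add: char_kernel_def)
  then obtain N :: int where "Re (\<rho> t a) = 0" "Im (\<rho> t a) = of_int (2 * N) * pi" using exp_eq_1 by blast
  then show ?thesis by (intro exI[of _ N]) (simp add: complex_eq_iff)
 qed simp
 then obtain N :: "('a \<Rightarrow> complex) \<Rightarrow> int" where N: "\<And>t. t \<in> char_kernel G a \<Longrightarrow> \<rho> t a = 2 * of_real pi * \<i> * of_int (N t)" by metis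
 have same: "W = W'" if W: "W \<in> components G (char_kernel G a)" "W' \<in> components G (char_kernel G a)" "t \<in> W" "t' \<in> W'"
  and eq: "N t mod \<psi> a = N t' mod \<psi> a" for W W' t t'
 proof -
  have k: "t \<in> char_kernel G a" "t' \<in> char_kernel G a" using W components_subset(1) by blast+
  then have T: "t \<in> carrier (torus G)" "t' \<in> carrier (torus G)" and t'a: "t' a = 1" by (auto simp: char_kernel_def)
  obtain j where j: "N t - N t' = \<psi> a * j" using eq by (auto simp: mod_eq_dvd_iff elim: dvdE)
  \<comment> \<open>The difference of the two logarithms, corrected by a homomorphism into the
    multiples of 2 pi \<i> so that it vanishes at a. Thus the path of all exp(r R) t' stays in the
    kernel of a and leads from t' at r = 0 to t at r = 1.\<close>
  define R where "R x = \<rho> t x - \<rho> t' x - 2 * of_real pi * \<i> * of_int (\<psi> x * j)" for x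
  have R_add: "R (x \<otimes>\<^bsub>G\<^esub> y) = R x + R y" if "x \<in> carrier G" "y \<in> carrier G" for x y
   using that \<rho>(1)[OF T(1)] \<rho>(1)[OF T(2)] hom_mult[OF \<psi>(1)] by (simp add: R_def algebra_simps)
  have "R a = 2 * of_real pi * \<i> * of_int (N t - N t' - \<psi> a * j)" using N[OF k(1)] N[OF k(2)] by (simp add: R_def algebra_simps)
  then have Ra: "R a = 0" using j by simp
  define u where "u r = (\<lambda>x\<in>carrier G. exp (of_real r * R x) * t' x)" for r :: real
  have uT: "u r \<in> carrier (torus G)" for r
   unfolding torus_iff using R_add torus_nz[OF T(2)] torus_mult[OF T(2)] comm_group.axioms(1)[OF lattice_comm_group[OF G]]
   by (auto simp: u_def ring_distribs exp_add comm_monoid.axioms monoid.m_closed)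
  have "continuous_map euclideanreal (torus_topology G) u"
   by (rule continuous_map_into_torus[OF uT]) (auto simp: u_def intro!: continuous_intros)
  then have con: "connectedin (torus_topology G) (range u)" using connectedin_continuous_map_image[of _ _ u UNIV] by simp
  have sub: "range u \<subseteq> char_kernel G a" using uT a t'a by (auto simp: char_kernel_def u_def Ra)
  have "exp (R x) * t' x = t x" if "x \<in> carrier G" for x
   using \<rho>(2)[OF T(1) that] \<rho>(2)[OF T(2) that] exp_integer_2pi[of "of_int (\<psi> x * j)"]
   by (simp add: R_def exp_diff mult_ac)
  then have "u 1 = t" by (intro torus_ext[OF uT T(1)]) (simp add: u_def)
  moreover have "u 0 = t'" by (intro torus_ext[OF uT T(2)]) (simp add: u_def)
  ultimately have "t \<in> range u" "t' \<in> range u" by (metis rangeI)+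
  then have "range u \<subseteq> W" "range u \<subseteq> W'" using components_maximal[OF W(1) con sub] components_maximal[OF W(2) con sub] W by blast+
  then show ?thesis using components_eq[OF W(1,2) W(3)] \<open>t \<in> range u\<close> by blast
 qed
 define p where "p W = N (SOME t. t \<in> W) mod \<psi> a" for W
 have p: "(SOME t. t \<in> W) \<in> W" if "W \<in> components G (char_kernel G a)" for W
  using components_nonempty[OF that] by (simp add: some_in_eq)
 have "inj_on p (components G (char_kernel G a))" using same p unfolding p_def inj_on_def by blast
 moreover have "p ` components G (char_kernel G a) \<subseteq> {- \<bar>\<psi> a\<bar>..\<bar>\<psi> a\<bar>}"
 proof -
  have "n mod \<psi> a \<in> {- \<bar>\<psi> a\<bar>..\<bar>\<psi> a\<bar>}" for n using abs_mod_less[OF \<psi>(2), of n] by auto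
  then show ?thesis by (auto simp: p_def simp del: atLeastAtMost_iff)
 qed
 ultimately show ?thesis using inj_on_finite by blast
qed

text \<open>A member of a chain of layers is determined by the set of elements of the arrangement that contain it.\<close>

lemma rank_zero_empty:
 assumes G: "lattice d G" and A: "toric_arrangement G \<A>" "arrangement_rank G \<A> = 0"
 shows "\<A> = {}"
proof (rule ccontr)
 assume "\<A> \<noteq> {}"
 interpret comm_group G by (rule lattice_comm_group[OF G])
 let ?T = "carrier (torus G)"
 obtain X where X: "finite X" "X \<subseteq> carrier G - {\<one>\<^bsub>G\<^esub>}" "\<A> = (\<Union>a\<in>X. components G (char_kernel G a))"
  using A(1) by (auto simp: toric_arrangement_def)
 obtain H a where H: "H \<in> \<A>" "a \<in> X" "H \<in> components G (char_kernel G a)" using \<open>\<A> \<noteq> {}\<close> X(3) by blast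
 have a: "a \<in> carrier G" "a \<noteq> \<one>\<^bsub>G\<^esub>" using H(2) X(2) by auto
 have fin: "finite \<A>" using X finite_components[OF G] by auto
 \<comment> \<open>The rank is a \<open>Max\<close>, which controls a given chain only once the set
   of all lengths is known to be bounded.\<close>
 have bound: "card C \<le> card (Pow \<A>)" if C: "C \<subseteq> layers G \<A>" "chain\<^sub>\<subseteq> C" for C
 proof (rule card_inj_on_le)
  have le: "W' \<subseteq> W" if W: "W \<in> C" "W \<subseteq> W'" "W' \<in> C" "{H \<in> \<A>. W \<subseteq> H} = {H \<in> \<A>. W' \<subseteq> H}" for W W'
  proof -
   obtain S where S: "S \<subseteq> \<A>" "W \<in> components G (?T \<inter> \<Inter>S)" using W(1) C(1) unfolding layers_def by blast
   obtain S' where S': "W' \<in> components G (?T \<inter> \<Inter>S')" using W(3) C(1) unfolding layers_def by blast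
   have "S \<subseteq> {H \<in> \<A>. W \<subseteq> H}" using S components_subset(1)[OF S(2)] by blast
   then have "W' \<subseteq> ?T \<inter> \<Inter>S" using W(4) components_subset(2)[OF S'] by blast
   then show ?thesis using components_maximal[OF S(2) components_connected[OF S']] components_nonempty[OF S(2)] W(2) by blast
  qed
  show "inj_on (\<lambda>W. {H \<in> \<A>. W \<subseteq> H}) C"
  proof (rule inj_onI)
   fix W W' assume "W \<in> C" "W' \<in> C" "{H \<in> \<A>. W \<subseteq> H} = {H \<in> \<A>. W' \<subseteq> H}"
   then show "W = W'" using C(2) le[of W W'] le[of W' W] unfolding chain_subset_def by blast
  qed
 qed (use fin in auto)
 have "?T \<in> components G (?T \<inter> \<Inter>{})" using connected_torus[OF G] connectedin_subset_topspace torus_one_in[OF is_group]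
  by (intro componentsI) fastforce+
 then have 1: "?T \<in> layers G \<A>" unfolding layers_def by blast
 have "H \<in> components G (?T \<inter> \<Inter>{H})"
  using components_connected[OF H(3)] components_nonempty[OF H(3)] components_subset[OF H(3)] by (intro componentsI) auto
 then have 2: "H \<in> layers G \<A>" unfolding layers_def using H(1) by blast
 obtain \<psi> where \<psi>: "\<psi> \<in> hom G integer_group" "\<psi> a \<noteq> 0" by (rule hom_nonzero[OF G a])
 \<comment> \<open>This character takes at a the value 2 to a nonzero power. So the kernel of a is a
   proper subset, and a component of it together with the torus is a chain with two members.\<close>
 have "(\<lambda>x\<in>carrier G. 2 powi \<psi> x) \<in> ?T - char_kernel G a"
  using hom_mult[OF \<psi>(1)] a powi_2_neq_1[OF \<psi>(2)] by (auto simp: torus_iff char_kernel_def power_int_add)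
 then have ne: "H \<noteq> ?T" using components_subset(1)[OF H(3)] by blast
 have "chain\<^sub>\<subseteq> {H, ?T}" using components_subset(2)[OF H(3)] by (auto simp: chain_subset_def)
 then have "card {H, ?T} - 1 \<in> {card C - 1 | C. C \<subseteq> layers G \<A> \<and> chain\<^sub>\<subseteq> C}" using 1 2 by blast
 moreover have "{card C - 1 | C. C \<subseteq> layers G \<A> \<and> chain\<^sub>\<subseteq> C} \<subseteq> {..card (Pow \<A>)}"
 proof
  fix n assume "n \<in> {card C - 1 | C. C \<subseteq> layers G \<A> \<and> chain\<^sub>\<subseteq> C}"
  then obtain C where "n = card C - 1" "C \<subseteq> layers G \<A>" "chain\<^sub>\<subseteq> C" by blast
  then show "n \<in> {..card (Pow \<A>)}" using bound[of C] by simp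
 qed
 ultimately have "card {H, ?T} - 1 \<le> arrangement_rank G \<A>"
  unfolding arrangement_rank_def poset_rank_def by (meson Max_ge finite_atMost finite_subset)
 then show False using ne A(2) by simp
qed

section \<open>From the TM-ideal condition to disjoint graphs over the complement of the quotient
  arrangement\<close>

section \<open>Strictly supersolvable arrangements\<close>

context splitting
begin

text \<open>Saturation with respect to the projection to the torus of K. It replaces the condition
  of being a union of cosets of \<open>Y\<close>.\<close>

definition invariant :: "('a \<Rightarrow> complex) set \<Rightarrow> bool" where
 "invariant H \<longleftrightarrow> (\<forall>t\<in>H. \<forall>t'\<in>T. restrict t' K = restrict t K \<longrightarrow> t' \<in> H)"

abbreviation "Y \<equiv> {t \<in> T. \<forall>a\<in>K. t a = 1}"

lemma coset_eq:
 assumes t: "t \<in> T" shows "Y #>\<^bsub>torus G\<^esub> t = {t' \<in> T. restrict t' K = restrict t K}"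
proof (intro equalityI subsetI)
 fix t' assume "t' \<in> Y #>\<^bsub>torus G\<^esub> t"
 then obtain h where h: "h \<in> T" "\<And>a. a \<in> K \<Longrightarrow> h a = 1" "t' = (\<lambda>a\<in>carrier G. h a * t a)"
  by (auto simp: r_coset_def torus_def)
 have "t' \<in> T" using h(1) t unfolding h(3) by (auto simp: torus_iff)
 moreover have "restrict t' K = restrict t K" using h(2) K_closed by (auto simp: h(3) fun_eq_iff)
 ultimately show "t' \<in> {t' \<in> T. restrict t' K = restrict t K}" by simp
next
 fix t' assume "t' \<in> {t' \<in> T. restrict t' K = restrict t K}"
 then have t': "t' \<in> T" and r: "restrict t' K = restrict t K" by auto
 have tk: "t' a = t a" if "a \<in> K" for a using fun_cong[OF r, of a] that by simp
 let ?h = "\<lambda>a\<in>carrier G. t' a / t a"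
 have hT: "?h \<in> T" using t t' by (auto simp: torus_iff)
 then have "?h \<in> Y" using tk torus_nz[OF t] K_closed by auto
 moreover have "t' = (\<lambda>a\<in>carrier G. ?h a * t a)" using t' torus_nz[OF t] by (auto simp: torus_iff extensional_def fun_eq_iff)
 ultimately show "t' \<in> Y #>\<^bsub>torus G\<^esub> t" by (auto simp: r_coset_def torus_def)
qed

lemma union_cosets_iff:
 assumes H: "H \<subseteq> T" shows "(\<exists>\<C>\<subseteq>rcosets\<^bsub>torus G\<^esub> Y. H = \<Union>\<C>) \<longleftrightarrow> invariant H"
proof
 assume "\<exists>\<C>\<subseteq>rcosets\<^bsub>torus G\<^esub> Y. H = \<Union>\<C>"
 then obtain \<C> where \<C>: "\<C> \<subseteq> rcosets\<^bsub>torus G\<^esub> Y" "H = \<Union>\<C>" by blast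
 show "invariant H" unfolding invariant_def
 proof (intro ballI impI)
  fix t t' assume t: "t \<in> H" and t': "t' \<in> T" "restrict t' K = restrict t K"
  obtain C where C: "C \<in> \<C>" "t \<in> C" using t \<C>(2) by blast
  have "C \<in> rcosets\<^bsub>torus G\<^esub> Y" using C(1) \<C>(1) by blast
  then obtain s where s: "s \<in> T" "C = Y #>\<^bsub>torus G\<^esub> s" by (auto simp: RCOSETS_def)
  have "t' \<in> C" using C(2) t' unfolding s(2) coset_eq[OF s(1)] by simp
  then show "t' \<in> H" using C(1) \<C>(2) by blast
 qed
next
 assume inv: "invariant H"
 have "H = (\<Union>t\<in>H. Y #>\<^bsub>torus G\<^esub> t)"
 proof (intro equalityI subsetI)
  show "t \<in> (\<Union>t\<in>H. Y #>\<^bsub>torus G\<^esub> t)" if "t \<in> H" for t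
  proof -
   have "t \<in> T" using that H by blast
   then show ?thesis using that coset_eq[OF \<open>t \<in> T\<close>] by blast
  qed
  show "t' \<in> H" if t': "t' \<in> (\<Union>t\<in>H. Y #>\<^bsub>torus G\<^esub> t)" for t'
  proof -
   obtain t where t: "t \<in> H" "t' \<in> Y #>\<^bsub>torus G\<^esub> t" using t' by blast
   have "t \<in> T" using t(1) H by blast
   then show ?thesis using t inv coset_eq[OF \<open>t \<in> T\<close>] unfolding invariant_def by blast
  qed
 qed
 moreover have "(\<lambda>t. Y #>\<^bsub>torus G\<^esub> t) ` H \<subseteq> rcosets\<^bsub>torus G\<^esub> Y"
  using H unfolding RCOSETS_def by blast
 ultimately show "\<exists>\<C>\<subseteq>rcosets\<^bsub>torus G\<^esub> Y. H = \<Union>\<C>" by blast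
qed

text \<open>A fibre of the projection is connected, and for a in K it lies in the kernel of a as
  soon as it meets it; maximality of the component does the rest.\<close>

lemma invariant_component:
 assumes a: "a \<in> K" and H: "H \<in> components G (char_kernel G a)" shows "invariant H" unfolding invariant_def
proof (intro ballI impI)
 fix t t' assume t: "t \<in> H" and t': "t' \<in> T" "restrict t' K = restrict t K"
 have tT: "t \<in> T" "t a = 1" using components_subset(1)[OF H] t by (auto simp: char_kernel_def)
 let ?C = "{t' \<in> T. restrict t' K \<in> {restrict t K}}"
 have "connectedin (torus_topology G) ?C" by (rule connectedin_preimage) (simp add: connectedin_sing restrict_torus tT)
 moreover have "?C \<subseteq> char_kernel G a"
 proof
  fix s assume s: "s \<in> ?C"
  then have "restrict s K a = restrict t K a" by simp
  then show "s \<in> char_kernel G a" using a tT s by (simp add: char_kernel_def)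
 qed
 ultimately have "?C \<subseteq> H" using components_maximal[OF H] t tT by blast
 then show "t' \<in> H" using t' by blast
qed

text \<open>If H were invariant, the value z of its characters at l could be changed freely, and
  t(a) would equal 1 for both z = 1 and z = 2.\<close>

lemma not_invariant_component:
 assumes a: "a \<in> carrier G" "a \<notin> K" and H: "H \<in> components G (char_kernel G a)"
 shows "\<not> invariant H" and "np a \<noteq> 0"
proof -
 show np: "np a \<noteq> 0"
 proof
  assume "np a = 0"
  then have "a = kp a" using decomp[OF a(1)] K_closed[OF kp_in[OF a(1)]] by simp
  then show False using kp_in[OF a(1)] a(2) by simp
 qed
 show "\<not> invariant H"
 proof
  assume inv: "invariant H"
  obtain t where t: "t \<in> H" using components_nonempty[OF H] by blast
  have sub: "H \<subseteq> char_kernel G a" by (rule components_subset(1)[OF H])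
  have tT: "t \<in> T" using t components_subset(2)[OF H] by blast
  have b: "restrict t K \<in> TK" by (rule restrict_torus[OF tT])
  have *: "t (kp a) * z powi np a = 1" if z: "z \<noteq> 0" for z
  proof -
   have "glue (restrict t K) z \<in> H" using inv t glue_torus[OF b z] restrict_glue[OF b] unfolding invariant_def by blast
   then have "glue (restrict t K) z a = 1" using sub by (auto simp: char_kernel_def)
   then show ?thesis using a(1) kp_in[OF a(1)] by (simp add: glue_def)
  qed
  have "t (kp a) = 1" using *[of 1] by simp
  then have "(2::complex) powi np a = 1" using *[of 2] by simp
  then show False using powi_2_neq_1[OF np] by simp
 qed
qed

text \<open>Preimages of connected sets under the projection are connected, so a larger connected
  subset downstairs would give a larger one upstairs.\<close>

lemma restrict_component:
 assumes a: "a \<in> K" and H: "H \<in> components G (char_kernel G a)"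
 shows "(\<lambda>t. restrict t K) ` H \<in> components \<Delta> (char_kernel \<Delta> a)"
proof (rule componentsI)
 show "connectedin (torus_topology \<Delta>) ((\<lambda>t. restrict t K) ` H)"
  by (rule connectedin_continuous_map_image[OF continuous_restrict components_connected[OF H]])
 show "(\<lambda>t. restrict t K) ` H \<subseteq> char_kernel \<Delta> a"
  using components_subset(1)[OF H] restrict_torus a by (auto simp: char_kernel_def)
 show "(\<lambda>t. restrict t K) ` H \<noteq> {}" using components_nonempty[OF H] by simp
 fix D assume D: "connectedin (torus_topology \<Delta>) D" "D \<subseteq> char_kernel \<Delta> a" "(\<lambda>t. restrict t K) ` H \<subseteq> D"
 let ?C = "{t \<in> T. restrict t K \<in> D}"
 obtain t where t: "t \<in> H" using components_nonempty[OF H] by blast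
 have "?C \<subseteq> char_kernel G a"
 proof
  fix s assume s: "s \<in> ?C"
  then have "restrict s K a = 1" using D(2) by (auto simp: char_kernel_def)
  then show "s \<in> char_kernel G a" using a s by (simp add: char_kernel_def)
 qed
 then have CH: "?C \<subseteq> H" using components_maximal[OF H connectedin_preimage[OF D(1)]] t D(3) components_subset(2)[OF H] by blast
 show "D \<subseteq> (\<lambda>t. restrict t K) ` H"
 proof
  fix b assume b: "b \<in> D"
  then have "b \<in> TK" using D(2) by (auto simp: char_kernel_def)
  then have "glue b 1 \<in> ?C" "b = restrict (glue b 1) K" using b glue_torus[of b 1] restrict_glue[of b 1] by simp_all
  then show "b \<in> (\<lambda>t. restrict t K) ` H" using CH by blast
 qed
qed

lemma restrict_components:
 assumes a: "a \<in> K"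
 shows "(\<lambda>H. (\<lambda>t. restrict t K) ` H) ` components G (char_kernel G a) = components \<Delta> (char_kernel \<Delta> a)"
proof (intro equalityI subsetI)
 fix C assume C: "C \<in> components \<Delta> (char_kernel \<Delta> a)"
 obtain b where b: "b \<in> C" using components_nonempty[OF C] by blast
 have bK: "b \<in> TK" "b a = 1" using components_subset(1)[OF C] b by (auto simp: char_kernel_def)
 let ?t = "glue b 1"
 have t: "?t \<in> T" "?t a = 1" using glue_torus[OF bK(1), of 1] glue_K[OF a] bK(2) by auto
 then obtain H where H: "H \<in> components G (char_kernel G a)" "?t \<in> H"
  using components_cover[of ?t G "char_kernel G a"] by (auto simp: char_kernel_def)
 have "b \<in> (\<lambda>t. restrict t K) ` H" using H(2) restrict_glue[OF bK(1), of 1] by (metis image_eqI)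
 then have "C = (\<lambda>t. restrict t K) ` H" using components_eq[OF C restrict_component[OF a H(1)] b] by blast
 then show "C \<in> (\<lambda>H. (\<lambda>t. restrict t K) ` H) ` components G (char_kernel G a)" using H(1) by blast
qed (use restrict_component[OF a] in blast)

end

locale arrangement_step = splitting G l K for G (structure) and l K +
 fixes d :: nat and X :: "'a set" and \<A> :: "('a \<Rightarrow> complex) set set"
 assumes lattice: "lattice d G" and X: "finite X" "X \<subseteq> carrier G - {\<one>}"
  and \<A>: "\<A> = (\<Union>a\<in>X. components G (char_kernel G a))"
  and TM: "TM_ideal G \<A> Y"
begin

lemma X_closed: "a \<in> X \<Longrightarrow> a \<in> carrier G" using X by blast

lemma \<A>_subset: "H \<in> \<A> \<Longrightarrow> H \<subseteq> T" using components_subset(2) unfolding \<A> by blast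

lemma sub_iff: "H \<in> sub_arrangement G \<A> Y \<longleftrightarrow> H \<in> \<A> \<and> invariant H"
 unfolding sub_arrangement_def using union_cosets_iff[OF \<A>_subset] by blast

lemma sub_eq: "sub_arrangement G \<A> Y = (\<Union>a\<in>X \<inter> K. components G (char_kernel G a))"
proof (intro equalityI subsetI)
 fix H assume "H \<in> sub_arrangement G \<A> Y"
 then have H: "H \<in> \<A>" "invariant H" by (simp_all add: sub_iff)
 obtain a where a: "a \<in> X" "H \<in> components G (char_kernel G a)" using H(1) unfolding \<A> by blast
 have "a \<in> K" using not_invariant_component(1)[OF X_closed[OF a(1)] _ a(2)] H(2) by blast
 then show "H \<in> (\<Union>a\<in>X \<inter> K. components G (char_kernel G a))" using a by blast
next
 fix H assume "H \<in> (\<Union>a\<in>X \<inter> K. components G (char_kernel G a))"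
 then obtain a where a: "a \<in> X" "a \<in> K" "H \<in> components G (char_kernel G a)" by blast
 show "H \<in> sub_arrangement G \<A> Y" unfolding sub_iff using a invariant_component[OF a(2,3)] \<A> by blast
qed

lemma quotient_eq: "quotient_arrangement G \<A> K Y = (\<Union>a\<in>X \<inter> K. components \<Delta> (char_kernel \<Delta> a))"
 unfolding quotient_arrangement_def sub_eq image_UN using restrict_components by (intro SUP_cong) auto

lemma toric_quotient: "toric_arrangement \<Delta> (quotient_arrangement G \<A> K Y)" unfolding toric_arrangement_def
 using X quotient_eq by (intro exI[of _ "X \<inter> K"]) auto

text \<open>Connectedness of \<open>H \<inter> Y\<close>, for the component \<open>H\<close> of the identity, forces the winding of each
 one-parameter subgroup of the torus of \<open>K\<close> along the \<open>K\<close>-part of \<open>a\<close> to be divisible by the exponent of \<open>l\<close>.\<close>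

lemma kp_divisible:
 assumes a: "a \<in> X" "a \<notin> K"
 shows "\<exists>\<kappa>\<in>K. kp a = \<kappa> [^] np a"
proof -
 have ac: "a \<in> carrier G" by (rule X_closed[OF a(1)])
 let ?n = "np a"
 let ?one = "\<lambda>x\<in>carrier G. 1"
 have one: "?one \<in> T" by (rule torus_one_in[OF is_group])
 obtain H where H: "H \<in> components G (char_kernel G a)" "?one \<in> H"
  using components_cover[OF one, of "char_kernel G a"] one ac by (auto simp: char_kernel_def)
 have n: "?n \<noteq> 0" and ni: "\<not> invariant H" using not_invariant_component[OF ac a(2) H(1)] by auto
 have "H \<in> \<A> - sub_arrangement G \<A> Y" using H(1) a(1) ni sub_iff \<A> by blast
 then have conn: "connectedin (torus_topology G) (H \<inter> Y)" by (rule bspec[OF TM[unfolded TM_ideal_def, THEN conjunct2]])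
 have "?n dvd \<psi> (kp a)" if \<psi>: "\<psi> \<in> hom \<Delta> integer_group" for \<psi>
 proof -
  \<comment> \<open>The value q is chosen so that the one-parameter path \<open>u\<close> stays in
    the kernel of a. At r = 1 the path is trivial on K, hence back in \<open>Y\<close>, and its
    value at l is exp(-2 pi \<i> q). It remains to show that this value is 1, which makes q an
    integer.\<close>
  define q where "q = (of_int (\<psi> (kp a)) / of_int ?n :: complex)"
  define L where "L x = 2 * of_real pi * \<i> * (of_int (\<psi> (kp x)) - q * of_int (np x))" for x
  define u where "u r = (\<lambda>x\<in>carrier G. exp (of_real r * L x))" for r :: real
  have uT: "u r \<in> T" for r unfolding torus_iff
  proof (intro conjI ballI)
   fix x y assume xy: "x \<in> carrier G" "y \<in> carrier G"
   have "\<psi> (kp x \<otimes> kp y) = \<psi> (kp x) + \<psi> (kp y)" using hom_mult[OF \<psi>, of "kp x" "kp y"] xy kp_in by simp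
   then have "L (x \<otimes> y) = L x + L y" using xy by (simp add: L_def parts_mult algebra_simps)
   then show "u r (x \<otimes> y) = u r x * u r y" using xy by (simp add: u_def exp_add distrib_left)
  qed (auto simp: u_def)
  have cont: "continuous_map euclideanreal (torus_topology G) u"
   by (rule continuous_map_into_torus[OF uT]) (auto simp: u_def intro!: continuous_intros)
  have con: "connectedin (torus_topology G) (range u)" using connectedin_continuous_map_image[OF cont, of UNIV] by simp
  have "u r a = 1" for r using ac n by (simp add: u_def L_def q_def)
  then have sub: "range u \<subseteq> char_kernel G a" using uT by (auto simp: char_kernel_def)
  have "u 0 = ?one" by (auto simp: u_def)
  then have "range u \<subseteq> H" using components_maximal[OF H(1) con sub] H(2) by (metis disjoint_iff rangeI)
  moreover have "u 1 \<in> Y"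
  proof -
   have "u 1 k = 1" if k: "k \<in> K" for k
   proof -
    have "u 1 k = exp (2 * of_int (\<psi> k) * of_real pi * \<i>)" using K_closed[OF k] by (simp add: u_def L_def parts_K k mult_ac)
    then show ?thesis using exp_integer_2pi[of "of_int (\<psi> k)"] by (simp add: mult_ac)
   qed
   then show ?thesis using uT by blast
  qed
  ultimately have u1: "u 1 \<in> H \<inter> Y" by blast
  have one': "?one \<in> H \<inter> Y" using H(2) one K_closed by auto
  let ?e = "\<lambda>t::'a \<Rightarrow> complex. t l"
  have "connectedin euclidean (?e ` (H \<inter> Y))" by (rule connectedin_continuous_map_image[OF continuous_torus_apply[OF l] conn])
  then have c: "connected (?e ` (H \<inter> Y))" by simp
  \<comment> \<open>On \<open>Y\<close> the K-part of a is trivial, so the value at l of a point in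
    the intersection is a root of unity. There are finitely many of these, and connectedness forces
    the value to be constant, equal to that at the identity.\<close>
  have "?e ` (H \<inter> Y) \<subseteq> {z. z powi ?n = 1}"
  proof
   fix z assume "z \<in> ?e ` (H \<inter> Y)"
   then obtain t where t: "t \<in> H" "t \<in> Y" "z = t l" by blast
   have "t a = 1" using t(1) components_subset(1)[OF H(1)] by (auto simp: char_kernel_def)
   moreover have "t (kp a) = 1" using t(2) kp_in[OF ac] by blast
   ultimately show "z \<in> {z. z powi ?n = 1}" using char_apply[of t a] t ac by simp
  qed
  then have "finite (?e ` (H \<inter> Y))" using finite_powi_eq_1[OF n] finite_subset by blast
  then have "?e ` (H \<inter> Y) = {} \<or> (\<exists>z. ?e ` (H \<inter> Y) = {z})" using connected_finite_iff_sing[OF c] by blast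
  then obtain z where z: "?e ` (H \<inter> Y) = {z}" using u1 by auto
  have "u 1 l \<in> ?e ` (H \<inter> Y)" "?one l \<in> ?e ` (H \<inter> Y)" using u1 one' by blast+
  then have "u 1 l = 1" using z l by auto
  moreover have "\<psi> \<one> = 0" using hom_one[OF \<psi> group_\<Delta> group_integer_group] by simp
  ultimately have "exp (2 * of_real pi * \<i> * (- q)) = 1" using l by (simp add: u_def L_def parts_l)
  then obtain k :: int where "Im (2 * of_real pi * \<i> * (- q)) = of_int (2 * k) * pi" using exp_eq_1 by blast
  moreover have "Im (2 * of_real pi * \<i> * (- q)) = - 2 * pi * (of_int (\<psi> (kp a)) / of_int ?n)"
  proof -
   have "q = of_real (of_int (\<psi> (kp a)) / of_int ?n)" by (simp add: q_def)
   then show ?thesis by simp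
  qed
  ultimately have "pi * (- (of_int (\<psi> (kp a)) / of_int ?n)) = pi * real_of_int k" by simp
  then have "- (real_of_int (\<psi> (kp a)) / of_int ?n) = of_int k" by (rule mult_left_cancel[OF pi_neq_zero, THEN iffD1])
  then have "real_of_int (\<psi> (kp a)) = of_int (?n * (- k))" using n by (simp add: field_simps)
  then have "\<psi> (kp a) = ?n * (- k)" by (simp only: of_int_eq_iff)
  then show ?thesis by (rule dvdI)
 qed
 moreover obtain e where "lattice e \<Delta>" using lattice_subgroup[OF lattice K] by blast
 ultimately obtain \<kappa> where "\<kappa> \<in> K" "kp a = \<kappa> [^]\<^bsub>\<Delta>\<^esub> ?n"
  using lattice_divisible[of e \<Delta> "kp a" ?n] kp_in[OF ac] by auto
 then show ?thesis using pow_K by auto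
qed

text \<open>By divisibility a is the power of l \<kappa> with exponent \<open>np a\<close>. On the
  connected set H the function t(l) t(\<kappa>) takes values among finitely many roots of unity, so
  it is a constant \<zeta>. Conversely the graph belonging to \<zeta> is a connected copy of the
  torus of K inside the kernel of a, so it is all of H.\<close>

lemma graph:
 assumes H: "H \<in> \<A> - sub_arrangement G \<A> Y"
 obtains \<kappa> \<zeta> where "\<kappa> \<in> K" "\<zeta> \<noteq> 0" "H = {t \<in> T. t l = \<zeta> / t \<kappa>}"
proof -
 obtain a where a: "a \<in> X" "H \<in> components G (char_kernel G a)" using H unfolding \<A> by blast
 have ac: "a \<in> carrier G" by (rule X_closed[OF a(1)])
 have aK: "a \<notin> K" using H invariant_component[OF _ a(2)] sub_iff by blast
 have n: "np a \<noteq> 0" by (rule not_invariant_component(2)[OF ac aK a(2)])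
 obtain \<kappa> where \<kappa>: "\<kappa> \<in> K" "kp a = \<kappa> [^] np a" using kp_divisible[OF a(1) aK] by blast
 have \<kappa>c: "\<kappa> \<in> carrier G" by (rule K_closed[OF \<kappa>(1)])
 have ta: "t a = (t l * t \<kappa>) powi np a" if t: "t \<in> T" for t
  using char_apply[OF t ac] torus_pow[OF is_group t \<kappa>c, of "np a"] by (simp add: \<kappa>(2) power_int_mult_distrib)
 let ?f = "\<lambda>t. t l * t \<kappa>"
 have "continuous_map (torus_topology G) euclidean ?f" by (intro continuous_map_times_complex continuous_torus_apply l \<kappa>c)
 then have "connectedin euclidean (?f ` H)" using connectedin_continuous_map_image components_connected[OF a(2)] by blast
 then have c: "connected (?f ` H)" by simp
 have Hsub: "H \<subseteq> char_kernel G a" by (rule components_subset(1)[OF a(2)])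
 have sub1: "?f ` H \<subseteq> {z. z powi np a = 1}" using Hsub ta by (auto simp: char_kernel_def)
 then have "finite (?f ` H)" using finite_powi_eq_1[OF n] finite_subset by blast
 then have "?f ` H = {} \<or> (\<exists>z. ?f ` H = {z})" using connected_finite_iff_sing[OF c] by blast
 then obtain \<zeta> where \<zeta>: "?f ` H = {\<zeta>}" using components_nonempty[OF a(2)] by auto
 have \<zeta>1: "\<zeta> powi np a = 1" using sub1 \<zeta> by blast
 have \<zeta>0: "\<zeta> \<noteq> 0" using \<zeta>1 n by (metis power_int_0_left zero_neq_one)
 let ?g = "\<lambda>b. glue b (\<zeta> / b \<kappa>)"
 have bnz: "b \<kappa> \<noteq> 0" if "b \<in> TK" for b using torus_nz[OF that] \<kappa>(1) by simp
 have "continuous_map (torus_topology \<Delta>) (torus_topology G) ?g"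
 proof (rule continuous_glue)
  have "continuous_map (torus_topology \<Delta>) euclidean (\<lambda>b. b \<kappa>)" using continuous_torus_apply[of \<kappa> \<Delta>] \<kappa>(1) by simp
  then show "continuous_map (torus_topology \<Delta>) euclidean (\<lambda>b. \<zeta> / b \<kappa>)"
   using bnz unfolding continuous_map_euclidean_iff by (auto intro!: tendsto_divide)
 qed (use bnz \<zeta>0 in auto)
 moreover obtain e where "lattice e \<Delta>" using lattice_subgroup[OF lattice K] by blast
 ultimately have con: "connectedin (torus_topology G) (?g ` TK)" using connectedin_continuous_map_image connected_torus by blast
 have img: "?g ` TK = {t \<in> T. t l = \<zeta> / t \<kappa>}"
 proof (intro equalityI subsetI)
  fix t assume "t \<in> ?g ` TK"
  then obtain b where b: "b \<in> TK" "t = ?g b" by blast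
  then show "t \<in> {t \<in> T. t l = \<zeta> / t \<kappa>}"
   using glue_torus[OF b(1), of "\<zeta> / b \<kappa>"] bnz[OF b(1)] \<zeta>0 glue_l[OF b(1)] glue_K[OF \<kappa>(1)] by simp
 next
  fix t assume t: "t \<in> {t \<in> T. t l = \<zeta> / t \<kappa>}"
  then have "t = ?g (restrict t K)" using glue_restrict[of t] \<kappa>(1) by simp
  then show "t \<in> ?g ` TK" using restrict_torus[of t] t by blast
 qed
 have fl: "?f t = \<zeta> \<longleftrightarrow> t l = \<zeta> / t \<kappa>" if "t \<in> T" for t
  using torus_nz[OF that \<kappa>c] by (auto simp: field_simps)
 have "{t \<in> T. t l = \<zeta> / t \<kappa>} \<subseteq> char_kernel G a"
 proof
  fix t assume t: "t \<in> {t \<in> T. t l = \<zeta> / t \<kappa>}"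
  then have "t l * t \<kappa> = \<zeta>" using fl by blast
  then show "t \<in> char_kernel G a" using ta[of t] t \<zeta>1 by (simp add: char_kernel_def)
 qed
 moreover have HS: "H \<subseteq> {t \<in> T. t l = \<zeta> / t \<kappa>}" using fl \<zeta> components_subset(2)[OF a(2)] by blast
 ultimately have "{t \<in> T. t l = \<zeta> / t \<kappa>} \<subseteq> H"
  using components_maximal[OF a(2) con[unfolded img]] components_nonempty[OF a(2)] by blast
 with HS have "H = {t \<in> T. t l = \<zeta> / t \<kappa>}" by blast
 then show thesis using that \<kappa>(1) \<zeta>0 by blast
qed

theorem flagged_step:
 assumes "flagged (complement \<Delta> (quotient_arrangement G \<A> K Y))"
 shows "flagged (complement G \<A>)"
proof -
 let ?\<G> = "\<A> - sub_arrangement G \<A> Y"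
 let ?Q = "quotient_arrangement G \<A> K Y"
 let ?Z = "TK - \<Union>?Q"
 have "finite \<A>" unfolding \<A> using X finite_components[OF lattice] by auto
 then have "finite ?\<G>" by simp
 then obtain h where h: "bij_betw h {0..<card ?\<G>} ?\<G>" using ex_bij_betw_nat_finite by blast
 define m where "m = card ?\<G>"
 have hG: "h j \<in> ?\<G>" if "j < m" for j using h that by (auto simp: m_def bij_betw_def)
 have hinj: "h i \<noteq> h j" if "i < m" "j < m" "i \<noteq> j" for i j
  using inj_onD[OF bij_betw_imp_inj_on[OF h], of i j] that by (auto simp: m_def)
 have hsurj: "?\<G> = h ` {..<m}" using h unfolding m_def lessThan_atLeast0 bij_betw_def by blast
 have "\<forall>j. \<exists>p. j < m \<longrightarrow> fst p \<in> K \<and> snd p \<noteq> 0 \<and> h j = {t \<in> T. t l = snd p / t (fst p)}"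
 proof (intro allI)
  fix j show "\<exists>p. j < m \<longrightarrow> fst p \<in> K \<and> snd p \<noteq> 0 \<and> h j = {t \<in> T. t l = snd p / t (fst p)}"
  proof (cases "j < m")
   case True
   obtain \<kappa> \<zeta> where "\<kappa> \<in> K" "\<zeta> \<noteq> 0" "h j = {t \<in> T. t l = \<zeta> / t \<kappa>}" by (rule graph[OF hG[OF True]])
   then show ?thesis by (intro exI[of _ "(\<kappa>, \<zeta>)"]) simp
  qed simp
 qed
 then obtain p where p: "\<forall>j. j < m \<longrightarrow> fst (p j) \<in> K \<and> snd (p j) \<noteq> 0 \<and> h j = {t \<in> T. t l = snd (p j) / t (fst (p j))}"
  by (rule choice[THEN exE])
 define \<kappa> \<zeta> where "\<kappa> j = fst (p j)" and "\<zeta> j = snd (p j)" for j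
 have \<kappa>: "\<kappa> j \<in> K" and \<zeta>: "\<zeta> j \<noteq> 0" and graph: "h j = {t \<in> T. t l = \<zeta> j / t (\<kappa> j)}" if "j < m" for j
  unfolding \<kappa>_def \<zeta>_def by (rule p[rule_format, OF that, THEN conjunct1], rule p[rule_format, OF that, THEN conjunct2, THEN conjunct1],
   rule p[rule_format, OF that, THEN conjunct2, THEN conjunct2])
 define s where "s j b = \<zeta> j / b (\<kappa> j)" for j and b :: "'a \<Rightarrow> complex"
 have bnz: "b (\<kappa> j) \<noteq> 0" if "b \<in> TK" "j < m" for b j using torus_nz[OF that(1)] \<kappa>[OF that(2)] by simp
 have snz: "s j b \<noteq> 0" if "j < m" "b \<in> TK" for j b using bnz[OF that(2,1)] \<zeta>[OF that(1)] by (simp add: s_def)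
 have in_h: "glue b (s j b) \<in> h j" if "j < m" "b \<in> TK" for j b
  using graph[OF that(1)] glue_torus[OF that(2) snz[OF that]] glue_l[OF that(2)] glue_K[OF \<kappa>[OF that(1)]] by (simp add: s_def)
 have "flagged (subtopology (torus_topology G) {t. restrict t K \<in> ?Z \<and> (\<forall>j<m. t l \<noteq> s j (restrict t K))})"
 proof (rule flagged_torus_tower)
  show "flagged (subtopology (torus_topology \<Delta>) ?Z)" using assms by (simp add: complement_def)
  show "continuous_map (subtopology (torus_topology \<Delta>) ?Z) euclidean (s j)" if "j < m" for j
  proof -
   have "continuous_map (torus_topology \<Delta>) euclidean (\<lambda>b. b (\<kappa> j))"
    using continuous_torus_apply[of "\<kappa> j" \<Delta>] \<kappa>[OF that] by simp
   then have "continuous_map (torus_topology \<Delta>) euclidean (s j)"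
    using bnz[OF _ that] unfolding continuous_map_euclidean_iff s_def by (auto intro!: tendsto_divide)
   then show ?thesis by (rule continuous_map_from_subtopology)
  qed
  show "s j b \<noteq> 0" if "j < m" "b \<in> TK" for j b by (rule snz[OF that])
  show "s i b \<noteq> s j b" if ij: "i < m" "j < m" "i \<noteq> j" and b: "b \<in> TK" "b \<in> ?Z" for i j b
  proof
   \<comment> \<open>A common point of two graphs over b lies in a component of their intersection.
     The TM condition places this component in an invariant member of the arrangement, so b lies in
     the quotient arrangement and was removed from the base.\<close>
   assume eq: "s i b = s j b"
   let ?t = "glue b (s i b)"
   have t: "?t \<in> T" "?t \<in> h i \<inter> h j"
    using glue_torus[OF b(1) snz[OF ij(1) b(1)]] in_h[OF ij(1) b(1)] in_h[OF ij(2) b(1)] eq by auto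
   obtain W where W: "W \<in> components G (h i \<inter> h j)" "?t \<in> W" using components_cover[OF t] by blast
   obtain H where H: "H \<in> sub_arrangement G \<A> Y" "W \<subseteq> H"
    using TM[unfolded TM_ideal_def, THEN conjunct1, THEN bspec, OF hG[OF ij(1)], THEN bspec, OF hG[OF ij(2)],
      THEN mp, OF hinj[OF ij], THEN bspec, OF W(1)] by (rule bexE)
   have "b = restrict ?t K" using restrict_glue[OF b(1)] by simp
   then have "b \<in> (\<lambda>t. restrict t K) ` H" using H(2) W(2) by blast
   then have "b \<in> \<Union>?Q" using H(1) unfolding quotient_arrangement_def by blast
   then show False using b(2) by blast
  qed
 qed
 moreover have "subtopology (torus_topology G) {t. restrict t K \<in> ?Z \<and> (\<forall>j<m. t l \<noteq> s j (restrict t K))} =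
  complement G \<A>"
 proof -
  have sub: "t \<in> \<Union>(sub_arrangement G \<A> Y) \<longleftrightarrow> restrict t K \<in> \<Union>?Q" if t: "t \<in> T" for t
  proof
   assume "restrict t K \<in> \<Union>?Q"
   then obtain H t' where H: "H \<in> sub_arrangement G \<A> Y" "t' \<in> H" "restrict t K = restrict t' K"
    unfolding quotient_arrangement_def by blast
   then have "t \<in> H" using t sub_iff[of H] unfolding invariant_def by blast
   then show "t \<in> \<Union>(sub_arrangement G \<A> Y)" using H(1) by blast
  qed (auto simp: quotient_arrangement_def)
  have gr: "t \<in> \<Union>?\<G> \<longleftrightarrow> (\<exists>j<m. t l = s j (restrict t K))" if t: "t \<in> T" for t
   unfolding hsurj using graph \<kappa> t by (auto simp: s_def)
  have un: "\<Union>\<A> = \<Union>(sub_arrangement G \<A> Y) \<union> \<Union>?\<G>" using sub_iff by blast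
  have mem: "t \<in> \<Union>\<A> \<longleftrightarrow> restrict t K \<notin> ?Z \<or> (\<exists>j<m. t l = s j (restrict t K))" if t: "t \<in> T" for t
   unfolding un Un_iff sub[OF t] gr[OF t] Diff_iff using restrict_torus[OF t] by simp
  have "T \<inter> {t. restrict t K \<in> ?Z \<and> (\<forall>j<m. t l \<noteq> s j (restrict t K))} = T - \<Union>\<A>"
  proof (intro equalityI subsetI)
   fix t assume "t \<in> T \<inter> {t. restrict t K \<in> ?Z \<and> (\<forall>j<m. t l \<noteq> s j (restrict t K))}"
   then have t: "t \<in> T" and "restrict t K \<in> ?Z \<and> (\<forall>j<m. t l \<noteq> s j (restrict t K))" by simp_all
   then have "t \<notin> \<Union>\<A>" unfolding mem[OF t] by simp
   with t show "t \<in> T - \<Union>\<A>" by (rule DiffI)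
  next
   fix t assume "t \<in> T - \<Union>\<A>"
   then have t: "t \<in> T" and "t \<notin> \<Union>\<A>" by (simp_all only: Diff_iff not_False_eq_True)
   then show "t \<in> T \<inter> {t. restrict t K \<in> ?Z \<and> (\<forall>j<m. t l \<noteq> s j (restrict t K))}"
    unfolding mem[OF t] by simp
  qed
  moreover have "subtopology (torus_topology G) {t. restrict t K \<in> ?Z \<and> (\<forall>j<m. t l \<noteq> s j (restrict t K))} =
   subtopology (torus_topology G) (T \<inter> {t. restrict t K \<in> ?Z \<and> (\<forall>j<m. t l \<noteq> s j (restrict t K))})"
   using subtopology_restrict[of "torus_topology G"] by simp
  ultimately show ?thesis unfolding complement_def by simp
 qed
 ultimately show ?thesis by simp
qed

end

theorem flagged_complement:
 assumes "strictly_supersolvable G \<A>" "lattice d G" "toric_arrangement G \<A>"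
 shows "flagged (complement G \<A>)" using assms
proof (induction arbitrary: d rule: strictly_supersolvable.induct)
 case (rank_zero G \<A>)
 \<comment> \<open>Rank zero does not make the lattice trivial: the complement is then a full torus,
   which has a flag of its own.\<close>
 have "\<A> = {}" by (rule rank_zero_empty[OF rank_zero(2,3,1)])
 then have "complement G \<A> = torus_topology G" using subtopology_topspace[of "torus_topology G"] by (simp add: complement_def)
 then show ?case using flagged_torus[OF rank_zero(2)] by simp
next
 case (step G K Y \<A>)
 have comm: "comm_group G" by (rule lattice_comm_group[OF step.prems(1)])
 obtain L where L: "subgroup L G" "subgroup K G" "L \<inter> K = {\<one>\<^bsub>G\<^esub>}" "L <#>\<^bsub>G\<^esub> K = carrier G"
  "G\<lparr>carrier := L\<rparr> \<cong> integer_group" and Y: "Y = {t \<in> carrier (torus G). \<forall>a\<in>K. t a = 1}"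
  using step.hyps(1) unfolding admissible_def by blast
 obtain l where l: "split_off G l K" by (rule split_off_if_direct_sum[OF comm L])
 obtain X where X: "finite X" "X \<subseteq> carrier G - {\<one>\<^bsub>G\<^esub>}" "\<A> = (\<Union>a\<in>X. components G (char_kernel G a))"
  using step.prems(2) unfolding toric_arrangement_def by blast
 interpret S: arrangement_step G l K d X \<A>
  by (intro arrangement_step.intro splittingI[OF comm l] arrangement_step_axioms.intro step.prems(1) X)
   (use step.hyps(2) Y in simp)
 obtain e where e: "lattice e (G\<lparr>carrier := K\<rparr>)" using lattice_subgroup[OF step.prems(1) L(2)] by blast
 have "flagged (complement (G\<lparr>carrier := K\<rparr>) (quotient_arrangement G \<A> K Y))"
  using step.IH[OF e] S.toric_quotient unfolding Y by blast
 then show ?case unfolding Y by (rule S.flagged_step)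
qed

theorem corollary4p2p2:
  fixes \<Gamma> :: "('g, 'r) monoid_scheme"
    and d :: nat
    and \<A> :: "('g \<Rightarrow> complex) set set"
  assumes "comm_group \<Gamma>"
    and "\<Gamma> \<cong> free_Abelian_group {..<d}"
    and "toric_arrangement \<Gamma> \<A>"
    and "strictly_supersolvable \<Gamma> \<A>"
  shows "(\<exists>\<phi> \<in> ring_iso (exterior_cohomology (complement \<Gamma> \<A>) Quot cup_kernel_ideal (complement \<Gamma> \<A>))
                  (cohomology_ring (complement \<Gamma> \<A>)).
            \<forall>v \<in> cohomology_part (complement \<Gamma> \<A>) 1.
              \<phi> (cup_kernel_ideal (complement \<Gamma> \<A>)
                   +>\<^bsub>exterior_cohomology (complement \<Gamma> \<A>)\<^esub>
                   exterior_class (first_cohomology_group (complement \<Gamma> \<A>)) (frag_of [v])) = v)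
         \<and> Koszul (cohomology_ring (complement \<Gamma> \<A>)) (cohomology_part (complement \<Gamma> \<A>))"
proof -
  interpret comm_group \<Gamma> by (rule assms(1))
  obtain h where "h \<in> iso \<Gamma> (free_Abelian_group {..<d})" using assms(2) by (auto simp: is_iso_def)
  then have "lattice d \<Gamma>" using lattice_free_Abelian_group[OF assms(1) iso_set_sym] by blast
  then have "flagged (complement \<Gamma> \<A>)" using flagged_complement assms(3,4) by blast
  then show ?thesis using flagged_Koszul by blast
qed

end
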